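(* Let $H\in C^2(\mathbb{T}^n\times\mathbb{R}^n)$ be strictly convex in $p$ and superlinear in $p$, and suppose there is $\gamma_1>0$ with $|D_xH(x,p)|\le\gamma_1(1+|H(x,p)|)$ for all $(x,p)$. Let $A\in C^2(\mathbb{T}^n)$ be a matrix-valued function with $A(x)$ symmetric positive semidefinite for every $x$. Let $\sigma\in C(\mathbb{T}^n)$ be positive. Let $u_1,u_2$ be two continuous viscosity solutions of the ergodic problem $$H(x,Du)=\mathrm{tr}\big(A(x)D^2u\big)+c_H\quad\text{in }\mathbb{T}^n.$$ If $$\int_{\mathbb{T}^n\times\mathbb{R}^n}u_1\,\sigma\,d\tilde\mu\le\int_{\mathbb{T}^n\times\mathbb{R}^n}u_2\,\sigma\,d\tilde\mu\qquad\text{for all }\tilde\mu\in\tilde{\mathcal{M}},$$ where $\tilde{\mathcal{M}}$ is the set of all generalized Mather measures, then $u_1\le u_2$ on $\mathbb{T}^n$.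
   Context: $\mathbb{T}^n=\mathbb{R}^n/\mathbb{Z}^n$. Superlinear in $p$ means $H(x,p)/|p|\to\infty$ as $|p|\to\infty$ uniformly in $x$. The ergodic constant $c_H\in\mathbb{R}$ is the unique constant for which the ergodic problem admits viscosity solutions. Functions of $x$ are integrated against measures on $\mathbb{T}^n\times\mathbb{R}^n$ as functions not depending on the second variable. Generalized Mather measures: let $L(x,v)=\sup_{p\in\mathbb{R}^n}(p\cdot v-H(x,p))$ be the Lagrangian. Let $\mathcal{P}(\mathbb{T}^n\times\mathbb{R}^n)$ be the set of Radon probability measures and $$\tilde{\mathcal{H}}=\Big\{\tilde\mu\in\mathcal{P}(\mathbb{T}^n\times\mathbb{R}^n):\int_{\mathbb{T}^n\times\mathbb{R}^n}v\cdot D\phi(x)-\mathrm{tr}\big(A(x)D^2\phi(x)\big)\,d\tilde\mu(x,v)=0\ \ \forall\,\phi\in C^2(\mathbb{T}^n)\Big\}$$ the holonomic measures. A generalized Mather measure is a minimizer of $\inf_{\tilde\mu\in\tilde{\mathcal{H}}}\int_{\mathbb{T}^n\times\mathbb{R}^n}L(x,v)\,d\tilde\mu(x,v)$ (the minimum value is known to be $-c_H$); $\tilde{\mathcal{M}}$ is the set of all of them. *)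

theory Defs
  imports "HOL-Probability.Probability"
begin

text \<open>
  Functions on the torus \<open>\<real>\<^sup>n/\<int>\<^sup>n\<close> are represented by their \<open>\<int>\<^sup>n\<close>-periodic lifts to
  \<open>\<real>\<^sup>n\<close>, that is, to \<^typ>\<open>real ^ 'n\<close> with \<open>n = CARD('n)\<close>.
\<close>

definition torus_fun :: "(real ^ 'n \<Rightarrow> 'b) \<Rightarrow> bool" where
  "torus_fun f \<longleftrightarrow> (\<forall>x k. (\<forall>i. k $ i \<in> \<int>) \<longrightarrow> f (x + k) = f x)"

definition C2 :: "('a::real_normed_vector \<Rightarrow> 'b::real_normed_vector) \<Rightarrow> bool" where
  "C2 f \<longleftrightarrow>
     (\<exists>(f' :: 'a \<Rightarrow> 'a \<Rightarrow>\<^sub>L 'b) (f'' :: 'a \<Rightarrow> 'a \<Rightarrow>\<^sub>L 'a \<Rightarrow>\<^sub>L 'b).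
        (\<forall>x. (f has_derivative blinfun_apply (f' x)) (at x)) \<and>
        (\<forall>x. (f' has_derivative blinfun_apply (f'' x)) (at x)) \<and>
        continuous_on UNIV f'')"

definition C2_torus :: "(real ^ 'n \<Rightarrow> 'b::real_normed_vector) \<Rightarrow> bool" where
  "C2_torus f \<longleftrightarrow> torus_fun f \<and> C2 f"

definition C0_torus :: "(real ^ 'n \<Rightarrow> 'b::topological_space) \<Rightarrow> bool" where
  "C0_torus f \<longleftrightarrow> torus_fun f \<and> continuous_on UNIV f"

definition grad :: "(real ^ 'n \<Rightarrow> real) \<Rightarrow> real ^ 'n \<Rightarrow> real ^ 'n" where
  "grad f x = (\<chi> i. frechet_derivative f (at x) (axis i 1))"

definition hess :: "(real ^ 'n \<Rightarrow> real) \<Rightarrow> real ^ 'n \<Rightarrow> real ^ 'n ^ 'n" where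
  "hess f x = (\<chi> i. grad (\<lambda>y. grad f y $ i) x)"

definition strictly_convex_in_p :: "(real ^ 'n \<Rightarrow> real ^ 'n \<Rightarrow> real) \<Rightarrow> bool" where
  "strictly_convex_in_p H \<longleftrightarrow>
     (\<forall>x p q t. p \<noteq> q \<longrightarrow> 0 < t \<longrightarrow> t < 1 \<longrightarrow>
        H x ((1 - t) *\<^sub>R p + t *\<^sub>R q) < (1 - t) * H x p + t * H x q)"

definition superlinear_in_p :: "(real ^ 'n \<Rightarrow> real ^ 'n \<Rightarrow> real) \<Rightarrow> bool" where
  "superlinear_in_p H \<longleftrightarrow> (\<forall>K. \<forall>\<^sub>F p in at_infinity. \<forall>x. H x p / norm p \<ge> K)"


text \<open>
  Viscosity solutions of \<open>H(x, Du) = tr(A(x) D\<^sup>2u) + c\<close> on the torus; the equation is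
  read as \<open>H(x, Du) - tr(A(x) D\<^sup>2u) - c = 0\<close>, so a subsolution satisfies \<open>\<le>\<close> at points where
  a test function touches from above.
\<close>

definition viscosity_subsolution ::
    "(real ^ 'n \<Rightarrow> real ^ 'n \<Rightarrow> real) \<Rightarrow> (real ^ 'n \<Rightarrow> real ^ 'n ^ 'n) \<Rightarrow> real
      \<Rightarrow> (real ^ 'n \<Rightarrow> real) \<Rightarrow> bool" where
  "viscosity_subsolution H A c u \<longleftrightarrow>
     (\<forall>\<phi> x. C2_torus \<phi> \<longrightarrow> (\<forall>\<^sub>F y in nhds x. u y - \<phi> y \<le> u x - \<phi> x) \<longrightarrow>
        H x (grad \<phi> x) \<le> trace (A x ** hess \<phi> x) + c)"

definition viscosity_supersolution ::
    "(real ^ 'n \<Rightarrow> real ^ 'n \<Rightarrow> real) \<Rightarrow> (real ^ 'n \<Rightarrow> real ^ 'n ^ 'n) \<Rightarrow> real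
      \<Rightarrow> (real ^ 'n \<Rightarrow> real) \<Rightarrow> bool" where
  "viscosity_supersolution H A c u \<longleftrightarrow>
     (\<forall>\<phi> x. C2_torus \<phi> \<longrightarrow> (\<forall>\<^sub>F y in nhds x. u y - \<phi> y \<ge> u x - \<phi> x) \<longrightarrow>
        H x (grad \<phi> x) \<ge> trace (A x ** hess \<phi> x) + c)"

definition viscosity_solution ::
    "(real ^ 'n \<Rightarrow> real ^ 'n \<Rightarrow> real) \<Rightarrow> (real ^ 'n \<Rightarrow> real ^ 'n ^ 'n) \<Rightarrow> real
      \<Rightarrow> (real ^ 'n \<Rightarrow> real) \<Rightarrow> bool" where
  "viscosity_solution H A c u \<longleftrightarrow>
     C0_torus u \<and> viscosity_subsolution H A c u \<and> viscosity_supersolution H A c u"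

definition ergodic_constant ::
    "(real ^ 'n \<Rightarrow> real ^ 'n \<Rightarrow> real) \<Rightarrow> (real ^ 'n \<Rightarrow> real ^ 'n ^ 'n) \<Rightarrow> real" where
  "ergodic_constant H A = (THE c. \<exists>u. viscosity_solution H A c u)"


text \<open>The supremum is a genuine one (the set is bounded above) when \<open>H\<close> is continuous and
  superlinear in \<open>p\<close>.\<close>

definition lagrangian ::
    "(real ^ 'n \<Rightarrow> real ^ 'n \<Rightarrow> real) \<Rightarrow> real ^ 'n \<Rightarrow> real ^ 'n \<Rightarrow> real" where
  "lagrangian H x v = (SUP p. p \<bullet> v - H x p)"

definition unit_cell :: "(real ^ 'n) set" where
  "unit_cell = {x. \<forall>i. 0 \<le> x $ i \<and> x $ i < 1}"

text \<open>
  The quotient map restricts to a Borel isomorphism from \<^const>\<open>unit_cell\<close> onto the torus, so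
  Borel probability measures on \<open>\<real>\<^sup>n/\<int>\<^sup>n \<times> \<real>\<^sup>n\<close> (all of them Radon, the space being Polish)
  correspond bijectively to the Borel probability measures on \<open>\<real>\<^sup>n \<times> \<real>\<^sup>n\<close> that are
  concentrated on \<open>unit_cell \<times> \<real>\<^sup>n\<close>; integrals of periodic functions are preserved.
\<close>

definition torus_prob_measures :: "((real ^ 'n) \<times> (real ^ 'n)) measure set" where
  "torus_prob_measures =
     {\<mu>. sets \<mu> = sets borel \<and> prob_space \<mu> \<and> (AE z in \<mu>. fst z \<in> unit_cell)}"

text \<open>
  The defining integrals are required to exist. Taking \<open>\<phi>(x) = sin(2\<pi>x\<^sub>i)\<close> and
  \<open>\<phi>(x) = cos(2\<pi>x\<^sub>i)\<close> shows that this amounts to integrability of \<open>|v|\<close>.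
\<close>

definition holonomic_measures ::
    "(real ^ 'n \<Rightarrow> real ^ 'n ^ 'n) \<Rightarrow> ((real ^ 'n) \<times> (real ^ 'n)) measure set" where
  "holonomic_measures A =
     {\<mu> \<in> torus_prob_measures. \<forall>\<phi>. C2_torus \<phi> \<longrightarrow>
        has_bochner_integral \<mu> (\<lambda>(x, v). v \<bullet> grad \<phi> x - trace (A x ** hess \<phi> x)) 0}"

text \<open>
  The integral of \<open>L\<close> takes values in \<open>(-\<infinity>, \<infinity>]\<close>, as \<open>L\<close> is bounded below
  by \<open>- max H(\<cdot>, 0)\<close>; so the difference below is never \<open>\<infinity> - \<infinity>\<close>.
\<close>

definition action ::
    "(real ^ 'n \<Rightarrow> real ^ 'n \<Rightarrow> real) \<Rightarrow> ((real ^ 'n) \<times> (real ^ 'n)) measure \<Rightarrow> ereal" where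
  "action H \<mu> =
     enn2ereal (\<integral>\<^sup>+(x, v). ennreal (lagrangian H x v) \<partial>\<mu>)
     - enn2ereal (\<integral>\<^sup>+(x, v). ennreal (- lagrangian H x v) \<partial>\<mu>)"

definition mather_measures ::
    "(real ^ 'n \<Rightarrow> real ^ 'n \<Rightarrow> real) \<Rightarrow> (real ^ 'n \<Rightarrow> real ^ 'n ^ 'n)
      \<Rightarrow> ((real ^ 'n) \<times> (real ^ 'n)) measure set" where
  "mather_measures H A =
     {\<mu> \<in> holonomic_measures A. \<forall>\<nu> \<in> holonomic_measures A. action H \<mu> \<le> action H \<nu>}"

end

theory Submission
  imports Defs
begin

text \<open>
  A viscosity solution \<open>u\<close> is Lipschitz continuous (Bernstein's method) and, by sup-convolution and
  mollification, a uniform limit of smooth functions \<open>\<psi>\<close> with \<open>H(x, D\<psi>) - tr(A D\<^sup>2\<psi>) \<le> c + \<epsilon>\<close>; the Lipschitz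
  continuity of the square root of \<open>A \<in> C\<^sup>2\<close> controls the error terms. Testing with \<open>\<psi>\<close> shows
  that every holonomic measure has action at least \<open>-c\<close>. Put \<open>g = \<sigma>(u\<^sub>1 - u\<^sub>2)\<close>. As \<open>g\<close> has nonpositive
  integral against all Mather measures, separation and weak compactness give, for \<open>\<delta>, R > 0\<close>,
  a \<open>K > 0\<close> and a smooth \<open>\<phi>\<close> with
  \<open>g(x) \<le> \<delta> + K(L(x, v) + c) - v \<cdot> D\<phi>(x) + tr(A(x) D\<^sup>2\<phi>(x))\<close> for \<open>|v| \<le> R\<close>.
  Let \<open>\<psi>\<close> approximate \<open>u\<^sub>1\<close>. The function \<open>w = t\<phi>/K + (1 - t)\<psi>\<close> is then a strict subsolution wherever
  \<open>g > 3\<delta>/2\<close>, so at a minimum point of \<open>u\<^sub>2 - w\<close> the supersolution property forces \<open>g \<le> 3\<delta>/2\<close>. The limits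
  \<open>t \<rightarrow> 0\<close> and \<open>\<delta> \<rightarrow> 0\<close> yield \<open>u\<^sub>1 \<le> u\<^sub>2\<close>.
\<close>

section \<open>Jets of periodic functions\<close>

text \<open>Two obstacles shape the proof. Weak compactness is available only on a compact set of
  velocities, hence the restriction to |v| <= R in the duality. It costs nothing: at a minimum point
  of \<open>u\<^sub>2 - w\<close> the gradient of \<open>w\<close> is at most the Lipschitz constant
  of \<open>u\<^sub>2\<close>, so the velocity that linearises H there lies in a ball fixed before
  \<open>\<phi>\<close>, K and t are chosen. The other obstacle is to smooth a viscosity subsolution
  when A may degenerate, without second derivatives almost everywhere. Mollification respects
  viscosity inequalities that are linear with constant coefficients, so near each point H is
  replaced by a supporting affine function and A by a constant matrix that dominates it; far away
  the right-hand side is raised until the inequality holds globally. Because the square root of A is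
  Lipschitz, the dominating matrix exceeds a multiple of A(x) close to 1 only by
  O(\<open>\<delta>\<close>^2), while the Hessian of a mollified Lipschitz function has trace
  O(1/\<open>\<delta>\<close>), so the product vanishes. The same square-root bound drives the
  sup-convolution estimate, where errors |s - t|^2/\<open>\<epsilon>\<close> appear.\<close>

definition frac_vec :: "real ^ 'n \<Rightarrow> real ^ 'n" where
  "frac_vec x = (\<chi> i. frac (x $ i))"

lemma frac_vec_in_unit_cell: "frac_vec x \<in> unit_cell"
  by (simp add: frac_vec_def unit_cell_def frac_lt_1)

lemma unit_cell_subset_cbox: "unit_cell \<subseteq> cbox 0 (1 :: real ^ 'n)"
  by (auto simp: unit_cell_def mem_box_cart less_eq_real_def)

lemma diff_frac_vec_Ints: "(x - frac_vec x) $ i \<in> \<int>"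
  by (simp add: frac_vec_def frac_def)

lemma torus_fun_frac_vec: "torus_fun f \<Longrightarrow> f (frac_vec x) = f x"
  unfolding torus_fun_def using diff_frac_vec_Ints[of x] by (metis add_diff_cancel_left' add.commute diff_add_cancel)

lemma torus_funD: "torus_fun f \<Longrightarrow> (\<And>i. k $ i \<in> \<int>) \<Longrightarrow> f (x + k) = f x"
  unfolding torus_fun_def by blast

lemma torus_fun_const: "torus_fun (\<lambda>x. c)"
  by (simp add: torus_fun_def)

lemma torus_fun_compose2: "torus_fun f \<Longrightarrow> torus_fun g \<Longrightarrow> torus_fun (\<lambda>x. F (f x) (g x))"
  by (simp add: torus_fun_def)

lemma torus_fun_compose: "torus_fun f \<Longrightarrow> torus_fun (\<lambda>x. F (f x))"
  by (simp add: torus_fun_def)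

section \<open>Extrema and bounds of periodic continuous functions\<close>

lemma torus_attains_sup:
  fixes f :: "real ^ 'n \<Rightarrow> real"
  assumes "torus_fun f" "continuous_on UNIV f"
  obtains x0 where "\<And>x. f x \<le> f x0"
proof -
  have "\<exists>x0\<in>cbox 0 (1 :: real ^ 'n). \<forall>x\<in>cbox 0 1. f x \<le> f x0"
  proof (rule continuous_attains_sup)
    show "cbox 0 (1 :: real ^ 'n) \<noteq> {}"
      using unit_cell_subset_cbox frac_vec_in_unit_cell by blast
    show "continuous_on (cbox 0 (1 :: real ^ 'n)) f"
      using assms(2) continuous_on_subset by blast
  qed simp
  then obtain x0 where x0: "\<forall>x\<in>cbox 0 1. f x \<le> f x0" by blast
  have "f x \<le> f x0" for x
    using x0 frac_vec_in_unit_cell[of x] unit_cell_subset_cbox torus_fun_frac_vec[OF assms(1), of x]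
    by (metis subsetD)
  then show ?thesis using that by blast
qed

lemma torus_attains_inf:
  fixes f :: "real ^ 'n \<Rightarrow> real"
  assumes "torus_fun f" "continuous_on UNIV f"
  obtains x0 where "\<And>x. f x0 \<le> f x"
proof -
  have "torus_fun (\<lambda>x. - f x)" "continuous_on UNIV (\<lambda>x. - f x)"
    using assms by (auto simp: torus_fun_def intro!: continuous_intros)
  then obtain x0 where "\<And>x. - f x \<le> - f x0" using torus_attains_sup by blast
  then show ?thesis using that by auto
qed

lemma torus_bounded:
  fixes f :: "real ^ 'n \<Rightarrow> 'b::real_normed_vector"
  assumes "torus_fun f" "continuous_on UNIV f"
  obtains M where "M > 0" "\<And>x. norm (f x) \<le> M"
proof -
  have "torus_fun (\<lambda>x. norm (f x))" "continuous_on UNIV (\<lambda>x. norm (f x))"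
    using assms by (auto simp: torus_fun_def intro!: continuous_intros)
  then obtain x0 where "\<And>x. norm (f x) \<le> norm (f x0)" using torus_attains_sup by blast
  then show ?thesis using that[of "norm (f x0) + 1"]
    by (metis add.commute add_pos_nonneg le_add_same_cancel2 norm_ge_zero order_trans zero_le_one zero_less_one)
qed

text \<open>\<open>C2\<close> for scalar functions in coordinates. Gradient and Hessian are
  arguments, so that the jets of sums, multiples and explicit functions can be computed;
  \<open>has_jet_iff\<close> identifies them with \<open>grad\<close> and
  \<open>hess\<close>.\<close>

definition has_jet ::
  "(real ^ 'n \<Rightarrow> real) \<Rightarrow> (real ^ 'n \<Rightarrow> real ^ 'n) \<Rightarrow> (real ^ 'n \<Rightarrow> real ^ 'n ^ 'n) \<Rightarrow> bool" where
  "has_jet f g h \<longleftrightarrow>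
     (\<forall>x. (f has_derivative (\<lambda>y. g x \<bullet> y)) (at x)) \<and>
     (\<forall>x. (g has_derivative (\<lambda>y. h x *v y)) (at x)) \<and> continuous_on UNIV h"

lemma grad_eqI:
  assumes "(f has_derivative (\<lambda>y. g \<bullet> y)) (at x)"
  shows "grad f x = g"
proof -
  have "frechet_derivative f (at x) = (\<lambda>y. g \<bullet> y)"
    using frechet_derivative_at[OF assms] by simp
  then show ?thesis by (simp add: grad_def vec_eq_iff inner_axis)
qed

lemma grad_has_derivative:
  fixes f :: "real ^ 'n \<Rightarrow> real"
  assumes "f differentiable (at x)"
  shows "(f has_derivative (\<lambda>y. grad f x \<bullet> y)) (at x)"
proof -
  let ?D = "frechet_derivative f (at x)"
  have D: "(f has_derivative ?D) (at x)" using assms frechet_derivative_works by blast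
  then interpret bounded_linear ?D by (rule has_derivative_bounded_linear)
  have "?D y = grad f x \<bullet> y" for y
  proof -
    have "?D y = ?D (\<Sum>i\<in>UNIV. (y $ i) *\<^sub>R axis i 1)"
      using basis_expansion[of y] by (simp add: scalar_mult_eq_scaleR)
    also have "\<dots> = grad f x \<bullet> y"
      by (simp add: sum scaleR grad_def inner_vec_def mult.commute)
    finally show ?thesis .
  qed
  then show ?thesis using D by (metis (no_types, lifting) ext)
qed

lemma has_jet_grad: "has_jet f g h \<Longrightarrow> grad f = g"
  unfolding has_jet_def by (auto intro!: grad_eqI)

lemma has_jet_hess:
  assumes "has_jet f g h"
  shows "hess f = h"
proof
  fix x
  have g: "grad f = g" by (rule has_jet_grad[OF assms])
  have "grad (\<lambda>y. g y $ i) x = h x $ i" for i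
  proof (rule grad_eqI)
    have "(g has_derivative (\<lambda>y. h x *v y)) (at x)" using assms by (simp add: has_jet_def)
    then have "((\<lambda>y. g y $ i) has_derivative (\<lambda>y. (h x *v y) $ i)) (at x)"
      by (rule bounded_linear.has_derivative[OF bounded_linear_vec_nth])
    then show "((\<lambda>y. g y $ i) has_derivative (\<lambda>y. h x $ i \<bullet> y)) (at x)"
      by (simp add: matrix_vector_mult_def inner_vec_def)
  qed
  then show "hess f x = h x" by (simp add: hess_def g vec_eq_iff)
qed

lemma linear_matrix_vector_mul_left: "linear (\<lambda>M :: real ^ 'n ^ 'm. M *v y)"
  by (intro linearI) (simp_all add: matrix_vector_mult_add_rdistrib scaleR_matrix_vector_assoc)

lemma has_jet_imp_C2:
  fixes f :: "real ^ 'n \<Rightarrow> real"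
  assumes "has_jet f g h"
  shows "C2 f"
proof -
  \<comment> \<open>\<open>\<Phi> M\<close> is the bilinear form of M as an operator-valued
    operator. It is linear in M, so continuity of the Hessian matrix carries over to the second
    derivative that \<open>C2\<close> asks for.\<close>
  define \<Phi> where "\<Phi> M = Blinfun (\<lambda>y. blinfun_inner_right (M *v y))" for M :: "real ^ 'n ^ 'n"
  have bl: "bounded_linear (\<lambda>y. blinfun_inner_right (M *v y) :: (real^'n) \<Rightarrow>\<^sub>L real)" for M :: "real ^ 'n ^ 'n"
    by (rule bounded_linear_compose[OF bounded_linear_blinfun_inner_right matrix_vector_mul_bounded_linear])
  have ap: "blinfun_apply (\<Phi> M) y = blinfun_inner_right (M *v y)" for M y
    unfolding \<Phi>_def by (simp add: bounded_linear_Blinfun_apply[OF bl])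
  have "linear \<Phi>"
    by (intro linearI blinfun_eqI)
       (simp_all add: ap blinfun.add_left blinfun.scaleR_left matrix_vector_mult_add_rdistrib
         scaleR_matrix_vector_assoc[symmetric] inner_add_left)
  then have "bounded_linear \<Phi>" by (simp add: linear_conv_bounded_linear)
  then have c: "continuous_on UNIV (\<lambda>x. \<Phi> (h x))"
    using assms bounded_linear.continuous_on unfolding has_jet_def by blast
  have d1: "(f has_derivative blinfun_apply (blinfun_inner_right (g x))) (at x)" for x
    using assms by (simp add: has_jet_def)
  have d2: "((\<lambda>x. blinfun_inner_right (g x)) has_derivative blinfun_apply (\<Phi> (h x))) (at x)" for x
  proof -
    have "(g has_derivative (\<lambda>y. h x *v y)) (at x)" using assms by (simp add: has_jet_def)
    from bounded_linear.has_derivative[OF bounded_linear_blinfun_inner_right this]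
    show ?thesis by (simp add: ap[abs_def])
  qed
  show ?thesis unfolding C2_def
    by (rule exI[of _ "\<lambda>x. blinfun_inner_right (g x)"], rule exI[of _ "\<lambda>x. \<Phi> (h x)"])
       (use c d1 d2 in simp)
qed

lemma C2_imp_has_jet:
  fixes f :: "real ^ 'n \<Rightarrow> real"
  assumes "C2 f"
  shows "has_jet f (grad f) (hess f)"
proof -
  obtain f' f'' where f': "\<And>x. (f has_derivative blinfun_apply (f' x)) (at x)"
    and f'': "\<And>x. (f' has_derivative blinfun_apply (f'' x)) (at x)"
    and c: "continuous_on UNIV f''"
    using assms unfolding C2_def by blast
  define g where "g x = (\<chi> i. f' x (axis i 1))" for x
  define h where "h x = (\<chi> i j. f'' x (axis j 1) (axis i 1))" for x
  have ex: "y = (\<Sum>i\<in>UNIV. (y $ i) *\<^sub>R axis i 1)" for y :: "real ^ 'n"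
    using basis_expansion[of y] by (simp add: scalar_mult_eq_scaleR)
  have g: "g x \<bullet> y = f' x y" for x y
  proof -
    have "f' x y = f' x (\<Sum>i\<in>UNIV. (y $ i) *\<^sub>R axis i 1)" using ex[of y] by simp
    also have "\<dots> = g x \<bullet> y"
      by (simp add: blinfun.sum_right blinfun.scaleR_right g_def inner_vec_def mult.commute)
    finally show ?thesis by simp
  qed
  have h: "(h x *v y) $ i = f'' x y (axis i 1)" for x y i
  proof -
    have "f'' x y (axis i 1) = f'' x (\<Sum>j\<in>UNIV. (y $ j) *\<^sub>R axis j 1) (axis i 1)" using ex[of y] by simp
    also have "\<dots> = (h x *v y) $ i"
      by (simp add: blinfun.sum_right blinfun.scaleR_right blinfun.sum_left blinfun.scaleR_left
          h_def matrix_vector_mult_def mult.commute)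
    finally show ?thesis by simp
  qed
  have d1: "(f has_derivative (\<lambda>y. g x \<bullet> y)) (at x)" for x
    using f'[of x] by (simp add: g[abs_def])
  have d2: "(g has_derivative (\<lambda>y. h x *v y)) (at x)" for x
  proof -
    have "((\<lambda>x. g x $ i) has_derivative (\<lambda>y. (h x *v y) $ i)) (at x)" for i
      unfolding g_def h by (simp add: bounded_linear.has_derivative[OF blinfun.bounded_linear_left f''])
    then have "((\<lambda>x. g x \<bullet> b) has_derivative (\<lambda>y. (h x *v y) \<bullet> b)) (at x)" if "b \<in> Basis" for b
      using that by (auto simp: Basis_vec_def inner_axis)
    then show ?thesis
      by (subst has_derivative_componentwise_within) auto
  qed
  have d3: "continuous_on UNIV h"
    unfolding h_def by (intro continuous_intros c)
  have "has_jet f g h" using d1 d2 d3 by (simp add: has_jet_def)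
  then show ?thesis using has_jet_grad has_jet_hess by blast
qed

lemma has_jet_iff: "has_jet f g h \<longleftrightarrow> C2 f \<and> grad f = g \<and> hess f = h"
  using C2_imp_has_jet has_jet_imp_C2 has_jet_grad has_jet_hess by blast

lemma has_jet_add:
  assumes "has_jet f g h" "has_jet f' g' h'"
  shows "has_jet (\<lambda>x. f x + f' x) (\<lambda>x. g x + g' x) (\<lambda>x. h x + h' x)"
  unfolding has_jet_def
proof (intro conjI allI)
  fix x
  have "(f has_derivative (\<lambda>y. g x \<bullet> y)) (at x)" "(f' has_derivative (\<lambda>y. g' x \<bullet> y)) (at x)"
    "(g has_derivative (\<lambda>y. h x *v y)) (at x)" "(g' has_derivative (\<lambda>y. h' x *v y)) (at x)"
    using assms by (auto simp: has_jet_def)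
  from has_derivative_add[OF this(1,2)] has_derivative_add[OF this(3,4)]
  show "((\<lambda>x. f x + f' x) has_derivative (\<lambda>y. (g x + g' x) \<bullet> y)) (at x)"
    "((\<lambda>x. g x + g' x) has_derivative (\<lambda>y. (h x + h' x) *v y)) (at x)"
    by (simp_all add: inner_add_left matrix_vector_mult_add_rdistrib)
qed (use assms in \<open>auto simp: has_jet_def intro!: continuous_on_add\<close>)

lemma has_jet_scaleR:
  assumes "has_jet f g h"
  shows "has_jet (\<lambda>x. c * f x) (\<lambda>x. c *\<^sub>R g x) (\<lambda>x. c *\<^sub>R h x)"
  unfolding has_jet_def
proof (intro conjI allI)
  fix x
  have "(f has_derivative (\<lambda>y. g x \<bullet> y)) (at x)" "(g has_derivative (\<lambda>y. h x *v y)) (at x)"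
    using assms by (auto simp: has_jet_def)
  from has_derivative_mult_right[OF this(1), of c] has_derivative_scaleR_right[OF this(2), of c]
  show "((\<lambda>x. c * f x) has_derivative (\<lambda>y. (c *\<^sub>R g x) \<bullet> y)) (at x)"
    "((\<lambda>x. c *\<^sub>R g x) has_derivative (\<lambda>y. (c *\<^sub>R h x) *v y)) (at x)"
    by (simp_all add: scaleR_matrix_vector_assoc[symmetric])
qed (use assms in \<open>auto simp: has_jet_def intro!: continuous_intros\<close>)

lemma has_jet_const: "has_jet (\<lambda>x :: real ^ 'n. c) (\<lambda>x. 0) (\<lambda>x. 0)"
proof -
  have "(\<bullet>) (0 :: real ^ 'n) = (\<lambda>y. 0)" "(*v) (0 :: real ^ 'n ^ 'n) = (\<lambda>y. 0)" by auto
  then show ?thesis unfolding has_jet_def by simp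
qed

lemma has_jet_periodic:
  assumes "has_jet f g h" "torus_fun f"
  shows "torus_fun g" "torus_fun h"
proof -
  have *: "g (x + k) = g x" if k: "\<And>i. k $ i \<in> \<int>" for x k
  proof -
    have "(f has_derivative (\<lambda>y. g (x + k) \<bullet> y)) (at (x + k))" using assms(1) by (simp add: has_jet_def)
    then have "((\<lambda>z. f (z + k)) has_derivative (\<lambda>y. g (x + k) \<bullet> y)) (at x)"
      by (auto intro!: has_derivative_compose[of "\<lambda>z. z + k" "\<lambda>y. y" x UNIV f] derivative_eq_intros)
    moreover have "(\<lambda>z. f (z + k)) = f" using torus_funD[OF assms(2)] k by blast
    ultimately show ?thesis
      using grad_eqI has_jet_grad[OF assms(1)] by metis
  qed
  then show "torus_fun g" by (simp add: torus_fun_def)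
  have "h (x + k) = h x" if k: "\<And>i. k $ i \<in> \<int>" for x k
  proof -
    have "(g has_derivative (\<lambda>y. h (x + k) *v y)) (at (x + k))" using assms(1) by (simp add: has_jet_def)
    then have "((\<lambda>z. g (z + k)) has_derivative (\<lambda>y. h (x + k) *v y)) (at x)"
      by (auto intro!: has_derivative_compose[of "\<lambda>z. z + k" "\<lambda>y. y" x UNIV g] derivative_eq_intros)
    moreover have "(\<lambda>z. g (z + k)) = g" using * k by blast
    ultimately have "(g has_derivative (\<lambda>y. h (x + k) *v y)) (at x)" by simp
    moreover have "(g has_derivative (\<lambda>y. h x *v y)) (at x)" using assms(1) by (simp add: has_jet_def)
    ultimately have "(\<lambda>y. h (x + k) *v y) = (\<lambda>y. h x *v y)" by (rule has_derivative_unique)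
    then show ?thesis by (simp add: matrix_eq fun_eq_iff)
  qed
  then show "torus_fun h" by (simp add: torus_fun_def)
qed

lemma has_jet_continuous:
  assumes "has_jet f g h"
  shows "continuous_on UNIV f" "continuous_on UNIV g" "continuous_on UNIV h"
  using assms unfolding has_jet_def
  by (auto intro!: has_derivative_continuous_on intro: has_derivative_at_withinI)

text \<open>Along the segment from x to z the derivative of the Taylor remainder is the first-order
  remainder of the gradient at x. This is at most \<open>\<tau>\<close> times the distance, and the
  mean value theorem does the rest.\<close>

lemma has_jet_taylor:
  assumes "has_jet f g h" "\<tau> > 0"
  shows "\<forall>\<^sub>F z in nhds x.
    \<bar>f z - (f x + g x \<bullet> (z - x) + (z - x) \<bullet> (h x *v (z - x)) / 2)\<bar> \<le> \<tau> * (norm (z - x))\<^sup>2"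
proof -
  have "(g has_derivative (\<lambda>y. h x *v y)) (at x)" using assms(1) by (simp add: has_jet_def)
  then obtain d where d: "d > 0"
    and D: "\<And>y. norm (y - x) < d \<Longrightarrow> norm (g y - g x - h x *v (y - x)) \<le> \<tau> * norm (y - x)"
    using \<open>\<tau> > 0\<close> unfolding has_derivative_at_alt by blast
  have "\<bar>f z - (f x + g x \<bullet> (z - x) + (z - x) \<bullet> (h x *v (z - x)) / 2)\<bar> \<le> \<tau> * (norm (z - x))\<^sup>2"
    if z: "dist z x < d" for z
  proof -
    define e where "e = z - x"
    define F where "F t = f (x + t *\<^sub>R e) - t * (g x \<bullet> e) - t\<^sup>2 * (e \<bullet> (h x *v e)) / 2" for t :: real
    have "\<exists>t. t > 0 \<and> t < 1 \<and> F 1 - F 0 = (1 - 0) * ((g (x + t *\<^sub>R e) - g x - h x *v (t *\<^sub>R e)) \<bullet> e)"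
    proof (rule MVT2)
      fix t :: real
      have 1: "(f has_derivative (\<lambda>y. g (x + t *\<^sub>R e) \<bullet> y)) (at (x + t *\<^sub>R e))"
        using assms(1) by (simp add: has_jet_def)
      have 2: "((\<lambda>s. x + s *\<^sub>R e) has_derivative (\<lambda>s. s *\<^sub>R e)) (at t)"
        by (auto intro!: derivative_eq_intros)
      note has_derivative_compose[OF 2 1]
      then have *: "((\<lambda>s. f (x + s *\<^sub>R e)) has_field_derivative g (x + t *\<^sub>R e) \<bullet> e) (at t)"
        unfolding has_field_derivative_def by (rule has_derivative_eq_rhs) (simp add: fun_eq_iff mult.commute)
      show "(F has_field_derivative (g (x + t *\<^sub>R e) - g x - h x *v (t *\<^sub>R e)) \<bullet> e) (at t)"
        unfolding F_def
        by (auto intro!: * derivative_eq_intros simp: inner_diff_left matrix_vector_mult_scaleR inner_commute[of e])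
    qed auto
    then obtain t where t: "0 < t" "t < 1"
      "F 1 - F 0 = (g (x + t *\<^sub>R e) - g x - h x *v (t *\<^sub>R e)) \<bullet> e" by auto
    have "norm (x + t *\<^sub>R e - x) < d"
    proof -
      have "t * norm e \<le> norm e" using t by (simp add: mult_left_le_one_le)
      then show ?thesis using t z by (simp add: e_def dist_norm)
    qed
    from D[OF this] have "norm (g (x + t *\<^sub>R e) - g x - h x *v (t *\<^sub>R e)) \<le> \<tau> * norm (t *\<^sub>R e)" by simp
    also have "\<dots> \<le> \<tau> * norm e" using t \<open>\<tau> > 0\<close> by (simp add: mult_left_le_one_le)
    finally have "\<bar>F 1 - F 0\<bar> \<le> \<tau> * norm e * norm e"
      unfolding t(3) by (metis Cauchy_Schwarz_ineq2 mult_right_mono norm_ge_zero order_trans)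
    then show ?thesis by (simp add: F_def e_def power2_eq_square algebra_simps)
  qed
  then show ?thesis using d unfolding eventually_nhds_metric by blast
qed

lemma C2_torus_has_jet: "C2_torus f \<Longrightarrow> has_jet f (grad f) (hess f)"
  by (simp add: C2_torus_def C2_imp_has_jet)

lemma C2_torusI: "has_jet f g h \<Longrightarrow> torus_fun f \<Longrightarrow> C2_torus f"
  by (simp add: C2_torus_def has_jet_imp_C2)

section \<open>Symmetric matrices and their square roots\<close>

lemma symmetric_inner_commute:
  fixes S :: "real ^ 'n ^ 'n"
  assumes "transpose S = S"
  shows "x \<bullet> (S *v y) = (S *v x) \<bullet> y"
  using dot_lmul_matrix[of x S y] transpose_matrix_vector[of S x] assms by simp

text \<open>The spectral theorem, stated for invariant subspaces so that induction on the dimension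
  works: a maximiser of the Rayleigh quotient on the unit sphere of U is an eigenvector, and its
  orthogonal complement inside U is again invariant.\<close>

lemma symmetric_eigen_subspace:
  fixes S :: "real ^ 'n ^ 'n"
  assumes sym: "transpose S = S"
  shows "subspace U \<Longrightarrow> (\<And>x. x \<in> U \<Longrightarrow> S *v x \<in> U) \<Longrightarrow>
    \<exists>B. finite B \<and> B \<subseteq> U \<and> card B = dim U \<and> pairwise orthogonal B \<and>
      (\<forall>b\<in>B. norm b = 1 \<and> (\<exists>l. S *v b = l *\<^sub>R b))"
proof (induction "dim U" arbitrary: U)
  case 0
  then show ?case by (intro exI[of _ "{}"]) auto
next
  case (Suc d)
  have "U \<noteq> {0}" using Suc.hyps(2) by auto
  then obtain u where u: "u \<in> U" "u \<noteq> 0" using Suc.prems(1) subspace_0 by blast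
  let ?K = "U \<inter> sphere 0 1"
  have "compact ?K" using Suc.prems(1) by (simp add: closed_Int_compact closed_subspace)
  moreover have "(1 / norm u) *\<^sub>R u \<in> ?K" using u Suc.prems(1) by (simp add: subspace_scale)
  moreover have "continuous_on ?K (\<lambda>x. x \<bullet> (S *v x))" by (intro continuous_intros)
  ultimately obtain e where e: "e \<in> ?K" and emax: "\<And>x. x \<in> ?K \<Longrightarrow> x \<bullet> (S *v x) \<le> e \<bullet> (S *v e)"
    using continuous_attains_sup[of ?K] by blast
  define l where "l = e \<bullet> (S *v e)"
  have n1: "norm e = 1" and eU: "e \<in> U" using e by auto
  then have ee: "e \<bullet> e = 1" by (simp add: norm_eq_1)
  have le: "x \<bullet> (S *v x) \<le> l * (x \<bullet> x)" if "x \<in> U" for x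
  proof (cases "x = 0")
    case False
    have "(1 / norm x) *\<^sub>R x \<in> ?K" using that False Suc.prems(1) by (simp add: subspace_scale)
    from emax[OF this] have "(x \<bullet> (S *v x)) / (norm x)\<^sup>2 \<le> l"
      by (simp add: l_def matrix_vector_mult_scaleR power2_eq_square)
    then show ?thesis using False by (simp add: divide_le_eq dot_square_norm)
  qed simp
  \<comment> \<open>First-order condition at the maximiser: comparing e with e + t y leaves
    \<open>2 * t * a \<le> t\<^sup>2 * b\<close> for every t, so the linear coefficient a must
    vanish.\<close>
  have orth: "e \<bullet> (S *v y) = 0" if y: "y \<in> U" "e \<bullet> y = 0" for y
  proof -
    define a where "a = e \<bullet> (S *v y)"
    define b where "b = l * (y \<bullet> y) - y \<bullet> (S *v y)"
    have b0: "b \<ge> 0" using le[OF y(1)] by (simp add: b_def)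
    have *: "2 * t * a \<le> t\<^sup>2 * b" for t
    proof -
      have "e + t *\<^sub>R y \<in> U" using eU y Suc.prems(1) by (simp add: subspace_add subspace_scale)
      from le[OF this] show ?thesis
        using y(2) ee symmetric_inner_commute[OF sym, of y e]
        by (simp add: a_def b_def l_def matrix_vector_right_distrib matrix_vector_mult_scaleR inner_add_left
            inner_add_right inner_commute power2_eq_square algebra_simps)
    qed
    have "a = 0"
    proof (rule ccontr)
      assume "a \<noteq> 0"
      then have "a\<^sup>2 > 0" by simp
      \<comment> \<open>A step proportional to a makes the linear term dominate; the denominator b +
        1 stays positive when b = 0.\<close>
      have "2 * (a / (b + 1)) * a \<le> (a / (b + 1))\<^sup>2 * b" by (rule *)
      then have "2 * a\<^sup>2 * (b + 1) \<le> a\<^sup>2 * b" using b0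
        by (simp add: power2_eq_square divide_simps split: if_splits)
      then have "a\<^sup>2 * (b + 2) \<le> 0" by (simp add: algebra_simps)
      then show False using \<open>a\<^sup>2 > 0\<close> b0 by (metis add_nonneg_pos mult_pos_pos not_less zero_less_numeral)
    qed
    then show ?thesis by (simp add: a_def)
  qed
  \<comment> \<open>The residual z lies in U and is orthogonal to e, so \<open>orth\<close> applies
    to z itself and yields z . z = 0.\<close>
  have Se: "S *v e = l *\<^sub>R e"
  proof -
    define z where "z = S *v e - l *\<^sub>R e"
    have "z \<in> U" using Suc.prems eU by (simp add: z_def subspace_diff subspace_scale)
    moreover have ez: "e \<bullet> z = 0" using ee by (simp add: z_def inner_diff_right l_def)
    ultimately have "e \<bullet> (S *v z) = 0" by (rule orth)
    then have "(S *v e) \<bullet> z = 0" by (simp add: symmetric_inner_commute[OF sym])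
    then have "z \<bullet> z = 0" using ez by (simp add: z_def inner_diff_left)
    then show ?thesis by (simp add: z_def)
  qed
  define V where "V = {y \<in> U. e \<bullet> y = 0}"
  have V: "subspace V"
    using Suc.prems(1) unfolding V_def subspace_def by (auto simp: inner_add_right)
  have "V = {y \<in> U. \<forall>x\<in>span {e}. orthogonal x y}"
    by (auto simp: V_def span_singleton orthogonal_def)
  moreover have "dim {y \<in> U. \<forall>x\<in>span {e}. orthogonal x y} + dim (span {e}) = dim U"
    using eU Suc.prems(1) by (intro dim_subspace_orthogonal_to_vectors) (auto simp: span_minimal)
  moreover have "dim (span {e}) = 1" using n1 by (auto simp: dim_eq_card_independent)
  ultimately have "d = dim V" using Suc.hyps(2) by simp
  moreover have "S *v x \<in> V" if "x \<in> V" for x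
    using that Suc.prems(2) by (simp add: V_def orth)
  ultimately obtain B where B: "finite B" "B \<subseteq> V" "card B = dim V" "pairwise orthogonal B"
    "\<forall>b\<in>B. norm b = 1 \<and> (\<exists>l. S *v b = l *\<^sub>R b)"
    using Suc.hyps(1)[OF _ V] by blast
  have "e \<notin> B" using B(2) ee by (auto simp: V_def)
  then show ?case
    using B n1 Se eU \<open>d = dim V\<close> Suc.hyps(2)
    by (intro exI[of _ "insert e B"])
       (auto simp: V_def pairwise_insert orthogonal_def inner_commute)
qed

theorem symmetric_eigenbasis:
  fixes S :: "real ^ 'n ^ 'n"
  assumes sym: "transpose S = S"
  obtains e :: "'n \<Rightarrow> real ^ 'n" and l where "\<And>i j. e i \<bullet> e j = (if i = j then 1 else 0)"
    "\<And>i. S *v e i = l i *\<^sub>R e i"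
proof -
  obtain B where B: "finite B" "card B = dim (UNIV :: (real ^ 'n) set)" "pairwise orthogonal B"
    "\<forall>b\<in>B. norm b = 1 \<and> (\<exists>l. S *v b = l *\<^sub>R b)"
    using symmetric_eigen_subspace[OF sym, of UNIV] by auto
  have "card B = CARD('n)" using B(2) by (simp add: dim_UNIV)
  then obtain e where e: "bij_betw e (UNIV :: 'n set) B"
    using finite_same_card_bij[OF finite B(1)] by metis
  have eB: "e i \<in> B" for i using e by (auto simp: bij_betw_def)
  then have "\<forall>i. \<exists>l. S *v e i = l *\<^sub>R e i" using B(4) by blast
  then obtain l where l: "\<And>i. S *v e i = l i *\<^sub>R e i" by metis
  have "e i \<bullet> e j = (if i = j then 1 else 0)" for i j
  proof (cases "i = j")
    case True then show ?thesis using B(4) eB by (simp add: dot_square_norm)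
  next
    case False
    then have "e i \<noteq> e j" using e by (auto simp: bij_betw_def inj_def)
    then show ?thesis using B(3) eB False by (simp add: pairwise_def orthogonal_def)
  qed
  then show ?thesis using l that by blast
qed

section \<open>Orthonormal bases, Gram factorisations and square roots\<close>

lemma orthonormal_expand:
  fixes e :: "'n \<Rightarrow> real ^ 'n"
  assumes on: "\<And>i j. e i \<bullet> e j = (if i = j then 1 else 0)"
  shows "(\<Sum>i\<in>UNIV. (e i \<bullet> y) *\<^sub>R e i) = y"
proof -
  have inj: "inj e" using on by (metis injI zero_neq_one)
  have c: "card (range e) = CARD('n)" using inj by (simp add: card_image)
  have orth: "pairwise orthogonal (range e)"
    using on by (auto simp: pairwise_def orthogonal_def)
  have n1: "\<And>b. b \<in> range e \<Longrightarrow> norm b = 1" using on by (auto simp: norm_eq_1)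
  have "independent (range e)"
    using orth n1 by (intro pairwise_orthogonal_independent) (metis norm_zero zero_neq_one)+
  then have "UNIV \<subseteq> span (range e)"
    using c by (intro card_ge_dim_independent) (auto simp: dim_UNIV)
  then have "(\<Sum>b\<in>range e. (y \<bullet> b) *\<^sub>R b) = y"
    using orth n1 by (intro orthonormal_basis_expand) auto
  then show ?thesis using inj by (simp add: sum.reindex inner_commute)
qed

lemma orthonormal_parseval:
  fixes e :: "'n \<Rightarrow> real ^ 'n"
  assumes on: "\<And>i j. e i \<bullet> e j = (if i = j then 1 else 0)"
  shows "(\<Sum>i\<in>UNIV. (e i \<bullet> x) * (e i \<bullet> y)) = x \<bullet> y"
proof -
  have "x \<bullet> y = (\<Sum>i\<in>UNIV. (e i \<bullet> x) *\<^sub>R e i) \<bullet> y" by (simp add: orthonormal_expand[OF on])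
  then show ?thesis by (simp add: inner_sum_left)
qed

text \<open>The matrix S S^T, where S has the columns \<open>m k\<close>. A square root of a
  semidefinite matrix is thus handled as a family of vectors, and \<open>trace_gram\<close> turns a
  trace against X into a sum of values of the quadratic form of X.\<close>

definition gram :: "('k::finite \<Rightarrow> real ^ 'n) \<Rightarrow> real ^ 'n ^ 'n" where
  "gram m = (\<chi> i j. \<Sum>k\<in>UNIV. m k $ i * m k $ j)"

lemma trace_gram: "trace (gram m ** X) = (\<Sum>k\<in>UNIV. m k \<bullet> (X *v m k))"
proof -
  have "trace (gram m ** X) = (\<Sum>i\<in>UNIV. \<Sum>j\<in>UNIV. \<Sum>k\<in>UNIV. m k $ i * m k $ j * X $ j $ i)"
    by (simp add: trace_def matrix_matrix_mult_def gram_def sum_distrib_right)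
  also have "\<dots> = (\<Sum>k\<in>UNIV. \<Sum>i\<in>UNIV. \<Sum>j\<in>UNIV. m k $ i * m k $ j * X $ j $ i)"
    by (subst sum.swap, subst (2) sum.swap) simp
  also have "\<dots> = (\<Sum>k\<in>UNIV. \<Sum>j\<in>UNIV. \<Sum>i\<in>UNIV. m k $ i * m k $ j * X $ j $ i)"
    by (subst (2) sum.swap) simp
  also have "\<dots> = (\<Sum>k\<in>UNIV. m k \<bullet> (X *v m k))"
    by (simp add: inner_vec_def matrix_vector_mult_def sum_distrib_left mult_ac)
  finally show ?thesis .
qed

lemma gram_vector_mult: "gram m *v y = (\<Sum>k\<in>UNIV. (m k \<bullet> y) *\<^sub>R m k)"
proof -
  have "(gram m *v y) $ i = (\<Sum>k\<in>UNIV. (m k \<bullet> y) *\<^sub>R m k) $ i" for i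
  proof -
    have "(gram m *v y) $ i = (\<Sum>j\<in>UNIV. \<Sum>k\<in>UNIV. m k $ i * m k $ j * y $ j)"
      by (simp add: gram_def matrix_vector_mult_def sum_distrib_right)
    also have "\<dots> = (\<Sum>k\<in>UNIV. \<Sum>j\<in>UNIV. m k $ i * m k $ j * y $ j)" by (rule sum.swap)
    also have "\<dots> = (\<Sum>k\<in>UNIV. (m k \<bullet> y) *\<^sub>R m k) $ i"
      by (simp add: inner_vec_def sum_distrib_left sum_distrib_right mult_ac)
    finally show ?thesis .
  qed
  then show ?thesis by (simp add: vec_eq_iff)
qed

lemma psd_eigenbasis:
  fixes S :: "real ^ 'n ^ 'n"
  assumes sym: "transpose S = S" and psd: "\<And>y. 0 \<le> y \<bullet> (S *v y)"
  obtains e :: "'n \<Rightarrow> real ^ 'n" and l where "\<And>i j. e i \<bullet> e j = (if i = j then 1 else 0)"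
    "\<And>i. S *v e i = l i *\<^sub>R e i" "\<And>i. l i \<ge> 0"
    "gram (\<lambda>k. sqrt (l k) *\<^sub>R e k) = S"
proof -
  obtain e :: "'n \<Rightarrow> real ^ 'n" and l where on: "\<And>i j. e i \<bullet> e j = (if i = j then 1 else 0)" and l: "\<And>i. S *v e i = l i *\<^sub>R e i"
    using symmetric_eigenbasis[OF sym] by blast
  have l0: "l i \<ge> 0" for i using psd[of "e i"] by (simp add: l on)
  have "gram (\<lambda>k. sqrt (l k) *\<^sub>R e k) *v y = S *v y" for y
  proof -
    have "S *v y = S *v (\<Sum>k\<in>UNIV. (e k \<bullet> y) *\<^sub>R e k)" by (simp add: orthonormal_expand[OF on])
    also have "\<dots> = (\<Sum>k\<in>UNIV. (e k \<bullet> y) *\<^sub>R (l k *\<^sub>R e k))"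
      by (simp add: vec.sum matrix_vector_mult_scaleR l)
    also have "\<dots> = (\<Sum>k\<in>UNIV. ((sqrt (l k) *\<^sub>R e k) \<bullet> y) *\<^sub>R (sqrt (l k) *\<^sub>R e k))"
    proof (intro sum.cong refl)
      fix k
      have "sqrt (l k) * sqrt (l k) = l k" using l0 by simp
      then have "(e k \<bullet> y) * l k = (sqrt (l k) * (e k \<bullet> y)) * sqrt (l k)" by (metis mult.assoc mult.commute)
      then show "(e k \<bullet> y) *\<^sub>R (l k *\<^sub>R e k) = ((sqrt (l k) *\<^sub>R e k) \<bullet> y) *\<^sub>R (sqrt (l k) *\<^sub>R e k)"
        by simp
    qed
    finally show ?thesis by (simp only: gram_vector_mult)
  qed
  then have "gram (\<lambda>k. sqrt (l k) *\<^sub>R e k) = S" by (simp add: matrix_eq)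
  with on l l0 show ?thesis by (rule that)
qed

lemma psd_gram:
  fixes S :: "real ^ 'n ^ 'n"
  assumes "transpose S = S" and "\<And>y. 0 \<le> y \<bullet> (S *v y)"
  obtains m :: "'n \<Rightarrow> real ^ 'n" where "gram m = S"
  by (rule psd_eigenbasis[OF assms]) (rule that)

lemma psd_trace_nonneg:
  fixes S :: "real ^ 'n ^ 'n"
  assumes "transpose S = S" and "\<And>y. 0 \<le> y \<bullet> (S *v y)" and "\<And>y. 0 \<le> y \<bullet> (X *v y)"
  shows "0 \<le> trace (S ** X)"
proof -
  obtain m :: "'n \<Rightarrow> real ^ 'n" where "gram m = S" using psd_gram[OF assms(1,2)] .
  then show ?thesis using trace_gram[of m X] assms(3) by (simp add: sum_nonneg)
qed

text \<open>With f an eigenbasis of Q and e one of P, the families are s k = Q^(1/2) f k and t k =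
  P^(1/2) f k, so the sum is the squared Hilbert-Schmidt norm of Q^(1/2) - P^(1/2). Its entries in
  the two bases are (sqrt (m k) - sqrt (l i)) (e i . f k); multiplied by sqrt (m k) + sqrt (l i)
  they become, up to sign, entries of P - Q, which polarisation bounds through the quadratic
  forms.\<close>

lemma psd_square_roots_close:
  fixes P Q :: "real ^ 'n ^ 'n"
  assumes symP: "transpose P = P" and psdP: "\<And>y. 0 \<le> y \<bullet> (P *v y)"
    and symQ: "transpose Q = Q" and psdQ: "\<And>y. 0 \<le> y \<bullet> (Q *v y)"
    and \<delta>: "\<delta> \<ge> 0"
    and close: "\<And>y. \<bar>sqrt (y \<bullet> (P *v y)) - sqrt (y \<bullet> (Q *v y))\<bar> \<le> \<delta> * norm y"
  obtains s t :: "'n \<Rightarrow> real ^ 'n" where "gram s = Q" "gram t = P"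
    "(\<Sum>k\<in>UNIV. (norm (s k - t k))\<^sup>2) \<le> 64 * (real CARD('n))\<^sup>2 * \<delta>\<^sup>2"
proof -
  obtain e :: "'n \<Rightarrow> real ^ 'n" and l where e: "\<And>i j. e i \<bullet> e j = (if i = j then 1 else 0)" "\<And>i. P *v e i = l i *\<^sub>R e i"
    "\<And>i. l i \<ge> 0" "gram (\<lambda>k. sqrt (l k) *\<^sub>R e k) = P"
    using psd_eigenbasis[OF symP psdP] by blast
  obtain f :: "'n \<Rightarrow> real ^ 'n" and m where f: "\<And>i j. f i \<bullet> f j = (if i = j then 1 else 0)" "\<And>i. Q *v f i = m i *\<^sub>R f i"
    "\<And>i. m i \<ge> 0" "gram (\<lambda>k. sqrt (m k) *\<^sub>R f k) = Q"
    using psd_eigenbasis[OF symQ psdQ] by blast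
  have ne: "norm (e i) = 1" and nf: "norm (f i) = 1" for i by (simp_all add: norm_eq_1 e(1) f(1))
  define s where "s k = sqrt (m k) *\<^sub>R f k" for k
  define t where "t k = (\<Sum>i\<in>UNIV. (sqrt (l i) * (e i \<bullet> f k)) *\<^sub>R e i)" for k
  have gs: "gram s = Q" using f(4) by (simp add: s_def[abs_def])
  have tk: "t k \<bullet> y = (\<Sum>i\<in>UNIV. (sqrt (l i) * (e i \<bullet> y)) * (e i \<bullet> f k))" for k y
    by (simp add: t_def inner_sum_left mult_ac)
  have tk2: "t k \<bullet> y = f k \<bullet> (\<Sum>i\<in>UNIV. (sqrt (l i) * (e i \<bullet> y)) *\<^sub>R e i)" for k y
    by (simp add: tk inner_sum_right inner_commute[of "f k"])
  have "gram t *v y = P *v y" for y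
  proof -
    have "x \<bullet> (gram t *v y) = x \<bullet> (P *v y)" for x
    proof -
      have "x \<bullet> (gram t *v y) = (\<Sum>k\<in>UNIV. (t k \<bullet> x) * (t k \<bullet> y))"
        by (simp add: gram_vector_mult inner_sum_right inner_commute[of x] mult_ac)
      also have "\<dots> = (\<Sum>i\<in>UNIV. (sqrt (l i) * (e i \<bullet> x)) *\<^sub>R e i) \<bullet> (\<Sum>i\<in>UNIV. (sqrt (l i) * (e i \<bullet> y)) *\<^sub>R e i)"
        unfolding tk2 by (rule orthonormal_parseval[OF f(1)])
      also have "\<dots> = (\<Sum>i\<in>UNIV. (sqrt (l i) * (e i \<bullet> x)) * (sqrt (l i) * (e i \<bullet> y)))"
        by (simp add: inner_sum_left inner_sum_right e(1) if_distrib cong: if_cong) (simp add: mult_ac)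
      also have "\<dots> = x \<bullet> (gram (\<lambda>k. sqrt (l k) *\<^sub>R e k) *v y)"
        by (simp add: gram_vector_mult inner_sum_right inner_commute[of x] mult_ac)
      finally show ?thesis by (simp add: e(4))
    qed
    then show ?thesis by (metis vector_eq_ldot)
  qed
  then have gt: "gram t = P" by (simp add: matrix_eq)
  have entry: "\<bar>e i \<bullet> (s k - t k)\<bar> \<le> 8 * \<delta>" for i k
  proof -
    define \<sigma> where "\<sigma> = sqrt (l i) + sqrt (m k)"
    have \<sigma>0: "\<sigma> \<ge> 0" using e(3) f(3) by (simp add: \<sigma>_def)
    have ev: "e i \<bullet> (s k - t k) = (sqrt (m k) - sqrt (l i)) * (e i \<bullet> f k)"
    proof -
      have "e i \<bullet> t k = sqrt (l i) * (e i \<bullet> f k)"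
        using tk[of k "e i"] by (simp add: inner_commute e(1) if_distrib if_distribR cong: if_cong)
      then show ?thesis by (simp add: s_def inner_diff_right algebra_simps)
    qed
    have ef: "\<bar>e i \<bullet> f k\<bar> \<le> 1"
      using Cauchy_Schwarz_ineq2[of "e i" "f k"] by (simp add: ne nf)
    show ?thesis
    \<comment> \<open>If the square roots of both eigenvalues are small, the entry is at most
      \<open>\<sigma>\<close> itself; otherwise the bound on \<open>\<sigma>\<close> times the entry
      may be divided by \<open>\<sigma>\<close>, with
      \<open>\<sigma> + \<delta> \<le> 2 * \<sigma>\<close>.\<close>
    proof (cases "\<sigma> < \<delta>")
      case True
      have "\<bar>sqrt (m k) - sqrt (l i)\<bar> \<le> \<sigma>" using e(3)[of i] f(3)[of k] by (simp add: \<sigma>_def abs_le_iff)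
      then have "\<bar>e i \<bullet> (s k - t k)\<bar> \<le> \<sigma> * 1" unfolding ev abs_mult using ef \<sigma>0 by (intro mult_mono) auto
      then show ?thesis using True \<delta> by simp
    next
      case False
      define D where "D y = y \<bullet> (P *v y) - y \<bullet> (Q *v y)" for y
      have NP: "sqrt (f k \<bullet> (P *v f k)) \<le> sqrt (m k) + \<delta>"
        using close[of "f k"] by (simp add: f(1,2) nf abs_le_iff)
      have NQ: "sqrt (e i \<bullet> (Q *v e i)) \<le> sqrt (l i) + \<delta>"
        using close[of "e i"] by (simp add: e(1,2) ne abs_le_iff)
      \<comment> \<open>The parallelogram law with one of its two nonnegative left-hand terms
        dropped.\<close>
      have par: "sqrt (y \<bullet> (R *v y)) \<le> 2 * (sqrt (a \<bullet> (R *v a)) + sqrt (b \<bullet> (R *v b)))"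
        if y: "y = a + b \<or> y = a - b" and R: "\<And>y. 0 \<le> y \<bullet> (R *v y)" for y a b and R :: "real ^ 'n ^ 'n"
      proof -
        have "y \<bullet> (R *v y) \<le> 2 * (a \<bullet> (R *v a)) + 2 * (b \<bullet> (R *v b))"
          using y R[of "a + b"] R[of "a - b"]
          by (auto simp: matrix_vector_right_distrib matrix_vector_mult_diff_distrib inner_add_left inner_add_right inner_diff_left inner_diff_right)
        also have "\<dots> \<le> (2 * (sqrt (a \<bullet> (R *v a)) + sqrt (b \<bullet> (R *v b))))\<^sup>2"
          using R[of a] R[of b] by (simp add: power2_eq_square algebra_simps)
        finally show ?thesis using R[of a] R[of b] by (simp add: real_le_lsqrt)
      qed
      have Dy: "\<bar>D y\<bar> \<le> 8 * \<delta> * (\<sigma> + \<delta>)" if y: "y = e i + f k \<or> y = e i - f k" for y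
      proof -
        have ny: "norm y \<le> 2"
          using y norm_triangle_ineq[of "e i" "f k"] norm_triangle_ineq4[of "e i" "f k"]
          by (auto simp: ne nf)
        have p: "sqrt (y \<bullet> (P *v y)) \<le> 2 * (sqrt (l i) + (sqrt (m k) + \<delta>))"
          using par[OF y psdP] NP by (simp add: e(1,2))
        have q: "sqrt (y \<bullet> (Q *v y)) \<le> 2 * (sqrt (l i) + \<delta> + sqrt (m k))"
          using par[OF y psdQ] NQ by (simp add: f(1,2))
        have "D y = (sqrt (y \<bullet> (P *v y)) - sqrt (y \<bullet> (Q *v y))) * (sqrt (y \<bullet> (P *v y)) + sqrt (y \<bullet> (Q *v y)))"
          using psdP[of y] psdQ[of y] by (simp add: D_def algebra_simps)
        also have "\<bar>\<dots>\<bar> \<le> (\<delta> * 2) * (4 * (\<sigma> + \<delta>))"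
          unfolding abs_mult
        proof (intro mult_mono)
          show "\<bar>sqrt (y \<bullet> (P *v y)) - sqrt (y \<bullet> (Q *v y))\<bar> \<le> \<delta> * 2"
            using close[of y] ny \<delta> by (meson mult_left_mono order_trans)
          show "\<bar>sqrt (y \<bullet> (P *v y)) + sqrt (y \<bullet> (Q *v y))\<bar> \<le> 4 * (\<sigma> + \<delta>)"
            using p q psdP[of y] psdQ[of y] by (simp add: \<sigma>_def)
        qed (use \<delta> in auto)
        finally show ?thesis by (simp add: algebra_simps)
      qed
      \<comment> \<open>Polarisation of the form of P - Q, evaluated with P e i = l i e i and Q f k
        = m k f k.\<close>
      have "4 * ((l i - m k) * (e i \<bullet> f k)) = D (e i + f k) - D (e i - f k)"
        using symmetric_inner_commute[OF symP, of "e i" "f k"] symmetric_inner_commute[OF symQ, of "e i" "f k"]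
        by (simp add: D_def matrix_vector_right_distrib matrix_vector_mult_diff_distrib inner_add_left inner_add_right
            inner_diff_left inner_diff_right e(2) f(2) inner_commute algebra_simps)
      then have "\<bar>(l i - m k) * (e i \<bullet> f k)\<bar> \<le> 4 * \<delta> * (\<sigma> + \<delta>)"
        using Dy[of "e i + f k"] Dy[of "e i - f k"] by (simp add: abs_le_iff)
      moreover have "l i - m k = (sqrt (l i) - sqrt (m k)) * \<sigma>"
        using e(3)[of i] f(3)[of k] by (simp add: \<sigma>_def algebra_simps)
      ultimately have "\<bar>e i \<bullet> (s k - t k)\<bar> * \<sigma> \<le> 4 * \<delta> * (\<sigma> + \<delta>)"
        using \<sigma>0 by (simp add: ev abs_mult abs_minus_commute mult_ac)
      also have "\<dots> \<le> 8 * \<delta> * \<sigma>" using False \<delta> mult_left_mono[of \<delta> \<sigma> \<delta>] by (simp add: algebra_simps)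
      finally have *: "\<bar>e i \<bullet> (s k - t k)\<bar> * \<sigma> \<le> (8 * \<delta>) * \<sigma>" .
      show ?thesis
      proof (cases "\<sigma> = 0")
        case True
        then have "sqrt (l i) = 0 \<and> sqrt (m k) = 0" using e(3)[of i] f(3)[of k] by (simp add: \<sigma>_def add_nonneg_eq_0_iff)
        then show ?thesis using \<delta> by (simp add: ev)
      next
        case False then show ?thesis using * \<sigma>0 by simp
      qed
    qed
  qed
  have "(norm (s k - t k))\<^sup>2 \<le> real CARD('n) * (64 * \<delta>\<^sup>2)" for k
  proof -
    have "(norm (s k - t k))\<^sup>2 = (\<Sum>i\<in>UNIV. (e i \<bullet> (s k - t k))\<^sup>2)"
      using orthonormal_parseval[OF e(1), of "s k - t k" "s k - t k"] by (simp add: dot_square_norm power2_eq_square)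
    also have "\<dots> \<le> (\<Sum>i\<in>(UNIV :: 'n set). (8 * \<delta>)\<^sup>2)"
      by (intro sum_mono) (metis entry abs_ge_zero power2_abs power_mono)
    finally show ?thesis by (simp add: power_mult_distrib)
  qed
  then have "(\<Sum>k\<in>(UNIV :: 'n set). (norm (s k - t k))\<^sup>2) \<le> (\<Sum>k\<in>(UNIV :: 'n set). real CARD('n) * (64 * \<delta>\<^sup>2))"
    by (intro sum_mono)
  then have "(\<Sum>k\<in>(UNIV :: 'n set). (norm (s k - t k))\<^sup>2) \<le> 64 * (real CARD('n))\<^sup>2 * \<delta>\<^sup>2"
    by (simp add: power2_eq_square algebra_simps)
  with gs gt show ?thesis by (rule that)
qed

lemma abs_quadratic_form_le:
  fixes M :: "real ^ 'n ^ 'n"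
  shows "\<bar>y \<bullet> (M *v y)\<bar> \<le> (real CARD('n))\<^sup>2 * norm M * (norm y)\<^sup>2"
proof -
  have "\<bar>y \<bullet> (M *v y)\<bar> = \<bar>\<Sum>i\<in>UNIV. \<Sum>j\<in>UNIV. y $ i * M $ i $ j * y $ j\<bar>"
    by (simp add: inner_vec_def matrix_vector_mult_def sum_distrib_left mult_ac)
  also have "\<dots> \<le> (\<Sum>i\<in>(UNIV :: 'n set). \<Sum>j\<in>(UNIV :: 'n set). norm y * norm M * norm y)"
    by (intro order_trans[OF sum_abs] sum_mono)
       (auto simp: abs_mult intro!: mult_mono component_le_norm_cart order_trans[OF component_le_norm_cart Finite_Cartesian_Product.norm_nth_le])
  finally show ?thesis by (simp add: power2_eq_square mult_ac)
qed

text \<open>A nonnegative function with |f''| <= M satisfies f'^2 <= 2 M f, since its upper Taylor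
  parabola must stay nonnegative at the vertex t = -f'(0)/M. Hence f(1) is at most the square of
  sqrt (f 0) + sqrt M, even if f vanishes somewhere.\<close>

lemma sqrt_nonneg_C11:
  fixes f f' f'' :: "real \<Rightarrow> real"
  assumes f: "\<And>t. (f has_real_derivative f' t) (at t)" and f': "\<And>t. (f' has_real_derivative f'' t) (at t)"
    and f'': "\<And>t. \<bar>f'' t\<bar> \<le> M" and pos: "\<And>t. f t \<ge> 0" and M: "M > 0"
  shows "sqrt (f 1) \<le> sqrt (f 0) + sqrt M"
proof -
  have T: "f t \<le> f 0 + f' 0 * t + M / 2 * t\<^sup>2" for t
  proof -
    have "\<exists>s. \<bar>s\<bar> \<le> \<bar>t\<bar> \<and> f t = (\<Sum>m<2. (if m = 0 then f else if m = 1 then f' else f'') 0 / fact m * t ^ m)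
        + (if (2::nat) = 0 then f else if (2::nat) = 1 then f' else f'') s / fact 2 * t ^ 2"
      by (rule Maclaurin_bi_le) (use f f' in \<open>auto simp: less_2_cases_iff\<close>)
    then obtain s where "f t = f 0 + f' 0 * t + f'' s / 2 * t\<^sup>2"
      by (auto simp: numeral_2_eq_2)
    moreover have "f'' s / 2 * t\<^sup>2 \<le> M / 2 * t\<^sup>2"
      using f''[of s] by (intro mult_right_mono) (auto simp: abs_le_iff)
    ultimately show ?thesis by simp
  qed
  have "0 \<le> f 0 + f' 0 * (- f' 0 / M) + M / 2 * (- f' 0 / M)\<^sup>2"
    using T[of "- f' 0 / M"] pos order_trans by blast
  then have "(f' 0)\<^sup>2 \<le> 2 * M * f 0"
    using M by (simp add: power2_eq_square field_simps)
  also have "\<dots> \<le> (2 * sqrt M * sqrt (f 0))\<^sup>2"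
    using M pos[of 0] by (simp add: power_mult_distrib)
  finally have "f' 0 \<le> 2 * sqrt M * sqrt (f 0)"
    by (rule power2_le_imp_le) (use M pos[of 0] in simp)
  then have "f 1 \<le> (sqrt (f 0) + sqrt M)\<^sup>2"
    using T[of 1] M pos[of 0] by (simp add: power2_sum mult_ac)
  then show ?thesis using M pos[of 0] by (simp add: real_le_lsqrt)
qed

text \<open>The second derivative of A enters here. Each y . A(x) y is nonnegative, so
  \<open>sqrt_nonneg_C11\<close> along segments makes its square root Lipschitz, also where A
  degenerates; periodicity of A'' makes the constant uniform.\<close>

lemma C2_torus_psd_sqrt_lipschitz:
  fixes A :: "real ^ 'n \<Rightarrow> real ^ 'n ^ 'n"
  assumes A: "C2_torus A" and psd: "\<And>x y. 0 \<le> y \<bullet> (A x *v y)"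
  obtains C where "C > 0"
    "\<And>x z y. \<bar>sqrt (y \<bullet> (A x *v y)) - sqrt (y \<bullet> (A z *v y))\<bar> \<le> C * norm (x - z) * norm y"
proof -
  obtain A' A'' where A': "\<And>x. (A has_derivative blinfun_apply (A' x)) (at x)"
    and A'': "\<And>x. (A' has_derivative blinfun_apply (A'' x)) (at x)"
    and c: "continuous_on UNIV A''"
    using A unfolding C2_torus_def C2_def by blast
  have per: "torus_fun A" using A by (simp add: C2_torus_def)
  have pA': "A' (x + k) = A' x" if k: "\<And>i. k $ i \<in> \<int>" for x k
  proof -
    have 2: "((\<lambda>z. z + k) has_derivative (\<lambda>y. y)) (at x)" by (auto intro!: derivative_eq_intros)
    note has_derivative_compose[OF 2 A'[of "x + k"]]
    moreover have "(\<lambda>z. A (z + k)) = A" using torus_funD[OF per] k by blast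
    ultimately have "(A has_derivative blinfun_apply (A' (x + k))) (at x)" by simp
    then have "blinfun_apply (A' (x + k)) = blinfun_apply (A' x)" using A'[of x] by (rule has_derivative_unique)
    then show ?thesis by (simp add: blinfun_eqI)
  qed
  have pA'': "A'' (x + k) = A'' x" if k: "\<And>i. k $ i \<in> \<int>" for x k
  proof -
    have 2: "((\<lambda>z. z + k) has_derivative (\<lambda>y. y)) (at x)" by (auto intro!: derivative_eq_intros)
    note has_derivative_compose[OF 2 A''[of "x + k"]]
    moreover have "(\<lambda>z. A' (z + k)) = A'" using pA' k by blast
    ultimately have "(A' has_derivative blinfun_apply (A'' (x + k))) (at x)" by simp
    then have "blinfun_apply (A'' (x + k)) = blinfun_apply (A'' x)" using A''[of x] by (rule has_derivative_unique)
    then show ?thesis by (simp add: blinfun_eqI)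
  qed
  have "torus_fun A''" by (simp add: torus_fun_def pA'')
  then obtain M where M: "M > 0" "\<And>x. norm (A'' x) \<le> M" using torus_bounded c by blast
  define C where "C = sqrt ((real CARD('n))\<^sup>2 * M + 1)"
  have half: "sqrt (y \<bullet> (A z *v y)) \<le> sqrt (y \<bullet> (A x *v y)) + C * norm (z - x) * norm y" for x z y
  proof (cases "z = x \<or> y = 0")
    case True
    then show ?thesis by (auto simp: C_def)
  next
    case False
    define e where "e = z - x"
    \<comment> \<open>Bound on the second derivative along the segment; its square root is the
      Lipschitz term \<open>C * norm (z - x) * norm y\<close>. The dimension factor inside C is that
      of \<open>abs_quadratic_form_le\<close>.\<close>
    define N where "N = C\<^sup>2 * (norm e)\<^sup>2 * (norm y)\<^sup>2"
    define q where "q B = y \<bullet> (B *v y)" for B :: "real ^ 'n ^ 'n"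
    have "linear q" unfolding q_def
      by (intro linearI) (simp_all add: matrix_vector_mult_add_rdistrib scaleR_matrix_vector_assoc[symmetric] inner_add_right)
    then have q: "bounded_linear q" by (simp add: linear_conv_bounded_linear)
    have lin: "((\<lambda>t. x + t *\<^sub>R e) has_derivative (\<lambda>s. s *\<^sub>R e)) (at t)" for t
      by (auto intro!: derivative_eq_intros)
    have d1: "((\<lambda>t. q (A (x + t *\<^sub>R e))) has_real_derivative q (A' (x + t *\<^sub>R e) e)) (at t)" for t
      using bounded_linear.has_derivative[OF q has_derivative_compose[OF lin A']]
      unfolding has_field_derivative_def
      by (rule has_derivative_eq_rhs) (simp add: fun_eq_iff blinfun.scaleR_right linear_cmul[OF \<open>linear q\<close>] mult.commute)
    have d2: "((\<lambda>t. q (A' (x + t *\<^sub>R e) e)) has_real_derivative q (A'' (x + t *\<^sub>R e) e e)) (at t)" for t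
      using bounded_linear.has_derivative[OF q
          bounded_linear.has_derivative[OF blinfun.bounded_linear_left has_derivative_compose[OF lin A'']]]
      unfolding has_field_derivative_def
      by (rule has_derivative_eq_rhs)
         (simp add: fun_eq_iff blinfun.scaleR_right blinfun.scaleR_left linear_cmul[OF \<open>linear q\<close>] mult.commute)
    have C2: "(real CARD('n))\<^sup>2 * M \<le> C\<^sup>2" "C > 0" using M by (auto simp: C_def add_nonneg_pos)
    have "\<bar>q (A'' (x + t *\<^sub>R e) e e)\<bar> \<le> N" for t
    proof -
      have "norm (A'' (x + t *\<^sub>R e) e e) \<le> norm (A'' (x + t *\<^sub>R e)) * norm e * norm e"
        by (meson norm_blinfun mult_right_mono norm_ge_zero order_trans)
      also have "\<dots> \<le> M * norm e * norm e" by (intro mult_right_mono M norm_ge_zero)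
      finally have "(real CARD('n))\<^sup>2 * norm (A'' (x + t *\<^sub>R e) e e) * (norm y)\<^sup>2 \<le> (real CARD('n))\<^sup>2 * (M * norm e * norm e) * (norm y)\<^sup>2"
        by (intro mult_right_mono mult_left_mono) auto
      also have "\<dots> = ((real CARD('n))\<^sup>2 * M) * ((norm e)\<^sup>2 * (norm y)\<^sup>2)" by (simp add: power2_eq_square mult_ac)
      also have "\<dots> \<le> C\<^sup>2 * ((norm e)\<^sup>2 * (norm y)\<^sup>2)" using C2 by (intro mult_right_mono) auto
      also have "\<dots> = N" by (simp add: N_def)
      finally show ?thesis using abs_quadratic_form_le[of y "A'' (x + t *\<^sub>R e) e e"] by (simp add: q_def)
    qed
    moreover have "N > 0" using False C2 by (simp add: N_def e_def)
    ultimately have "sqrt (q (A (x + 1 *\<^sub>R e))) \<le> sqrt (q (A (x + 0 *\<^sub>R e))) + sqrt N"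
      using psd by (intro sqrt_nonneg_C11[OF d1 d2]) (auto simp: q_def)
    moreover have "sqrt N = C * norm (z - x) * norm y" using C2 by (simp add: N_def e_def real_sqrt_mult)
    ultimately show ?thesis by (simp add: q_def e_def)
  qed
  have "\<bar>sqrt (y \<bullet> (A x *v y)) - sqrt (y \<bullet> (A z *v y))\<bar> \<le> C * norm (x - z) * norm y" for x z y
    using half[of y z x] half[of y x z] by (simp add: norm_minus_commute abs_le_iff)
  moreover have "C > 0" using M by (simp add: C_def add_nonneg_pos)
  ultimately show ?thesis by (rule that[rotated])
qed

section \<open>Superjets and sup-convolutions\<close>

text \<open>The second-order superjet J^{2,+}; the usual o(|z - x|^2) is spelled as
  \<open>\<tau> * (norm (z - x))\<^sup>2\<close> for every \<open>\<tau> > 0\<close>.\<close>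

definition superjet :: "(real ^ 'n \<Rightarrow> real) \<Rightarrow> real ^ 'n \<Rightarrow> real ^ 'n \<Rightarrow> real ^ 'n ^ 'n \<Rightarrow> bool" where
  "superjet w x p X \<longleftrightarrow> transpose X = X \<and>
     (\<forall>\<tau>>0. \<forall>\<^sub>F z in nhds x.
        w z \<le> w x + p \<bullet> (z - x) + (z - x) \<bullet> (X *v (z - x)) / 2 + \<tau> * (norm (z - x))\<^sup>2)"

lemma le_of_le_add_small:
  fixes a b k :: real
  assumes "\<And>\<tau>. \<tau> > 0 \<Longrightarrow> a \<le> b + \<tau> * k"
  shows "a \<le> b"
proof (rule field_le_epsilon)
  fix e :: real assume "e > 0"
  then have "a \<le> b + e / (\<bar>k\<bar> + 1) * k" by (intro assms) (simp add: add_nonneg_pos)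
  also have "e / (\<bar>k\<bar> + 1) * k \<le> e / (\<bar>k\<bar> + 1) * (\<bar>k\<bar> + 1)"
    using \<open>e > 0\<close> by (intro mult_left_mono) auto
  also have "\<dots> = e" by (simp add: add_nonneg_eq_0_iff)
  finally show "a \<le> b + e" by simp
qed

lemma has_derivative_vecI:
  fixes f :: "'a::real_normed_vector \<Rightarrow> real ^ 'n"
  assumes "\<And>i. ((\<lambda>x. f x $ i) has_derivative (\<lambda>y. f' y $ i)) (at x within S)"
  shows "(f has_derivative f') (at x within S)"
proof -
  have "((\<lambda>x. f x \<bullet> b) has_derivative (\<lambda>y. f' y \<bullet> b)) (at x within S)" if "b \<in> Basis" for b
    using that assms by (auto simp: Basis_vec_def inner_axis)
  then show ?thesis by (subst has_derivative_componentwise_within) auto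
qed

text \<open>Test functions have to be periodic, so a quadratic polynomial in z - y is not allowed.
  Replacing each coordinate of z - y by sin (2 pi (z - y)) / (2 pi), which agrees with it to second
  order at y, gives a periodic function with the prescribed jet.\<close>

lemma periodic_function_with_jet:
  fixes y p :: "real ^ 'n"
  assumes sym: "transpose Y = Y"
  obtains \<phi> where "C2_torus \<phi>" "\<phi> y = 0" "grad \<phi> y = p" "hess \<phi> y = Y"
proof -
  define S where "S z = (\<chi> i. sin (2 * pi * (z - y) $ i) / (2 * pi))" for z :: "real ^ 'n"
  define c where "c z = (\<chi> i. cos (2 * pi * (z - y) $ i))" for z :: "real ^ 'n"
  define \<phi> where "\<phi> z = p \<bullet> S z + S z \<bullet> (Y *v S z) / 2" for z
  define g where "g z = (\<chi> i. c z $ i * (p + Y *v S z) $ i)" for z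
  define h where "h z = (\<chi> i j. c z $ i * Y $ i $ j * c z $ j
      - (if i = j then 2 * pi * sin (2 * pi * (z - y) $ i) * (p + Y *v S z) $ i else 0))" for z
  have dS: "(S has_derivative (\<lambda>e. \<chi> i. c x $ i * e $ i)) (at x)" for x
  proof (rule has_derivative_vecI)
    fix i
    have "((\<lambda>z. sin (2 * pi * (z - y) $ i) / (2 * pi)) has_derivative
        (\<lambda>e. cos (2 * pi * (x - y) $ i) * e $ i)) (at x)"
      by (rule derivative_eq_intros bounded_linear.has_derivative[OF bounded_linear_vec_nth] refl)+
         (simp_all add: fun_eq_iff)
    then show "((\<lambda>z. S z $ i) has_derivative (\<lambda>e. (\<chi> i. c x $ i * e $ i) $ i)) (at x)"
      by (simp add: S_def c_def)
  qed
  have dc: "((\<lambda>z. c z $ i) has_derivative (\<lambda>e. - (2 * pi * sin (2 * pi * (x - y) $ i) * e $ i))) (at x)" for x i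
    unfolding c_def vec_lambda_beta
    by (rule derivative_eq_intros bounded_linear.has_derivative[OF bounded_linear_vec_nth] refl)+
       (simp add: fun_eq_iff)
  have dY: "((\<lambda>z. Y *v S z) has_derivative (\<lambda>e. Y *v (\<chi> i. c x $ i * e $ i))) (at x)" for x
    by (rule bounded_linear.has_derivative[OF matrix_vector_mul_bounded_linear dS])
  have d1: "(\<phi> has_derivative (\<lambda>e. g x \<bullet> e)) (at x)" for x
  proof -
    have "(\<phi> has_derivative (\<lambda>e. p \<bullet> (\<chi> i. c x $ i * e $ i)
        + (S x \<bullet> (Y *v (\<chi> i. c x $ i * e $ i)) + (\<chi> i. c x $ i * e $ i) \<bullet> (Y *v S x)) / 2)) (at x)"
      unfolding \<phi>_def
      by (rule has_derivative_add[OF bounded_linear.has_derivative[OF bounded_linear_inner_right dS]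
            bounded_linear.has_derivative[OF bounded_linear_divide has_derivative_inner[OF dS dY]]])
    moreover have "p \<bullet> (\<chi> i. c x $ i * e $ i)
        + (S x \<bullet> (Y *v (\<chi> i. c x $ i * e $ i)) + (\<chi> i. c x $ i * e $ i) \<bullet> (Y *v S x)) / 2 = g x \<bullet> e" for e
    proof -
      have "S x \<bullet> (Y *v (\<chi> i. c x $ i * e $ i)) = (\<chi> i. c x $ i * e $ i) \<bullet> (Y *v S x)"
        by (metis symmetric_inner_commute[OF sym] inner_commute)
      moreover have "g x \<bullet> e = (p + Y *v S x) \<bullet> (\<chi> i. c x $ i * e $ i)"
        by (simp add: g_def inner_vec_def mult_ac)
      ultimately show ?thesis by (simp add: inner_add_left inner_commute)
    qed
    ultimately show ?thesis by simp
  qed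
  have d2: "(g has_derivative (\<lambda>e. h x *v e)) (at x)" for x
  proof (rule has_derivative_vecI)
    fix i
    have "((\<lambda>z. c z $ i * (p + Y *v S z) $ i) has_derivative
       (\<lambda>e. c x $ i * (Y *v (\<chi> i. c x $ i * e $ i)) $ i - 2 * pi * sin (2 * pi * (x - y) $ i) * e $ i * (p + Y *v S x) $ i)) (at x)"
      by (rule derivative_eq_intros dc bounded_linear.has_derivative[OF bounded_linear_vec_nth] dY refl)+
         (simp add: fun_eq_iff)
    moreover have "c x $ i * (Y *v (\<chi> i. c x $ i * e $ i)) $ i - 2 * pi * sin (2 * pi * (x - y) $ i) * e $ i * (p + Y *v S x) $ i
       = (h x *v e) $ i" for e
    proof -
      define b where "b = 2 * pi * sin (2 * pi * (x - y) $ i) * (p + Y *v S x) $ i"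
      have "h x $ i $ j = c x $ i * Y $ i $ j * c x $ j - (if i = j then b else 0)" for j
        by (simp add: h_def b_def)
      then have "(h x *v e) $ i = (\<Sum>j\<in>UNIV. c x $ i * Y $ i $ j * c x $ j * e $ j - (if i = j then b else 0) * e $ j)"
        by (simp add: matrix_vector_mult_def left_diff_distrib)
      also have "\<dots> = (\<Sum>j\<in>UNIV. c x $ i * Y $ i $ j * c x $ j * e $ j) - b * e $ i"
        by (simp add: sum_subtractf mult_delta_left)
      also have "(\<Sum>j\<in>UNIV. c x $ i * Y $ i $ j * c x $ j * e $ j) = c x $ i * (Y *v (\<chi> i. c x $ i * e $ i)) $ i"
        by (simp add: matrix_vector_mult_def sum_distrib_left mult.assoc)
      finally show ?thesis by (simp add: b_def mult_ac)
    qed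
    ultimately show "((\<lambda>z. g z $ i) has_derivative (\<lambda>e. (h x *v e) $ i)) (at x)" by (simp add: g_def)
  qed
  have cY: "continuous_on UNIV (\<lambda>z. Y *v S z)" using dY by (rule has_derivative_continuous_on)
  have cc: "continuous_on UNIV (\<lambda>z. c z $ i)" for i using dc by (rule has_derivative_continuous_on)
  have d3: "continuous_on UNIV h"
    unfolding h_def
  proof (intro continuous_on_vec_lambda)
    fix i j
    have "continuous_on UNIV (\<lambda>z. 2 * pi * sin (2 * pi * (z - y) $ i) * (p + Y *v S z) $ i)"
      by (intro continuous_intros cY)
    then show "continuous_on UNIV (\<lambda>z. c z $ i * Y $ i $ j * c z $ j
      - (if i = j then 2 * pi * sin (2 * pi * (z - y) $ i) * (p + Y *v S z) $ i else 0))"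
      by (cases "i = j") (simp_all add: continuous_on_diff continuous_on_mult cc)
  qed
  have jet: "has_jet \<phi> g h" using d1 d2 d3 by (simp add: has_jet_def)
  have per: "torus_fun \<phi>"
  proof -
    have "S (x + k) = S x" if k: "\<And>i. k $ i \<in> \<int>" for x k
    proof -
      have "sin (2 * pi * (x + k - y) $ i) = sin (2 * pi * (x - y) $ i)" for i
      proof -
        obtain m :: int where "k $ i = of_int m" using k[of i] Ints_cases by blast
        then have "2 * pi * (x + k - y) $ i = 2 * pi * (x - y) $ i + of_int m * (2 * pi)" by (simp add: algebra_simps)
        then show ?thesis
          using sin.plus_of_int[of "2 * pi * (x - y) $ i" m] by (simp add: mult.commute)
      qed
      then show ?thesis by (simp add: S_def)
    qed
    then show ?thesis by (simp add: torus_fun_def \<phi>_def)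
  qed
  have S0: "S y = 0" by (simp add: S_def vec_eq_iff)
  have "g y = p" by (simp add: g_def c_def S0 vec_eq_iff)
  moreover have "h y = Y" by (simp add: h_def c_def S0 vec_eq_iff)
  ultimately show ?thesis
    using that[of \<phi>] C2_torusI[OF jet per] has_jet_grad[OF jet] has_jet_hess[OF jet] S0 by (simp add: \<phi>_def)
qed

lemma trace_add_scaleR:
  fixes A X Y :: "real ^ 'n ^ 'n"
  shows "trace (A ** (X + r *\<^sub>R Y)) = trace (A ** X) + r * trace (A ** Y)"
  by (simp add: matrix_add_ldistrib trace_add) (simp add: trace_def matrix_matrix_mult_def sum_distrib_left mult_ac)

lemma transpose_add_scaleR: "transpose (X + r *\<^sub>R Y) = transpose X + r *\<^sub>R transpose Y"
  by (simp add: transpose_def vec_eq_iff)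

lemma viscosity_subsolution_superjet:
  fixes Y :: "real ^ 'n ^ 'n"
  assumes sub: "viscosity_subsolution H A c u" and jet: "superjet u y p Y"
  shows "H y p \<le> trace (A y ** Y) + c"
proof (rule le_of_le_add_small)
  fix \<tau> :: real assume \<tau>: "\<tau> > 0"
  \<comment> \<open>Half of the added Hessian is \<open>2 * \<tau>\<close>: one
    \<open>\<tau>\<close> absorbs the error in the superjet, the other the Taylor error of
    \<open>\<phi>\<close>. Thus \<open>\<phi>\<close> touches u from above, up to a
    constant.\<close>
  define Y' where "Y' = Y + (4 * \<tau>) *\<^sub>R mat 1"
  have "transpose Y' = Y'" using jet by (simp add: Y'_def superjet_def transpose_add_scaleR)
  then obtain \<phi> where \<phi>: "C2_torus \<phi>" "\<phi> y = 0" "grad \<phi> y = p" "hess \<phi> y = Y'"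
    by (rule periodic_function_with_jet)
  have "\<forall>\<^sub>F z in nhds y. u z - \<phi> z \<le> u y - \<phi> y"
  proof -
    have "\<forall>\<^sub>F z in nhds y. u z \<le> u y + p \<bullet> (z - y) + (z - y) \<bullet> (Y *v (z - y)) / 2 + \<tau> * (norm (z - y))\<^sup>2"
      using jet \<tau> by (simp add: superjet_def)
    moreover note has_jet_taylor[OF C2_torus_has_jet[OF \<phi>(1)] \<tau>, of y]
    ultimately show ?thesis
    proof eventually_elim
      case (elim z)
      have "(z - y) \<bullet> (Y' *v (z - y)) = (z - y) \<bullet> (Y *v (z - y)) + 4 * \<tau> * (norm (z - y))\<^sup>2"
        by (simp add: Y'_def matrix_vector_mult_add_rdistrib scaleR_matrix_vector_assoc[symmetric] inner_add_right dot_square_norm)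
      then show ?case using elim unfolding \<phi> by (simp add: abs_le_iff add_divide_distrib)
    qed
  qed
  then have "H y p \<le> trace (A y ** Y') + c"
    using sub \<phi> unfolding viscosity_subsolution_def by metis
  then show "H y p \<le> trace (A y ** Y) + c + \<tau> * (4 * trace (A y ** mat 1))"
    by (simp add: Y'_def trace_add_scaleR mult_ac)
qed

lemma eventually_nhds_scaleR:
  fixes d :: "'a::real_normed_vector"
  assumes "\<forall>\<^sub>F z in nhds x. P z"
  shows "\<forall>\<^sub>F t in at_right (0::real). P (x + t *\<^sub>R d)"
proof -
  have "((\<lambda>t. x + t *\<^sub>R d) \<longlongrightarrow> x + 0 *\<^sub>R d) (at_right (0::real))"
    by (intro tendsto_intros)
  then have "filterlim (\<lambda>t. x + t *\<^sub>R d) (nhds x) (at_right (0::real))" by simp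
  then show ?thesis using assms by (rule eventually_compose_filterlim[rotated])
qed

text \<open>Adding the superjet inequalities at x + t d and x - t d cancels the gradient, and the
  second difference is bounded below.\<close>

lemma superjet_semiconvex:
  assumes jet: "superjet w x p X"
    and conv: "\<And>h. w (x + h) + w (x - h) - 2 * w x \<ge> - \<Lambda> * (norm h)\<^sup>2"
  shows "- \<Lambda> * (norm d)\<^sup>2 \<le> d \<bullet> (X *v d)"
proof (rule le_of_le_add_small)
  fix \<tau> :: real assume \<tau>: "\<tau> > 0"
  have ev: "\<forall>\<^sub>F z in nhds x. w z \<le> w x + p \<bullet> (z - x) + (z - x) \<bullet> (X *v (z - x)) / 2 + \<tau> * (norm (z - x))\<^sup>2"
    using jet \<tau> by (simp add: superjet_def)
  have "\<forall>\<^sub>F t in at_right (0::real). t > 0" by (simp add: eventually_at_right_less)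
  with eventually_nhds_scaleR[OF ev, of d] eventually_nhds_scaleR[OF ev, of "- d"]
  have "\<forall>\<^sub>F t in at_right (0::real). - \<Lambda> * (norm d)\<^sup>2 \<le> d \<bullet> (X *v d) + \<tau> * (2 * (norm d)\<^sup>2)"
  proof eventually_elim
    case (elim t)
    have "- \<Lambda> * (t * norm d)\<^sup>2 \<le> w (x + t *\<^sub>R d) + w (x - t *\<^sub>R d) - 2 * w x"
      using conv[of "t *\<^sub>R d"] elim(3) by simp
    also have "\<dots> \<le> (t *\<^sub>R d) \<bullet> (X *v (t *\<^sub>R d)) + 2 * \<tau> * (t * norm d)\<^sup>2"
      using elim by (simp add: matrix_vector_mult_scaleR vec.neg)
    finally have "t\<^sup>2 * (- \<Lambda> * (norm d)\<^sup>2) \<le> t\<^sup>2 * (d \<bullet> (X *v d) + \<tau> * (2 * (norm d)\<^sup>2))"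
      by (simp add: matrix_vector_mult_scaleR power_mult_distrib power2_eq_square algebra_simps)
    then show ?case using elim(3) by (metis mult_le_cancel_left_pos zero_less_power)
  qed
  then show "- \<Lambda> * (norm d)\<^sup>2 \<le> d \<bullet> (X *v d) + \<tau> * (2 * (norm d)\<^sup>2)"
    using eventually_happens'[OF trivial_limit_at_right_real] by blast
qed

text \<open>A paraboloid with slope q below w at x, together with the superjet above, forces q = p:
  move a distance t along q - p and let t tend to 0. For a sup-convolution the paraboloid comes from
  the point where the supremum is attained.\<close>

lemma superjet_gradient_unique:
  assumes jet: "superjet w x p X"
    and low: "\<And>z. w z \<ge> w x + q \<bullet> (z - x) - C * (norm (z - x))\<^sup>2"
  shows "q = p"
proof -
  define d where "d = q - p"
  define K where "K = \<bar>d \<bullet> (X *v d)\<bar> + (\<bar>C\<bar> + 1) * (norm d)\<^sup>2"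
  have ev: "\<forall>\<^sub>F z in nhds x. w z \<le> w x + p \<bullet> (z - x) + (z - x) \<bullet> (X *v (z - x)) / 2 + 1 * (norm (z - x))\<^sup>2"
    using jet unfolding superjet_def by (meson zero_less_one)
  have "d \<bullet> d \<le> 0"
  proof (rule le_of_le_add_small)
    fix e :: real assume e: "e > 0"
    have "\<forall>\<^sub>F t in at_right (0::real). t > 0 \<and> t < e" using e by (simp add: eventually_conj eventually_at_right_less eventually_at_right[of 0 e] exI[of _ e])
    with eventually_nhds_scaleR[OF ev, of d]
    have "\<forall>\<^sub>F t in at_right (0::real). d \<bullet> d \<le> 0 + e * K"
    proof eventually_elim
      case (elim t)
      have "t * (d \<bullet> d) \<le> (t *\<^sub>R d) \<bullet> (X *v (t *\<^sub>R d)) / 2 + (1 + C) * (norm (t *\<^sub>R d))\<^sup>2"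
        using low[of "x + t *\<^sub>R d"] elim by (simp add: d_def inner_diff_left algebra_simps)
      also have "\<dots> = t\<^sup>2 * (d \<bullet> (X *v d) / 2 + (1 + C) * (norm d)\<^sup>2)"
        by (simp add: matrix_vector_mult_scaleR power_mult_distrib power2_eq_square algebra_simps)
      also have "\<dots> \<le> t\<^sup>2 * K"
      proof (intro mult_left_mono)
        have "(1 + C) * (norm d)\<^sup>2 \<le> (\<bar>C\<bar> + 1) * (norm d)\<^sup>2" by (intro mult_right_mono) auto
        then show "d \<bullet> (X *v d) / 2 + (1 + C) * (norm d)\<^sup>2 \<le> K" by (simp add: K_def)
      qed simp
      finally have "d \<bullet> d \<le> t * K" using elim by (simp add: power2_eq_square)
      also have "\<dots> \<le> e * K" using elim by (intro mult_right_mono) (auto simp: K_def)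
      finally show ?case by simp
    qed
    then show "d \<bullet> d \<le> 0 + e * K"
      using eventually_happens'[OF trivial_limit_at_right_real] by blast
  qed
  then have "d \<bullet> d = 0" using inner_ge_zero[of d] by linarith
  then show ?thesis by (simp add: d_def)
qed

section \<open>Sup-convolution of a continuous periodic function\<close>

definition supconv :: "real \<Rightarrow> (real ^ 'n \<Rightarrow> real) \<Rightarrow> real ^ 'n \<Rightarrow> real" where
  "supconv \<epsilon> u x = (SUP y. u y - (norm (x - y))\<^sup>2 / (2 * \<epsilon>))"

context
  fixes u :: "real ^ 'n \<Rightarrow> real" and \<epsilon> :: real
  assumes u: "C0_torus u" and \<epsilon>: "\<epsilon> > 0"
begin

lemma supconv_attained:
  obtains y where "supconv \<epsilon> u x = u y - (norm (x - y))\<^sup>2 / (2 * \<epsilon>)"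
    "\<And>z. u z - (norm (x - z))\<^sup>2 / (2 * \<epsilon>) \<le> u y - (norm (x - y))\<^sup>2 / (2 * \<epsilon>)"
proof -
  obtain M where M: "M > 0" "\<And>x. norm (u x) \<le> M" using u torus_bounded unfolding C0_torus_def by blast
  \<comment> \<open>From distance r on the penalty is at least 2 M, which bounds the oscillation of
    u, so the supremum may be taken over a compact ball.\<close>
  define r where "r = sqrt (4 * M * \<epsilon>)"
  have r: "r > 0" "r\<^sup>2 = 4 * M * \<epsilon>" using M \<epsilon> by (auto simp: r_def)
  have "\<exists>y\<in>cball x r. \<forall>z\<in>cball x r. u z - (norm (x - z))\<^sup>2 / (2 * \<epsilon>) \<le> u y - (norm (x - y))\<^sup>2 / (2 * \<epsilon>)"
    using r \<epsilon> u unfolding C0_torus_def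
    by (intro continuous_attains_sup continuous_intros) (auto intro: continuous_on_subset)
  then obtain y where y: "\<And>z. z \<in> cball x r \<Longrightarrow> u z - (norm (x - z))\<^sup>2 / (2 * \<epsilon>) \<le> u y - (norm (x - y))\<^sup>2 / (2 * \<epsilon>)"
    by blast
  have *: "u z - (norm (x - z))\<^sup>2 / (2 * \<epsilon>) \<le> u y - (norm (x - y))\<^sup>2 / (2 * \<epsilon>)" for z
  proof (cases "z \<in> cball x r")
    case False
    then have "r \<le> norm (x - z)" by (simp add: dist_norm)
    then have "4 * M * \<epsilon> \<le> (norm (x - z))\<^sup>2" using r by (metis less_imp_le power_mono)
    then have "2 * M \<le> (norm (x - z))\<^sup>2 / (2 * \<epsilon>)" using \<epsilon> by (simp add: field_simps)
    then have "u z - (norm (x - z))\<^sup>2 / (2 * \<epsilon>) \<le> u x - (norm (x - x))\<^sup>2 / (2 * \<epsilon>)"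
      using M(2)[of z] M(2)[of x] by (simp add: abs_le_iff)
    also have "\<dots> \<le> u y - (norm (x - y))\<^sup>2 / (2 * \<epsilon>)" using r by (intro y) simp
    finally show ?thesis .
  qed (rule y)
  have "supconv \<epsilon> u x = u y - (norm (x - y))\<^sup>2 / (2 * \<epsilon>)"
    unfolding supconv_def using * by (intro cSup_eq_maximum) auto
  then show ?thesis using * by (rule that)
qed

lemma supconv_upper: "u z - (norm (x - z))\<^sup>2 / (2 * \<epsilon>) \<le> supconv \<epsilon> u x"
  by (rule supconv_attained[of x]) metis

lemma supconv_ge: "u x \<le> supconv \<epsilon> u x"
  using supconv_upper[of x x] by simp

lemma supconv_torus_fun: "torus_fun (supconv \<epsilon> u)"
proof -
  have "supconv \<epsilon> u x \<le> supconv \<epsilon> u (x + k)" if k: "\<And>i. k $ i \<in> \<int>" for x k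
  proof (rule supconv_attained[of x])
    fix y assume "supconv \<epsilon> u x = u y - (norm (x - y))\<^sup>2 / (2 * \<epsilon>)"
    also have "\<dots> = u (y + k) - (norm (x + k - (y + k)))\<^sup>2 / (2 * \<epsilon>)"
      using u k torus_funD unfolding C0_torus_def by fastforce
    also have "\<dots> \<le> supconv \<epsilon> u (x + k)" by (rule supconv_upper)
    finally show ?thesis .
  qed
  note * = this
  have "supconv \<epsilon> u (x + k) = supconv \<epsilon> u x" if k: "\<And>i. k $ i \<in> \<int>" for x k
    using *[of k x] *[of "- k" "x + k"] k by simp
  then show ?thesis by (simp add: torus_fun_def)
qed

text \<open>Keeping the point y that is optimal for x as a competitor for z gives a paraboloid
  touching from below at x. Semiconvexity, the Lipschitz bound and the gradient of superjets all
  follow from it.\<close>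

lemma supconv_lower_quadratic:
  assumes y: "supconv \<epsilon> u x = u y - (norm (x - y))\<^sup>2 / (2 * \<epsilon>)"
  shows "supconv \<epsilon> u z \<ge> supconv \<epsilon> u x + ((1 / \<epsilon>) *\<^sub>R (y - x)) \<bullet> (z - x) - 1 / (2 * \<epsilon>) * (norm (z - x))\<^sup>2"
proof -
  have "(norm (z - y))\<^sup>2 = (norm (x - y))\<^sup>2 - 2 * ((y - x) \<bullet> (z - x)) + (norm (z - x))\<^sup>2"
    unfolding power2_norm_eq_inner by (simp add: inner_diff_left inner_diff_right inner_commute)
  moreover have "((1 / \<epsilon>) *\<^sub>R (y - x)) \<bullet> (z - x) = ((y - x) \<bullet> (z - x)) / \<epsilon>" by simp
  ultimately have "u y - (norm (z - y))\<^sup>2 / (2 * \<epsilon>)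
    = supconv \<epsilon> u x + ((1 / \<epsilon>) *\<^sub>R (y - x)) \<bullet> (z - x) - 1 / (2 * \<epsilon>) * (norm (z - x))\<^sup>2"
    unfolding y using \<epsilon> by (simp only:) (simp add: field_simps)
  then show ?thesis using supconv_upper[of y z] by simp
qed

lemma supconv_semiconvex:
  "supconv \<epsilon> u (x + h) + supconv \<epsilon> u (x - h) - 2 * supconv \<epsilon> u x \<ge> - (1 / \<epsilon>) * (norm h)\<^sup>2"
proof (rule supconv_attained[of x])
  fix y assume y: "supconv \<epsilon> u x = u y - (norm (x - y))\<^sup>2 / (2 * \<epsilon>)"
  show ?thesis
    using supconv_lower_quadratic[OF y, of "x + h"] supconv_lower_quadratic[OF y, of "x - h"] \<epsilon>
    by (simp add: field_simps)
qed

text \<open>The slope of the touching paraboloid is at most r / \<open>\<epsilon>\<close>, which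
  serves for points at distance at most 1; farther points are covered by the bound 2 M on the
  oscillation. The constant may blow up as \<open>\<epsilon>\<close> tends to 0.\<close>

lemma supconv_lipschitz:
  obtains K where "K \<ge> 0" "\<And>x z. \<bar>supconv \<epsilon> u x - supconv \<epsilon> u z\<bar> \<le> K * norm (x - z)"
proof -
  obtain M where M: "M > 0" "\<And>x. norm (u x) \<le> M" using u torus_bounded unfolding C0_torus_def by blast
  define r where "r = sqrt (4 * M * \<epsilon>)"
  have r: "r > 0" "r\<^sup>2 = 4 * M * \<epsilon>" using M \<epsilon> by (auto simp: r_def)
  define K where "K = 2 * M + (r + 1) / \<epsilon>"
  have bd: "- M \<le> supconv \<epsilon> u x" "supconv \<epsilon> u x \<le> M" for x
  proof -
    show "- M \<le> supconv \<epsilon> u x" using supconv_ge[of x] M(2)[of x] by (simp add: abs_le_iff)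
    show "supconv \<epsilon> u x \<le> M"
    proof (rule supconv_attained[of x])
      fix y assume "supconv \<epsilon> u x = u y - (norm (x - y))\<^sup>2 / (2 * \<epsilon>)"
      moreover have "(norm (x - y))\<^sup>2 / (2 * \<epsilon>) \<ge> 0" using \<epsilon> by simp
      ultimately show ?thesis using M(2)[of y] by (simp add: abs_le_iff)
    qed
  qed
  have half: "supconv \<epsilon> u x - supconv \<epsilon> u z \<le> K * norm (x - z)" for x z
  proof (cases "norm (x - z) \<le> 1")
    case False
    have "supconv \<epsilon> u x - supconv \<epsilon> u z \<le> 2 * M" using bd[of x] bd[of z] by simp
    also have "\<dots> \<le> K * 1" using r \<epsilon> by (simp add: K_def)
    also have "\<dots> \<le> K * norm (x - z)" using False r \<epsilon> M by (intro mult_left_mono) (auto simp: K_def)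
    finally show ?thesis .
  next
    case True
    show ?thesis
    proof (rule supconv_attained[of x])
      fix y assume y: "supconv \<epsilon> u x = u y - (norm (x - y))\<^sup>2 / (2 * \<epsilon>)"
      have "(norm (x - y))\<^sup>2 / (2 * \<epsilon>) \<le> 2 * M"
        using y supconv_ge[of x] M(2)[of x] M(2)[of y] by (simp add: abs_le_iff)
      then have "(norm (x - y))\<^sup>2 \<le> r\<^sup>2" using \<epsilon> by (simp add: r field_simps)
      then have nr: "norm (x - y) \<le> r" using r power2_le_imp_le by (metis less_imp_le)
      have "supconv \<epsilon> u x - supconv \<epsilon> u z \<le> - (((1 / \<epsilon>) *\<^sub>R (y - x)) \<bullet> (z - x)) + 1 / (2 * \<epsilon>) * (norm (z - x))\<^sup>2"
        using supconv_lower_quadratic[OF y, of z] by simp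
      also have "- (((1 / \<epsilon>) *\<^sub>R (y - x)) \<bullet> (z - x)) \<le> (r / \<epsilon>) * norm (x - z)"
      proof -
        have "- ((y - x) \<bullet> (z - x)) \<le> norm (y - x) * norm (z - x)"
          using Cauchy_Schwarz_ineq2[of "y - x" "z - x"] by (simp add: abs_le_iff)
        also have "\<dots> \<le> r * norm (x - z)" using nr by (simp add: norm_minus_commute mult_right_mono)
        finally have "- ((y - x) \<bullet> (z - x)) / \<epsilon> \<le> r * norm (x - z) / \<epsilon>" using \<epsilon> by (intro divide_right_mono) auto
        then show ?thesis by simp
      qed
      also have "1 / (2 * \<epsilon>) * (norm (z - x))\<^sup>2 \<le> 1 / \<epsilon> * norm (x - z)"
      proof -
        have "(norm (z - x))\<^sup>2 \<le> 1 * norm (x - z)"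
          unfolding power2_eq_square using True by (simp add: norm_minus_commute mult_left_le_one_le mult_right_le_one_le)
        then have "1 / (2 * \<epsilon>) * (norm (z - x))\<^sup>2 \<le> 1 / (2 * \<epsilon>) * norm (x - z)" using \<epsilon> by (intro mult_left_mono) auto
        also have "\<dots> \<le> 1 / \<epsilon> * norm (x - z)" using \<epsilon> by (intro mult_right_mono) (auto simp: field_simps)
        finally show ?thesis .
      qed
      finally have "supconv \<epsilon> u x - supconv \<epsilon> u z \<le> (r + 1) / \<epsilon> * norm (x - z)"
        using \<epsilon> by (simp add: add_divide_distrib algebra_simps)
      also have "\<dots> \<le> K * norm (x - z)" using M by (intro mult_right_mono) (auto simp: K_def)
      finally show ?thesis .
    qed
  qed
  have "\<bar>supconv \<epsilon> u x - supconv \<epsilon> u z\<bar> \<le> K * norm (x - z)" for x z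
    using half[of x z] half[of z x] by (simp add: norm_minus_commute abs_le_iff)
  moreover have "K \<ge> 0" using M r \<epsilon> by (simp add: K_def)
  ultimately show ?thesis using that by blast
qed

lemma supconv_superjet_gradient:
  assumes "superjet (supconv \<epsilon> u) x p X" "supconv \<epsilon> u x = u y - (norm (x - y))\<^sup>2 / (2 * \<epsilon>)"
  shows "p = (1 / \<epsilon>) *\<^sub>R (y - x)"
  using superjet_gradient_unique[OF assms(1) supconv_lower_quadratic[OF assms(2)]] by simp

text \<open>
  Testing \<open>u(z) \<le> w(x') + |x' - z|\<^sup>2/2\<epsilon>\<close> along \<open>x' = x + G(z - y)\<close> with \<open>G = (I + \<epsilon>X)\<^sup>-\<^sup>1\<close>
  gives a superjet of \<open>u\<close> whose Hessian \<open>Y\<close> is the best one with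
  \<open>s\<cdot>Ys \<le> t\<cdot>Xt + |t - s|\<^sup>2/\<epsilon>\<close> for all \<open>s, t\<close>; no theorem on sums is needed.
\<close>

lemma supconv_superjet_subsolution:
  fixes s t :: "'k::finite \<Rightarrow> real ^ 'n"
  assumes sub: "viscosity_subsolution H A c u"
    and jet: "superjet (supconv \<epsilon> u) x p X"
    and y: "supconv \<epsilon> u x = u y - (norm (x - y))\<^sup>2 / (2 * \<epsilon>)"
    and s: "gram s = A y"
  shows "H y p \<le> (\<Sum>k\<in>UNIV. t k \<bullet> (X *v t k)) + (\<Sum>k\<in>UNIV. (norm (t k - s k))\<^sup>2) / \<epsilon> + c"
proof (rule le_of_le_add_small)
  fix \<tau> :: real assume \<tau>: "\<tau> > 0"
  let ?w = "supconv \<epsilon> u"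
  have p: "p = (1 / \<epsilon>) *\<^sub>R (y - x)" by (rule supconv_superjet_gradient[OF jet y])
  have pv: "p \<bullet> v = ((y - x) \<bullet> v) / \<epsilon>" for v by (simp add: p)
  have symX: "transpose X = X" using jet by (simp add: superjet_def)
  \<comment> \<open>Semiconvexity only gives X >= -1/\<open>\<epsilon>\<close>, so I +
    \<open>\<epsilon>\<close> X may be singular; the shift makes it strictly positive and absorbs
    the \<open>\<tau>\<close>-error of the superjet.\<close>
  define X' where "X' = X + (2 * \<tau>) *\<^sub>R mat 1"
  have X'q: "d \<bullet> (X' *v d) = d \<bullet> (X *v d) + 2 * \<tau> * (norm d)\<^sup>2" for d
    by (simp add: X'_def matrix_vector_mult_add_rdistrib scaleR_matrix_vector_assoc[symmetric] inner_add_right dot_square_norm)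
  have symX': "transpose X' = X'" using symX by (simp add: X'_def transpose_add_scaleR)
  have Xlow: "- (1 / \<epsilon>) * (norm d)\<^sup>2 \<le> d \<bullet> (X *v d)" for d
    by (rule superjet_semiconvex[OF jet supconv_semiconvex])
  define M where "M = mat 1 + \<epsilon> *\<^sub>R X'"
  have Mv: "M *v d = d + \<epsilon> *\<^sub>R (X' *v d)" for d
    by (simp add: M_def matrix_vector_mult_add_rdistrib scaleR_matrix_vector_assoc[symmetric])
  have "M *v d = 0 \<Longrightarrow> d = 0" for d
  proof -
    assume "M *v d = 0"
    then have "d \<bullet> (M *v d) = 0" by simp
    then have "(norm d)\<^sup>2 + \<epsilon> * (d \<bullet> (X *v d)) + \<epsilon> * (2 * \<tau>) * (norm d)\<^sup>2 = 0"
      by (simp add: Mv inner_add_right X'q dot_square_norm algebra_simps)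
    moreover have "- (norm d)\<^sup>2 \<le> \<epsilon> * (d \<bullet> (X *v d))"
      using mult_left_mono[OF Xlow[of d], of \<epsilon>] \<epsilon> by simp
    ultimately have "\<epsilon> * (2 * \<tau>) * (norm d)\<^sup>2 \<le> 0" by simp
    then show "d = 0" using \<epsilon> \<tau> by (simp add: mult_le_0_iff)
  qed
  then have "\<exists>B. B ** M = mat 1" by (simp add: matrix_left_invertible_ker)
  then obtain G where "M ** G = mat 1" using matrix_left_right_inverse by blast
  then have MG: "M *v (G *v d) = d" for d by (simp add: matrix_vector_mul_assoc)
  \<comment> \<open>d . Y d is the value of a . X' a + |a - d|^2 / \<open>\<epsilon>\<close> at its
    minimiser a = G d.\<close>
  define Y where "Y = transpose G ** X' ** G + (1 / \<epsilon>) *\<^sub>R (transpose (G - mat 1) ** (G - mat 1))"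
  have symY: "transpose Y = Y"
    by (simp add: Y_def transpose_add_scaleR matrix_transpose_mul symX' matrix_mul_assoc)
  have tr: "d \<bullet> (e v* B) = (B *v d) \<bullet> e" for B :: "real ^ 'n ^ 'n" and d e
    by (metis dot_lmul_matrix inner_commute)
  have Yq: "d \<bullet> (Y *v d) = (G *v d) \<bullet> (X' *v (G *v d)) + (norm (G *v d - d))\<^sup>2 / \<epsilon>" for d
    by (simp add: Y_def matrix_vector_mult_add_rdistrib scaleR_matrix_vector_assoc[symmetric] inner_add_right
        matrix_vector_mul_assoc[symmetric] tr matrix_vector_mult_diff_rdistrib power2_norm_eq_inner)
  have "superjet u y p Y"
    unfolding superjet_def
  proof (intro conjI allI impI symY)
    fix \<rho> :: real assume \<rho>: "\<rho> > 0"
    have "((\<lambda>z. x + G *v (z - y)) \<longlongrightarrow> x + G *v (y - y)) (nhds y)"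
      by (intro tendsto_intros bounded_linear.tendsto[OF matrix_vector_mul_bounded_linear] filterlim_ident)
    then have lim: "filterlim (\<lambda>z. x + G *v (z - y)) (nhds x) (nhds y)" by simp
    have "\<forall>\<^sub>F z in nhds x. ?w z \<le> ?w x + p \<bullet> (z - x) + (z - x) \<bullet> (X *v (z - x)) / 2 + \<tau> * (norm (z - x))\<^sup>2"
      using jet \<tau> by (simp add: superjet_def)
    from eventually_compose_filterlim[OF this lim]
    show "\<forall>\<^sub>F z in nhds y. u z \<le> u y + p \<bullet> (z - y) + (z - y) \<bullet> (Y *v (z - y)) / 2 + \<rho> * (norm (z - y))\<^sup>2"
    proof eventually_elim
      case (elim z)
      define d where "d = z - y"
      define a where "a = G *v d"
      have "u z \<le> ?w (x + a) + (norm (x + a - z))\<^sup>2 / (2 * \<epsilon>)" using supconv_upper[of z "x + a"] by simp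
      also have "?w (x + a) \<le> ?w x + p \<bullet> a + (a \<bullet> (X' *v a)) / 2"
        using elim by (simp add: a_def d_def X'q add_divide_distrib)
      also have "(norm (x + a - z))\<^sup>2 = (norm (x - y))\<^sup>2 - 2 * ((y - x) \<bullet> (a - d)) + (norm (a - d))\<^sup>2"
        unfolding power2_norm_eq_inner
        by (simp add: d_def inner_diff_left inner_diff_right inner_add_left inner_add_right inner_commute algebra_simps)
      \<comment> \<open>The first-order terms in a cancel because p = (y - x) /
        \<open>\<epsilon>\<close>, which leaves the slope p for u at y.\<close>
      also have "?w x + p \<bullet> a + (a \<bullet> (X' *v a)) / 2
         + ((norm (x - y))\<^sup>2 - 2 * ((y - x) \<bullet> (a - d)) + (norm (a - d))\<^sup>2) / (2 * \<epsilon>)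
         = u y + p \<bullet> d + (d \<bullet> (Y *v d)) / 2"
        unfolding y Yq pv using \<epsilon> by (simp add: a_def[symmetric] inner_diff_right field_simps)
      finally have "u z \<le> u y + p \<bullet> d + (d \<bullet> (Y *v d)) / 2" by simp
      moreover have "0 \<le> \<rho> * (norm d)\<^sup>2" using \<rho> by simp
      ultimately show ?case by (simp add: d_def)
    qed
  qed
  then have "H y p \<le> trace (A y ** Y) + c" by (rule viscosity_subsolution_superjet[OF sub])
  also have "trace (A y ** Y) = (\<Sum>k\<in>UNIV. s k \<bullet> (Y *v s k))" by (simp add: s[symmetric] trace_gram)
  also have "\<dots> \<le> (\<Sum>k\<in>UNIV. t k \<bullet> (X *v t k) + 2 * \<tau> * (norm (t k))\<^sup>2 + (norm (t k - s k))\<^sup>2 / \<epsilon>)"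
  proof (intro sum_mono)
    fix k
    \<comment> \<open>z minimises the quadratic a . X' a + |a - s k|^2 / \<open>\<epsilon>\<close>.
      Completing the square around z shows that the competitor t k gives a value at least as large,
      because X' >= -1/\<open>\<epsilon>\<close>.\<close>
    define z where "z = G *v s k"
    define d where "d = t k - z"
    have z: "s k = z + \<epsilon> *\<^sub>R (X' *v z)" using MG[of "s k"] by (simp add: Mv z_def)
    have tk: "t k = z + d" by (simp add: d_def)
    have "d \<bullet> (X' *v d) + (norm d)\<^sup>2 / \<epsilon> \<ge> 0"
    proof -
      have "2 * \<tau> * (norm d)\<^sup>2 \<ge> 0" using \<tau> by simp
      then show ?thesis using Xlow[of d] by (simp add: X'q)
    qed
    moreover have "t k \<bullet> (X' *v t k) + (norm (t k - s k))\<^sup>2 / \<epsilon>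
       = z \<bullet> (X' *v z) + (norm (z - s k))\<^sup>2 / \<epsilon> + (d \<bullet> (X' *v d) + (norm d)\<^sup>2 / \<epsilon>)"
    proof -
      have "t k - s k = d - \<epsilon> *\<^sub>R (X' *v z)" "z - s k = - (\<epsilon> *\<^sub>R (X' *v z))" by (simp_all add: z tk)
      then have "(norm (t k - s k))\<^sup>2 = (norm (z - s k))\<^sup>2 + (norm d)\<^sup>2 - 2 * \<epsilon> * (d \<bullet> (X' *v z))"
        unfolding power2_norm_eq_inner by (simp add: inner_diff_left inner_diff_right inner_commute)
      moreover have "t k \<bullet> (X' *v t k) = z \<bullet> (X' *v z) + 2 * (d \<bullet> (X' *v z)) + d \<bullet> (X' *v d)"
        using symmetric_inner_commute[OF symX', of z d]
        by (simp add: tk matrix_vector_right_distrib inner_add_left inner_add_right inner_commute)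
      ultimately show ?thesis using \<epsilon> by (simp add: field_simps)
    qed
    ultimately have "z \<bullet> (X' *v z) + (norm (z - s k))\<^sup>2 / \<epsilon> \<le> t k \<bullet> (X' *v t k) + (norm (t k - s k))\<^sup>2 / \<epsilon>" by linarith
    then show "s k \<bullet> (Y *v s k) \<le> t k \<bullet> (X *v t k) + 2 * \<tau> * (norm (t k))\<^sup>2 + (norm (t k - s k))\<^sup>2 / \<epsilon>"
      unfolding Yq X'q[of "t k"] z_def by simp
  qed
  also have "\<dots> = (\<Sum>k\<in>UNIV. t k \<bullet> (X *v t k)) + (\<Sum>k\<in>UNIV. (norm (t k - s k))\<^sup>2) / \<epsilon>
      + \<tau> * (2 * (\<Sum>k\<in>UNIV. (norm (t k))\<^sup>2))"
    by (simp add: sum.distrib sum_divide_distrib sum_distrib_left mult_ac)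
  finally show "H y p \<le> (\<Sum>k\<in>UNIV. t k \<bullet> (X *v t k)) + (\<Sum>k\<in>UNIV. (norm (t k - s k))\<^sup>2) / \<epsilon> + c
      + \<tau> * (2 * (\<Sum>k\<in>UNIV. (norm (t k))\<^sup>2))" by simp
qed

text \<open>Here the matrix at y is compared with (1 + r)^2 A x instead of A x. The free scale r
  costs \<open>2 * r\<^sup>2 * T / \<epsilon>\<close>; \<open>penalization_maximum_bound\<close>
  takes r negative and proportional to |x - y|, \<open>smooth_subsolution_approximation\<close>
  takes r = 0. The 128 is twice the 64 of \<open>psd_square_roots_close\<close>, from (a + b)^2 <= 2
  a^2 + 2 b^2.\<close>

lemma supconv_superjet_scaled:
  fixes A :: "real ^ 'n \<Rightarrow> real ^ 'n ^ 'n"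
  assumes sub: "viscosity_subsolution H A c u"
    and sym: "\<And>x. transpose (A x) = A x" and psd: "\<And>x \<xi>. 0 \<le> \<xi> \<bullet> (A x *v \<xi>)"
    and lip: "\<And>x z y. \<bar>sqrt (y \<bullet> (A x *v y)) - sqrt (y \<bullet> (A z *v y))\<bar> \<le> C * norm (x - z) * norm y" "C \<ge> 0"
    and T: "trace (A x) \<le> T"
    and jet: "superjet (supconv \<epsilon> u) x p X"
    and y: "supconv \<epsilon> u x = u y - (norm (x - y))\<^sup>2 / (2 * \<epsilon>)"
  shows "H y p - c \<le> (1 + r)\<^sup>2 * trace (A x ** X)
    + (128 * (real CARD('n))\<^sup>2 * C\<^sup>2 * (norm (x - y))\<^sup>2 + 2 * r\<^sup>2 * T) / \<epsilon>"
proof -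
  obtain s t :: "'n \<Rightarrow> real ^ 'n" where s: "gram s = A y" and t: "gram t = A x"
    and st: "(\<Sum>k\<in>UNIV. (norm (s k - t k))\<^sup>2) \<le> 64 * (real CARD('n))\<^sup>2 * (C * norm (x - y))\<^sup>2"
    by (rule psd_square_roots_close[OF sym psd sym psd _ lip(1), of x y]) (use lip(2) in auto)
  have trt: "(\<Sum>k\<in>UNIV. (norm (t k))\<^sup>2) = trace (A x)"
    using trace_gram[of t "mat 1"] by (simp add: t matrix_mul_rid dot_square_norm)
  have "H y p \<le> (\<Sum>k\<in>UNIV. ((1 + r) *\<^sub>R t k) \<bullet> (X *v ((1 + r) *\<^sub>R t k)))
     + (\<Sum>k\<in>UNIV. (norm ((1 + r) *\<^sub>R t k - s k))\<^sup>2) / \<epsilon> + c"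
    by (rule supconv_superjet_subsolution[OF sub jet y s])
  also have "(\<Sum>k\<in>UNIV. ((1 + r) *\<^sub>R t k) \<bullet> (X *v ((1 + r) *\<^sub>R t k))) = (1 + r)\<^sup>2 * trace (A x ** X)"
    by (simp add: t[symmetric] trace_gram matrix_vector_mult_scaleR sum_distrib_left power2_eq_square mult.assoc)
  also have "(\<Sum>k\<in>UNIV. (norm ((1 + r) *\<^sub>R t k - s k))\<^sup>2) \<le> (\<Sum>k\<in>UNIV. 2 * (norm (s k - t k))\<^sup>2 + 2 * r\<^sup>2 * (norm (t k))\<^sup>2)"
  proof (intro sum_mono)
    fix k
    have "norm ((1 + r) *\<^sub>R t k - s k) \<le> norm (t k - s k) + norm (r *\<^sub>R t k)"
      using norm_triangle_ineq[of "t k - s k" "r *\<^sub>R t k"] by (simp add: algebra_simps)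
    then have "(norm ((1 + r) *\<^sub>R t k - s k))\<^sup>2 \<le> (norm (t k - s k) + norm (r *\<^sub>R t k))\<^sup>2"
      by (intro power_mono) auto
    also have "\<dots> \<le> 2 * (norm (t k - s k))\<^sup>2 + 2 * (norm (r *\<^sub>R t k))\<^sup>2"
      using zero_le_power2[of "norm (t k - s k) - norm (r *\<^sub>R t k)"] by (simp add: power2_sum power2_diff)
    finally show "(norm ((1 + r) *\<^sub>R t k - s k))\<^sup>2 \<le> 2 * (norm (s k - t k))\<^sup>2 + 2 * r\<^sup>2 * (norm (t k))\<^sup>2"
      by (simp add: norm_minus_commute power_mult_distrib)
  qed
  also have "\<dots> \<le> 128 * (real CARD('n))\<^sup>2 * C\<^sup>2 * (norm (x - y))\<^sup>2 + 2 * r\<^sup>2 * T"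
  proof -
    have "2 * r\<^sup>2 * trace (A x) \<le> 2 * r\<^sup>2 * T" using T by (intro mult_left_mono) auto
    then show ?thesis using st by (simp add: sum.distrib sum_distrib_left[symmetric] trt power_mult_distrib)
  qed
  finally show ?thesis using \<epsilon> by (simp add: divide_right_mono)
qed

end

section \<open>Trigonometric polynomials\<close>

text \<open>Real trigonometric polynomials; the phase a brings in the sines. They are dense, and
  constant-coefficient operators and convolutions act on them frequency by frequency.\<close>

inductive trig_poly :: "(real ^ 'n \<Rightarrow> real) \<Rightarrow> bool" where
  cos: "(\<And>i. k $ i \<in> \<int>) \<Longrightarrow> trig_poly (\<lambda>x. cos (2 * pi * (k \<bullet> x) + a))"
| add: "trig_poly f \<Longrightarrow> trig_poly g \<Longrightarrow> trig_poly (\<lambda>x. f x + g x)"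
| scale: "trig_poly f \<Longrightarrow> trig_poly (\<lambda>x. c * f x)"

lemma trig_poly_const: "trig_poly (\<lambda>x. c)"
  using trig_poly.scale[OF trig_poly.cos[of 0 0], of c] by simp

lemma trig_poly_sin: "(\<And>i. k $ i \<in> \<int>) \<Longrightarrow> trig_poly (\<lambda>x. sin (2 * pi * (k \<bullet> x) + a))"
  using trig_poly.cos[of k "a - pi / 2"] by (simp add: add_diff_eq cos_diff)

lemma trig_poly_diff: "trig_poly f \<Longrightarrow> trig_poly g \<Longrightarrow> trig_poly (\<lambda>x. f x - g x)"
  using trig_poly.add[of f "\<lambda>x. -1 * g x"] trig_poly.scale[of g "-1"] by simp

lemma trig_poly_mult:
  assumes "trig_poly f" "trig_poly g"
  shows "trig_poly (\<lambda>x. f x * g x)"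
  using assms
proof (induction arbitrary: g)
  case (cos k a)
  from cos(2) show ?case
  proof induction
    case (cos l b)
    have "trig_poly (\<lambda>x. cos (2 * pi * ((k - l) \<bullet> x) + (a - b)))" "trig_poly (\<lambda>x. cos (2 * pi * ((k + l) \<bullet> x) + (a + b)))"
      using cos \<open>\<And>i. k $ i \<in> \<int>\<close> by (auto intro!: trig_poly.cos)
    from trig_poly.scale[OF trig_poly.add[OF this], of "1/2"]
    show ?case by (simp add: cos_times_cos inner_diff_left inner_add_left algebra_simps add_divide_distrib)
  next
    case (add f g)
    then show ?case using trig_poly.add by (simp add: distrib_left)
  next
    case (scale f c)
    then show ?case using trig_poly.scale[OF scale.IH, of c] by (simp add: mult_ac)
  qed
next
  case (add f h)
  show ?case using trig_poly.add[OF add.IH(1)[OF add.prems] add.IH(2)[OF add.prems]] by (simp add: distrib_right)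
next
  case (scale f c)
  then show ?case using trig_poly.scale[OF scale.IH, of g c] by (simp add: mult_ac)
qed

lemma inner_Ints:
  fixes k l :: "real ^ 'n"
  shows "(\<And>i. k $ i \<in> \<int>) \<Longrightarrow> (\<And>i. l $ i \<in> \<int>) \<Longrightarrow> k \<bullet> l \<in> \<int>"
  by (auto simp: inner_vec_def intro!: Ints_sum Ints_mult)

lemma trig_poly_torus_fun: "trig_poly f \<Longrightarrow> torus_fun f"
proof (induction rule: trig_poly.induct)
  case (cos k a)
  show ?case unfolding torus_fun_def
  proof (intro allI impI)
    fix x l :: "real ^ 'a" assume "\<forall>i. l $ i \<in> \<int>"
    then have "k \<bullet> l \<in> \<int>" using cos by (intro inner_Ints) auto
    then obtain m :: int where "k \<bullet> l = of_int m" using Ints_cases by blast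
    then have e: "2 * pi * (k \<bullet> (x + l)) + a = (2 * pi * (k \<bullet> x) + a) + of_int m * (2 * pi)"
      by (simp add: inner_add_right algebra_simps)
    show "cos (2 * pi * (k \<bullet> (x + l)) + a) = cos (2 * pi * (k \<bullet> x) + a)"
      unfolding e using cos.plus_of_int[of "2 * pi * (k \<bullet> x) + a" m] by (simp add: mult.commute)
  qed
qed (auto simp: torus_fun_def)

lemma has_jet_cos:
  "has_jet (\<lambda>x. cos (2 * pi * (k \<bullet> x) + a)) (\<lambda>x. (- 2 * pi * sin (2 * pi * (k \<bullet> x) + a)) *\<^sub>R k)
     (\<lambda>x. \<chi> i j. - 4 * pi\<^sup>2 * cos (2 * pi * (k \<bullet> x) + a) * k $ i * k $ j)"
  unfolding has_jet_def
proof (intro conjI allI)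
  fix x
  have th: "((\<lambda>x. 2 * pi * (k \<bullet> x) + a) has_derivative (\<lambda>y. 2 * pi * (k \<bullet> y))) (at x)"
    by (auto intro!: derivative_eq_intros)
  show "((\<lambda>x. cos (2 * pi * (k \<bullet> x) + a)) has_derivative
      (\<lambda>y. ((- 2 * pi * sin (2 * pi * (k \<bullet> x) + a)) *\<^sub>R k) \<bullet> y)) (at x)"
    by (rule has_derivative_eq_rhs[OF has_derivative_cos[OF th]]) (simp add: fun_eq_iff)
  have "((\<lambda>x. (- 2 * pi * sin (2 * pi * (k \<bullet> x) + a)) *\<^sub>R k) has_derivative
     (\<lambda>y. (- 2 * pi * (2 * pi * (k \<bullet> y) * cos (2 * pi * (k \<bullet> x) + a))) *\<^sub>R k)) (at x)"
    by (rule has_derivative_scaleR_left has_derivative_mult_right)+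
       (rule has_derivative_eq_rhs[OF has_derivative_sin[OF th]], simp add: fun_eq_iff)
  then show "((\<lambda>x. (- 2 * pi * sin (2 * pi * (k \<bullet> x) + a)) *\<^sub>R k) has_derivative
     (\<lambda>y. (\<chi> i j. - 4 * pi\<^sup>2 * cos (2 * pi * (k \<bullet> x) + a) * k $ i * k $ j) *v y)) (at x)"
    by (rule has_derivative_eq_rhs)
       (simp add: fun_eq_iff vec_eq_iff matrix_vector_mult_def inner_vec_def sum_distrib_left sum_distrib_right
         power2_eq_square mult_ac sum_negf)
qed (intro continuous_intros continuous_on_vec_lambda)

lemma trig_poly_C2:
  assumes "trig_poly f"
  shows "has_jet f (grad f) (hess f)"
proof -
  have "\<exists>g h. has_jet f g h" using assms
    by induction (blast intro: has_jet_cos has_jet_add has_jet_scaleR)+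
  then show ?thesis using has_jet_iff by metis
qed

lemma trig_poly_continuous: "trig_poly f \<Longrightarrow> continuous_on UNIV f"
  using trig_poly_C2 has_jet_continuous by blast

text \<open>The operator tr(B D^2) - v . D with B and v frozen. Its coefficients are constant so
  that it commutes with mollification.\<close>

definition lin_op :: "real ^ 'n ^ 'n \<Rightarrow> real ^ 'n \<Rightarrow> (real ^ 'n \<Rightarrow> real) \<Rightarrow> real ^ 'n \<Rightarrow> real" where
  "lin_op B v f x = trace (B ** hess f x) - v \<bullet> grad f x"

lemma lin_op_jet: "has_jet f g h \<Longrightarrow> lin_op B v f x = trace (B ** h x) - v \<bullet> g x"
  by (simp add: lin_op_def has_jet_grad has_jet_hess)

lemma trace_mult_scaleR:
  fixes B M :: "real ^ 'n ^ 'n"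
  shows "trace (B ** (c *\<^sub>R M)) = c * trace (B ** M)"
  by (simp add: trace_def matrix_matrix_mult_def sum_distrib_left mult_ac)

lemma lin_op_add:
  assumes "has_jet f g h" "has_jet f' g' h'"
  shows "lin_op B v (\<lambda>x. f x + f' x) x = lin_op B v f x + lin_op B v f' x"
  using lin_op_jet[OF assms(1)] lin_op_jet[OF assms(2)] lin_op_jet[OF has_jet_add[OF assms]]
    trace_add_scaleR[of B "h x" 1 "h' x"] by (simp add: inner_add_right)

lemma lin_op_scale:
  assumes "has_jet f g h"
  shows "lin_op B v (\<lambda>x. c * f x) x = c * lin_op B v f x"
  unfolding lin_op_jet[OF assms] lin_op_jet[OF has_jet_scaleR[OF assms]]
  by (simp add: trace_mult_scaleR algebra_simps)

lemma lin_op_diff: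
  assumes "has_jet f g h" "has_jet f' g' h'"
  shows "lin_op B v (\<lambda>x. f x - f' x) x = lin_op B v f x - lin_op B v f' x"
  using lin_op_add[OF assms(1) has_jet_scaleR[OF assms(2), of "-1"], of B v x] lin_op_scale[OF assms(2), of B v "-1" x]
  by simp

lemma lin_op_cos:
  "lin_op B v (\<lambda>x. cos (2 * pi * (k \<bullet> x) + a)) x
    = - (4 * pi\<^sup>2 * (k \<bullet> (B *v k))) * cos (2 * pi * (k \<bullet> x) + a) + 2 * pi * (v \<bullet> k) * sin (2 * pi * (k \<bullet> x) + a)"
proof -
  have "trace (B ** (\<chi> i j. - 4 * pi\<^sup>2 * cos (2 * pi * (k \<bullet> x) + a) * k $ i * k $ j))
    = - (4 * pi\<^sup>2 * (k \<bullet> (B *v k))) * cos (2 * pi * (k \<bullet> x) + a)"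
    by (simp add: trace_def matrix_matrix_mult_def inner_vec_def matrix_vector_mult_def sum_distrib_left sum_distrib_right
         sum_negf mult_ac)
  then show ?thesis by (simp add: lin_op_jet[OF has_jet_cos])
qed

lemma lin_op_sin:
  "lin_op B v (\<lambda>x. sin (2 * pi * (k \<bullet> x) + a)) x
    = - (4 * pi\<^sup>2 * (k \<bullet> (B *v k))) * sin (2 * pi * (k \<bullet> x) + a) - 2 * pi * (v \<bullet> k) * cos (2 * pi * (k \<bullet> x) + a)"
  using lin_op_cos[of B v k "a - pi / 2" x] by (simp add: add_diff_eq cos_diff sin_diff)

lemma trig_poly_lin_op:
  assumes "trig_poly f"
  shows "trig_poly (lin_op B v f)"
  using assms
proof induction
  case (cos k a)
  show ?case unfolding lin_op_cos[abs_def]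
    by (intro trig_poly.add trig_poly.scale trig_poly.cos trig_poly_sin cos)
next
  case (add f g)
  have "lin_op B v (\<lambda>x. f x + g x) = (\<lambda>x. lin_op B v f x + lin_op B v g x)"
    by (rule ext) (rule lin_op_add[OF trig_poly_C2[OF add.hyps(1)] trig_poly_C2[OF add.hyps(2)]])
  then show ?case using trig_poly.add[OF add.IH] by simp
next
  case (scale f c)
  have "lin_op B v (\<lambda>x. c * f x) = (\<lambda>x. c * lin_op B v f x)"
    by (rule ext) (rule lin_op_scale[OF trig_poly_C2[OF scale.hyps(1)]])
  then show ?case using trig_poly.scale[OF scale.IH] by simp
qed

text \<open>The operator \<open>1 - \<mu> L\<close> maps the plane spanned by the cosine and the
  sine of one frequency into itself. With \<open>\<kappa> \<ge> 1\<close> because B is semidefinite,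
  the determinant \<open>\<kappa>\<^sup>2 + \<omega>\<^sup>2\<close> is positive, and (P, Q) solves
  the 2 by 2 system whose right-hand side is the cosine.\<close>

lemma trig_poly_resolvent:
  assumes "trig_poly f" and psd: "\<And>y. 0 \<le> y \<bullet> (B *v y)" and \<mu>: "\<mu> \<ge> 0"
  obtains z where "trig_poly z" "\<And>x. z x - \<mu> * lin_op B v z x = f x"
proof -
  have "\<exists>z. trig_poly z \<and> (\<forall>x. z x - \<mu> * lin_op B v z x = f x)"
    using assms(1)
  proof induction
    case (cos k a)
    define \<kappa> where "\<kappa> = 1 + \<mu> * (4 * pi\<^sup>2 * (k \<bullet> (B *v k)))"
    define \<omega> where "\<omega> = \<mu> * (2 * pi * (v \<bullet> k))"
    define D where "D = \<kappa>\<^sup>2 + \<omega>\<^sup>2"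
    have "\<kappa> \<ge> 1" unfolding \<kappa>_def using psd[of k] \<mu> by simp
    then have D: "D > 0" by (simp add: D_def add_pos_nonneg)
    let ?c = "\<lambda>x. cos (2 * pi * (k \<bullet> x) + a)" and ?s = "\<lambda>x. sin (2 * pi * (k \<bullet> x) + a)"
    define P where "P = \<kappa> / D"
    define Q where "Q = \<omega> / D"
    have PQ: "\<kappa> * P + \<omega> * Q = 1" "\<kappa> * Q - \<omega> * P = 0"
      using D \<open>\<kappa> \<ge> 1\<close> by (simp_all add: P_def Q_def D_def power2_eq_square add_divide_distrib[symmetric])
    define z where "z x = P * ?c x + Q * ?s x" for x
    have tc: "trig_poly ?c" and ts: "trig_poly ?s" using cos by (auto intro: trig_poly.cos trig_poly_sin)
    have Lz: "lin_op B v z x = P * lin_op B v ?c x + Q * lin_op B v ?s x" for x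
      unfolding z_def
      by (subst lin_op_add[OF has_jet_scaleR[OF trig_poly_C2[OF tc]] has_jet_scaleR[OF trig_poly_C2[OF ts]]])
         (simp only: lin_op_scale[OF trig_poly_C2[OF tc]] lin_op_scale[OF trig_poly_C2[OF ts]])
    have "z x - \<mu> * lin_op B v z x = ?c x * (\<kappa> * P + \<omega> * Q) + ?s x * (\<kappa> * Q - \<omega> * P)" for x
      unfolding Lz lin_op_cos lin_op_sin z_def \<kappa>_def \<omega>_def by (simp add: algebra_simps)
    then have "z x - \<mu> * lin_op B v z x = ?c x" for x by (simp add: PQ)
    moreover have "trig_poly z" unfolding z_def by (intro trig_poly.add trig_poly.scale tc ts)
    ultimately show ?case by blast
  next
    case (add f g)
    then obtain z z' where z: "trig_poly z" "\<And>x. z x - \<mu> * lin_op B v z x = f x"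
      "trig_poly z'" "\<And>x. z' x - \<mu> * lin_op B v z' x = g x" by blast
    have "(z x + z' x) - \<mu> * lin_op B v (\<lambda>x. z x + z' x) x = f x + g x" for x
      using z(2)[of x] z(4)[of x]
      unfolding lin_op_add[OF trig_poly_C2[OF z(1)] trig_poly_C2[OF z(3)]] by (simp add: algebra_simps)
    then show ?case using trig_poly.add[OF z(1,3)] by blast
  next
    case (scale f c)
    then obtain z where z: "trig_poly z" "\<And>x. z x - \<mu> * lin_op B v z x = f x" by blast
    have "(c * z x) - \<mu> * lin_op B v (\<lambda>x. c * z x) x = c * (z x - \<mu> * lin_op B v z x)" for x
      unfolding lin_op_scale[OF trig_poly_C2[OF z(1)]] by (simp add: algebra_simps)
    then show ?case using trig_poly.scale[OF z(1)] z(2) by auto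
  qed
  then show ?thesis using that by blast
qed

text \<open>E embeds the torus as a compact set of cosines and sines, and a periodic function
  factors through E. Stone-Weierstrass is then applied on the image S to the algebra of continuous
  functions g whose composition with E is a trigonometric polynomial.\<close>

theorem trig_poly_dense:
  fixes f :: "real ^ 'n \<Rightarrow> real"
  assumes per: "torus_fun f" and cont: "continuous_on UNIV f" and e: "e > 0"
  obtains g where "trig_poly g" "\<And>x. \<bar>f x - g x\<bar> < e"
proof -
  define E where "E x = ((\<chi> i. cos (2 * pi * x $ i)), (\<chi> i. sin (2 * pi * x $ i)))" for x :: "real ^ 'n"
  define S where "S = range E"
  define F where "F s = f (SOME x. E x = s)" for s
  have Eeq: "f x = f y" if "E x = E y" for x y
  proof -
    have "(y - x) $ i \<in> \<int>" for i
    proof -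
      have "cos (2 * pi * y $ i) = cos (2 * pi * x $ i)" "sin (2 * pi * y $ i) = sin (2 * pi * x $ i)"
        using that by (simp_all add: E_def vec_eq_iff)
      then obtain n :: int where "2 * pi * y $ i = 2 * pi * x $ i + 2 * pi * n"
        using sin_cos_eq_iff by blast
      then have "2 * pi * (y $ i - x $ i) = 2 * pi * n" by (simp add: algebra_simps)
      then have "y $ i - x $ i = n" by simp
      then show ?thesis by simp
    qed
    then have "f (x + (y - x)) = f x" by (rule torus_funD[OF per])
    then show ?thesis by simp
  qed
  have FE: "F (E x) = f x" for x
    unfolding F_def by (rule Eeq) (rule someI[of "\<lambda>z. E z = E x" x], simp)
  have contE: "continuous_on X E" for X
    unfolding E_def by (intro continuous_intros continuous_on_vec_lambda)
  have Eper: "E (frac_vec x) = E x" for x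
  proof -
    have "E x = E (frac_vec x + (x - frac_vec x))" by simp
    also have "\<dots> = E (frac_vec x)"
    proof -
      have "\<exists>n::int. x $ i = frac_vec x $ i + n" for i
        using diff_frac_vec_Ints[of x i] by (metis Ints_cases add.commute diff_add_cancel vector_minus_component)
      then have "cos (2 * pi * x $ i) = cos (2 * pi * frac_vec x $ i) \<and> sin (2 * pi * x $ i) = sin (2 * pi * frac_vec x $ i)" for i
        using sin_cos_eq_iff[of "2 * pi * x $ i" "2 * pi * frac_vec x $ i"] by (metis distrib_left)
      then show ?thesis by (simp add: E_def)
    qed
    finally show ?thesis by simp
  qed
  have SC: "E ` cbox 0 1 = S"
    unfolding S_def using Eper frac_vec_in_unit_cell unit_cell_subset_cbox by (force intro: rev_image_eqI)
  have "compact S" unfolding SC[symmetric] by (intro compact_continuous_image contE compact_cbox)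
  \<comment> \<open>F is continuous because E restricted to the unit cube is a closed map: preimages
    of closed sets under F are E-images of compact sets.\<close>
  have contF: "continuous_on S F"
    unfolding continuous_on_closed_invariant
  proof (intro allI impI)
    fix T :: "real set" assume T: "closed T"
    have "closed (E ` (cbox 0 1 \<inter> f -` T))"
      by (rule compact_imp_closed, rule compact_continuous_image[OF contE], rule compact_Int_closed[OF compact_cbox])
        (rule closed_vimage[OF T cont])
    moreover have "E ` (cbox 0 1 \<inter> f -` T) \<inter> S = F -` T \<inter> S"
    proof -
      have "E x \<in> E ` (cbox 0 1 \<inter> f -` T)" if "f x \<in> T" for x
        using that Eper[of x] frac_vec_in_unit_cell[of x] unit_cell_subset_cbox torus_fun_frac_vec[OF per, of x]
        by (intro image_eqI[of _ _ "frac_vec x"]) auto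
      then show ?thesis by (auto simp: S_def FE)
    qed
    ultimately show "\<exists>A. closed A \<and> A \<inter> S = F -` T \<inter> S" by blast
  qed
  have axis_trig: "trig_poly (\<lambda>x. cos (2 * pi * x $ i))" "trig_poly (\<lambda>x. sin (2 * pi * x $ i))" for i :: 'n
  proof -
    have "axis i (1::real) $ j \<in> \<int>" for j by (simp add: axis_def)
    from trig_poly.cos[of "axis i 1" 0, OF this] trig_poly_sin[of "axis i 1" 0, OF this]
    show "trig_poly (\<lambda>x. cos (2 * pi * x $ i))" "trig_poly (\<lambda>x. sin (2 * pi * x $ i))"
      by (simp_all add: inner_axis inner_axis')
  qed
  have "\<exists>g. (trig_poly (\<lambda>x. g (E x)) \<and> continuous_on S g) \<and> (\<forall>s\<in>S. \<bar>F s - g s\<bar> < e)"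
  proof (rule Stone_Weierstrass_HOL[OF \<open>compact S\<close>])
    fix s t assume st: "s \<in> S \<and> t \<in> S \<and> s \<noteq> t"
    then have "\<exists>i. fst s $ i \<noteq> fst t $ i \<or> snd s $ i \<noteq> snd t $ i" by (auto simp: prod_eq_iff vec_eq_iff)
    then obtain i where i: "fst s $ i \<noteq> fst t $ i \<or> snd s $ i \<noteq> snd t $ i" by blast
    have "trig_poly (\<lambda>x. fst (E x) $ i) \<and> continuous_on S (\<lambda>s. fst s $ i)"
      "trig_poly (\<lambda>x. snd (E x) $ i) \<and> continuous_on S (\<lambda>s. snd s $ i)"
      using axis_trig by (auto simp: E_def intro!: continuous_intros)
    then show "\<exists>f. (trig_poly (\<lambda>x. f (E x)) \<and> continuous_on S f) \<and> f s \<noteq> f t"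
      using i by (elim disjE) (rule exI, erule conjI, assumption)+
  qed (use contF e in \<open>auto intro: trig_poly_const trig_poly.add trig_poly_mult continuous_intros\<close>)
  then obtain g where "trig_poly (\<lambda>x. g (E x))" "\<forall>s\<in>S. \<bar>F s - g s\<bar> < e" by blast
  then show ?thesis using that[of "\<lambda>x. g (E x)"] FE by (auto simp: S_def)
qed

section \<open>Mollification of linear subsolutions\<close>

lemma max0_power_has_derivative:
  "((\<lambda>t::real. (max 0 t) ^ Suc (Suc m)) has_real_derivative (real (Suc (Suc m)) * (max 0 t) ^ Suc m)) (at t)"
proof -
  consider "t > 0" | "t < 0" | "t = 0" by linarith
  then show ?thesis
  proof cases
    case 1
    have "((\<lambda>t::real. t ^ Suc (Suc m)) has_real_derivative (real (Suc (Suc m)) * t ^ Suc m)) (at t)"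
      by (rule DERIV_cong[OF DERIV_pow]) simp
    then have "((\<lambda>t::real. (max 0 t) ^ Suc (Suc m)) has_real_derivative (real (Suc (Suc m)) * t ^ Suc m)) (at t)"
      using has_field_derivative_transform_within_open[of "\<lambda>t. t ^ Suc (Suc m)" _ t "{0<..}"] 1 by auto
    then show ?thesis using 1 by (simp add: max_def)
  next
    case 2
    have "((\<lambda>t::real. 0 :: real) has_real_derivative 0) (at t)" by simp
    then have "((\<lambda>t::real. (max 0 t) ^ Suc (Suc m)) has_real_derivative 0) (at t)"
      using has_field_derivative_transform_within_open[of "\<lambda>t. 0" 0 t "{..<0}"] 2 by auto
    then show ?thesis using 2 by (simp add: max_def)
  next
    case 3
    have "((\<lambda>h::real. (max 0 h) ^ Suc m) \<longlongrightarrow> (max 0 0) ^ Suc m) (at 0)"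
      by (intro tendsto_intros)
    moreover have "(max 0 (0 + h) ^ Suc (Suc m) - max 0 0 ^ Suc (Suc m)) / h = (max 0 h) ^ Suc m" for h :: real
      by (cases "h = 0") (auto simp: max_def)
    ultimately show ?thesis using 3 by (simp add: DERIV_def)
  qed
qed

lemma matrix_blinfun:
  obtains \<Phi> :: "real ^ 'n ^ 'n \<Rightarrow> (real ^ 'n) \<Rightarrow>\<^sub>L (real ^ 'n)"
  where "bounded_linear \<Phi>" "\<And>M y. blinfun_apply (\<Phi> M) y = M *v y"
proof -
  define \<Phi> where "\<Phi> M = Blinfun (\<lambda>y. M *v y)" for M :: "real ^ 'n ^ 'n"
  have ap: "blinfun_apply (\<Phi> M) y = M *v y" for M y
    unfolding \<Phi>_def by (simp add: bounded_linear_Blinfun_apply[OF matrix_vector_mul_bounded_linear])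
  have "linear \<Phi>"
    by (intro linearI blinfun_eqI)
       (simp_all add: ap blinfun.add_left blinfun.scaleR_left matrix_vector_mult_add_rdistrib
         scaleR_matrix_vector_assoc[symmetric])
  then show ?thesis using that ap by (simp add: linear_conv_bounded_linear)
qed

lemma integrable_compact_support:
  fixes f :: "real ^ 'n \<Rightarrow> 'b::euclidean_space"
  assumes "continuous_on UNIV f" "\<And>y. y \<notin> cball a r \<Longrightarrow> f y = 0"
  shows "integrable lborel f"
proof -
  have "integrable lborel (\<lambda>y. indicator (cball a r) y *\<^sub>R f y)"
    by (rule borel_integrable_compact) (use assms(1) continuous_on_subset in auto)
  moreover have "(\<lambda>y. indicator (cball a r) y *\<^sub>R f y) = f"
    using assms(2) by (auto simp: indicator_def fun_eq_iff)
  ultimately show ?thesis by simp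
qed

text \<open>The mollifier is a multiple of \<open>(1 - |y|\<^sup>2)\<^sub>+\<^sup>3\<close>.\<close>

lemma mollifier_exists:
  obtains \<rho> :: "real ^ 'n \<Rightarrow> real" and a b where "has_jet \<rho> a b" "\<And>y. \<rho> y \<ge> 0"
    "\<And>y. y \<notin> cball 0 1 \<Longrightarrow> \<rho> y = 0" "\<And>y. y \<notin> cball 0 1 \<Longrightarrow> a y = 0" "\<And>y. y \<notin> cball 0 1 \<Longrightarrow> b y = 0"
    "(\<integral>y. \<rho> y \<partial>lborel) = 1"
proof -
  define m where "m y = max 0 (1 - y \<bullet> y)" for y :: "real ^ 'n"
  define I where "I = (\<integral>y. (m y) ^ 3 \<partial>(lborel :: (real ^ 'n) measure))"
  have m0: "m y \<ge> 0" for y by (simp add: m_def)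
  have mz: "m y = 0" if "y \<notin> cball 0 1" for y
  proof -
    have "norm y > 1" using that by simp
    then have "y \<bullet> y > 1" by (simp add: dot_square_norm one_less_power)
    then show ?thesis by (simp add: m_def)
  qed
  have cm: "continuous_on UNIV m" unfolding m_def by (intro continuous_intros)
  have int: "integrable lborel (\<lambda>y. (m y) ^ 3)"
    by (rule integrable_compact_support[of _ 0 1]) (auto intro!: continuous_intros cm simp: mz)
  have "I > 0"
  proof -
    have "0 < (3/4) ^ 3 * measure lborel (ball (0 :: real ^ 'n) (1/2))"
      using content_ball_pos[of "1/2" "0 :: real ^ 'n"] by simp
    also have "\<dots> = (\<integral>y. (3/4) ^ 3 * indicator (ball (0 :: real ^ 'n) (1/2)) y \<partial>lborel)"
      using emeasure_bounded_finite[of "ball (0 :: real ^ 'n) (1/2)"] by (simp add: power_divide)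
    also have "\<dots> \<le> I" unfolding I_def
    proof (rule integral_mono)
      show "integrable lborel (\<lambda>y. (3/4) ^ 3 * indicator (ball (0 :: real ^ 'n) (1/2)) y :: real)"
        using emeasure_bounded_finite[of "ball (0 :: real ^ 'n) (1/2)"] by (intro integrable_mult_right integrable_real_indicator) auto
      fix y :: "real ^ 'n"
      show "(3/4) ^ 3 * indicator (ball (0 :: real ^ 'n) (1/2)) y \<le> m y ^ 3"
      proof (cases "y \<in> ball 0 (1/2)")
        case True
        then have "norm y \<le> 1/2" by simp
        then have "(norm y)\<^sup>2 \<le> (1/2)\<^sup>2" by (intro power_mono) auto
        then have "3/4 \<le> m y" by (simp add: m_def dot_square_norm power2_eq_square)
        then have "(3/4) ^ 3 \<le> m y ^ 3" by (intro power_mono) auto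
        then show ?thesis using True by simp
      qed (simp add: m0)
    qed (rule int)
    finally show ?thesis .
  qed
  define c where "c = 1 / I"
  define \<rho> where "\<rho> y = c * (m y) ^ 3" for y
  define a where "a y = (- 6 * c * (m y) ^ 2) *\<^sub>R y" for y
  define b where "b y = (\<chi> i j. 24 * c * m y * y $ i * y $ j - (if i = j then 6 * c * (m y) ^ 2 else 0))" for y
  have d0: "((\<lambda>y. 1 - y \<bullet> y) has_derivative (\<lambda>h. - 2 * (x \<bullet> h))) (at x)" for x :: "real ^ 'n"
    by (auto intro!: derivative_eq_intros simp: fun_eq_iff inner_commute)
  have dm: "((\<lambda>y. (m y) ^ Suc (Suc k)) has_derivative (\<lambda>h. real (Suc (Suc k)) * m x ^ Suc k * (- 2 * (x \<bullet> h)))) (at x)" for x k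
    using has_derivative_compose[OF d0 max0_power_has_derivative[of k, THEN has_field_derivative_imp_has_derivative]]
    by (simp add: m_def)
  have dm3: "((\<lambda>y. m y ^ 3) has_derivative (\<lambda>h. 3 * (m x)\<^sup>2 * (- 2 * (x \<bullet> h)))) (at x)" for x
    using dm[of 1 x] by (simp add: numeral_3_eq_3 numeral_2_eq_2)
  have dm2: "((\<lambda>y. (m y)\<^sup>2) has_derivative (\<lambda>h. 2 * m x * (- 2 * (x \<bullet> h)))) (at x)" for x
    using dm[of 0 x] by (simp add: numeral_2_eq_2)
  have d1: "(\<rho> has_derivative (\<lambda>h. a x \<bullet> h)) (at x)" for x
    unfolding \<rho>_def a_def
    by (rule has_derivative_eq_rhs[OF has_derivative_mult_right[OF dm3]]) (simp add: fun_eq_iff)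
  have d2: "(a has_derivative (\<lambda>h. b x *v h)) (at x)" for x
  proof -
    have "(a has_derivative (\<lambda>h. (- 6 * c * m x ^ 2) *\<^sub>R h + (- 6 * c * (2 * m x * (- 2 * (x \<bullet> h)))) *\<^sub>R x)) (at x)"
      unfolding a_def
      by (rule has_derivative_eq_rhs[OF has_derivative_scaleR[OF has_derivative_mult_right[OF dm2] has_derivative_ident]])
         (simp add: fun_eq_iff)
    moreover have "(- 6 * c * m x ^ 2) *\<^sub>R h + (- 6 * c * (2 * m x * (- 2 * (x \<bullet> h)))) *\<^sub>R x = b x *v h" for h
    proof -
      have "(b x *v h) $ i = (\<Sum>j\<in>UNIV. 24 * c * m x * x $ i * x $ j * h $ j) - 6 * c * (m x)\<^sup>2 * h $ i" for i
        by (simp add: b_def matrix_vector_mult_def left_diff_distrib sum_subtractf mult_delta_left)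
      moreover have "(\<Sum>j\<in>UNIV. 24 * c * m x * x $ i * x $ j * h $ j) = 24 * c * m x * x $ i * (x \<bullet> h)" for i
        by (simp add: inner_vec_def sum_distrib_left mult.assoc)
      ultimately show ?thesis by (simp add: vec_eq_iff)
    qed
    ultimately show ?thesis by simp
  qed
  have cb: "continuous_on UNIV b"
    unfolding b_def
  proof (intro continuous_on_vec_lambda)
    fix i j
    show "continuous_on UNIV (\<lambda>y. 24 * c * m y * y $ i * y $ j - (if i = j then 6 * c * (m y) ^ 2 else 0))"
      by (cases "i = j") (auto intro!: continuous_intros cm)
  qed
  have "has_jet \<rho> a b" using d1 d2 cb by (simp add: has_jet_def)
  moreover have "\<rho> y \<ge> 0" for y using \<open>I > 0\<close> m0 by (simp add: \<rho>_def c_def)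
  moreover have "\<rho> y = 0" "a y = 0" "b y = 0" if "y \<notin> cball 0 1" for y
    using mz[OF that] by (simp_all add: \<rho>_def a_def b_def vec_eq_iff)
  moreover have "(\<integral>y. \<rho> y \<partial>lborel) = 1" using \<open>I > 0\<close> by (simp add: \<rho>_def c_def I_def)
  ultimately show ?thesis using that by blast
qed

text \<open>w is merely continuous, so translation moves x into the kernel, as w y times k(y - x),
  and the derivative falls on k with a minus sign. The Leibniz rule needs one box for all z near x;
  the box Q contains the support of k(y - z) for every z within distance 1 of x.\<close>

lemma convolution_has_derivative:
  fixes k :: "real ^ 'n \<Rightarrow> 'b::euclidean_space" and D :: "real ^ 'n \<Rightarrow> (real ^ 'n) \<Rightarrow>\<^sub>L 'b"
  assumes k: "\<And>y. (k has_derivative blinfun_apply (D y)) (at y)" and D: "continuous_on UNIV D"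
    and sk: "\<And>y. y \<notin> cball 0 1 \<Longrightarrow> k y = 0" and sD: "\<And>y. y \<notin> cball 0 1 \<Longrightarrow> D y = 0"
    and w: "continuous_on UNIV w"
  shows "((\<lambda>x. \<integral>y. w (x + y) *\<^sub>R k y \<partial>lborel) has_derivative
     (\<lambda>h. - (\<integral>y. w (x + y) *\<^sub>R D y h \<partial>lborel))) (at x)"
proof -
  have ck: "continuous_on UNIV k" using k by (rule has_derivative_continuous_on)
  have shift: "(\<integral>y. w (x + y) *\<^sub>R g y \<partial>lborel) = (\<integral>y. w y *\<^sub>R g (y - x) \<partial>lborel)"
    if g: "continuous_on UNIV g" for g :: "real ^ 'n \<Rightarrow> 'b" and x
  proof -
    have "(\<lambda>y. w y *\<^sub>R g (y - x)) \<in> borel_measurable borel"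
      by (intro borel_measurable_continuous_onI continuous_intros continuous_on_compose2[OF g] w) auto
    then have "(\<integral>y. w y *\<^sub>R g (y - x) \<partial>distr lborel borel ((+) x)) = (\<integral>y. w (x + y) *\<^sub>R g (x + y - x) \<partial>lborel)"
      by (intro integral_distr) auto
    then show ?thesis by (simp add: lborel_distr_plus)
  qed
  define r where "r = norm x + 3"
  let ?Q = "cbox (- r *\<^sub>R One) (r *\<^sub>R One :: real ^ 'n)"
  have inQ: "y \<in> ?Q" if "z \<in> ball x 1" "y - z \<in> cball 0 1" for y z
  proof -
    have "norm y \<le> norm (y - z) + norm (z - x) + norm x"
      using norm_triangle_ineq[of "y - z" "z - x"] norm_triangle_ineq[of "y - x" x] by simp
    also have "\<dots> \<le> r" using that by (simp add: r_def dist_norm norm_minus_commute)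
    finally have "norm y \<le> r" .
    then show ?thesis
      by (auto simp: mem_box abs_le_iff dest: order_trans[OF Basis_le_norm[of _ y]])
  qed
  have HK: "(\<integral>y. w y *\<^sub>R g (y - z) \<partial>lborel) = integral ?Q (\<lambda>y. w y *\<^sub>R g (y - z))"
    if g: "continuous_on UNIV g" "\<And>y. y \<notin> cball 0 1 \<Longrightarrow> g y = 0" and z: "z \<in> ball x 1" for g :: "real ^ 'n \<Rightarrow> 'b" and z
  proof -
    have "continuous_on UNIV (\<lambda>y. w y *\<^sub>R g (y - z))"
      by (intro continuous_intros continuous_on_compose2[OF g(1)] w) auto
    moreover have "w y *\<^sub>R g (y - z) = 0" if "y \<notin> ?Q" for y using inQ[OF z] that g(2) by auto
    ultimately have "set_integrable lborel ?Q (\<lambda>y. w y *\<^sub>R g (y - z))"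
      unfolding set_integrable_def by (intro borel_integrable_compact compact_cbox) (auto intro: continuous_on_subset)
    then have "(LINT y:?Q|lborel. w y *\<^sub>R g (y - z)) = integral ?Q (\<lambda>y. w y *\<^sub>R g (y - z))"
      by (rule set_borel_integral_eq_integral)
    moreover have "(LINT y:?Q|lborel. w y *\<^sub>R g (y - z)) = (\<integral>y. w y *\<^sub>R g (y - z) \<partial>lborel)"
      unfolding set_lebesgue_integral_def
      by (intro Bochner_Integration.integral_cong) (use inQ[OF z] g(2) in \<open>auto simp: indicator_def\<close>)
    ultimately show ?thesis by simp
  qed
  have "((\<lambda>z. integral ?Q (\<lambda>y. w y *\<^sub>R k (y - z))) has_derivative
      blinfun_apply (integral ?Q (\<lambda>y. - (w y *\<^sub>R D (y - x))))) (at x within ball x 1)"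
  proof (rule leibniz_rule)
    show "((\<lambda>z. w t *\<^sub>R k (t - z)) has_derivative blinfun_apply (- (w t *\<^sub>R D (t - z)))) (at z within ball x 1)" for z t
    proof -
      have "((\<lambda>z. t - z) has_derivative (\<lambda>h. - h)) (at z)" by (auto intro!: derivative_eq_intros)
      from has_derivative_compose[OF this k]
      have "((\<lambda>z. w t *\<^sub>R k (t - z)) has_derivative (\<lambda>h. w t *\<^sub>R D (t - z) (- h))) (at z)"
        by (rule has_derivative_scaleR_right)
      then have "((\<lambda>z. w t *\<^sub>R k (t - z)) has_derivative blinfun_apply (- (w t *\<^sub>R D (t - z)))) (at z)"
        by (rule has_derivative_eq_rhs) (simp add: fun_eq_iff blinfun.minus_left blinfun.minus_right blinfun.scaleR_left)
      then show ?thesis by (rule has_derivative_at_withinI)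
    qed
    show "(\<lambda>y. w y *\<^sub>R k (y - z)) integrable_on ?Q" for z
      by (intro integrable_continuous continuous_intros continuous_on_compose2[OF ck] continuous_on_subset[OF w]) auto
    show "continuous_on (ball x 1 \<times> ?Q) (\<lambda>(x, t). - (w t *\<^sub>R D (t - x)))"
      unfolding split_beta
      by (intro continuous_intros continuous_on_compose2[OF D] continuous_on_compose2[OF w]) auto
  qed auto
  then have L: "((\<lambda>z. integral ?Q (\<lambda>y. w y *\<^sub>R k (y - z))) has_derivative
      blinfun_apply (integral ?Q (\<lambda>y. - (w y *\<^sub>R D (y - x))))) (at x)"
    by (simp add: at_within_open[of x "ball x 1"])
  have R: "blinfun_apply (integral ?Q (\<lambda>y. - (w y *\<^sub>R D (y - x)))) h = - (\<integral>y. w (x + y) *\<^sub>R D y h \<partial>lborel)" for h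
  proof -
    have cD: "continuous_on UNIV (\<lambda>y. D y h)" by (intro continuous_intros D)
    have "(\<lambda>y. - (w y *\<^sub>R D (y - x))) integrable_on ?Q"
      by (intro integrable_continuous continuous_intros continuous_on_compose2[OF D] continuous_on_subset[OF w]) auto
    then have "blinfun_apply (integral ?Q (\<lambda>y. - (w y *\<^sub>R D (y - x)))) h = integral ?Q (\<lambda>y. - (w y *\<^sub>R D (y - x) h))"
      by (subst blinfun_apply_integral) (auto simp: blinfun.minus_left blinfun.scaleR_left)
    also have "\<dots> = - integral ?Q (\<lambda>y. w y *\<^sub>R D (y - x) h)" by simp
    also have "integral ?Q (\<lambda>y. w y *\<^sub>R D (y - x) h) = (\<integral>y. w y *\<^sub>R D (y - x) h \<partial>lborel)"
      by (rule HK[OF cD, symmetric]) (auto simp: sD)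
    also have "\<dots> = (\<integral>y. w (x + y) *\<^sub>R D y h \<partial>lborel)" by (rule shift[OF cD, symmetric])
    finally show ?thesis .
  qed
  have "((\<lambda>x. \<integral>y. w (x + y) *\<^sub>R k y \<partial>lborel) has_derivative
      blinfun_apply (integral ?Q (\<lambda>y. - (w y *\<^sub>R D (y - x))))) (at x)"
  proof (rule has_derivative_transform_within_open[OF L, of "ball x 1"])
    fix z assume "z \<in> ball x 1"
    then show "integral ?Q (\<lambda>y. w y *\<^sub>R k (y - z)) = (\<integral>y. w (z + y) *\<^sub>R k y \<partial>lborel)"
      using HK[OF ck sk] shift[OF ck] by simp
  qed auto
  then show ?thesis by (rule has_derivative_eq_rhs) (rule ext, rule R)
qed

lemma trig_poly_sum: "finite J \<Longrightarrow> (\<And>i. trig_poly (f i)) \<Longrightarrow> trig_poly (\<lambda>x. \<Sum>i\<in>J. f i x)"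
  by (induction J rule: finite_induct) (auto intro: trig_poly_const trig_poly.add)

section \<open>Mollification and constant-coefficient operators\<close>

definition mollifier :: "(real ^ 'n \<Rightarrow> real) \<Rightarrow> (real ^ 'n \<Rightarrow> real ^ 'n) \<Rightarrow> (real ^ 'n \<Rightarrow> real ^ 'n ^ 'n) \<Rightarrow> bool" where
  "mollifier \<rho> a b \<longleftrightarrow> has_jet \<rho> a b \<and> (\<forall>y. \<rho> y \<ge> 0) \<and>
    (\<forall>y. y \<notin> cball 0 1 \<longrightarrow> \<rho> y = 0 \<and> a y = 0 \<and> b y = 0) \<and> (\<integral>y. \<rho> y \<partial>lborel) = 1"

text \<open>Written as an average of the translates w(x + \<open>\<delta>\<close> y), so that
  monotonicity, periodicity and Lipschitz bounds pass to it directly.\<close>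

definition mollify :: "(real ^ 'n \<Rightarrow> real) \<Rightarrow> real \<Rightarrow> (real ^ 'n \<Rightarrow> real) \<Rightarrow> real ^ 'n \<Rightarrow> real" where
  "mollify \<rho> \<delta> w x = (\<integral>y. \<rho> y * w (x + \<delta> *\<^sub>R y) \<partial>lborel)"

lemma compact_support_integral_continuous:
  fixes g :: "real ^ 'n \<Rightarrow> 'b::euclidean_space"
  assumes g: "continuous_on UNIV g" "\<And>y. y \<notin> cball 0 1 \<Longrightarrow> g y = 0" and w: "continuous_on UNIV w"
  shows "continuous_on UNIV (\<lambda>x. \<integral>y. w (x + y) *\<^sub>R g y \<partial>lborel)"
proof -
  let ?Q = "cbox (- One) (One :: real ^ 'n)"
  have inQ: "y \<in> ?Q" if "y \<in> cball 0 1" for y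
    using that by (auto simp: mem_box abs_le_iff dest: order_trans[OF Basis_le_norm[of _ y]])
  have "(\<integral>y. w (x + y) *\<^sub>R g y \<partial>lborel) = integral ?Q (\<lambda>y. w (x + y) *\<^sub>R g y)" for x
  proof -
    have "continuous_on UNIV (\<lambda>y. w (x + y) *\<^sub>R g y)"
      by (intro continuous_intros continuous_on_compose2[OF w] g) auto
    then have "set_integrable lborel ?Q (\<lambda>y. w (x + y) *\<^sub>R g y)"
      unfolding set_integrable_def by (intro borel_integrable_compact compact_cbox) (auto intro: continuous_on_subset)
    then have "(LINT y:?Q|lborel. w (x + y) *\<^sub>R g y) = integral ?Q (\<lambda>y. w (x + y) *\<^sub>R g y)"
      by (rule set_borel_integral_eq_integral)
    moreover have "(LINT y:?Q|lborel. w (x + y) *\<^sub>R g y) = (\<integral>y. w (x + y) *\<^sub>R g y \<partial>lborel)"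
      unfolding set_lebesgue_integral_def
      by (intro Bochner_Integration.integral_cong) (use inQ g(2) in \<open>auto simp: indicator_def\<close>)
    ultimately show ?thesis by simp
  qed
  moreover have "continuous_on UNIV (\<lambda>x. integral ?Q (\<lambda>y. w (x + y) *\<^sub>R g y))"
    by (rule integral_continuous_on_param)
       (auto simp: split_beta intro!: continuous_intros continuous_on_compose2[OF w] continuous_on_compose2[OF g(1)])
  ultimately show ?thesis by simp
qed

lemma has_jet_at_max:
  assumes jet: "has_jet f g h" and max: "\<And>z. f z \<le> f x"
  shows "g x = 0" "d \<bullet> (h x *v d) \<le> 0"
proof -
  have "(f has_derivative (\<lambda>y. g x \<bullet> y)) (at x)" using jet by (simp add: has_jet_def)
  then have "(\<lambda>y. g x \<bullet> y) = (\<lambda>y. 0)"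
    using differential_zero_maxmin[of x UNIV f "\<lambda>y. g x \<bullet> y"] max by auto
  then have "g x \<bullet> g x = 0" by metis
  then show g0: "g x = 0" by simp
  show "d \<bullet> (h x *v d) \<le> 0"
  proof (rule le_of_le_add_small)
    fix \<tau> :: real assume \<tau>: "\<tau> > 0"
    have "\<forall>\<^sub>F t in at_right (0::real). t > 0" by (simp add: eventually_at_right_less)
    with eventually_nhds_scaleR[OF has_jet_taylor[OF jet \<tau>, of x], of d]
    have "\<forall>\<^sub>F t in at_right (0::real). d \<bullet> (h x *v d) \<le> 0 + \<tau> * (2 * (norm d)\<^sup>2)"
    proof eventually_elim
      case (elim t)
      have e: "(t *\<^sub>R d) \<bullet> (h x *v (t *\<^sub>R d)) = t\<^sup>2 * (d \<bullet> (h x *v d))" "(norm (t *\<^sub>R d))\<^sup>2 = t\<^sup>2 * (norm d)\<^sup>2"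
        by (simp_all add: matrix_vector_mult_scaleR power_mult_distrib power2_eq_square)
      have "f x + t\<^sup>2 * (d \<bullet> (h x *v d)) / 2 - f (x + t *\<^sub>R d) \<le> \<tau> * (t\<^sup>2 * (norm d)\<^sup>2)"
        using elim(1) unfolding g0 add_diff_cancel_left' e by (simp add: abs_le_iff)
      then have "t\<^sup>2 * (d \<bullet> (h x *v d)) / 2 \<le> \<tau> * (t\<^sup>2 * (norm d)\<^sup>2)"
        using max[of "x + t *\<^sub>R d"] by linarith
      then have "t\<^sup>2 * (d \<bullet> (h x *v d)) \<le> t\<^sup>2 * (\<tau> * (2 * (norm d)\<^sup>2))" by (simp add: mult_ac)
      then show ?case using elim by simp
    qed
    then show "d \<bullet> (h x *v d) \<le> 0 + \<tau> * (2 * (norm d)\<^sup>2)"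
      using eventually_happens'[OF trivial_limit_at_right_real] by blast
  qed
qed

lemma lin_op_at_max:
  assumes jet: "has_jet f g h" and max: "\<And>z. f z \<le> f x"
    and B: "transpose B = B" "\<And>y. 0 \<le> y \<bullet> (B *v y)"
  shows "lin_op B v f x \<le> 0"
proof -
  have "0 \<le> trace (B ** ((-1) *\<^sub>R h x))"
  proof (rule psd_trace_nonneg[OF B])
    show "0 \<le> y \<bullet> (((-1) *\<^sub>R h x) *v y)" for y
      unfolding scaleR_matrix_vector_assoc[symmetric] using has_jet_at_max(2)[OF jet max, of y] by simp
  qed
  then have "trace (B ** h x) \<le> 0" unfolding trace_mult_scaleR by linarith
  then show ?thesis by (simp add: lin_op_jet[OF jet] has_jet_at_max(1)[OF jet max])
qed

context
  fixes \<rho> :: "real ^ 'n \<Rightarrow> real" and a b and \<delta> :: real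
  assumes m: "mollifier \<rho> a b" and \<delta>: "\<delta> > 0"
begin

lemma mollifier_cont: "continuous_on UNIV \<rho>" "continuous_on UNIV a" "continuous_on UNIV b"
  using m has_jet_continuous unfolding mollifier_def by blast+

lemma mollify_integrable:
  fixes w g :: "real ^ 'n \<Rightarrow> real"
  assumes w: "continuous_on UNIV w" and g: "continuous_on UNIV g" "\<And>y. y \<notin> cball 0 1 \<Longrightarrow> g y = 0"
  shows "integrable lborel (\<lambda>y. g y * w (x + \<delta> *\<^sub>R y))"
  by (rule integrable_compact_support[of _ 0 1])
     (auto intro!: continuous_intros g continuous_on_compose2[OF w] simp: g(2))

lemma mollify_integrable_\<rho>:
  assumes w: "continuous_on UNIV w"
  shows "integrable lborel (\<lambda>y. \<rho> y * w (x + \<delta> *\<^sub>R y))"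
  using m by (intro mollify_integrable w mollifier_cont) (auto simp: mollifier_def)

lemma mollify_const: "mollify \<rho> \<delta> (\<lambda>x. c) x = c"
  using m by (simp add: mollify_def mollifier_def)

lemma mollify_add:
  assumes "continuous_on UNIV f" "continuous_on UNIV g"
  shows "mollify \<rho> \<delta> (\<lambda>x. f x + g x) x = mollify \<rho> \<delta> f x + mollify \<rho> \<delta> g x"
  unfolding mollify_def distrib_left
  by (rule Bochner_Integration.integral_add) (intro mollify_integrable_\<rho> assms)+

lemma mollify_scale: "mollify \<rho> \<delta> (\<lambda>x. c * f x) x = c * mollify \<rho> \<delta> f x"
  unfolding mollify_def by (simp add: mult.left_commute)

lemma mollify_mono:
  assumes f: "continuous_on UNIV f" and g: "continuous_on UNIV g"
    and le: "\<And>y. norm (y - x) \<le> \<delta> \<Longrightarrow> f y \<le> g y"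
  shows "mollify \<rho> \<delta> f x \<le> mollify \<rho> \<delta> g x"
  unfolding mollify_def
proof (rule integral_mono)
  fix y
  show "\<rho> y * f (x + \<delta> *\<^sub>R y) \<le> \<rho> y * g (x + \<delta> *\<^sub>R y)"
  proof (cases "y \<in> cball 0 1")
    case True
    then have "norm (x + \<delta> *\<^sub>R y - x) \<le> \<delta>" using \<delta> by (simp add: mult_left_le)
    from le[OF this] show ?thesis using m by (simp add: mollifier_def mult_left_mono)
  next
    case False then show ?thesis using m by (simp add: mollifier_def)
  qed
qed (intro mollify_integrable_\<rho> assms)+

lemma mollify_torus_fun: "torus_fun w \<Longrightarrow> torus_fun (mollify \<rho> \<delta> w)"
  unfolding torus_fun_def mollify_def
proof (intro allI impI)
  fix x k :: "real ^ 'n"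
  assume w: "\<forall>x k. (\<forall>i. k $ i \<in> \<int>) \<longrightarrow> w (x + k) = w x" and k: "\<forall>i. k $ i \<in> \<int>"
  have "w (x + k + \<delta> *\<^sub>R y) = w (x + \<delta> *\<^sub>R y)" for y
    using w k by (metis add.assoc add.commute)
  then show "(\<integral>y. \<rho> y * w (x + k + \<delta> *\<^sub>R y) \<partial>lborel) = (\<integral>y. \<rho> y * w (x + \<delta> *\<^sub>R y) \<partial>lborel)" by simp
qed

lemma mollify_close:
  assumes f: "continuous_on UNIV f" and g: "continuous_on UNIV g"
    and le: "\<And>y. norm (y - x) \<le> \<delta> \<Longrightarrow> \<bar>f y - g y\<bar> \<le> e"
  shows "\<bar>mollify \<rho> \<delta> f x - mollify \<rho> \<delta> g x\<bar> \<le> e"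
proof -
  have "mollify \<rho> \<delta> f x \<le> mollify \<rho> \<delta> (\<lambda>x. g x + e) x"
    by (intro mollify_mono f continuous_intros g) (use le in \<open>force simp: abs_le_iff\<close>)
  moreover have "mollify \<rho> \<delta> g x \<le> mollify \<rho> \<delta> (\<lambda>x. f x + e) x"
    by (intro mollify_mono g continuous_intros f) (use le in \<open>force simp: abs_le_iff\<close>)
  ultimately show ?thesis using f g by (simp add: mollify_add mollify_const)
qed

lemma mollify_lipschitz_close:
  assumes w: "continuous_on UNIV w" and lip: "\<And>x z. \<bar>w x - w z\<bar> \<le> K * norm (x - z)" "K \<ge> 0"
  shows "\<bar>mollify \<rho> \<delta> w x - w x\<bar> \<le> K * \<delta>"
proof -
  have "\<bar>w y - w x\<bar> \<le> K * \<delta>" if "norm (y - x) \<le> \<delta>" for y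
    using lip(1)[of y x] mult_left_mono[OF that lip(2)] by linarith
  from mollify_close[OF w continuous_on_const this] show ?thesis by (simp add: mollify_const)
qed

lemma mollify_lipschitz:
  assumes w: "continuous_on UNIV w" and lip: "\<And>x z. \<bar>w x - w z\<bar> \<le> K * norm (x - z)"
  shows "\<bar>mollify \<rho> \<delta> w x - mollify \<rho> \<delta> w z\<bar> \<le> K * norm (x - z)"
proof -
  have "mollify \<rho> \<delta> w z = mollify \<rho> \<delta> (\<lambda>y. w (y + (z - x))) x"
    by (simp add: mollify_def algebra_simps)
  moreover have "\<bar>mollify \<rho> \<delta> w x - mollify \<rho> \<delta> (\<lambda>y. w (y + (z - x))) x\<bar> \<le> K * norm (x - z)"
  proof (rule mollify_close[OF w])
    show "continuous_on UNIV (\<lambda>y. w (y + (z - x)))"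
      by (intro continuous_on_compose2[OF w] continuous_intros) auto
    show "\<bar>w y - w (y + (z - x))\<bar> \<le> K * norm (x - z)" for y
      using lip[of y "y + (z - x)"] by (simp add: norm_minus_commute)
  qed
  ultimately show ?thesis by simp
qed

lemma mollify_has_jet:
  assumes w: "continuous_on UNIV w"
  shows "has_jet (mollify \<rho> \<delta> w) (\<lambda>x. (- 1 / \<delta>) *\<^sub>R (\<integral>y. w (x + \<delta> *\<^sub>R y) *\<^sub>R a y \<partial>lborel))
     (\<lambda>x. (1 / \<delta>\<^sup>2) *\<^sub>R (\<integral>y. w (x + \<delta> *\<^sub>R y) *\<^sub>R b y \<partial>lborel))"
proof -
  have jet: "has_jet \<rho> a b" and supp: "\<And>y. y \<notin> cball 0 1 \<Longrightarrow> \<rho> y = 0" "\<And>y. y \<notin> cball 0 1 \<Longrightarrow> a y = 0"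
    "\<And>y. y \<notin> cball 0 1 \<Longrightarrow> b y = 0" using m by (auto simp: mollifier_def)
  \<comment> \<open>Rescaling by \<open>\<delta>\<close> reduces to kernels on the unit ball; every
    derivative in x then brings out a factor 1/\<open>\<delta>\<close>, and a minus sign from
    \<open>convolution_has_derivative\<close>.\<close>
  define v where "v z = w (\<delta> *\<^sub>R z)" for z
  have v: "continuous_on UNIV v" unfolding v_def by (intro continuous_on_compose2[OF w] continuous_intros) auto
  have vw: "v ((1 / \<delta>) *\<^sub>R x + y) = w (x + \<delta> *\<^sub>R y)" for x y using \<delta> by (simp add: v_def scaleR_add_right)
  obtain \<Phi> :: "real ^ 'n ^ 'n \<Rightarrow> (real ^ 'n) \<Rightarrow>\<^sub>L (real ^ 'n)"
    where \<Phi>: "bounded_linear \<Phi>" "\<And>M y. blinfun_apply (\<Phi> M) y = M *v y" using matrix_blinfun by blast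
  have intb: "integrable lborel (\<lambda>y. v (x + y) *\<^sub>R b y)" for x
    by (rule integrable_compact_support[of _ 0 1])
       (auto intro!: continuous_intros mollifier_cont continuous_on_compose2[OF v] simp: supp)
  have inta: "integrable lborel (\<lambda>y. v (x + y) *\<^sub>R a y)" for x
    by (rule integrable_compact_support[of _ 0 1])
       (auto intro!: continuous_intros mollifier_cont continuous_on_compose2[OF v] simp: supp)
  have sc: "((\<lambda>x. (1 / \<delta>) *\<^sub>R x) has_derivative (\<lambda>h. (1 / \<delta>) *\<^sub>R h)) (at x)" for x :: "real ^ 'n"
    by (auto intro!: derivative_eq_intros)
  have d1: "((\<lambda>x. \<integral>y. v (x + y) *\<^sub>R \<rho> y \<partial>lborel) has_derivative (\<lambda>h. - (\<integral>y. v (x + y) *\<^sub>R blinfun_inner_right (a y) h \<partial>lborel))) (at x)" for x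
    by (rule convolution_has_derivative)
       (use jet in \<open>auto simp: has_jet_def supp linear_simps(3)[OF bounded_linear_blinfun_inner_right]
          intro!: v bounded_linear.continuous_on[OF bounded_linear_blinfun_inner_right] mollifier_cont\<close>)
  have e1: "(mollify \<rho> \<delta> w has_derivative (\<lambda>h. ((- 1 / \<delta>) *\<^sub>R (\<integral>y. w (x + \<delta> *\<^sub>R y) *\<^sub>R a y \<partial>lborel)) \<bullet> h)) (at x)" for x
  proof -
    have E: "mollify \<rho> \<delta> w = (\<lambda>x. \<integral>y. v ((1 / \<delta>) *\<^sub>R x + y) *\<^sub>R \<rho> y \<partial>lborel)"
      by (simp add: mollify_def[abs_def] vw mult.commute)
    have F: "- (\<integral>y. v ((1 / \<delta>) *\<^sub>R x + y) *\<^sub>R blinfun_inner_right (a y) ((1 / \<delta>) *\<^sub>R h) \<partial>lborel)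
       = ((- 1 / \<delta>) *\<^sub>R (\<integral>y. w (x + \<delta> *\<^sub>R y) *\<^sub>R a y \<partial>lborel)) \<bullet> h" for h
    proof -
      have "(\<integral>y. w (x + \<delta> *\<^sub>R y) *\<^sub>R a y \<partial>lborel) \<bullet> h = (\<integral>y. (w (x + \<delta> *\<^sub>R y) *\<^sub>R a y) \<bullet> h \<partial>lborel)"
        using integral_bounded_linear[OF bounded_linear_inner_left inta[of "(1 / \<delta>) *\<^sub>R x"], of h] by (simp add: vw)
      then show ?thesis by (simp add: vw mult.commute)
    qed
    show ?thesis unfolding E by (rule has_derivative_eq_rhs[OF has_derivative_compose[OF sc d1]]) (rule ext, rule F)
  qed
  have \<Phi>': "blinfun_apply (\<Phi> M) = (*v) M" for M using \<Phi>(2) by (rule ext)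
  have d2: "((\<lambda>x. \<integral>y. v (x + y) *\<^sub>R a y \<partial>lborel) has_derivative (\<lambda>h. - (\<integral>y. v (x + y) *\<^sub>R \<Phi> (b y) h \<partial>lborel))) (at x)" for x
    by (rule convolution_has_derivative)
       (use jet in \<open>auto simp: has_jet_def supp \<Phi>' linear_simps(3)[OF \<Phi>(1)] intro!: v bounded_linear.continuous_on[OF \<Phi>(1)] mollifier_cont\<close>)
  have e2: "((\<lambda>x. (- 1 / \<delta>) *\<^sub>R (\<integral>y. w (x + \<delta> *\<^sub>R y) *\<^sub>R a y \<partial>lborel)) has_derivative
      (\<lambda>h. ((1 / \<delta>\<^sup>2) *\<^sub>R (\<integral>y. w (x + \<delta> *\<^sub>R y) *\<^sub>R b y \<partial>lborel)) *v h)) (at x)" for x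
  proof -
    have "((\<lambda>x. (- 1 / \<delta>) *\<^sub>R (\<integral>y. v ((1 / \<delta>) *\<^sub>R x + y) *\<^sub>R a y \<partial>lborel)) has_derivative
       (\<lambda>h. (- 1 / \<delta>) *\<^sub>R (- (\<integral>y. v ((1 / \<delta>) *\<^sub>R x + y) *\<^sub>R \<Phi> (b y) ((1 / \<delta>) *\<^sub>R h) \<partial>lborel)))) (at x)"
      by (rule has_derivative_scaleR_right[OF has_derivative_compose[OF sc d2]])
    moreover have "(- 1 / \<delta>) *\<^sub>R (- (\<integral>y. v ((1 / \<delta>) *\<^sub>R x + y) *\<^sub>R \<Phi> (b y) ((1 / \<delta>) *\<^sub>R h) \<partial>lborel))
       = ((1 / \<delta>\<^sup>2) *\<^sub>R (\<integral>y. w (x + \<delta> *\<^sub>R y) *\<^sub>R b y \<partial>lborel)) *v h" for h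
    proof -
      have bl: "bounded_linear (\<lambda>M :: real ^ 'n ^ 'n. M *v h)"
        using linear_matrix_vector_mul_left by (simp add: linear_conv_bounded_linear)
      have "(\<integral>y. w (x + \<delta> *\<^sub>R y) *\<^sub>R b y \<partial>lborel) *v h = (\<integral>y. (w (x + \<delta> *\<^sub>R y) *\<^sub>R b y) *v h \<partial>lborel)"
        using integral_bounded_linear[OF bl intb[of "(1 / \<delta>) *\<^sub>R x"]] by (simp add: vw)
      moreover have "(\<integral>y. w (x + \<delta> *\<^sub>R y) *\<^sub>R (b y *v ((1 / \<delta>) *\<^sub>R h)) \<partial>lborel)
          = (1 / \<delta>) *\<^sub>R (\<integral>y. w (x + \<delta> *\<^sub>R y) *\<^sub>R (b y *v h) \<partial>lborel)"
        unfolding matrix_vector_mult_scaleR scaleR_left_commute[of _ "1 / \<delta>"] by (rule integral_scaleR_right)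
      ultimately show ?thesis
        by (simp add: vw \<Phi> scaleR_matrix_vector_assoc[symmetric] power2_eq_square)
    qed
    ultimately show ?thesis by (simp add: vw)
  qed
  have e3: "continuous_on UNIV (\<lambda>x. (1 / \<delta>\<^sup>2) *\<^sub>R (\<integral>y. w (x + \<delta> *\<^sub>R y) *\<^sub>R b y \<partial>lborel))"
  proof -
    have "continuous_on UNIV (\<lambda>x. \<integral>y. v (x + y) *\<^sub>R b y \<partial>lborel)"
      by (rule compact_support_integral_continuous) (use mollifier_cont supp v in auto)
    moreover have "continuous_on UNIV (\<lambda>x :: real ^ 'n. (1 / \<delta>) *\<^sub>R x)" by (intro continuous_intros)
    ultimately have "continuous_on UNIV (\<lambda>x. \<integral>y. v ((1 / \<delta>) *\<^sub>R x + y) *\<^sub>R b y \<partial>lborel)"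
      by (rule continuous_on_compose2) simp
    then show ?thesis by (auto simp: vw intro!: continuous_intros)
  qed
  show ?thesis unfolding has_jet_def using e1 e2 e3 by blast
qed

lemma mollify_continuous: "continuous_on UNIV w \<Longrightarrow> continuous_on UNIV (mollify \<rho> \<delta> w)"
  using mollify_has_jet has_jet_continuous by blast

lemma lin_op_mollify:
  assumes w: "continuous_on UNIV w"
  shows "lin_op B v (mollify \<rho> \<delta> w) x
    = (\<integral>y. (trace (B ** b y) / \<delta>\<^sup>2 + (v \<bullet> a y) / \<delta>) * w (x + \<delta> *\<^sub>R y) \<partial>lborel)"
proof -
  have supp: "\<And>y. y \<notin> cball 0 1 \<Longrightarrow> a y = 0" "\<And>y. y \<notin> cball 0 1 \<Longrightarrow> b y = 0" using m by (auto simp: mollifier_def)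
  have inta: "integrable lborel (\<lambda>y. w (x + \<delta> *\<^sub>R y) *\<^sub>R a y)"
    by (rule integrable_compact_support[of _ 0 1])
       (auto intro!: continuous_intros mollifier_cont continuous_on_compose2[OF w] simp: supp)
  have intb: "integrable lborel (\<lambda>y. w (x + \<delta> *\<^sub>R y) *\<^sub>R b y)"
    by (rule integrable_compact_support[of _ 0 1])
       (auto intro!: continuous_intros mollifier_cont continuous_on_compose2[OF w] simp: supp)
  have "linear (\<lambda>M. trace (B ** M))"
    using trace_add_scaleR[of B _ 1] by (intro linearI) (simp_all add: trace_mult_scaleR)
  then have bl: "bounded_linear (\<lambda>M. trace (B ** M))" by (simp add: linear_conv_bounded_linear)
  have "lin_op B v (mollify \<rho> \<delta> w) x
     = trace (B ** ((1 / \<delta>\<^sup>2) *\<^sub>R (\<integral>y. w (x + \<delta> *\<^sub>R y) *\<^sub>R b y \<partial>lborel)))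
       - v \<bullet> ((- 1 / \<delta>) *\<^sub>R (\<integral>y. w (x + \<delta> *\<^sub>R y) *\<^sub>R a y \<partial>lborel))"
    by (rule lin_op_jet[OF mollify_has_jet[OF w]])
  also have "\<dots> = (\<integral>y. trace (B ** (w (x + \<delta> *\<^sub>R y) *\<^sub>R b y)) \<partial>lborel) / \<delta>\<^sup>2
       + (\<integral>y. v \<bullet> (w (x + \<delta> *\<^sub>R y) *\<^sub>R a y) \<partial>lborel) / \<delta>"
    unfolding trace_mult_scaleR[of B "1 / \<delta>\<^sup>2"]
    using integral_bounded_linear[OF bl intb] integral_bounded_linear[OF bounded_linear_inner_right inta, of v] by simp
  also have "\<dots> = (\<integral>y. trace (B ** (w (x + \<delta> *\<^sub>R y) *\<^sub>R b y)) / \<delta>\<^sup>2 + v \<bullet> (w (x + \<delta> *\<^sub>R y) *\<^sub>R a y) / \<delta> \<partial>lborel)"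
    using integrable_bounded_linear[OF bl intb] integrable_bounded_linear[OF bounded_linear_inner_right inta, of v]
    by (subst Bochner_Integration.integral_add) auto
  also have "\<dots> = (\<integral>y. (trace (B ** b y) / \<delta>\<^sup>2 + (v \<bullet> a y) / \<delta>) * w (x + \<delta> *\<^sub>R y) \<partial>lborel)"
    by (simp add: trace_mult_scaleR algebra_simps)
  finally show ?thesis .
qed

text \<open>For fixed \<open>\<delta>\<close> the derivatives fall on the kernel, so the operator
  applied to a mollification is continuous in the sup norm. C depends on \<open>\<delta>\<close>, B
  and v; the accuracy e can be chosen after it.\<close>

lemma lin_op_mollify_bound:
  obtains C where "C \<ge> 0" "\<And>f g e x. continuous_on UNIV f \<Longrightarrow> continuous_on UNIV g \<Longrightarrow>
    (\<And>y. norm (y - x) \<le> \<delta> \<Longrightarrow> \<bar>f y - g y\<bar> \<le> e) \<Longrightarrow>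
    \<bar>lin_op B v (mollify \<rho> \<delta> f) x - lin_op B v (mollify \<rho> \<delta> g) x\<bar> \<le> C * e"
proof -
  define l where "l y = trace (B ** b y) / \<delta>\<^sup>2 + (v \<bullet> a y) / \<delta>" for y
  have "linear (\<lambda>M. trace (B ** M))"
    using trace_add_scaleR[of B _ 1] by (intro linearI) (simp_all add: trace_mult_scaleR)
  then have bl: "bounded_linear (\<lambda>M. trace (B ** M))" by (simp add: linear_conv_bounded_linear)
  have cl: "continuous_on UNIV l"
    unfolding l_def using \<delta> by (intro continuous_intros bounded_linear.continuous_on[OF bl] mollifier_cont) auto
  have sl: "l y = 0" if "y \<notin> cball 0 1" for y
    using m that trace_mult_scaleR[of B 0 0] by (simp add: mollifier_def l_def)
  have il: "integrable lborel (\<lambda>y. \<bar>l y\<bar>)"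
    by (rule integrable_compact_support[of _ 0 1]) (auto intro!: continuous_intros cl simp: sl)
  define C where "C = (\<integral>y. \<bar>l y\<bar> \<partial>lborel)"
  have "C \<ge> 0" by (simp add: C_def)
  moreover have "\<bar>lin_op B v (mollify \<rho> \<delta> f) x - lin_op B v (mollify \<rho> \<delta> g) x\<bar> \<le> C * e"
    if f: "continuous_on UNIV f" and g: "continuous_on UNIV g" and fg: "\<And>y. norm (y - x) \<le> \<delta> \<Longrightarrow> \<bar>f y - g y\<bar> \<le> e" for f g e x
  proof -
    have i: "integrable lborel (\<lambda>y. l y * f (x + \<delta> *\<^sub>R y))" "integrable lborel (\<lambda>y. l y * g (x + \<delta> *\<^sub>R y))"
      using mollify_integrable[OF f cl sl] mollify_integrable[OF g cl sl] by auto
    have "lin_op B v (mollify \<rho> \<delta> f) x - lin_op B v (mollify \<rho> \<delta> g) x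
      = (\<integral>y. l y * f (x + \<delta> *\<^sub>R y) - l y * g (x + \<delta> *\<^sub>R y) \<partial>lborel)"
      unfolding lin_op_mollify[OF f] lin_op_mollify[OF g] l_def[symmetric] using i by simp
    also have "\<bar>\<dots>\<bar> \<le> (\<integral>y. \<bar>l y * f (x + \<delta> *\<^sub>R y) - l y * g (x + \<delta> *\<^sub>R y)\<bar> \<partial>lborel)"
      by (rule integral_abs_bound)
    also have "\<dots> \<le> (\<integral>y. \<bar>l y\<bar> * e \<partial>lborel)"
    proof (rule integral_mono)
      fix y
      show "\<bar>l y * f (x + \<delta> *\<^sub>R y) - l y * g (x + \<delta> *\<^sub>R y)\<bar> \<le> \<bar>l y\<bar> * e"
      proof (cases "y \<in> cball 0 1")
        case True
        then have "norm (x + \<delta> *\<^sub>R y - x) \<le> \<delta>" using \<delta> by (simp add: mult_left_le)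
        from fg[OF this] show ?thesis by (simp add: right_diff_distrib[symmetric] abs_mult mult_left_mono)
      qed (simp add: sl)
    qed (use i il in auto)
    also have "\<dots> = C * e" by (simp add: C_def)
    finally show ?thesis .
  qed
  ultimately show ?thesis using that by blast
qed

text \<open>Mollification multiplies the wave of frequency k by a Fourier coefficient of the kernel,
  here the pair P, Q acting on the plane of cosine and sine. The operator acts on the same plane in
  the same form, hence the two commute.\<close>

lemma trig_poly_mollify:
  assumes "trig_poly f"
  shows "trig_poly (mollify \<rho> \<delta> f)" "lin_op B v (mollify \<rho> \<delta> f) x = mollify \<rho> \<delta> (lin_op B v f) x"
proof -
  have "trig_poly (mollify \<rho> \<delta> f) \<and> (\<forall>x. lin_op B v (mollify \<rho> \<delta> f) x = mollify \<rho> \<delta> (lin_op B v f) x)"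
    using assms
  proof induction
    case (cos k c)
    define P where "P = (\<integral>y. \<rho> y * cos (2 * pi * (k \<bullet> (0 + \<delta> *\<^sub>R y))) \<partial>lborel)"
    define Q where "Q = (\<integral>y. \<rho> y * sin (2 * pi * (k \<bullet> (0 + \<delta> *\<^sub>R y))) \<partial>lborel)"
    let ?c = "\<lambda>x. cos (2 * pi * (k \<bullet> x) + c)" and ?s = "\<lambda>x. sin (2 * pi * (k \<bullet> x) + c)"
    have tc: "trig_poly ?c" and ts: "trig_poly ?s" using cos by (auto intro: trig_poly.cos trig_poly_sin)
    have ip: "integrable lborel (\<lambda>y. \<rho> y * cos (2 * pi * (k \<bullet> (0 + \<delta> *\<^sub>R y))))"
      "integrable lborel (\<lambda>y. \<rho> y * sin (2 * pi * (k \<bullet> (0 + \<delta> *\<^sub>R y))))"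
      by (intro mollify_integrable_\<rho> continuous_intros)+
    have mc: "mollify \<rho> \<delta> ?c x = P * ?c x + (- Q) * ?s x" for x
    proof -
      have "mollify \<rho> \<delta> ?c x = (\<integral>y. ?c x * (\<rho> y * cos (2 * pi * (k \<bullet> (0 + \<delta> *\<^sub>R y))))
          - ?s x * (\<rho> y * sin (2 * pi * (k \<bullet> (0 + \<delta> *\<^sub>R y)))) \<partial>lborel)"
        unfolding mollify_def
      proof (rule Bochner_Integration.integral_cong[OF refl])
        fix y
        have "2 * pi * (k \<bullet> (x + \<delta> *\<^sub>R y)) + c = (2 * pi * (k \<bullet> x) + c) + 2 * pi * (k \<bullet> (0 + \<delta> *\<^sub>R y))"
          by (simp add: inner_add_right algebra_simps)
        then show "\<rho> y * cos (2 * pi * (k \<bullet> (x + \<delta> *\<^sub>R y)) + c) = ?c x * (\<rho> y * cos (2 * pi * (k \<bullet> (0 + \<delta> *\<^sub>R y))))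
          - ?s x * (\<rho> y * sin (2 * pi * (k \<bullet> (0 + \<delta> *\<^sub>R y))))"
          by (simp only: cos_add) (simp add: algebra_simps)
      qed
      also have "\<dots> = P * ?c x + (- Q) * ?s x"
        using ip by (simp add: P_def Q_def mult.commute)
      finally show ?thesis .
    qed
    have ms: "mollify \<rho> \<delta> ?s x = P * ?s x + Q * ?c x" for x
    proof -
      have "mollify \<rho> \<delta> ?s x = (\<integral>y. ?s x * (\<rho> y * cos (2 * pi * (k \<bullet> (0 + \<delta> *\<^sub>R y))))
          + ?c x * (\<rho> y * sin (2 * pi * (k \<bullet> (0 + \<delta> *\<^sub>R y)))) \<partial>lborel)"
        unfolding mollify_def
      proof (rule Bochner_Integration.integral_cong[OF refl])
        fix y
        have "2 * pi * (k \<bullet> (x + \<delta> *\<^sub>R y)) + c = (2 * pi * (k \<bullet> x) + c) + 2 * pi * (k \<bullet> (0 + \<delta> *\<^sub>R y))"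
          by (simp add: inner_add_right algebra_simps)
        then show "\<rho> y * sin (2 * pi * (k \<bullet> (x + \<delta> *\<^sub>R y)) + c) = ?s x * (\<rho> y * cos (2 * pi * (k \<bullet> (0 + \<delta> *\<^sub>R y))))
          + ?c x * (\<rho> y * sin (2 * pi * (k \<bullet> (0 + \<delta> *\<^sub>R y))))"
          by (simp only: sin_add) (simp add: algebra_simps)
      qed
      also have "\<dots> = P * ?s x + Q * ?c x"
        using ip by (simp add: P_def Q_def mult.commute)
      finally show ?thesis .
    qed
    have "mollify \<rho> \<delta> ?c = (\<lambda>x. P * ?c x + (- Q) * ?s x)" using mc by (rule ext)
    moreover have "trig_poly (\<lambda>x. P * ?c x + (- Q) * ?s x)" by (intro trig_poly.add trig_poly.scale tc ts)
    moreover have "lin_op B v (\<lambda>x. P * ?c x + (- Q) * ?s x) x = mollify \<rho> \<delta> (lin_op B v ?c) x" for x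
    proof -
      have "lin_op B v (\<lambda>x. P * ?c x + (- Q) * ?s x) x = P * lin_op B v ?c x + (- Q) * lin_op B v ?s x"
        by (subst lin_op_add[OF has_jet_scaleR[OF trig_poly_C2[OF tc]] has_jet_scaleR[OF trig_poly_C2[OF ts]]])
           (simp only: lin_op_scale[OF trig_poly_C2[OF tc]] lin_op_scale[OF trig_poly_C2[OF ts]])
      also have "\<dots> = (- (4 * pi\<^sup>2 * (k \<bullet> (B *v k)))) * mollify \<rho> \<delta> ?c x + (2 * pi * (v \<bullet> k)) * mollify \<rho> \<delta> ?s x"
        unfolding lin_op_cos lin_op_sin mc ms by (simp add: algebra_simps)
      also have "\<dots> = mollify \<rho> \<delta> (\<lambda>x. (- (4 * pi\<^sup>2 * (k \<bullet> (B *v k)))) * ?c x + (2 * pi * (v \<bullet> k)) * ?s x) x"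
        by (subst mollify_add) (intro continuous_intros | simp only: mollify_scale)+
      finally show ?thesis by (simp only: lin_op_cos[abs_def])
    qed
    ultimately show ?case by simp
  next
    case (add f g)
    have cf: "continuous_on UNIV f" "continuous_on UNIV g" using add trig_poly_continuous by auto
    have cL: "continuous_on UNIV (lin_op B v f)" "continuous_on UNIV (lin_op B v g)"
      using add trig_poly_continuous trig_poly_lin_op by blast+
    have e: "mollify \<rho> \<delta> (\<lambda>x. f x + g x) = (\<lambda>x. mollify \<rho> \<delta> f x + mollify \<rho> \<delta> g x)"
      using mollify_add[OF cf] by (rule ext)
    have "lin_op B v (\<lambda>x. f x + g x) = (\<lambda>x. lin_op B v f x + lin_op B v g x)"
      by (rule ext) (rule lin_op_add[OF trig_poly_C2[OF add.hyps(1)] trig_poly_C2[OF add.hyps(2)]])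
    then have "mollify \<rho> \<delta> (lin_op B v (\<lambda>x. f x + g x)) x = mollify \<rho> \<delta> (lin_op B v f) x + mollify \<rho> \<delta> (lin_op B v g) x" for x
      by (simp add: mollify_add[OF cL])
    moreover have "lin_op B v (\<lambda>x. mollify \<rho> \<delta> f x + mollify \<rho> \<delta> g x) x = mollify \<rho> \<delta> (lin_op B v f) x + mollify \<rho> \<delta> (lin_op B v g) x" for x
      using add.IH by (simp add: lin_op_add[OF trig_poly_C2 trig_poly_C2])
    ultimately show ?case unfolding e using add.IH trig_poly.add by auto
  next
    case (scale f c)
    have e: "mollify \<rho> \<delta> (\<lambda>x. c * f x) = (\<lambda>x. c * mollify \<rho> \<delta> f x)"
      using mollify_scale by (rule ext)
    have "lin_op B v (\<lambda>x. c * f x) = (\<lambda>x. c * lin_op B v f x)"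
      by (rule ext) (rule lin_op_scale[OF trig_poly_C2[OF scale.hyps(1)]])
    then have "mollify \<rho> \<delta> (lin_op B v (\<lambda>x. c * f x)) x = c * mollify \<rho> \<delta> (lin_op B v f) x" for x
      by (simp add: mollify_scale)
    moreover have "lin_op B v (\<lambda>x. c * mollify \<rho> \<delta> f x) x = c * mollify \<rho> \<delta> (lin_op B v f) x" for x
      using scale.IH lin_op_scale[OF trig_poly_C2] by metis
    ultimately show ?case unfolding e using scale.IH trig_poly.scale by auto
  qed
  then show "trig_poly (mollify \<rho> \<delta> f)" "lin_op B v (mollify \<rho> \<delta> f) x = mollify \<rho> \<delta> (lin_op B v f) x" by auto
qed

text \<open>
  The subsolution \<open>w\<close> is compared with solutions of the resolvent equation \<open>z - \<mu>(Lz + f) = w\<close>, which is solved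
  explicitly for trigonometric polynomials; then \<open>\<mu> \<rightarrow> 0\<close>.
\<close>

lemma mollify_linear_subsolution:
  assumes w: "C0_torus w" and f: "C0_torus f"
    and B: "transpose B = B" "\<And>y. 0 \<le> y \<bullet> (B *v y)"
    and visc: "\<And>\<phi> x. trig_poly \<phi> \<Longrightarrow> (\<And>z. w z - \<phi> z \<le> w x - \<phi> x) \<Longrightarrow>
      v \<bullet> grad \<phi> x - trace (B ** hess \<phi> x) \<le> f x"
  shows "- lin_op B v (mollify \<rho> \<delta> w) x0 \<le> mollify \<rho> \<delta> f x0"
proof (rule ccontr)
  assume neg: "\<not> ?thesis"
  have cw: "continuous_on UNIV w" "torus_fun w" and cf: "continuous_on UNIV f" "torus_fun f"
    using w f by (auto simp: C0_torus_def)
  \<comment> \<open>The claim says h >= 0 at x0; it is assumed that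
    \<open>h x0 = - 3 * \<eta>\<close> is negative.\<close>
  define h where "h x = lin_op B v (mollify \<rho> \<delta> w) x + mollify \<rho> \<delta> f x" for x
  define \<eta> where "\<eta> = - h x0 / 3"
  have \<eta>: "\<eta> > 0" using neg by (simp add: \<eta>_def h_def)
  obtain gw hw where jetw: "has_jet (mollify \<rho> \<delta> w) gw hw" using mollify_has_jet[OF cw(1)] by blast
  have "linear (\<lambda>M. trace (B ** M))"
    using trace_add_scaleR[of B _ 1] by (intro linearI) (simp_all add: trace_mult_scaleR)
  then have bl: "bounded_linear (\<lambda>M. trace (B ** M))" by (simp add: linear_conv_bounded_linear)
  have ch: "continuous_on UNIV h"
    unfolding h_def lin_op_jet[OF jetw]
    using has_jet_continuous[OF jetw] mollify_continuous[OF cf(1)]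
    by (intro continuous_intros bounded_linear.continuous_on[OF bl])
  have ph: "torus_fun h"
    using has_jet_periodic[OF jetw mollify_torus_fun[OF cw(2)]] mollify_torus_fun[OF cf(2)]
    unfolding h_def[abs_def] lin_op_jet[OF jetw] torus_fun_def by simp
  \<comment> \<open>A nonnegative trigonometric polynomial that vanishes exactly on the lattice
    translates of x0.\<close>
  define S where "S x = (\<Sum>i\<in>UNIV. 1 - cos (2 * pi * (axis i 1 \<bullet> x) + - (2 * pi * x0 $ i)))" for x :: "real ^ 'n"
  have tS: "trig_poly S"
  proof -
    have "trig_poly (\<lambda>x. 1 - cos (2 * pi * (axis i 1 \<bullet> x) + - (2 * pi * x0 $ i)))" for i
      by (intro trig_poly_diff trig_poly_const trig_poly.cos) (simp add: axis_def)
    then show ?thesis unfolding S_def[abs_def] by (rule trig_poly_sum[OF finite])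
  qed
  have S0: "S x0 = 0" by (simp add: S_def inner_axis')
  have Spos: "S x > 0 \<or> h x = h x0" for x
  proof (cases "S x = 0")
    case True
    have "1 - cos (2 * pi * (axis i 1 \<bullet> x) + - (2 * pi * x0 $ i)) = 0" for i
      using True unfolding S_def by (subst (asm) sum_nonneg_eq_0_iff) auto
    then have "cos (2 * pi * (x $ i - x0 $ i)) = 1" for i
      by (simp add: inner_axis' right_diff_distrib)
    then have "\<exists>n::int. 2 * pi * (x $ i - x0 $ i) = of_int n * (2 * pi)" for i
      by (subst (asm) cos_one_2pi_int) (metis mult.commute mult.left_commute)
    then have "(x - x0) $ i \<in> \<int>" for i
    proof -
      obtain n :: int where "2 * pi * (x $ i - x0 $ i) = of_int n * (2 * pi)"
        using \<open>\<And>i. \<exists>n::int. 2 * pi * (x $ i - x0 $ i) = of_int n * (2 * pi)\<close>[of i] by blast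
      then have "x $ i - x0 $ i = of_int n" by simp
      then show ?thesis by simp
    qed
    then have "h (x0 + (x - x0)) = h x0" by (rule torus_funD[OF ph])
    then show ?thesis by simp
  next
    case False
    moreover have "S x \<ge> 0" unfolding S_def by (intro sum_nonneg) simp
    ultimately show ?thesis by simp
  qed
  obtain M where M: "M > 0" "\<And>x. norm (h x) \<le> M" using torus_bounded[OF ph ch] by blast
  \<comment> \<open>The set where h >= -2 \<open>\<eta>\<close> is closed and avoids the zeros of S,
    so S is bounded below on it, and a large multiple of S lifts the bound over h there. This gives
    a trigonometric majorant of h that is still negative at x0.\<close>
  have "\<exists>C'\<ge>0. \<forall>x. h x \<le> - 2 * \<eta> + C' * S x"
  proof -
    define Z where "Z = cbox 0 1 \<inter> h -` {- 2 * \<eta>..}"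
    have "compact Z" unfolding Z_def by (intro compact_Int_closed compact_cbox closed_vimage ch closed_atLeast)
    have Zc: "frac_vec x \<in> Z" if "h x \<ge> - 2 * \<eta>" for x
      using that torus_fun_frac_vec[OF ph, of x] frac_vec_in_unit_cell[of x] unit_cell_subset_cbox by (auto simp: Z_def)
    have Sn: "S x \<ge> 0" for x unfolding S_def by (intro sum_nonneg) simp
    show ?thesis
    proof (cases "Z = {}")
      case True
      then have "h x \<le> - 2 * \<eta>" for x using Zc[of x] by force
      then show ?thesis by (intro exI[of _ 0]) simp
    next
      case False
      then obtain z where z: "z \<in> Z" "\<And>y. y \<in> Z \<Longrightarrow> S z \<le> S y"
        using continuous_attains_inf[OF \<open>compact Z\<close> False continuous_on_subset[OF trig_poly_continuous[OF tS]]] by blast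
      have "S z > 0" using Spos[of z] z(1) \<eta> by (auto simp: Z_def \<eta>_def)
      define C' where "C' = (M + 2 * \<eta>) / S z"
      have C': "C' \<ge> 0" using M \<eta> \<open>S z > 0\<close> by (simp add: C'_def)
      have "h x \<le> - 2 * \<eta> + C' * S x" for x
      proof (cases "h x \<ge> - 2 * \<eta>")
        case True
        have "S z \<le> S x" using z(2)[OF Zc[OF True]] torus_fun_frac_vec[OF trig_poly_torus_fun[OF tS], of x] by simp
        then have "C' * S z \<le> C' * S x" using C' by (rule mult_left_mono)
        moreover have "C' * S z = M + 2 * \<eta>" using \<open>S z > 0\<close> by (simp add: C'_def)
        ultimately show ?thesis using M(2)[of x] by (simp add: abs_le_iff)
      next
        case False
        have "0 \<le> C' * S x" using C' Sn[of x] by simp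
        then show ?thesis using False by simp
      qed
      then show ?thesis using C' by blast
    qed
  qed
  then obtain C' where C': "C' \<ge> 0" "\<And>x. h x \<le> - 2 * \<eta> + C' * S x" by blast
  define s where "s x = - \<eta> + C' * S x" for x
  have ts: "trig_poly s" unfolding s_def by (intro trig_poly.add trig_poly_const trig_poly.scale tS)
  have tLs: "trig_poly (lin_op B v s)" by (rule trig_poly_lin_op[OF ts])
  obtain Cs where Cs: "Cs > 0" "\<And>x. norm (lin_op B v s x) \<le> Cs"
    using torus_bounded[OF trig_poly_torus_fun[OF tLs] trig_poly_continuous[OF tLs]] by blast
  obtain Cl where Cl: "Cl \<ge> 0" "\<And>f g e x. continuous_on UNIV f \<Longrightarrow> continuous_on UNIV g \<Longrightarrow>
    (\<And>y. norm (y - x) \<le> \<delta> \<Longrightarrow> \<bar>f y - g y\<bar> \<le> e) \<Longrightarrow>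
    \<bar>lin_op B v (mollify \<rho> \<delta> f) x - lin_op B v (mollify \<rho> \<delta> g) x\<bar> \<le> Cl * e"
    using lin_op_mollify_bound[of B v] by metis
  \<comment> \<open>With this \<open>\<mu>\<close> the error \<open>\<mu>\<^sup>2 * Cs\<close> is
    half of the gain \<open>\<mu> * \<eta>\<close>; e is then taken small against both
    \<open>\<eta>\<close> and \<open>\<mu> * \<eta>\<close>.\<close>
  define \<mu> where "\<mu> = \<eta> / (2 * Cs)"
  have \<mu>: "\<mu> > 0" using \<eta> Cs by (simp add: \<mu>_def)
  define e where "e = min (\<eta> / (Cl + 1)) (\<mu> * \<eta> / 4)"
  have e: "e > 0" "(Cl + 1) * e \<le> \<eta>" "e < \<mu> * \<eta> / 2"
  proof -
    show "e > 0" using \<eta> Cl \<mu> by (simp add: e_def)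
    have "(Cl + 1) * e \<le> (Cl + 1) * (\<eta> / (Cl + 1))" using Cl by (intro mult_left_mono) (auto simp: e_def)
    then show "(Cl + 1) * e \<le> \<eta>" using Cl by simp
    have "e \<le> \<mu> * \<eta> / 4" unfolding e_def by (rule min.cobounded2)
    moreover have "0 < \<mu> * \<eta>" using \<mu> \<eta> by simp
    ultimately show "e < \<mu> * \<eta> / 2" by linarith
  qed
  have approx: "\<exists>g. trig_poly g \<and> (\<forall>x. u x \<le> g x \<and> g x \<le> u x + e)" if u: "torus_fun u" "continuous_on UNIV u" for u :: "real ^ 'n \<Rightarrow> real"
  proof -
    have "e / 2 > 0" using e by simp
    then obtain g where g: "trig_poly g" "\<And>x. \<bar>u x - g x\<bar> < e / 2" using trig_poly_dense[OF u] by blast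
    have "u x \<le> g x + e / 2 \<and> g x + e / 2 \<le> u x + e" for x using g(2)[of x] unfolding abs_less_iff by linarith
    then show ?thesis using trig_poly.add[OF g(1) trig_poly_const] by blast
  qed
  obtain w' where w': "trig_poly w'" "\<And>x. w x \<le> w' x" "\<And>x. w' x \<le> w x + e" using approx[OF cw(2,1)] by blast
  obtain f' where f': "trig_poly f'" "\<And>x. f x \<le> f' x" "\<And>x. f' x \<le> f x + e" using approx[OF cf(2,1)] by blast
  have cw': "continuous_on UNIV w'" and cf': "continuous_on UNIV f'" using w' f' trig_poly_continuous by auto
  obtain z where z: "trig_poly z" "\<And>x. z x - \<mu> * lin_op B v z x = w' x + \<mu> * f' x"
    using trig_poly_resolvent[OF trig_poly.add[OF w'(1) trig_poly.scale[OF f'(1)]] B(2)] \<mu> by (metis less_imp_le)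
  have cz: "continuous_on UNIV z" by (rule trig_poly_continuous[OF z(1)])
  \<comment> \<open>Comparison: at a maximum of w - z the resolvent z is itself a test function, so
    L z + f >= 0 there, and the resolvent equation gives z >= w' >= w at that point.\<close>
  have wz: "w x \<le> z x" for x
  proof -
    have "torus_fun (\<lambda>x. w x - z x)" "continuous_on UNIV (\<lambda>x. w x - z x)"
      using cw trig_poly_torus_fun[OF z(1)] cz by (auto intro: torus_fun_compose2 continuous_intros)
    then obtain x1 where x1: "\<And>x. w x - z x \<le> w x1 - z x1" using torus_attains_sup by blast
    have "- lin_op B v z x1 \<le> f x1" using visc[OF z(1) x1] by (simp add: lin_op_def)
    then have "\<mu> * (lin_op B v z x1 + f' x1) \<ge> 0" using f'(2)[of x1] \<mu> by simp
    then have "w' x1 \<le> z x1" using z(2)[of x1] by (simp add: algebra_simps)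
    then show ?thesis using x1[of x] w'(2)[of x1] by simp
  qed
  \<comment> \<open>By \<open>wz\<close> q is nonnegative up to e, yet it solves the resolvent
    equation with right-hand side \<open>\<mu> * h'\<close>, which is negative at x0. The maximum
    principle applied to \<open>q - \<mu> * s\<close> produces the contradiction.\<close>
  define q where "q x = mollify \<rho> \<delta> z x - mollify \<rho> \<delta> w' x" for x
  define h' where "h' x = lin_op B v (mollify \<rho> \<delta> w') x + mollify \<rho> \<delta> f' x" for x
  have tq: "trig_poly q" unfolding q_def by (intro trig_poly_diff trig_poly_mollify z w')
  have q_low: "q x \<ge> - e" for x
  proof -
    have "mollify \<rho> \<delta> w' x \<le> mollify \<rho> \<delta> (\<lambda>x. z x + e) x"
      by (intro mollify_mono cw' continuous_intros cz) (use wz w'(3) in \<open>meson add_right_mono order_trans\<close>)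
    then show ?thesis by (simp add: q_def mollify_add[OF cz] mollify_const)
  qed
  have q_eq: "q x - \<mu> * lin_op B v q x = \<mu> * h' x" for x
  proof -
    have L: "lin_op B v q x = mollify \<rho> \<delta> (lin_op B v z) x - lin_op B v (mollify \<rho> \<delta> w') x"
      unfolding q_def
      by (subst lin_op_diff[OF trig_poly_C2 trig_poly_C2]) (simp_all add: trig_poly_mollify z w')
    moreover have "mollify \<rho> \<delta> z x - \<mu> * mollify \<rho> \<delta> (lin_op B v z) x = mollify \<rho> \<delta> w' x + \<mu> * mollify \<rho> \<delta> f' x"
    proof -
      have cL: "continuous_on UNIV (lin_op B v z)" by (intro trig_poly_continuous trig_poly_lin_op z)
      have "mollify \<rho> \<delta> z x - \<mu> * mollify \<rho> \<delta> (lin_op B v z) x = mollify \<rho> \<delta> (\<lambda>x. z x + (- \<mu>) * lin_op B v z x) x"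
        by (subst mollify_add[OF cz]) (intro continuous_intros cL | simp only: mollify_scale)+
      also have "\<dots> = mollify \<rho> \<delta> (\<lambda>x. w' x + \<mu> * f' x) x"
        using z(2) by simp
      also have "\<dots> = mollify \<rho> \<delta> w' x + \<mu> * mollify \<rho> \<delta> f' x"
        by (subst mollify_add[OF cw']) (intro continuous_intros cf' | simp only: mollify_scale)+
      finally show ?thesis .
    qed
    ultimately show ?thesis unfolding L by (simp add: q_def h'_def algebra_simps)
  qed
  have h's: "h' x \<le> s x" for x
  proof -
    have "\<bar>lin_op B v (mollify \<rho> \<delta> w') x - lin_op B v (mollify \<rho> \<delta> w) x\<bar> \<le> Cl * e"
      using w'(2,3) by (intro Cl cw' cw) (simp add: abs_le_iff le_diff_eq diff_le_eq add.commute)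
    moreover have "\<bar>mollify \<rho> \<delta> f' x - mollify \<rho> \<delta> f x\<bar> \<le> e"
      using f'(2,3) by (intro mollify_close cf' cf) (simp add: abs_le_iff le_diff_eq diff_le_eq add.commute)
    ultimately have "h' x \<le> h x + (Cl + 1) * e" by (simp add: h'_def h_def algebra_simps abs_le_iff)
    then show ?thesis using C'(2)[of x] e(2) by (simp add: s_def)
  qed
  define Q where "Q x = q x - \<mu> * s x" for x
  have tQ: "trig_poly Q" unfolding Q_def by (intro trig_poly_diff trig_poly.scale tq ts)
  have LQ: "lin_op B v Q x = lin_op B v q x - \<mu> * lin_op B v s x" for x
    unfolding Q_def lin_op_diff[OF trig_poly_C2[OF tq] trig_poly_C2[OF trig_poly.scale[OF ts]]]
    by (simp only: lin_op_scale[OF trig_poly_C2[OF ts]])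
  obtain xm where xm: "\<And>x. Q x \<le> Q xm"
    using torus_attains_sup[OF trig_poly_torus_fun[OF tQ] trig_poly_continuous[OF tQ]] by blast
  have "lin_op B v Q xm \<le> 0" by (rule lin_op_at_max[OF trig_poly_C2[OF tQ] xm B])
  then have "\<mu> * lin_op B v Q xm \<le> 0" using \<mu> by (simp add: mult_nonneg_nonpos)
  moreover have "Q xm = \<mu> * lin_op B v Q xm + \<mu> * (h' xm - s xm) + \<mu>\<^sup>2 * lin_op B v s xm"
    using q_eq[of xm] by (simp add: Q_def LQ power2_eq_square algebra_simps)
  moreover have "\<mu> * (h' xm - s xm) \<le> 0" using \<mu> h's[of xm] by (simp add: mult_nonneg_nonpos)
  moreover have "\<mu>\<^sup>2 * lin_op B v s xm \<le> \<mu>\<^sup>2 * Cs" using Cs(2)[of xm] by (intro mult_left_mono) auto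
  ultimately have "Q x0 \<le> \<mu>\<^sup>2 * Cs" using xm[of x0] by linarith
  then have "q x0 \<le> - \<mu> * \<eta> + \<mu>\<^sup>2 * Cs" by (simp add: Q_def s_def S0)
  also have "\<mu>\<^sup>2 * Cs = \<mu> * \<eta> / 2" using Cs by (simp add: \<mu>_def power2_eq_square)
  finally show False using q_low[of x0] e(3) by (simp add: mult.commute)
qed

end

section \<open>The Hamiltonian\<close>

locale viscous_hamiltonian =
  fixes H :: "real ^ 'n \<Rightarrow> real ^ 'n \<Rightarrow> real"
    and A :: "real ^ 'n \<Rightarrow> real ^ 'n ^ 'n"
    and \<gamma> :: real
  assumes H_periodic: "torus_fun H"
    and H_C2: "C2 (\<lambda>(x, p). H x p)"
    and H_convex: "strictly_convex_in_p H"
    and H_superlinear: "superlinear_in_p H"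
    and \<gamma>_pos: "\<gamma> > 0"
    and H_growth: "\<And>x p. norm (grad (\<lambda>y. H y p) x) \<le> \<gamma> * (1 + \<bar>H x p\<bar>)"
    and A_C2: "C2_torus A"
    and A_sym: "\<And>x. transpose (A x) = A x"
    and A_psd: "\<And>x \<xi>. 0 \<le> \<xi> \<bullet> (A x *v \<xi>)"
begin

lemma H_differentiable: "(\<lambda>(x, p). H x p) differentiable (at z)"
  using H_C2 unfolding C2_def differentiable_def by blast

lemma H_continuous: "continuous_on UNIV (\<lambda>(x, p). H x p)"
  by (simp add: H_differentiable differentiable_imp_continuous_on differentiable_on_def)

lemma H_continuous_compose:
  "continuous_on S f \<Longrightarrow> continuous_on S g \<Longrightarrow> continuous_on S (\<lambda>x. H (f x) (g x))"
  using continuous_on_compose2[OF H_continuous, of S "\<lambda>x. (f x, g x)"] by (simp add: continuous_on_Pair)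

lemma H_differentiable_x: "(\<lambda>y. H y p) differentiable (at x)"
proof -
  have "(\<lambda>y. (y, p)) differentiable (at x)"
    by (auto simp: differentiable_def intro!: exI derivative_eq_intros)
  from differentiable_chain_at[OF this H_differentiable] show ?thesis by (simp add: o_def)
qed

lemma H_differentiable_p: "H x differentiable (at p)"
proof -
  have "(\<lambda>p. (x, p)) differentiable (at p)"
    by (auto simp: differentiable_def intro!: exI derivative_eq_intros)
  from differentiable_chain_at[OF this H_differentiable] show ?thesis by (simp add: o_def)
qed

lemma H_shift: "(\<And>i. k $ i \<in> \<int>) \<Longrightarrow> H (x + k) = H x"
  using torus_funD[OF H_periodic] by blast

lemma H_convexD: "0 \<le> t \<Longrightarrow> t \<le> 1 \<Longrightarrow> H x ((1 - t) *\<^sub>R p + t *\<^sub>R q) \<le> (1 - t) * H x p + t * H x q"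
proof -
  assume t: "0 \<le> t" "t \<le> 1"
  show ?thesis
  proof (cases "p = q \<or> t = 0 \<or> t = 1")
    case True
    have "(1 - t) *\<^sub>R p + t *\<^sub>R p = p" by (simp add: scaleR_left_distrib[symmetric])
    then show ?thesis using True by (auto simp: algebra_simps)
  next
    case False
    then have "p \<noteq> q" "0 < t" "t < 1" using t by auto
    then show ?thesis using H_convex unfolding strictly_convex_in_p_def by (meson less_imp_le)
  qed
qed

definition subgradient :: "real ^ 'n \<Rightarrow> real ^ 'n \<Rightarrow> real ^ 'n \<Rightarrow> bool" where
  "subgradient x p v \<longleftrightarrow> (\<forall>q. H x p + v \<bullet> (q - p) \<le> H x q)"

lemma subgradient_exists: obtains v where "subgradient x p v"
proof -
  have "H x p + grad (H x) p \<bullet> (q - p) \<le> H x q" for q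
  proof -
    define d where "d = q - p"
    define f where "f t = H x (p + t *\<^sub>R d)" for t :: real
    have 1: "(H x has_derivative (\<lambda>y. grad (H x) p \<bullet> y)) (at (p + 0 *\<^sub>R d))"
      using grad_has_derivative[OF H_differentiable_p] by simp
    have 2: "((\<lambda>s. p + s *\<^sub>R d) has_derivative (\<lambda>s. s *\<^sub>R d)) (at 0)"
      by (auto intro!: derivative_eq_intros)
    have "(f has_field_derivative grad (H x) p \<bullet> d) (at 0)"
      unfolding f_def has_field_derivative_def
      by (rule has_derivative_eq_rhs[OF has_derivative_compose[OF 2 1]]) (simp add: fun_eq_iff mult.commute)
    then have "((\<lambda>h. (f (0 + h) - f 0) / h) \<longlongrightarrow> grad (H x) p \<bullet> d) (at 0)"
      unfolding DERIV_def .
    then have "((\<lambda>h. (f (0 + h) - f 0) / h) \<longlongrightarrow> grad (H x) p \<bullet> d) (at_right 0)"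
      by (rule tendsto_mono[rotated]) (simp add: at_within_le_at)
    moreover have "\<forall>\<^sub>F h in at_right 0. (f (0 + h) - f 0) / h \<le> H x q - H x p"
    proof -
      have "\<forall>\<^sub>F h in at_right (0::real). h > 0 \<and> h < 1" by (auto simp: eventually_at_right[of 0 1] intro!: exI[of _ 1])
      then show ?thesis
      proof eventually_elim
        case (elim h)
        have "f h \<le> (1 - h) * H x p + h * H x q"
          using H_convexD[of h x p q] elim by (simp add: f_def d_def algebra_simps)
        then show ?case using elim by (simp add: f_def field_simps)
      qed
    qed
    ultimately have "grad (H x) p \<bullet> d \<le> H x q - H x p"
      using tendsto_upperbound trivial_limit_at_right_real by blast
    then show ?thesis by (simp add: d_def)
  qed
  then show ?thesis using that unfolding subgradient_def by blast
qed

lemma H_bounded: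
  obtains M where "M > 0" "\<And>x p. norm p \<le> K \<Longrightarrow> \<bar>H x p\<bar> \<le> M"
proof -
  have "compact ((\<lambda>(x, p). H x p) ` (cbox 0 1 \<times> cball 0 K))"
    by (intro compact_continuous_image compact_Times compact_cbox compact_cball continuous_on_subset[OF H_continuous]) auto
  then obtain M where M: "\<And>y. y \<in> (\<lambda>(x, p). H x p) ` (cbox 0 1 \<times> cball 0 K) \<Longrightarrow> norm y \<le> M"
    using compact_imp_bounded bounded_iff by metis
  have "\<bar>H x p\<bar> \<le> \<bar>M\<bar> + 1" if "norm p \<le> K" for x p
  proof -
    have "H (frac_vec x) p \<in> (\<lambda>(x, p). H x p) ` (cbox 0 1 \<times> cball 0 K)"
      using that frac_vec_in_unit_cell[of x] unit_cell_subset_cbox by force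
    from M[OF this] show ?thesis using torus_fun_frac_vec[OF H_periodic, of x] by simp
  qed
  then show ?thesis using that[of "\<bar>M\<bar> + 1"] by simp
qed

lemma subgradient_bounded:
  obtains R where "R > 0" "\<And>x p v. norm p \<le> K \<Longrightarrow> subgradient x p v \<Longrightarrow> norm v \<le> R"
proof -
  obtain M where M: "M > 0" "\<And>x p. norm p \<le> K + 1 \<Longrightarrow> \<bar>H x p\<bar> \<le> M" using H_bounded by blast
  have "norm v \<le> 2 * M" if p: "norm p \<le> K" and v: "subgradient x p v" for x p v
  proof (cases "v = 0")
    case False
    \<comment> \<open>A unit step from p in the direction of v raises the supporting affine function
      by |v|, while H stays bounded on the slightly larger ball.\<close>
    define q where "q = p + (1 / norm v) *\<^sub>R v"
    have "norm q \<le> K + 1" using norm_triangle_ineq[of p "(1 / norm v) *\<^sub>R v"] p False by (simp add: q_def)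
    have "H x p + v \<bullet> (q - p) \<le> H x q" using v by (simp add: subgradient_def)
    moreover have "v \<bullet> (q - p) = norm v" using False by (simp add: q_def dot_square_norm power2_eq_square)
    ultimately show ?thesis using M(2)[OF \<open>norm q \<le> K + 1\<close>, of x] M(2)[of p x] p by (simp add: abs_le_iff)
  qed (use M in simp)
  then show ?thesis using that[of "2 * M"] M(1) by simp
qed

text \<open>Instead of integrating a differential inequality, take the maximal deviation M along the
  segment: the growth condition gives
  \<open>M \<le> \<gamma> * r * (1 + \<bar>f 0\<bar> + M)\<close>, and the smallness of
  \<open>\<gamma> * r\<close> absorbs M on the left.\<close>

lemma H_oscillation:
  assumes "\<gamma> * norm (x - y) \<le> 1 / 2"
  shows "\<bar>H x p - H y p\<bar> \<le> 2 * \<gamma> * norm (x - y) * (1 + \<bar>H y p\<bar>)"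
proof -
  define r where "r = norm (x - y)"
  define z where "z t = y + t *\<^sub>R (x - y)" for t :: real
  define f where "f t = H (z t) p" for t
  have d: "((\<lambda>s. f s) has_field_derivative grad (\<lambda>y. H y p) (z t) \<bullet> (x - y)) (at t)" for t
  proof -
    have 1: "((\<lambda>y. H y p) has_derivative (\<lambda>h. grad (\<lambda>y. H y p) (z t) \<bullet> h)) (at (y + t *\<^sub>R (x - y)))"
      using grad_has_derivative[OF H_differentiable_x] by (simp add: z_def)
    have 2: "((\<lambda>s. y + s *\<^sub>R (x - y)) has_derivative (\<lambda>s. s *\<^sub>R (x - y))) (at t)"
      by (auto intro!: derivative_eq_intros)
    show ?thesis
      unfolding f_def z_def[abs_def] has_field_derivative_def
      by (rule has_derivative_eq_rhs[OF has_derivative_compose[OF 2 1]]) (simp add: z_def fun_eq_iff mult.commute)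
  qed
  have cf: "continuous_on UNIV f" unfolding f_def z_def by (intro H_continuous_compose continuous_intros)
  obtain t0 where t0: "t0 \<in> {0..1}" "\<And>t. t \<in> {0..1} \<Longrightarrow> \<bar>f t - f 0\<bar> \<le> \<bar>f t0 - f 0\<bar>"
  proof -
    have "continuous_on {0..1} (\<lambda>t. \<bar>f t - f 0\<bar>)" by (intro continuous_intros continuous_on_subset[OF cf]) auto
    then have "\<exists>s\<in>{0..1}. \<forall>t\<in>{0..1}. \<bar>f t - f 0\<bar> \<le> \<bar>f s - f 0\<bar>" by (intro continuous_attains_sup) auto
    then show ?thesis using that by blast
  qed
  define M where "M = \<bar>f t0 - f 0\<bar>"
  have "M \<le> \<gamma> * r * (1 + \<bar>f 0\<bar> + M)"
  proof (cases "t0 = 0")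
    case True
    then show ?thesis using \<gamma>_pos by (simp add: M_def r_def)
  next
    case False
    then have "0 < t0" using t0(1) by simp
    from MVT2[OF this, of f "\<lambda>t. grad (\<lambda>y. H y p) (z t) \<bullet> (x - y)"] d
    obtain t where t: "0 < t" "t < t0" "f t0 - f 0 = (t0 - 0) * (grad (\<lambda>y. H y p) (z t) \<bullet> (x - y))" by blast
    have "M = t0 * \<bar>grad (\<lambda>y. H y p) (z t) \<bullet> (x - y)\<bar>" using \<open>0 < t0\<close> unfolding M_def t(3) by (simp add: abs_mult)
    also have "\<dots> \<le> 1 * (norm (grad (\<lambda>y. H y p) (z t)) * r)"
      using t0(1) \<open>0 < t0\<close> unfolding r_def by (intro mult_mono Cauchy_Schwarz_ineq2) auto
    also have "\<dots> \<le> \<gamma> * (1 + \<bar>f t\<bar>) * r" using H_growth[of p "z t"] by (simp add: f_def r_def mult_right_mono)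
    also have "\<dots> \<le> \<gamma> * (1 + \<bar>f 0\<bar> + M) * r"
    proof -
      have "\<bar>f t\<bar> \<le> \<bar>f 0\<bar> + M" using t0(2)[of t] t t0(1) unfolding M_def by auto
      then show ?thesis using \<gamma>_pos by (intro mult_right_mono mult_left_mono) (auto simp: r_def)
    qed
    finally show ?thesis by (simp add: mult_ac)
  qed
  also have "\<dots> = \<gamma> * r * (1 + \<bar>f 0\<bar>) + \<gamma> * r * M" by (simp add: distrib_left)
  also have "\<gamma> * r * M \<le> 1 / 2 * M" using assms by (intro mult_right_mono) (auto simp: r_def M_def)
  finally have "M \<le> 2 * (\<gamma> * r * (1 + \<bar>f 0\<bar>))" by simp
  moreover have "\<bar>f 1 - f 0\<bar> \<le> M" using t0(2)[of 1] by (simp add: M_def)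
  ultimately show ?thesis by (simp add: f_def z_def r_def mult.assoc)
qed

lemma H_coercive:
  obtains K where "K > 0" "\<And>x p. norm p \<ge> K \<Longrightarrow> H x p \<ge> M * norm p"
proof -
  have "\<forall>\<^sub>F p in at_infinity. \<forall>x. H x p / norm p \<ge> M" using H_superlinear by (simp add: superlinear_in_p_def)
  then obtain b where b: "\<And>p x. norm p \<ge> b \<Longrightarrow> H x p / norm p \<ge> M" unfolding eventually_at_infinity by blast
  have "H x p \<ge> M * norm p" if "norm p \<ge> max b 1" for x p
  proof -
    have "norm p > 0" "norm p \<ge> b" using that by auto
    then show ?thesis using b[of p x] by (simp add: pos_le_divide_eq)
  qed
  then show ?thesis using that[of "max b 1"] by simp
qed

lemma A_periodic: "torus_fun A" and A_continuous: "continuous_on UNIV A"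
proof -
  show "torus_fun A" using A_C2 by (simp add: C2_torus_def)
  obtain A' :: "real ^ 'n \<Rightarrow> (real ^ 'n) \<Rightarrow>\<^sub>L (real ^ 'n ^ 'n)" where "\<And>x. (A has_derivative blinfun_apply (A' x)) (at x)"
    using A_C2 unfolding C2_torus_def C2_def by blast
  then show "continuous_on UNIV A" by (rule has_derivative_continuous_on)
qed

lemma trace_A_bounded:
  obtains T where "T > 0" "\<And>x. 0 \<le> trace (A x)" "\<And>x. trace (A x) \<le> T"
proof -
  have "torus_fun (\<lambda>x. trace (A x))" by (rule torus_fun_compose[OF A_periodic])
  moreover have "continuous_on UNIV (\<lambda>x. trace (A x))"
    unfolding trace_def by (intro continuous_intros A_continuous)
  ultimately obtain T where T: "T > 0" "\<And>x. norm (trace (A x)) \<le> T" using torus_bounded by blast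
  have "0 \<le> trace (A x)" for x
    using psd_trace_nonneg[OF A_sym A_psd, of "mat 1" x] by simp
  then show ?thesis using that T by (simp add: abs_le_iff)
qed

lemma A_sqrt_lipschitz:
  obtains C where "C > 0"
    "\<And>x z y. \<bar>sqrt (y \<bullet> (A x *v y)) - sqrt (y \<bullet> (A z *v y))\<bar> \<le> C * norm (x - z) * norm y"
  using C2_torus_psd_sqrt_lipschitz[OF A_C2 A_psd] by blast

end

text \<open>Young's inequality for square roots. A multiplicative loss \<open>\<theta>\<close> is
  traded for an additive error quadratic in the distance; a plain Lipschitz bound on A would leave a
  linear one, too large against a Hessian of order 1/\<open>\<delta>\<close>.\<close>

lemma quadratic_form_compare:
  fixes P Q :: "real ^ 'n ^ 'n"
  assumes "\<bar>sqrt (y \<bullet> (P *v y)) - sqrt (y \<bullet> (Q *v y))\<bar> \<le> d * norm y"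
    and "0 \<le> y \<bullet> (P *v y)" "0 \<le> y \<bullet> (Q *v y)" "\<theta> > 0" "d \<ge> 0"
  shows "y \<bullet> (P *v y) \<le> (1 + \<theta>) * (y \<bullet> (Q *v y)) + (1 + 1 / \<theta>) * d\<^sup>2 * (norm y)\<^sup>2"
proof -
  define q where "q = sqrt (y \<bullet> (Q *v y))"
  define e where "e = d * norm y"
  have "y \<bullet> (P *v y) = (sqrt (y \<bullet> (P *v y)))\<^sup>2" using assms(2) by simp
  also have "\<dots> \<le> (q + e)\<^sup>2"
    by (rule power_mono) (use assms in \<open>auto simp: q_def e_def abs_le_iff\<close>)
  also have "\<dots> \<le> (1 + \<theta>) * q\<^sup>2 + (1 + 1 / \<theta>) * e\<^sup>2"
  proof -
    have "0 \<le> (\<theta> * q - e)\<^sup>2 / \<theta>" using assms(4) by simp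
    also have "\<dots> = \<theta> * q\<^sup>2 - 2 * q * e + e\<^sup>2 / \<theta>"
      using assms(4) by (simp add: power2_eq_square field_simps)
    finally show ?thesis by (simp add: power2_sum algebra_simps)
  qed
  finally show ?thesis using assms(3) by (simp add: q_def e_def power_mult_distrib mult_ac)
qed

lemma superjet_lipschitz:
  assumes jet: "superjet w x p X" and lip: "\<And>x z. \<bar>w x - w z\<bar> \<le> K * norm (x - z)"
  shows "norm p \<le> K"
proof (cases "p = 0")
  case True
  \<comment> \<open>\<open>axis undefined 1\<close> stands for an arbitrary unit vector; the two
    points show K >= 0.\<close>
  have "0 \<le> K * norm (x + axis undefined 1 - x)" using lip[of "x + axis undefined 1" x] by linarith
  then show ?thesis using True by simp
next
  case False
  have ev: "\<forall>\<^sub>F z in nhds x. w z \<le> w x + p \<bullet> (z - x) + (z - x) \<bullet> (X *v (z - x)) / 2 + 1 * (norm (z - x))\<^sup>2"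
    using jet unfolding superjet_def by (meson zero_less_one)
  define C where "C = \<bar>p \<bullet> (X *v p)\<bar> + (norm p)\<^sup>2"
  have "(norm p)\<^sup>2 \<le> K * norm p"
  proof (rule le_of_le_add_small)
    fix e :: real assume e: "e > 0"
    have "\<forall>\<^sub>F t in at_right (0::real). t > 0 \<and> t < e" using e by (auto simp: eventually_at_right[of 0 e] intro!: exI[of _ e])
    with eventually_nhds_scaleR[OF ev, of "- p"]
    have "\<forall>\<^sub>F t in at_right (0::real). (norm p)\<^sup>2 \<le> K * norm p + e * C"
    proof eventually_elim
      case (elim t)
      have "w x - w (x + t *\<^sub>R - p) \<le> K * (t * norm p)"
        using lip[of x "x + t *\<^sub>R - p"] elim(2) by simp
      moreover have "(t *\<^sub>R - p) \<bullet> (X *v (t *\<^sub>R - p)) = t\<^sup>2 * (p \<bullet> (X *v p))"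
        by (simp add: matrix_vector_mult_scaleR vec.neg power2_eq_square)
      moreover have "p \<bullet> (t *\<^sub>R - p) = - t * (norm p)\<^sup>2" by (simp add: dot_square_norm)
      moreover have "(norm (t *\<^sub>R - p))\<^sup>2 = t\<^sup>2 * (norm p)\<^sup>2" by (simp add: power_mult_distrib)
      ultimately have "t * (norm p)\<^sup>2 \<le> K * (t * norm p) + t\<^sup>2 * (p \<bullet> (X *v p)) / 2 + t\<^sup>2 * (norm p)\<^sup>2"
        using elim(1) unfolding add_diff_cancel_left' by linarith
      also have "\<dots> \<le> K * (t * norm p) + t\<^sup>2 * C"
      proof -
        have "p \<bullet> (X *v p) / 2 \<le> \<bar>p \<bullet> (X *v p)\<bar>" by simp
        then have "t\<^sup>2 * (p \<bullet> (X *v p) / 2) \<le> t\<^sup>2 * \<bar>p \<bullet> (X *v p)\<bar>" by (intro mult_left_mono) auto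
        then show ?thesis by (simp add: C_def distrib_left)
      qed
      finally have "t * (norm p)\<^sup>2 \<le> t * (K * norm p + t * C)" by (simp add: power2_eq_square algebra_simps)
      then have "(norm p)\<^sup>2 \<le> K * norm p + t * C" using elim(2) by simp
      also have "t * C \<le> e * C" using elim(2) by (intro mult_right_mono) (auto simp: C_def)
      finally show ?case by simp
    qed
    then show "(norm p)\<^sup>2 \<le> K * norm p + e * C"
      using eventually_happens'[OF trivial_limit_at_right_real] by blast
  qed
  then show ?thesis using False by (simp add: power2_eq_square)
qed

lemma trig_poly_hess_symmetric:
  assumes "trig_poly f"
  shows "transpose (hess f x) = hess f x"
  using assms
proof induction
  case (cos k a)
  show ?case unfolding has_jet_hess[OF has_jet_cos] by (simp add: transpose_def vec_eq_iff mult_ac)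
next
  case (add f g)
  have "hess (\<lambda>x. f x + g x) x = hess f x + hess g x"
    using has_jet_hess[OF has_jet_add[OF trig_poly_C2[OF add.hyps(1)] trig_poly_C2[OF add.hyps(2)]]] by metis
  then show ?case using add.IH by (simp add: transpose_def vec_eq_iff)
next
  case (scale f c)
  have "hess (\<lambda>x. c * f x) x = c *\<^sub>R hess f x"
    using has_jet_hess[OF has_jet_scaleR[OF trig_poly_C2[OF scale.hyps(1)]]] by metis
  then show ?case using scale.IH by (simp add: transpose_def vec_eq_iff)
qed

lemma superjet_of_test_function:
  assumes "trig_poly \<phi>" "\<And>z. w z - \<phi> z \<le> w x - \<phi> x"
  shows "superjet w x (grad \<phi> x) (hess \<phi> x)"
  unfolding superjet_def
proof (intro conjI allI impI trig_poly_hess_symmetric assms(1))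
  fix \<tau> :: real assume "\<tau> > 0"
  from has_jet_taylor[OF trig_poly_C2[OF assms(1)] this, of x]
  show "\<forall>\<^sub>F z in nhds x. w z \<le> w x + grad \<phi> x \<bullet> (z - x) + (z - x) \<bullet> (hess \<phi> x *v (z - x)) / 2 + \<tau> * (norm (z - x))\<^sup>2"
  proof eventually_elim
    case (elim z)
    then show ?case using assms(2)[of z] by (simp add: abs_le_iff)
  qed
qed

lemma superjet_shift:
  assumes w: "torus_fun w" and k: "\<And>i. k $ i \<in> \<int>" and jet: "superjet w (x + k) p X"
  shows "superjet w x p X"
  unfolding superjet_def
proof (intro conjI allI impI)
  show "transpose X = X" using jet by (simp add: superjet_def)
  fix \<tau> :: real assume "\<tau> > 0"
  then have "\<forall>\<^sub>F z in nhds (x + k). w z \<le> w (x + k) + p \<bullet> (z - (x + k)) + (z - (x + k)) \<bullet> (X *v (z - (x + k))) / 2 + \<tau> * (norm (z - (x + k)))\<^sup>2"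
    using jet by (simp add: superjet_def)
  moreover have "filterlim (\<lambda>z. z + k) (nhds (x + k)) (nhds x)"
    by (intro tendsto_add filterlim_ident tendsto_const)
  ultimately have "\<forall>\<^sub>F z in nhds x. w (z + k) \<le> w (x + k) + p \<bullet> (z + k - (x + k)) + (z + k - (x + k)) \<bullet> (X *v (z + k - (x + k))) / 2 + \<tau> * (norm (z + k - (x + k)))\<^sup>2"
    by (rule eventually_compose_filterlim)
  then show "\<forall>\<^sub>F z in nhds x. w z \<le> w x + p \<bullet> (z - x) + (z - x) \<bullet> (X *v (z - x)) / 2 + \<tau> * (norm (z - x))\<^sup>2"
    by (simp add: torus_funD[OF w k])
qed

text \<open>The kernel \<open>trace (b y)\<close> has integral 0, as mollified constants have zero
  Hessian. So w(x + \<open>\<delta>\<close> y) may be replaced by its difference to w(x), which is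
  at most K \<open>\<delta>\<close>, and one power of 1/\<open>\<delta>\<close> is saved.\<close>

lemma mollify_trace_hess_bound:
  assumes m: "mollifier \<rho> a b" and \<delta>: "\<delta> > 0" and w: "continuous_on UNIV w"
    and lip: "\<And>x z. \<bar>w x - w z\<bar> \<le> K * norm (x - z)" "K \<ge> 0"
  shows "\<bar>trace (hess (mollify \<rho> \<delta> w) x)\<bar> \<le> (\<integral>y. \<bar>trace (b y)\<bar> \<partial>lborel) * K / \<delta>"
proof -
  have tr: "trace (hess (mollify \<rho> \<delta> f) x) = (\<integral>y. trace (b y) / \<delta>\<^sup>2 * f (x + \<delta> *\<^sub>R y) \<partial>lborel)"
    if "continuous_on UNIV f" for f x
    using lin_op_mollify[OF m \<delta> that, of "mat 1" 0 x] by (simp add: lin_op_def)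
  have cb: "continuous_on UNIV (\<lambda>y. trace (b y))"
    unfolding trace_def by (intro continuous_intros mollifier_cont[OF m \<delta>])
  have sb: "trace (b y) = 0" if "y \<notin> cball 0 1" for y
    using m that by (simp add: mollifier_def trace_def)
  have "mollify \<rho> \<delta> (\<lambda>_. w x) = (\<lambda>_. w x)" using mollify_const[OF m \<delta>] by (rule ext)
  then have z: "(\<integral>y. trace (b y) / \<delta>\<^sup>2 * w x \<partial>lborel) = 0"
  proof -
    have "hess (\<lambda>_. w x) x = 0" using has_jet_hess[OF has_jet_const[of "w x"]] by metis
    then have "trace (hess (mollify \<rho> \<delta> (\<lambda>_. w x)) x) = 0"
      using \<open>mollify \<rho> \<delta> (\<lambda>_. w x) = (\<lambda>_. w x)\<close> by (simp add: trace_def)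
    then show ?thesis using tr[of "\<lambda>_. w x" x] by simp
  qed
  have i1: "integrable lborel (\<lambda>y. trace (b y) / \<delta>\<^sup>2 * w (x + \<delta> *\<^sub>R y))"
    by (rule mollify_integrable[OF m \<delta> w]) (use \<delta> in \<open>auto intro!: continuous_intros cb simp: sb\<close>)
  have i2: "integrable lborel (\<lambda>y. trace (b y) / \<delta>\<^sup>2 * w x)"
  proof (rule mollify_integrable[OF m \<delta>, of "\<lambda>_. w x"])
    show "continuous_on UNIV (\<lambda>y. trace (b y) / \<delta>\<^sup>2)" using \<delta> by (intro continuous_intros cb) auto
  qed (simp_all add: sb)
  have i3: "integrable lborel (\<lambda>y. \<bar>trace (b y)\<bar> * (K / \<delta>))"
  proof (rule mollify_integrable[OF m \<delta>, of "\<lambda>_. K / \<delta>"])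
    show "continuous_on UNIV (\<lambda>y. \<bar>trace (b y)\<bar>)" by (intro continuous_intros cb)
  qed (simp_all add: sb)
  have "trace (hess (mollify \<rho> \<delta> w) x) = (\<integral>y. trace (b y) / \<delta>\<^sup>2 * w (x + \<delta> *\<^sub>R y) - trace (b y) / \<delta>\<^sup>2 * w x \<partial>lborel)"
    unfolding tr[OF w] using i1 i2 z by simp
  also have "\<bar>\<dots>\<bar> \<le> (\<integral>y. \<bar>trace (b y) / \<delta>\<^sup>2 * w (x + \<delta> *\<^sub>R y) - trace (b y) / \<delta>\<^sup>2 * w x\<bar> \<partial>lborel)"
    by (rule integral_abs_bound)
  also have "\<dots> \<le> (\<integral>y. \<bar>trace (b y)\<bar> * (K / \<delta>) \<partial>lborel)"
  proof (rule integral_mono)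
    fix y
    show "\<bar>trace (b y) / \<delta>\<^sup>2 * w (x + \<delta> *\<^sub>R y) - trace (b y) / \<delta>\<^sup>2 * w x\<bar> \<le> \<bar>trace (b y)\<bar> * (K / \<delta>)"
    proof (cases "y \<in> cball 0 1")
      case True
      have "\<bar>w (x + \<delta> *\<^sub>R y) - w x\<bar> \<le> K * (\<delta> * norm y)" using lip(1)[of "x + \<delta> *\<^sub>R y" x] \<delta> by simp
      also have "\<dots> \<le> K * \<delta>" using True \<delta> lip(2) by (intro mult_left_mono) (auto simp: mult_left_le)
      finally have "\<bar>trace (b y) / \<delta>\<^sup>2\<bar> * \<bar>w (x + \<delta> *\<^sub>R y) - w x\<bar> \<le> \<bar>trace (b y) / \<delta>\<^sup>2\<bar> * (K * \<delta>)"
        by (intro mult_left_mono) auto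
      also have "\<dots> = \<bar>trace (b y)\<bar> * (K / \<delta>)" using \<delta> by (simp add: power2_eq_square)
      finally show ?thesis unfolding right_diff_distrib[symmetric] abs_mult .
    qed (simp add: sb)
  qed (use i1 i2 i3 in auto)
  also have "\<dots> = (\<integral>y. \<bar>trace (b y)\<bar> \<partial>lborel) * K / \<delta>" by simp
  finally show ?thesis .
qed

section \<open>Smoothing of semiconvex subsolutions\<close>

text \<open>For localisation: the linear viscosity inequality will be known only near c, and adding
  a large multiple of f to the right-hand side makes it hold everywhere without changing it on the
  ball of radius \<open>\<delta>\<close> / 2. The lattice translates enter because f must be
  periodic.\<close>

lemma periodic_cutoff:
  fixes c :: "real ^ 'n"
  assumes "\<delta> > 0"
  shows "\<exists>f :: real ^ 'n \<Rightarrow> real. C0_torus f \<and> (\<forall>x. f x \<ge> 0) \<and> (\<forall>x. norm (x - c) \<le> \<delta> / 2 \<longrightarrow> f x = 0) \<and>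
    (\<forall>x. (\<nexists>k. (\<forall>i. k $ i \<in> \<int>) \<and> norm (x + k - c) \<le> \<delta>) \<longrightarrow> f x \<ge> 1)"
proof -
  define L where "L = {c - k | k :: real ^ 'n. \<forall>i. k $ i \<in> \<int>}"
  have cL: "c \<in> L" unfolding L_def by (auto intro!: exI[of _ 0])
  define f where "f x = max 0 (2 * infdist x L / \<delta> - 1)" for x
  have "torus_fun (\<lambda>x. infdist x L)"
    unfolding torus_fun_def
  proof (intro allI impI)
    fix x l :: "real ^ 'n" assume l: "\<forall>i. l $ i \<in> \<int>"
    have ne: "L \<noteq> {}" using cL by blast
    have "dist (x + l) ` L = dist x ` L"
    proof -
      have "\<exists>z'\<in>L. dist (x + l) z = dist x z'" if "z \<in> L" for z
      proof -
        from that obtain k where k: "z = c - k" "\<forall>i. k $ i \<in> \<int>" by (auto simp: L_def)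
        have "c - (k + l) \<in> L" unfolding L_def using k l by (intro CollectI exI[of _ "k + l"]) auto
        moreover have "dist (x + l) z = dist x (c - (k + l))" by (simp add: k dist_norm algebra_simps)
        ultimately show ?thesis by blast
      qed
      moreover have "\<exists>z'\<in>L. dist x z = dist (x + l) z'" if "z \<in> L" for z
      proof -
        from that obtain k where k: "z = c - k" "\<forall>i. k $ i \<in> \<int>" by (auto simp: L_def)
        have "c - (k - l) \<in> L" unfolding L_def using k l by (intro CollectI exI[of _ "k - l"]) auto
        moreover have "dist x z = dist (x + l) (c - (k - l))" by (simp add: k dist_norm algebra_simps)
        ultimately show ?thesis by blast
      qed
      ultimately show ?thesis by (auto simp: image_iff)
    qed
    then show "infdist (x + l) L = infdist x L" using ne by (simp add: infdist_notempty)
  qed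
  then have "torus_fun f" unfolding f_def torus_fun_def by simp
  moreover have "continuous_on UNIV f" unfolding f_def using assms by (intro continuous_intros) auto
  ultimately have "C0_torus f" by (simp add: C0_torus_def)
  moreover have "f x \<ge> 0" for x by (simp add: f_def)
  moreover have "f x = 0" if "norm (x - c) \<le> \<delta> / 2" for x
  proof -
    have "infdist x L \<le> \<delta> / 2" using infdist_le[OF cL, of x] that by (simp add: dist_norm)
    then show ?thesis using assms by (simp add: f_def field_simps)
  qed
  moreover have "f x \<ge> 1" if far: "\<nexists>k. (\<forall>i. k $ i \<in> \<int>) \<and> norm (x + k - c) \<le> \<delta>" for x
  proof -
    have "\<delta> \<le> infdist x L"
    proof -
      have "\<delta> \<le> dist x z" if "z \<in> L" for z
      proof -
        from that obtain k where k: "z = c - k" "\<And>i. k $ i \<in> \<int>" by (auto simp: L_def)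
        have e: "x + k - c = x - z" by (simp add: k(1))
        have "\<not> norm (x + k - c) \<le> \<delta>" using far k(2) by blast
        then show ?thesis unfolding dist_norm e by simp
      qed
      then show ?thesis using cL by (auto simp: infdist_def intro!: cINF_greatest)
    qed
    then show ?thesis using assms by (simp add: f_def field_simps)
  qed
  ultimately show ?thesis by blast
qed

text \<open>An upper bound on increments from x is what remains when f touches a Lipschitz function
  from below at x; moving along p itself uses nothing else.\<close>

lemma gradient_le_one_sided_lipschitz:
  fixes f :: "real ^ 'n \<Rightarrow> real"
  assumes d: "(f has_derivative (\<lambda>y. p \<bullet> y)) (at x)" and lip: "\<And>z. f z - f x \<le> K * norm (z - x)" and K: "K \<ge> 0"
  shows "norm p \<le> K"
proof -
  have "norm p * norm p \<le> K * norm p"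
  proof -
    have 1: "(f has_derivative (\<lambda>y. p \<bullet> y)) (at (x + 0 *\<^sub>R p))" using d by simp
    have 2: "((\<lambda>s. x + s *\<^sub>R p) has_derivative (\<lambda>s. s *\<^sub>R p)) (at 0)"
      by (auto intro!: derivative_eq_intros)
    have "((\<lambda>s. f (x + s *\<^sub>R p)) has_field_derivative p \<bullet> p) (at 0)"
      unfolding has_field_derivative_def
      by (rule has_derivative_eq_rhs[OF has_derivative_compose[OF 2 1]]) (simp add: fun_eq_iff mult.commute)
    then have "((\<lambda>h. (f (x + (0 + h) *\<^sub>R p) - f (x + 0 *\<^sub>R p)) / h) \<longlongrightarrow> p \<bullet> p) (at 0)"
      unfolding DERIV_def .
    then have "((\<lambda>h. (f (x + h *\<^sub>R p) - f x) / h) \<longlongrightarrow> p \<bullet> p) (at_right 0)"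
      by (intro tendsto_mono[of "at_right 0" "at (0::real)"]) (simp_all add: at_within_le_at)
    moreover have "\<forall>\<^sub>F h in at_right (0::real). (f (x + h *\<^sub>R p) - f x) / h \<le> K * norm p"
      using eventually_at_right_less[of "0::real"]
    proof eventually_elim
      case (elim h)
      have "f (x + h *\<^sub>R p) - f x \<le> K * (h * norm p)" using lip[of "x + h *\<^sub>R p"] elim by simp
      then show ?case using elim by (simp add: pos_divide_le_eq mult_ac)
    qed
    ultimately have "p \<bullet> p \<le> K * norm p" by (rule tendsto_upperbound) simp
    then show ?thesis by (simp add: dot_square_norm power2_eq_square)
  qed
  then show ?thesis using K by (cases "p = 0") auto
qed

lemma trace_mult_diff_left:
  fixes A B X :: "real ^ 'n ^ 'n"
  shows "trace ((A - B) ** X) = trace (A ** X) - trace (B ** X)"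
  by (simp add: trace_def matrix_matrix_mult_def sum_subtractf left_diff_distrib)

lemma trace_mult_comb_left:
  fixes A B X :: "real ^ 'n ^ 'n"
  shows "trace ((r *\<^sub>R A + s *\<^sub>R B) ** X) = r * trace (A ** X) + s * trace (B ** X)"
  by (simp add: trace_def matrix_matrix_mult_def sum.distrib sum_distrib_left algebra_simps)

context viscous_hamiltonian
begin

text \<open>
  Near \<open>x\<close> the matrix \<open>A\<close> is dominated by the
  constant \<open>B = (1 + \<theta>)A(x) + (1 + 1/\<theta>)C\<^sup>2\<delta>\<^sup>2I\<close>; semiconvexity makes the excess harmless, and the
  Lipschitz bound controls \<open>\<delta>\<^sup>2\<Delta>\<psi>\<close>.
\<close>

lemma smoothing:
  assumes w: "C0_torus w" and lip: "\<And>x z. \<bar>w x - w z\<bar> \<le> K * norm (x - z)" and K: "K \<ge> 0"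
    and conv: "\<And>x h. w (x + h) + w (x - h) - 2 * w x \<ge> - \<Lambda> * (norm h)\<^sup>2" and \<Lambda>: "\<Lambda> \<ge> 0"
    and \<eta>: "\<eta> > 0" and G: "G \<ge> 0"
  obtains \<delta> \<psi> where "0 < \<delta>" "\<delta> \<le> \<eta>" "C2_torus \<psi>" "\<And>x. \<bar>\<psi> x - w x\<bar> \<le> \<eta>" "\<And>x. norm (grad \<psi> x) \<le> K"
    "\<And>x g. \<bar>g\<bar> \<le> G \<Longrightarrow>
      (\<And>z p X. superjet w z p X \<Longrightarrow> norm (z - x) \<le> \<delta> \<Longrightarrow> H z p - trace (A z ** X) \<le> g) \<Longrightarrow>
      H x (grad \<psi> x) - trace (A x ** hess \<psi> x) \<le> g + \<eta>"
proof -
  obtain \<rho> :: "real ^ 'n \<Rightarrow> real" and a b where m: "mollifier \<rho> a b"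
    unfolding mollifier_def using mollifier_exists by metis
  obtain M where M: "M > 0" "\<And>x p. norm p \<le> K \<Longrightarrow> \<bar>H x p\<bar> \<le> M" using H_bounded by blast
  obtain T where T: "T > 0" "\<And>x. 0 \<le> trace (A x)" "\<And>x. trace (A x) \<le> T" using trace_A_bounded by blast
  obtain C where C: "C > 0"
    "\<And>x z y. \<bar>sqrt (y \<bullet> (A x *v y)) - sqrt (y \<bullet> (A z *v y))\<bar> \<le> C * norm (x - z) * norm y"
    using A_sqrt_lipschitz by blast
  define n where "n = real CARD('n)"
  define C1 where "C1 = (\<integral>y. \<bar>trace (b y)\<bar> \<partial>lborel)"
  have C1: "C1 \<ge> 0" by (simp add: C1_def)
  define e where "e = min \<eta> 1"
  have e: "0 < e" "e \<le> 1" "e \<le> \<eta>" using \<eta> by (auto simp: e_def)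
  \<comment> \<open>Chosen so that \<open>\<theta>\<close> times M + G + 1, which bounds tr(A D^2
    \<open>\<psi>\<close>) from above if the claim fails, and \<open>\<theta>\<close> times the
    semiconvexity excess \<open>\<Lambda> * T\<close> are both at most e / 8.\<close>
  define \<theta> where "\<theta> = e / (8 * (M + G + 1 + \<Lambda> * T))"
  have den: "M + G + 1 + \<Lambda> * T > 0" using M G \<Lambda> T by (simp add: add_pos_nonneg)
  have \<theta>: "\<theta> > 0" using e den by (simp add: \<theta>_def)
  have th: "\<theta> * (M + G + 1 + \<Lambda> * T) = e / 8"
    using den nonzero_mult_divide_mult_cancel_right[of "M + G + 1 + \<Lambda> * T" e 8] by (simp only: \<theta>_def) simp
  have \<theta>1: "\<theta> * (M + G + 1) \<le> e / 8" "\<theta> * (\<Lambda> * T) \<le> e / 8"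
  proof -
    have "0 \<le> \<theta> * (\<Lambda> * T)" "0 \<le> \<theta> * (M + G + 1)" using \<theta> \<Lambda> T M G by auto
    then show "\<theta> * (M + G + 1) \<le> e / 8" "\<theta> * (\<Lambda> * T) \<le> e / 8" using th distrib_left[of \<theta> "M + G + 1" "\<Lambda> * T"] by linarith+
  qed
  define b0 where "b0 = (1 + 1 / \<theta>) * C\<^sup>2"
  have b0: "b0 \<ge> 0" using \<theta> by (simp add: b0_def)
  \<comment> \<open>Collects the errors of order \<open>\<delta>\<close>: the oscillation of H,
    semiconvexity times the trace of \<open>\<beta> I\<close>, and \<open>\<beta>\<close> times the
    Laplacian of \<open>\<psi>\<close>.\<close>
  define c1 where "c1 = 2 * \<gamma> * (1 + M) + \<Lambda> * (2 * n * b0) + 2 * b0 * C1 * K"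
  have n: "n \<ge> 0" by (simp add: n_def)
  have c1: "c1 \<ge> 0" using \<gamma>_pos M \<Lambda> n b0 C1 K by (simp add: c1_def)
  define \<delta> where "\<delta> = min (min (e / (4 * (c1 + 1))) (1 / (2 * \<gamma>))) (min (e / (K + 1)) e)"
  have \<delta>: "0 < \<delta>" "\<delta> \<le> e" "\<gamma> * \<delta> \<le> 1 / 2" "K * \<delta> \<le> e" "c1 * \<delta> \<le> e / 4"
  proof -
    show "0 < \<delta>" using e c1 \<gamma>_pos K by (simp add: \<delta>_def)
    show "\<delta> \<le> e" by (simp add: \<delta>_def)
    have "\<delta> \<le> 1 / (2 * \<gamma>)" by (simp add: \<delta>_def)
    then have "\<gamma> * \<delta> \<le> \<gamma> * (1 / (2 * \<gamma>))" using \<gamma>_pos by (intro mult_left_mono) auto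
    then show "\<gamma> * \<delta> \<le> 1 / 2" using \<gamma>_pos by simp
    have "\<delta> \<le> e / (K + 1)" by (simp add: \<delta>_def)
    then have "(K + 1) * \<delta> \<le> (K + 1) * (e / (K + 1))" using K by (intro mult_left_mono) auto
    then have "(K + 1) * \<delta> \<le> e" using K by simp
    then show "K * \<delta> \<le> e" using \<open>0 < \<delta>\<close> by (simp add: distrib_right)
    have "\<delta> \<le> e / (4 * (c1 + 1))" by (simp add: \<delta>_def)
    then have "(c1 + 1) * \<delta> \<le> (c1 + 1) * (e / (4 * (c1 + 1)))" using c1 by (intro mult_left_mono) auto
    also have "(c1 + 1) * (e / (4 * (c1 + 1))) = e / 4" using c1 by (simp add: field_simps)
    finally have "(c1 + 1) * \<delta> \<le> e / 4" .
    then show "c1 * \<delta> \<le> e / 4" using \<open>0 < \<delta>\<close> by (simp add: distrib_right)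
  qed
  \<comment> \<open>The kernel then only sees the ball on which the cutoff below vanishes.\<close>
  define r where "r = \<delta> / 2"
  have r: "r > 0" using \<delta> by (simp add: r_def)
  have cw: "continuous_on UNIV w" "torus_fun w" using w by (auto simp: C0_torus_def)
  define \<psi> where "\<psi> = mollify \<rho> r w"
  obtain g' h' where jet: "has_jet \<psi> g' h'" unfolding \<psi>_def using mollify_has_jet[OF m r cw(1)] by blast
  have C2: "C2_torus \<psi>" using C2_torusI[OF jet] mollify_torus_fun[OF m r cw(2)] by (simp add: \<psi>_def)
  have close: "\<bar>\<psi> x - w x\<bar> \<le> \<eta>" for x
  proof -
    have "\<bar>\<psi> x - w x\<bar> \<le> K * r" unfolding \<psi>_def by (rule mollify_lipschitz_close[OF m r cw(1) lip K])
    also have "\<dots> \<le> K * \<delta>" using K \<delta> by (intro mult_left_mono) (auto simp: r_def)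
    finally show ?thesis using \<delta> e by simp
  qed
  have gradK: "norm (grad \<psi> x) \<le> K" for x
  proof (rule gradient_le_one_sided_lipschitz)
    show "(\<psi> has_derivative (\<lambda>y. grad \<psi> x \<bullet> y)) (at x)"
      using C2_torus_has_jet[OF C2] by (simp add: has_jet_def)
    have "\<bar>\<psi> z - \<psi> x\<bar> \<le> K * norm (z - x)" for z
      unfolding \<psi>_def by (rule mollify_lipschitz[OF m r cw(1) lip])
    then show "\<psi> z - \<psi> x \<le> K * norm (z - x)" for z by (meson abs_le_D1)
    show "K \<ge> 0" by (rule K)
  qed
  have main: "H x (grad \<psi> x) - trace (A x ** hess \<psi> x) \<le> g + \<eta>"
    if g: "\<bar>g\<bar> \<le> G" and hyp: "\<And>z p X. superjet w z p X \<Longrightarrow> norm (z - x) \<le> \<delta> \<Longrightarrow> H z p - trace (A z ** X) \<le> g" for x g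
  proof -
    define p0 where "p0 = grad \<psi> x"
    \<comment> \<open>H is linearised at the very gradient that the mollified function has at x, so
      that the supporting affine function is exact in the final estimate.\<close>
    obtain v where v: "subgradient x p0 v" by (rule subgradient_exists)
    define \<beta> where "\<beta> = b0 * \<delta>\<^sup>2"
    have \<beta>: "\<beta> \<ge> 0" using b0 by (simp add: \<beta>_def)
    define Y where "Y x z = ((1 + \<theta>) *\<^sub>R A x + \<beta> *\<^sub>R mat 1) - A z" for x z
    have Ysym: "transpose (Y x z) = Y x z" for x z
      using A_sym[of x] A_sym[of z] by (simp add: Y_def transpose_def vec_eq_iff mat_def)
    have Yq: "y \<bullet> (Y x z *v y) = (1 + \<theta>) * (y \<bullet> (A x *v y)) + \<beta> * (norm y)\<^sup>2 - y \<bullet> (A z *v y)" for x z y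
      by (simp add: Y_def matrix_vector_mult_diff_rdistrib matrix_vector_mult_add_rdistrib
          scaleR_matrix_vector_assoc[symmetric] inner_diff_right inner_add_right dot_square_norm)
    have Ypsd: "0 \<le> y \<bullet> (Y x z *v y)" if "norm (z - x) \<le> \<delta>" for x z y
    proof -
      have "y \<bullet> (A z *v y) \<le> (1 + \<theta>) * (y \<bullet> (A x *v y)) + (1 + 1 / \<theta>) * (C * norm (z - x))\<^sup>2 * (norm y)\<^sup>2"
        using quadratic_form_compare[OF C(2)[of y z x] A_psd A_psd \<theta>] C(1) by simp
      also have "(1 + 1 / \<theta>) * (C * norm (z - x))\<^sup>2 * (norm y)\<^sup>2 \<le> \<beta> * (norm y)\<^sup>2"
      proof (rule mult_right_mono)
        have "(norm (z - x))\<^sup>2 \<le> \<delta>\<^sup>2" using that by (intro power_mono) auto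
        then have "b0 * (norm (z - x))\<^sup>2 \<le> \<beta>" unfolding \<beta>_def using b0 by (rule mult_left_mono)
        then show "(1 + 1 / \<theta>) * (C * norm (z - x))\<^sup>2 \<le> \<beta>" by (simp add: b0_def power_mult_distrib mult_ac)
      qed simp
      finally show ?thesis by (simp add: Yq)
    qed
    have trI: "trace (mat 1 :: real ^ 'n ^ 'n) = n" by (simp add: trace_def mat_def n_def)
    have Ytr: "trace (Y x z ** X) = (1 + \<theta>) * trace (A x ** X) + \<beta> * trace X - trace (A z ** X)" for x z X
      unfolding Y_def trace_mult_diff_left trace_mult_comb_left by (simp add: matrix_mul_lid)
    have Ytrace: "trace (Y x z) \<le> 2 * \<theta> * T + 2 * n * \<beta>" if "norm (z - x) \<le> \<delta>" for x z
    proof -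
      have "0 \<le> trace (Y z x ** mat 1)"
        by (rule psd_trace_nonneg[OF Ysym Ypsd]) (use that in \<open>auto simp: norm_minus_commute\<close>)
      then have "trace (A x) - trace (A z) \<le> \<theta> * trace (A z) + n * \<beta>"
        unfolding Ytr by (simp add: matrix_mul_rid trI algebra_simps)
      moreover have "\<theta> * trace (A z) \<le> \<theta> * T" "\<theta> * trace (A x) \<le> \<theta> * T" using T(3) \<theta> by (auto intro: mult_left_mono)
      moreover have "trace (Y x z) = (1 + \<theta>) * trace (A x) + \<beta> * n - trace (A z)"
        using Ytr[of x z "mat 1"] by (simp add: matrix_mul_rid trI)
      ultimately show ?thesis by (simp add: algebra_simps)
    qed
    define B where "B = (1 + \<theta>) *\<^sub>R A x + \<beta> *\<^sub>R mat 1"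
    have Btr: "trace (B ** X) = (1 + \<theta>) * trace (A x ** X) + \<beta> * trace X" for X
      unfolding B_def trace_mult_comb_left by (simp add: matrix_mul_lid)
    have Bsym: "transpose B = B" using A_sym[of x] by (simp add: B_def transpose_def vec_eq_iff mat_def)
    have Bpsd: "0 \<le> y \<bullet> (B *v y)" for y
      using A_psd[of y x] \<theta> \<beta> by (simp add: B_def matrix_vector_mult_add_rdistrib
          scaleR_matrix_vector_assoc[symmetric] inner_add_right)
    define E1 where "E1 = 2 * \<gamma> * \<delta> * (1 + M) + \<Lambda> * (2 * \<theta> * T + 2 * n * \<beta>)"
    define g1 where "g1 = g + v \<bullet> p0 - H x p0 + E1"
    have XL: "0 \<le> y \<bullet> ((X + \<Lambda> *\<^sub>R mat 1) *v y)" if "superjet w z p X" for z p X y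
      using superjet_semiconvex[OF that conv, of y]
      by (simp add: matrix_vector_mult_add_rdistrib scaleR_matrix_vector_assoc[symmetric] inner_add_right dot_square_norm)
    \<comment> \<open>Near x, pass from H z p through H x p to the affine function, and from A z to
      B. The difference Y of the matrices and \<open>X + \<Lambda> I\<close> are both semidefinite,
      so the excess is at most \<open>\<Lambda> * trace (Y x z)\<close>.\<close>
    have near: "v \<bullet> p - trace (B ** X) \<le> g1" if sj: "superjet w z p X" and zx: "norm (z - x) \<le> \<delta>" for z p X
    proof -
      have pK: "norm p \<le> K" by (rule superjet_lipschitz[OF sj lip])
      have "\<gamma> * norm (x - z) \<le> \<gamma> * \<delta>" using zx \<gamma>_pos by (intro mult_left_mono) (auto simp: norm_minus_commute)
      then have "\<bar>H x p - H z p\<bar> \<le> 2 * \<gamma> * norm (x - z) * (1 + \<bar>H z p\<bar>)" using \<delta> by (intro H_oscillation) simp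
      also have "\<dots> \<le> 2 * \<gamma> * \<delta> * (1 + M)"
        using zx \<gamma>_pos \<delta>(1) M(2)[OF pK, of z] by (intro mult_mono) (auto simp: norm_minus_commute)
      finally have 1: "H x p \<le> H z p + 2 * \<gamma> * \<delta> * (1 + M)" by linarith
      have "0 \<le> trace (Y x z ** (X + \<Lambda> *\<^sub>R mat 1))"
        by (rule psd_trace_nonneg[OF Ysym Ypsd[OF zx] XL[OF sj]])
      then have "- trace (Y x z ** X) \<le> \<Lambda> * trace (Y x z)"
        by (simp add: trace_add_scaleR matrix_mul_rid)
      also have "\<dots> \<le> \<Lambda> * (2 * \<theta> * T + 2 * n * \<beta>)" by (intro mult_left_mono Ytrace zx \<Lambda>)
      finally have 2: "- trace (B ** X) \<le> - trace (A z ** X) + \<Lambda> * (2 * \<theta> * T + 2 * n * \<beta>)"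
        unfolding Ytr Btr by simp
      have 3: "v \<bullet> p \<le> H x p - H x p0 + v \<bullet> p0" using v by (simp add: subgradient_def inner_diff_right algebra_simps)
      show ?thesis using 1 2 3 hyp[OF sj zx] by (simp add: g1_def E1_def)
    qed
    \<comment> \<open>A crude bound for all superjets, from the Lipschitz bound on p and
      semiconvexity alone; F is read off from it.\<close>
    have far: "v \<bullet> p - trace (B ** X) \<le> norm v * K + \<Lambda> * trace B" if sj: "superjet w z p X" for z p X
    proof -
      have "0 \<le> trace (B ** (X + \<Lambda> *\<^sub>R mat 1))" by (rule psd_trace_nonneg[OF Bsym Bpsd XL[OF sj]])
      then have "- trace (B ** X) \<le> \<Lambda> * trace B" by (simp add: trace_add_scaleR matrix_mul_rid)
      moreover have "v \<bullet> p \<le> norm v * norm p" by (rule norm_cauchy_schwarz)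
      moreover have "norm v * norm p \<le> norm v * K" by (intro mult_left_mono superjet_lipschitz[OF sj lip]) auto
      ultimately show ?thesis by linarith
    qed
    define F where "F = max 0 (norm v * K + \<Lambda> * trace B - g1)"
    obtain f0 :: "real ^ 'n \<Rightarrow> real" where f0: "C0_torus f0" "\<And>y. f0 y \<ge> 0" "\<And>y. norm (y - x) \<le> \<delta> / 2 \<Longrightarrow> f0 y = 0"
      "\<And>y. \<nexists>k. (\<forall>i. k $ i \<in> \<int>) \<and> norm (y + k - x) \<le> \<delta> \<Longrightarrow> f0 y \<ge> 1"
      using periodic_cutoff[OF \<delta>(1), of x] by blast
    define f where "f y = g1 + F * f0 y" for y
    have f: "C0_torus f" using f0(1) unfolding C0_torus_def f_def torus_fun_def by (auto intro!: continuous_intros)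
    have "- lin_op B v \<psi> x \<le> mollify \<rho> r f x"
      unfolding \<psi>_def
    proof (rule mollify_linear_subsolution[OF m r w f Bsym Bpsd])
      fix \<phi> z assume \<phi>: "trig_poly \<phi>" "\<And>y. w y - \<phi> y \<le> w z - \<phi> z"
      have sj: "superjet w z (grad \<phi> z) (hess \<phi> z)" by (rule superjet_of_test_function[OF \<phi>])
      show "v \<bullet> grad \<phi> z - trace (B ** hess \<phi> z) \<le> f z"
      proof (cases "\<exists>k. (\<forall>i. k $ i \<in> \<int>) \<and> norm (z + k - x) \<le> \<delta>")
        case True
        then obtain k where k: "\<And>i. k $ i \<in> \<int>" "norm (z + k - x) \<le> \<delta>" by blast
        have "superjet w (z + k) (grad \<phi> z) (hess \<phi> z)"
          by (rule superjet_shift[OF cw(2), of "- k"]) (use k sj in auto)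
        from near[OF this k(2)] show ?thesis
          using f0(2)[of z] by (simp add: f_def F_def add_increasing2)
      next
        case False
        then have "f0 z \<ge> 1" by (rule f0(4))
        then have "F * 1 \<le> F * f0 z" by (intro mult_left_mono) (auto simp: F_def)
        moreover have "norm v * K + \<Lambda> * trace B - g1 \<le> F" by (simp add: F_def)
        ultimately show ?thesis using far[OF sj] by (simp add: f_def)
      qed
    qed
    also have "mollify \<rho> r f x \<le> mollify \<rho> r (\<lambda>_. g1) x"
      using f f0(3) by (intro mollify_mono[OF m r]) (auto simp: C0_torus_def f_def r_def)
    also have "\<dots> = g1" by (rule mollify_const[OF m r])
    finally have "v \<bullet> p0 - trace (B ** hess \<psi> x) \<le> g1" by (simp add: lin_op_def p0_def)
    define t where "t = trace (A x ** hess \<psi> x)"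
    have "\<bar>trace (hess \<psi> x)\<bar> \<le> C1 * K / r"
      unfolding \<psi>_def C1_def by (rule mollify_trace_hess_bound[OF m r cw(1) lip K])
    then have "trace (hess \<psi> x) \<le> C1 * K / r" by linarith
    then have "\<beta> * trace (hess \<psi> x) \<le> \<beta> * (C1 * K / r)" using \<beta> by (rule mult_left_mono)
    also have "\<dots> = 2 * b0 * C1 * K * \<delta>" using \<delta>(1) by (simp add: \<beta>_def r_def power2_eq_square)
    finally have bt: "\<beta> * trace (hess \<psi> x) \<le> 2 * b0 * C1 * K * \<delta>" .
    have "\<delta>\<^sup>2 \<le> \<delta>" using \<delta> e by (simp add: power2_eq_square mult_left_le)
    then have "\<Lambda> * (2 * n * b0) * \<delta>\<^sup>2 \<le> \<Lambda> * (2 * n * b0) * \<delta>" using \<Lambda> n b0 by (intro mult_left_mono) auto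
    then have "E1 + 2 * b0 * C1 * K * \<delta> \<le> c1 * \<delta> + 2 * (\<theta> * (\<Lambda> * T))"
      by (simp add: E1_def c1_def \<beta>_def algebra_simps)
    also have "\<dots> \<le> e / 2" using \<delta>(5) \<theta>1(2) by linarith
    finally have "H x p0 - g \<le> (1 + \<theta>) * t + e / 2"
      using \<open>v \<bullet> p0 - trace (B ** hess \<psi> x) \<le> g1\<close> bt unfolding Btr g1_def t_def by linarith
    \<comment> \<open>This removes the factor \<open>1 + \<theta>\<close> in front of t: if the
      claim failed, t would be at most M + G + 1, and \<open>\<theta> * t\<close> would be
      negligible.\<close>
    have "H x p0 - g - t \<le> e"
    proof (rule ccontr)
      assume neg: "\<not> ?thesis"
      then have "t < H x p0 - g - e" by simp
      moreover have "H x p0 \<le> M" using M(2)[OF gradK, of x x] by (simp add: p0_def abs_le_iff)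
      ultimately have "t \<le> M + G + 1" using g e by (simp add: abs_le_iff)
      then have "\<theta> * t \<le> \<theta> * (M + G + 1)" using \<theta> by (intro mult_left_mono) auto
      then have "\<theta> * t \<le> e / 8" using \<theta>1(1) by linarith
      moreover have "H x p0 - g - t \<le> \<theta> * t + e / 2"
        using \<open>H x p0 - g \<le> (1 + \<theta>) * t + e / 2\<close> by (simp add: distrib_right)
      ultimately show False using neg e by linarith
    qed
    then show ?thesis using e by (simp add: p0_def t_def)
  qed
  have "\<delta> \<le> \<eta>" using \<delta> e by simp
  then show ?thesis using that[OF \<delta>(1) _ C2 close gradK main] by blast
qed

end

section \<open>Lipschitz regularity and smooth subsolutions\<close>

lemma torus_uniformly_continuous:
  fixes f :: "real ^ 'n \<Rightarrow> real"
  assumes per: "torus_fun f" and cont: "continuous_on UNIV f" and e: "e > 0"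
  shows "\<exists>d>0. \<forall>x z. norm (x - z) < d \<longrightarrow> \<bar>f x - f z\<bar> < e"
proof -
  let ?S = "{x + y | x y. x \<in> cbox 0 (1 :: real ^ 'n) \<and> y \<in> cball 0 1}"
  have "compact ?S" by (intro compact_sums compact_cbox compact_cball)
  then have "uniformly_continuous_on ?S f"
    by (intro compact_uniformly_continuous continuous_on_subset[OF cont]) auto
  then obtain d where d: "d > 0" "\<And>x z. x \<in> ?S \<Longrightarrow> z \<in> ?S \<Longrightarrow> dist z x < d \<Longrightarrow> dist (f z) (f x) < e"
    unfolding uniformly_continuous_on_def using e by meson
  have "\<bar>f x - f z\<bar> < e" if xz: "norm (x - z) < min d 1" for x z
  proof -
    define k where "k = frac_vec x - x"
    have k: "k $ i \<in> \<int>" for i using diff_frac_vec_Ints[of x i] by (simp add: k_def) (metis Ints_minus minus_diff_eq)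
    have fx: "frac_vec x \<in> cbox 0 1" using frac_vec_in_unit_cell unit_cell_subset_cbox by blast
    have "x + k \<in> ?S"
      using fx by (intro CollectI exI[of _ "frac_vec x"] exI[of _ "0 :: real ^ 'n"]) (auto simp: k_def)
    moreover have "z + k \<in> ?S"
      using fx xz by (intro CollectI exI[of _ "frac_vec x"] exI[of _ "z - x"]) (auto simp: k_def norm_minus_commute)
    ultimately have "dist (f (x + k)) (f (z + k)) < e"
      using xz by (intro d(2)) (auto simp: dist_norm)
    then show ?thesis by (simp add: torus_funD[OF per k] dist_real_def)
  qed
  then show ?thesis using d(1) by (intro exI[of _ "min d 1"]) simp
qed

context viscous_hamiltonian
begin

lemma supconv_attained_close:
  assumes u: "C0_torus u" and \<epsilon>: "\<epsilon> > 0" and M: "\<And>x. \<bar>u x\<bar> \<le> M"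
    and y: "supconv \<epsilon> u x = u y - (norm (x - y))\<^sup>2 / (2 * \<epsilon>)"
  shows "(norm (x - y))\<^sup>2 \<le> 4 * M * \<epsilon>"
proof -
  have "(norm (x - y))\<^sup>2 / (2 * \<epsilon>) \<le> 2 * M"
    using y supconv_ge[OF u \<epsilon>, of x] M[of x] M[of y] by (simp add: abs_le_iff)
  then show ?thesis using \<epsilon> by (simp add: field_simps)
qed

text \<open>
  The Bernstein estimate at a maximum of \<open>u(y) - u(x) - |x - y|\<^sup>2/2\<epsilon>\<close>: comparing \<open>A(y)\<close> with the
  scaled matrix \<open>(1 - \<beta>r)\<^sup>2A(x)\<close>, where \<open>r = |x - y|\<close>, gains a term \<open>-2\<beta>rH\<close> that beats the
  oscillation \<open>2\<gamma>r(1 + |H|)\<close> of \<open>H\<close> in \<open>x\<close> and, by superlinearity, the error \<open>Cr|p|\<close>.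
\<close>

lemma penalization_maximum_bound:
  assumes sol: "viscosity_solution H A c u"
  shows "\<exists>K0>0. \<exists>\<epsilon>0>0. \<forall>\<epsilon>. 0 < \<epsilon> \<longrightarrow> \<epsilon> \<le> \<epsilon>0 \<longrightarrow>
    (\<exists>x y. norm (x - y) \<le> \<epsilon> * K0 \<and>
      (\<forall>x' y'. u y' - u x' - (norm (x' - y'))\<^sup>2 / (2 * \<epsilon>) \<le> u y - u x - (norm (x - y))\<^sup>2 / (2 * \<epsilon>)))"
proof -
  have u: "C0_torus u" and sub: "viscosity_subsolution H A c u" and super: "viscosity_supersolution H A c u"
    using sol by (auto simp: viscosity_solution_def)
  have cu: "continuous_on UNIV u" "torus_fun u" using u by (auto simp: C0_torus_def)
  obtain M where M: "M > 0" "\<And>x. \<bar>u x\<bar> \<le> M" using torus_bounded[OF cu(2,1)] unfolding real_norm_def by blast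
  obtain T where T: "T > 0" "\<And>x. 0 \<le> trace (A x)" "\<And>x. trace (A x) \<le> T" using trace_A_bounded by blast
  obtain C where C: "C > 0"
    "\<And>x z y. \<bar>sqrt (y \<bullet> (A x *v y)) - sqrt (y \<bullet> (A z *v y))\<bar> \<le> C * norm (x - z) * norm y"
    using A_sqrt_lipschitz by blast
  \<comment> \<open>One more than \<open>\<gamma>\<close>, so that the gain
    \<open>2 * \<beta> * r * h\<close> exceeds the oscillation \<open>2 * \<gamma> * r * h\<close>
    of H by \<open>2 * r * h\<close>.\<close>
  define \<beta> where "\<beta> = \<gamma> + 1"
  have \<beta>: "\<beta> > 1" using \<gamma>_pos by (simp add: \<beta>_def)
  define C1 where "C1 = 128 * (real CARD('n))\<^sup>2 * C\<^sup>2 + 2 * \<beta>\<^sup>2 * T"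
  have C1: "C1 \<ge> 0" using T by (simp add: C1_def)
  obtain Ka where Ka: "Ka > 0" "\<And>x p. norm p \<ge> Ka \<Longrightarrow> H x p \<ge> (C1 + 1) * norm p" using H_coercive by blast
  define K0 where "K0 = max Ka (\<gamma> * (1 + \<bar>c\<bar>) + 1 + \<bar>c\<bar>)"
  have K0: "K0 > 0" "K0 \<ge> Ka" "K0 \<ge> \<gamma> * (1 + \<bar>c\<bar>) + 1 + \<bar>c\<bar>" using Ka by (auto simp: K0_def)
  \<comment> \<open>Then r^2 <= 4 M \<open>\<epsilon>\<close> forces
    \<open>\<beta> * r \<le> 1 / 2\<close>.\<close>
  define \<epsilon>0 where "\<epsilon>0 = 1 / (16 * M * \<beta>\<^sup>2)"
  have \<epsilon>0: "\<epsilon>0 > 0" using M \<beta> by (simp add: \<epsilon>0_def)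
  have "\<exists>x y. norm (x - y) \<le> \<epsilon> * K0 \<and>
      (\<forall>x' y'. u y' - u x' - (norm (x' - y'))\<^sup>2 / (2 * \<epsilon>) \<le> u y - u x - (norm (x - y))\<^sup>2 / (2 * \<epsilon>))"
    if \<epsilon>: "0 < \<epsilon>" "\<epsilon> \<le> \<epsilon>0" for \<epsilon>
  proof (rule ccontr)
    \<comment> \<open>If no maximiser is this close to the diagonal, pairs within distance
      \<open>\<epsilon> * K0\<close> stay below the maximum m by a fixed gap. So wherever w - u is
      nearly maximal, superjet gradients of w exceed K0, and there w turns out to be a strict
      subsolution; touching u by a smoothed w contradicts the supersolution property.\<close>
    assume contra: "\<not> ?thesis"
    define w where "w = supconv \<epsilon> u"
    obtain K where K: "K \<ge> 0" "\<And>x z. \<bar>w x - w z\<bar> \<le> K * norm (x - z)"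
      unfolding w_def using supconv_lipschitz[OF u \<epsilon>(1)] by blast
    have "K-lipschitz_on UNIV w" by (rule lipschitz_onI) (use K in \<open>auto simp: dist_norm\<close>)
    then have cw: "continuous_on UNIV w" by (rule lipschitz_on_continuous_on)
    have pw: "torus_fun w" unfolding w_def by (rule supconv_torus_fun[OF u \<epsilon>(1)])
    have pd: "torus_fun (\<lambda>x. w x - u x)" and cd: "continuous_on UNIV (\<lambda>x. w x - u x)"
      using torus_fun_compose2[OF pw cu(2)] cw cu(1) by (auto intro: continuous_intros)
    obtain xm where xm: "\<And>x. w x - u x \<le> w xm - u xm" using torus_attains_sup[OF pd cd] by blast
    define m where "m = w xm - u xm"
    define \<Phi> where "\<Phi> x y = u y - u x - (norm (x - y))\<^sup>2 / (2 * \<epsilon>)" for x y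
    have \<Phi>m: "\<Phi> x y \<le> m" for x y
      using supconv_upper[OF u \<epsilon>(1), of y x] xm[of x] by (simp add: \<Phi>_def m_def w_def)
    \<comment> \<open>By periodicity x may be taken in the unit cube. The pairs near the diagonal
      then form a compact set, whose maximum is attained and hence strictly below m.\<close>
    obtain m' where m': "m' < m" "\<And>x y. norm (x - y) \<le> \<epsilon> * K0 \<Longrightarrow> \<Phi> x y \<le> m'"
    proof -
      let ?S = "cbox 0 (1 :: real ^ 'n) \<times> cball 0 (\<epsilon> * K0)"
      have "continuous_on ?S (\<lambda>(x, d). \<Phi> x (x + d))"
        unfolding \<Phi>_def split_beta using \<epsilon>
        by (intro continuous_intros continuous_on_compose2[OF cu(1)]) auto
      moreover have "(frac_vec 0, 0) \<in> ?S"
        using frac_vec_in_unit_cell[of 0] unit_cell_subset_cbox \<epsilon> K0 by auto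
      then have "?S \<noteq> {}" by (rule ex_in_conv[THEN iffD1, OF exI])
      ultimately have "\<exists>z\<in>?S. \<forall>z'\<in>?S. (\<lambda>(x, d). \<Phi> x (x + d)) z' \<le> (\<lambda>(x, d). \<Phi> x (x + d)) z"
        by (intro continuous_attains_sup compact_Times compact_cbox compact_cball)
      then obtain x0 d0 where z: "(x0, d0) \<in> ?S" "\<forall>z'\<in>?S. (\<lambda>(x, d). \<Phi> x (x + d)) z' \<le> \<Phi> x0 (x0 + d0)"
        by auto
      have "norm (x0 - (x0 + d0)) \<le> \<epsilon> * K0" using z(1) by simp
      then have "\<Phi> x0 (x0 + d0) \<noteq> m" using contra \<Phi>m unfolding \<Phi>_def by metis
      then have lt: "\<Phi> x0 (x0 + d0) < m" using \<Phi>m[of x0 "x0 + d0"] by simp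
      have "\<Phi> x y \<le> \<Phi> x0 (x0 + d0)" if xy: "norm (x - y) \<le> \<epsilon> * K0" for x y
      proof -
        define k where "k = frac_vec x - x"
        have k: "k $ i \<in> \<int>" for i using diff_frac_vec_Ints[of x i] by (simp add: k_def) (metis Ints_minus minus_diff_eq)
        have "(frac_vec x, y - x) \<in> ?S"
          using xy frac_vec_in_unit_cell[of x] unit_cell_subset_cbox by (auto simp: norm_minus_commute)
        from bspec[OF z(2) this] have "\<Phi> (frac_vec x) (frac_vec x + (y - x)) \<le> \<Phi> x0 (x0 + d0)" by simp
        moreover have "frac_vec x = x + k" "frac_vec x + (y - x) = y + k" by (simp_all add: k_def)
        moreover have "u (x + k) = u x" "u (y + k) = u y" "u (k + y) = u y"
          using torus_funD[OF cu(2) k, of x] torus_funD[OF cu(2) k, of y] by (simp_all add: add.commute[of k y])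
        ultimately show ?thesis by (simp add: \<Phi>_def del: diff_diff_eq)
      qed
      then show ?thesis using that lt by blast
    qed
    define \<rho> where "\<rho> = m - m'"
    have \<rho>: "\<rho> > 0" using m' by (simp add: \<rho>_def)
    \<comment> \<open>The gain \<open>2 * r\<close> obtained below is larger than this, as
      \<open>r > \<epsilon> * K0\<close>.\<close>
    define \<eta>0 where "\<eta>0 = 2 * \<epsilon> * K0"
    have \<eta>0: "\<eta>0 > 0" using \<epsilon> K0 by (simp add: \<eta>0_def)
    obtain d where d: "d > 0" "\<And>x z. norm (x - z) < d \<Longrightarrow> \<bar>(w x - u x) - (w z - u z)\<bar> < \<rho> / 2"
      using torus_uniformly_continuous[OF pd cd half_gt_zero[OF \<rho>]] by blast
    define \<eta> where "\<eta> = min (\<rho> / 8) (min (d / 2) (\<eta>0 / 2))"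
    have \<eta>: "\<eta> > 0" "\<eta> \<le> \<rho> / 8" "\<eta> < d" "\<eta> < \<eta>0" using \<rho> d(1) \<eta>0 by (auto simp: \<eta>_def)
    have wC0: "C0_torus w" using cw pw by (simp add: C0_torus_def)
    have conv: "w (x + h) + w (x - h) - 2 * w x \<ge> - (1 / \<epsilon>) * (norm h)\<^sup>2" for x h
      unfolding w_def by (rule supconv_semiconvex[OF u \<epsilon>(1)])
    obtain \<delta> \<psi> where \<delta>: "0 < \<delta>" "\<delta> \<le> \<eta>" and \<psi>: "C2_torus \<psi>" "\<And>x. \<bar>\<psi> x - w x\<bar> \<le> \<eta>"
      and main: "\<And>x g. \<bar>g\<bar> \<le> \<bar>c\<bar> + \<eta>0 \<Longrightarrow>
        (\<And>z p X. superjet w z p X \<Longrightarrow> norm (z - x) \<le> \<delta> \<Longrightarrow> H z p - trace (A z ** X) \<le> g) \<Longrightarrow>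
        H x (grad \<psi> x) - trace (A x ** hess \<psi> x) \<le> g + \<eta>"
      by (rule smoothing[OF wC0 K(2,1) conv _ \<eta>(1), of "\<bar>c\<bar> + \<eta>0"]) (use \<epsilon> \<eta>0 in auto)
    have "torus_fun (\<lambda>x. \<psi> x - u x)" "continuous_on UNIV (\<lambda>x. \<psi> x - u x)"
      using \<psi>(1) cu has_jet_continuous(1)[OF C2_torus_has_jet[OF \<psi>(1)]]
      by (auto simp: C2_torus_def intro: torus_fun_compose2 continuous_intros)
    then obtain x1 where x1: "\<And>x. \<psi> x - u x \<le> \<psi> x1 - u x1" using torus_attains_sup by blast
    have wx1: "w x1 - u x1 \<ge> m - 2 * \<eta>"
      using x1[of xm] \<psi>(2)[of xm] \<psi>(2)[of x1] unfolding m_def abs_le_iff by linarith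
    have "H x1 (grad \<psi> x1) - trace (A x1 ** hess \<psi> x1) \<le> (c - \<eta>0) + \<eta>"
    proof (rule main)
      show "\<bar>c - \<eta>0\<bar> \<le> \<bar>c\<bar> + \<eta>0" using \<eta>0 by linarith
      fix z p X assume jet: "superjet w z p X" and zx: "norm (z - x1) \<le> \<delta>"
      obtain y where y: "supconv \<epsilon> u z = u y - (norm (z - y))\<^sup>2 / (2 * \<epsilon>)"
        using supconv_attained[OF u \<epsilon>(1), of z] by metis
      have p: "p = (1 / \<epsilon>) *\<^sub>R (y - z)" by (rule supconv_superjet_gradient[OF u \<epsilon>(1) jet[unfolded w_def] y])
      define r where "r = norm (z - y)"
      have r: "r = \<epsilon> * norm p" "r \<ge> 0" using \<epsilon> by (auto simp: p r_def norm_minus_commute)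
      have "\<bar>(w z - u z) - (w x1 - u x1)\<bar> < \<rho> / 2" using zx \<delta> \<eta> by (intro d(2)) simp
      then have "- (w z - u z - (w x1 - u x1)) < \<rho> / 2" by (simp only: abs_less_iff)
      then have "w z - u z > m - \<rho>" using wx1 \<eta>(2) \<rho> by linarith
      moreover have "\<Phi> z y = w z - u z" using y by (simp add: \<Phi>_def w_def)
      ultimately have "\<Phi> z y > m'" by (simp add: \<rho>_def)
      then have rK: "r > \<epsilon> * K0" using m'(2)[of z y] by (auto simp: r_def not_le[symmetric])
      then have pK: "norm p > K0" using \<epsilon> by (simp add: r)
      have "r\<^sup>2 \<le> 4 * M * \<epsilon>" unfolding r_def by (rule supconv_attained_close[OF u \<epsilon>(1) M(2) y])
      also have "\<dots> \<le> 4 * M * \<epsilon>0" using \<epsilon> M by (intro mult_left_mono) auto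
      also have "\<dots> = (1 / (2 * \<beta>))\<^sup>2" using M \<beta> by (simp add: \<epsilon>0_def power2_eq_square field_simps)
      finally have "r \<le> 1 / (2 * \<beta>)" using \<beta> by (intro power2_le_imp_le[of r]) auto
      then have \<beta>r: "\<beta> * r \<le> 1 / 2" using \<beta> by (simp add: field_simps)
      have r1: "r \<le> 1" using \<beta>r \<beta> r(2) mult_right_mono[of 1 \<beta> r] by simp
      have \<gamma>r: "\<gamma> * r \<le> 1 / 2" using \<beta>r r(2) by (simp add: \<beta>_def distrib_right)
      define t where "t = trace (A z ** X)"
      define h where "h = H y p - c"
      have "(C1 + 1) * norm p \<le> H y p" using Ka(2) pK K0 by simp
      then have hlow: "h \<ge> C1 * norm p + \<gamma> * (1 + \<bar>c\<bar>) + 1"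
        using pK K0(3) unfolding h_def distrib_right by linarith
      have gc: "0 \<le> \<gamma> * (1 + \<bar>c\<bar>)" using \<gamma>_pos by simp
      have "h \<le> (1 + (- \<beta> * r))\<^sup>2 * t + (128 * (real CARD('n))\<^sup>2 * C\<^sup>2 * r\<^sup>2 + 2 * (- \<beta> * r)\<^sup>2 * T) / \<epsilon>"
        unfolding h_def t_def r_def
        by (rule supconv_superjet_scaled[OF u \<epsilon>(1) sub A_sym A_psd C(2) _ T(3) jet[unfolded w_def] y]) (use C in simp)
      also have "(128 * (real CARD('n))\<^sup>2 * C\<^sup>2 * r\<^sup>2 + 2 * (- \<beta> * r)\<^sup>2 * T) / \<epsilon> = C1 * (r * norm p)"
        using \<epsilon> by (simp add: C1_def r(1) power2_eq_square field_simps)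
      finally have ht: "h - C1 * (r * norm p) \<le> (1 - \<beta> * r)\<^sup>2 * t" by simp
      have "C1 * (r * norm p) \<le> C1 * norm p" using r1 C1 by (intro mult_left_mono) (auto simp: mult_left_le_one_le r(2))
      then have a0: "h - C1 * (r * norm p) \<ge> 0" using hlow gc by linarith
      \<comment> \<open>So division by \<open>(1 - \<beta> * r)\<^sup>2\<close> yields at least the
        factor \<open>1 + 2 * (\<beta> * r)\<close>, which is what the scaling of A gains.\<close>
      have q: "(1 + 2 * (\<beta> * r)) * (1 - \<beta> * r)\<^sup>2 \<le> 1"
      proof -
        have "(1 + 2 * (\<beta> * r)) * (1 - \<beta> * r)\<^sup>2 = 1 - (\<beta> * r)\<^sup>2 * (3 - 2 * (\<beta> * r))"
          by (simp add: power2_eq_square algebra_simps)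
        moreover have "0 \<le> (\<beta> * r)\<^sup>2 * (3 - 2 * (\<beta> * r))" using \<beta>r by (intro mult_nonneg_nonneg) auto
        ultimately show ?thesis by linarith
      qed
      have t0: "t \<ge> 0"
      proof (rule ccontr)
        assume "\<not> t \<ge> 0"
        moreover have "(1 - \<beta> * r)\<^sup>2 > 0" using \<beta>r by (intro zero_less_power) simp
        ultimately have "(1 - \<beta> * r)\<^sup>2 * t < 0" by (simp add: mult_pos_neg)
        then show False using ht a0 by linarith
      qed
      have "(1 + 2 * (\<beta> * r)) * (h - C1 * (r * norm p)) \<le> (1 + 2 * (\<beta> * r)) * ((1 - \<beta> * r)\<^sup>2 * t)"
        using ht \<beta> r(2) by (intro mult_left_mono) auto
      also have "\<dots> \<le> 1 * t" using mult_right_mono[OF q t0] by (simp only: mult.assoc)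
      finally have tlow: "(1 + 2 * (\<beta> * r)) * (h - C1 * (r * norm p)) \<le> t" by simp
      have "\<bar>H z p - H y p\<bar> \<le> 2 * \<gamma> * r * (1 + \<bar>H y p\<bar>)"
        unfolding r_def by (rule H_oscillation) (use \<gamma>r in \<open>simp add: r_def\<close>)
      also have "\<dots> \<le> 2 * \<gamma> * r * (1 + \<bar>c\<bar> + h)"
      proof (rule mult_left_mono)
        have "0 \<le> C1 * norm p" using C1 by simp
        then have "h \<ge> 0" using hlow gc by linarith
        then show "1 + \<bar>H y p\<bar> \<le> 1 + \<bar>c\<bar> + h" unfolding h_def by linarith
      qed (use \<gamma>_pos r in auto)
      finally have "H z p \<le> h + c + 2 * \<gamma> * r * (1 + \<bar>c\<bar> + h)" unfolding h_def abs_le_iff by linarith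
      then have "H z p - t \<le> h + c + 2 * \<gamma> * r * (1 + \<bar>c\<bar> + h) - (1 + 2 * (\<beta> * r)) * (h - C1 * (r * norm p))"
        using tlow by linarith
      also have "\<dots> = c + r * (2 * (\<gamma> * (1 + \<bar>c\<bar>)) - 2 * h + C1 * norm p * (1 + 2 * (\<beta> * r)))"
        by (simp add: \<beta>_def algebra_simps)
      also have "\<dots> \<le> c + r * (2 * (\<gamma> * (1 + \<bar>c\<bar>)) - 2 * h + C1 * norm p * 2)"
        using \<beta>r r(2) C1 by (intro add_left_mono mult_left_mono) auto
      also have "\<dots> \<le> c + r * (- 2)"
        using hlow r(2) by (intro add_left_mono mult_left_mono) auto
      also have "\<dots> \<le> c - \<eta>0" using rK by (simp add: \<eta>0_def)
      finally show "H z p - trace (A z ** X) \<le> c - \<eta>0" by (simp add: t_def)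
    qed
    then have "H x1 (grad \<psi> x1) < trace (A x1 ** hess \<psi> x1) + c" using \<eta>(4) by linarith
    moreover have "\<forall>\<^sub>F y in nhds x1. u y - \<psi> y \<ge> u x1 - \<psi> x1"
    proof (intro always_eventually allI)
      fix y
      show "u y - \<psi> y \<ge> u x1 - \<psi> x1" using x1[of y] by linarith
    qed
    then have "H x1 (grad \<psi> x1) \<ge> trace (A x1 ** hess \<psi> x1) + c"
      using super \<psi>(1) unfolding viscosity_supersolution_def by blast
    ultimately show False by simp
  qed
  then show ?thesis using K0(1) \<epsilon>0 by blast
qed

text \<open>The previous bound locates a maximiser but does not bound the maximum. Using the
  estimate for \<open>\<epsilon> / 2\<close> at a maximiser for \<open>\<epsilon>\<close> raises the
  constant b by only \<open>K0\<^sup>2 * \<epsilon> / 2\<close>; under repeated halving these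
  increments form a geometric series, and uniform continuity starts the iteration with arbitrarily
  small b.\<close>

lemma solution_lipschitz:
  assumes sol: "viscosity_solution H A c u"
  obtains K where "K > 0" "\<And>x z. \<bar>u x - u z\<bar> \<le> K * norm (x - z)"
proof -
  have u: "C0_torus u" using sol by (auto simp: viscosity_solution_def)
  have cu: "continuous_on UNIV u" "torus_fun u" using u by (auto simp: C0_torus_def)
  obtain M where M: "M > 0" "\<And>x. \<bar>u x\<bar> \<le> M" using torus_bounded[OF cu(2,1)] unfolding real_norm_def by blast
  obtain K0 \<epsilon>0 where K0: "K0 > 0" and \<epsilon>0: "\<epsilon>0 > 0" and key: "\<And>\<epsilon>. 0 < \<epsilon> \<Longrightarrow> \<epsilon> \<le> \<epsilon>0 \<Longrightarrow>
    \<exists>x y. norm (x - y) \<le> \<epsilon> * K0 \<and>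
      (\<forall>x' y'. u y' - u x' - (norm (x' - y'))\<^sup>2 / (2 * \<epsilon>) \<le> u y - u x - (norm (x - y))\<^sup>2 / (2 * \<epsilon>))"
    using penalization_maximum_bound[OF sol] by blast
  define P where "P \<epsilon> b \<longleftrightarrow> (\<forall>x y. u y - u x \<le> (norm (x - y))\<^sup>2 / (2 * \<epsilon>) + b)" for \<epsilon> b :: real
  have Pmono: "P \<epsilon> b \<Longrightarrow> b \<le> b' \<Longrightarrow> P \<epsilon> b'" for \<epsilon> b b'
    unfolding P_def by (meson add_left_mono order_trans)
  have step: "P \<epsilon> (b + K0\<^sup>2 * \<epsilon> / 2)" if \<epsilon>: "0 < \<epsilon>" "\<epsilon> \<le> \<epsilon>0" and P: "P (\<epsilon> / 2) b" for \<epsilon> b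
  proof -
    obtain x y where xy: "norm (x - y) \<le> \<epsilon> * K0"
      "\<And>x' y'. u y' - u x' - (norm (x' - y'))\<^sup>2 / (2 * \<epsilon>) \<le> u y - u x - (norm (x - y))\<^sup>2 / (2 * \<epsilon>)"
      using key[OF \<epsilon>] by blast
    have "u y - u x \<le> (norm (x - y))\<^sup>2 / \<epsilon> + b" using P unfolding P_def by simp
    moreover have "(norm (x - y))\<^sup>2 / \<epsilon> = 2 * ((norm (x - y))\<^sup>2 / (2 * \<epsilon>))" by simp
    moreover have "(norm (x - y))\<^sup>2 / (2 * \<epsilon>) \<le> K0\<^sup>2 * \<epsilon> / 2"
    proof -
      have "(norm (x - y))\<^sup>2 \<le> (\<epsilon> * K0)\<^sup>2" using xy(1) by (intro power_mono) auto
      then have "(norm (x - y))\<^sup>2 / (2 * \<epsilon>) \<le> (\<epsilon> * K0)\<^sup>2 / (2 * \<epsilon>)" using \<epsilon> by (intro divide_right_mono) auto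
      then show ?thesis using \<epsilon> by (simp add: power2_eq_square field_simps)
    qed
    ultimately have v: "u y - u x - (norm (x - y))\<^sup>2 / (2 * \<epsilon>) \<le> b + K0\<^sup>2 * \<epsilon> / 2" by linarith
    show ?thesis unfolding P_def
    proof (intro allI)
      fix x' y'
      show "u y' - u x' \<le> (norm (x' - y'))\<^sup>2 / (2 * \<epsilon>) + (b + K0\<^sup>2 * \<epsilon> / 2)" using xy(2)[of y' x'] v by linarith
    qed
  qed
  have iter: "P \<epsilon> (b + K0\<^sup>2 * \<epsilon>)" if \<epsilon>: "0 < \<epsilon>" "\<epsilon> \<le> \<epsilon>0" and P: "P (\<epsilon> / 2 ^ k) b" for \<epsilon> b k
  proof -
    have *: "P \<epsilon> (b + K0\<^sup>2 * \<epsilon> * (1 - 1 / 2 ^ k))" using \<epsilon> P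
    proof (induction k arbitrary: \<epsilon>)
      case (Suc k)
      have "P (\<epsilon> / 2) (b + K0\<^sup>2 * (\<epsilon> / 2) * (1 - 1 / 2 ^ k))"
        by (rule Suc.IH) (use Suc.prems in auto)
      from step[OF Suc.prems(1,2) this]
      have S: "P \<epsilon> (b + K0\<^sup>2 * (\<epsilon> / 2) * (1 - 1 / 2 ^ k) + K0\<^sup>2 * \<epsilon> / 2)" .
      have E: "b + K0\<^sup>2 * (\<epsilon> / 2) * (1 - 1 / 2 ^ k) + K0\<^sup>2 * \<epsilon> / 2 = b + K0\<^sup>2 * \<epsilon> * (1 - 1 / 2 ^ Suc k)"
        by (simp add: field_simps)
      show ?case using S unfolding E .
    qed simp
    have "K0\<^sup>2 * \<epsilon> * (1 - 1 / 2 ^ k) \<le> K0\<^sup>2 * \<epsilon> * 1" using \<epsilon> by (intro mult_left_mono) auto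
    then show ?thesis by (intro Pmono[OF *]) simp
  qed
  have Pe: "P \<epsilon> (K0\<^sup>2 * \<epsilon>)" if \<epsilon>: "0 < \<epsilon>" "\<epsilon> \<le> \<epsilon>0" for \<epsilon>
    unfolding P_def
  proof (intro allI, rule field_le_epsilon)
    fix x y and e :: real assume e: "e > 0"
    obtain d where d: "d > 0" "\<And>x z. norm (x - z) < d \<Longrightarrow> \<bar>u x - u z\<bar> < e"
      using torus_uniformly_continuous[OF cu(2,1) e] by blast
    have "(\<lambda>k. \<epsilon> / 2 ^ k) \<longlonglongrightarrow> 0"
      using tendsto_mult_right_zero[OF LIMSEQ_power_zero[of "1/2 :: real"], of \<epsilon>] by (simp add: power_divide)
    then have "\<forall>\<^sub>F k in sequentially. \<epsilon> / 2 ^ k < d\<^sup>2 / (4 * M)"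
      by (rule order_tendstoD(2)) (use d M in auto)
    then obtain k where k: "\<epsilon> / 2 ^ k < d\<^sup>2 / (4 * M)" using eventually_happens'[OF sequentially_bot] by blast
    have "P (\<epsilon> / 2 ^ k) e"
      unfolding P_def
    proof (intro allI)
      fix x y
      show "u y - u x \<le> (norm (x - y))\<^sup>2 / (2 * (\<epsilon> / 2 ^ k)) + e"
      proof (cases "norm (x - y) < d")
        case True
        have "0 \<le> (norm (x - y))\<^sup>2 / (2 * (\<epsilon> / 2 ^ k))" using \<epsilon> by simp
        then show ?thesis using d(2)[OF True] by linarith
      next
        case False
        then have "d\<^sup>2 \<le> (norm (x - y))\<^sup>2" using d(1) by (intro power_mono) auto
        moreover have "4 * M * (\<epsilon> / 2 ^ k) < d\<^sup>2" using k M by (simp add: pos_less_divide_eq mult.commute)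
        ultimately have "2 * M * (2 * (\<epsilon> / 2 ^ k)) \<le> (norm (x - y))\<^sup>2" by linarith
        then have "2 * M \<le> (norm (x - y))\<^sup>2 / (2 * (\<epsilon> / 2 ^ k))" using \<epsilon> by (subst pos_le_divide_eq) auto
        then show ?thesis using M(2)[of x] M(2)[of y] e unfolding abs_le_iff by linarith
      qed
    qed
    from iter[OF \<epsilon> this] have "u y - u x \<le> (norm (x - y))\<^sup>2 / (2 * \<epsilon>) + (e + K0\<^sup>2 * \<epsilon>)"
      unfolding P_def by blast
    then show "u y - u x \<le> (norm (x - y))\<^sup>2 / (2 * \<epsilon>) + K0\<^sup>2 * \<epsilon> + e" by simp
  qed
  define K where "K = 2 * K0 + 2 * M / (K0 * \<epsilon>0)"
  have half: "u y - u x \<le> K * norm (x - y)" for x y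
  proof (cases "x = y")
    case False
    define r where "r = norm (x - y)"
    have r: "r > 0" using False by (simp add: r_def)
    have "0 \<le> 2 * M / (K0 * \<epsilon>0)" using M K0 \<epsilon>0 by simp
    show ?thesis
    proof (cases "r / K0 \<le> \<epsilon>0")
      case True
      \<comment> \<open>With r / K0 in the role of \<open>\<epsilon>\<close> both terms of the
        estimate are of order K0 r.\<close>
      have "P (r / K0) (K0\<^sup>2 * (r / K0))" by (rule Pe) (use True r K0 in auto)
      then have "u y - u x \<le> r\<^sup>2 / (2 * (r / K0)) + K0\<^sup>2 * (r / K0)" by (simp add: P_def r_def)
      also have "\<dots> = K0 * r / 2 + K0 * r" using r K0 by (simp add: power2_eq_square)
      also have "\<dots> \<le> 2 * K0 * r" using r K0 by simp
      also have "\<dots> \<le> K * r" using r \<open>0 \<le> 2 * M / (K0 * \<epsilon>0)\<close> unfolding K_def by (intro mult_right_mono) auto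
      finally show ?thesis by (simp add: r_def)
    next
      case False
      then have "K0 * \<epsilon>0 \<le> r" using K0 by (simp add: field_simps)
      then have "2 * M / (K0 * \<epsilon>0) * (K0 * \<epsilon>0) \<le> 2 * M / (K0 * \<epsilon>0) * r" using \<open>0 \<le> 2 * M / (K0 * \<epsilon>0)\<close> by (rule mult_left_mono)
      then have "2 * M \<le> 2 * M / (K0 * \<epsilon>0) * r" using K0 \<epsilon>0 by simp
      also have "\<dots> \<le> K * r" using r K0 unfolding K_def by (intro mult_right_mono) auto
      finally have "2 * M \<le> K * r" .
      then show ?thesis using M(2)[of x] M(2)[of y] unfolding r_def abs_le_iff by linarith
    qed
  qed simp
  have "\<bar>u x - u z\<bar> \<le> K * norm (x - z)" for x z
    using half[of x z] half[of z x] by (simp add: norm_minus_commute abs_le_iff)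
  moreover have "K > 0" using K0 M \<epsilon>0 by (simp add: K_def add_pos_pos)
  ultimately show ?thesis using that by blast
qed

text \<open>For Lipschitz u the optimal point is within \<open>2 * K * \<epsilon>\<close> of x,
  instead of order sqrt \<open>\<epsilon>\<close>. The error |x - y|^2 / \<open>\<epsilon>\<close>
  from the square roots of A, the oscillation of H and |w - u| are then all
  O(\<open>\<epsilon>\<close>), with total constant C2.\<close>

theorem smooth_subsolution_approximation:
  assumes sol: "viscosity_solution H A c u" and \<eta>: "\<eta> > 0"
  obtains \<psi> where "C2_torus \<psi>" "\<And>x. \<bar>\<psi> x - u x\<bar> \<le> \<eta>"
    "\<And>x. H x (grad \<psi> x) - trace (A x ** hess \<psi> x) \<le> c + \<eta>"
proof -
  have u: "C0_torus u" and sub: "viscosity_subsolution H A c u" using sol by (auto simp: viscosity_solution_def)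
  obtain K where K: "K > 0" "\<And>x z. \<bar>u x - u z\<bar> \<le> K * norm (x - z)" using solution_lipschitz[OF sol] by blast
  obtain M where M: "M > 0" "\<And>x p. norm p \<le> 2 * K \<Longrightarrow> \<bar>H x p\<bar> \<le> M" using H_bounded by blast
  obtain T where T: "T > 0" "\<And>x. trace (A x) \<le> T" using trace_A_bounded by blast
  obtain C where C: "C > 0"
    "\<And>x z y. \<bar>sqrt (y \<bullet> (A x *v y)) - sqrt (y \<bullet> (A z *v y))\<bar> \<le> C * norm (x - z) * norm y"
    using A_sqrt_lipschitz by blast
  define n where "n = 128 * (real CARD('n))\<^sup>2 * C\<^sup>2"
  have n: "n \<ge> 0" by (simp add: n_def)
  define C2 where "C2 = n * (4 * K\<^sup>2) + 4 * \<gamma> * K * (1 + M) + 2 * K\<^sup>2"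
  have C2: "C2 > 0" using n K \<gamma>_pos M by (simp add: C2_def add_nonneg_pos add_pos_pos)
  define \<epsilon> where "\<epsilon> = min (\<eta> / (2 * C2)) (1 / (4 * \<gamma> * K))"
  have \<epsilon>: "\<epsilon> > 0" using \<eta> C2 \<gamma>_pos K by (simp add: \<epsilon>_def)
  have \<epsilon>1: "C2 * \<epsilon> \<le> \<eta> / 2" "2 * \<gamma> * K * \<epsilon> \<le> 1 / 2"
  proof -
    have "C2 * \<epsilon> \<le> C2 * (\<eta> / (2 * C2))" using C2 by (intro mult_left_mono) (auto simp: \<epsilon>_def)
    then show "C2 * \<epsilon> \<le> \<eta> / 2" using C2 by simp
    have "2 * \<gamma> * K * \<epsilon> \<le> 2 * \<gamma> * K * (1 / (4 * \<gamma> * K))" using \<gamma>_pos K by (intro mult_left_mono) (auto simp: \<epsilon>_def)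
    then show "2 * \<gamma> * K * \<epsilon> \<le> 1 / 2" using \<gamma>_pos K by simp
  qed
  define w where "w = supconv \<epsilon> u"
  have rb: "norm (x - y) \<le> 2 * K * \<epsilon>" if y: "supconv \<epsilon> u x = u y - (norm (x - y))\<^sup>2 / (2 * \<epsilon>)" for x y
  proof -
    have "(norm (x - y))\<^sup>2 / (2 * \<epsilon>) \<le> K * norm (x - y)"
      using y supconv_ge[OF u \<epsilon>, of x] K(2)[of x y] by (simp add: abs_le_iff)
    then have "norm (x - y) * norm (x - y) \<le> 2 * K * \<epsilon> * norm (x - y)" using \<epsilon> by (simp add: power2_eq_square field_simps)
    then show ?thesis using K \<epsilon> by (cases "x = y") auto
  qed
  obtain K' where K': "K' \<ge> 0" "\<And>x z. \<bar>w x - w z\<bar> \<le> K' * norm (x - z)"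
    unfolding w_def using supconv_lipschitz[OF u \<epsilon>] by blast
  have "K'-lipschitz_on UNIV w" by (rule lipschitz_onI) (use K' in \<open>auto simp: dist_norm\<close>)
  then have wC0: "C0_torus w" unfolding C0_torus_def using supconv_torus_fun[OF u \<epsilon>]
    by (simp add: w_def lipschitz_on_continuous_on)
  have conv: "w (x + h) + w (x - h) - 2 * w x \<ge> - (1 / \<epsilon>) * (norm h)\<^sup>2" for x h
    unfolding w_def by (rule supconv_semiconvex[OF u \<epsilon>])
  have wu: "\<bar>w x - u x\<bar> \<le> \<eta> / 2" for x
  proof -
    obtain y where y: "supconv \<epsilon> u x = u y - (norm (x - y))\<^sup>2 / (2 * \<epsilon>)"
      using supconv_attained[OF u \<epsilon>, of x] by metis
    have "0 \<le> (norm (x - y))\<^sup>2 / (2 * \<epsilon>)" using \<epsilon> by simp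
    then have "w x - u x \<le> K * norm (x - y)" using y K(2)[of x y] unfolding w_def abs_le_iff by linarith
    also have "\<dots> \<le> K * (2 * K * \<epsilon>)" using rb[OF y] K by (intro mult_left_mono) auto
    also have "\<dots> = 2 * K\<^sup>2 * \<epsilon>" by (simp add: power2_eq_square)
    also have "\<dots> \<le> C2 * \<epsilon>" using \<epsilon> n K \<gamma>_pos M unfolding C2_def by (intro mult_right_mono) auto
    finally show ?thesis using \<epsilon>1(1) supconv_ge[OF u \<epsilon>, of x] by (simp add: w_def)
  qed
  have jets: "H z p - trace (A z ** X) \<le> c + \<eta> / 2" if jet: "superjet w z p X" for z p X
  proof -
    obtain y where y: "supconv \<epsilon> u z = u y - (norm (z - y))\<^sup>2 / (2 * \<epsilon>)"
      using supconv_attained[OF u \<epsilon>, of z] by metis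
    have p: "p = (1 / \<epsilon>) *\<^sub>R (y - z)" by (rule supconv_superjet_gradient[OF u \<epsilon> jet[unfolded w_def] y])
    define r where "r = norm (z - y)"
    have r: "0 \<le> r" "r \<le> 2 * K * \<epsilon>" using rb[OF y] by (auto simp: r_def)
    have "norm p = r / \<epsilon>" using \<epsilon> by (simp add: p r_def norm_minus_commute)
    then have pK: "norm p \<le> 2 * K" using r(2) \<epsilon> by (simp add: pos_divide_le_eq)
    have "H y p - c \<le> (1 + 0)\<^sup>2 * trace (A z ** X) + (128 * (real CARD('n))\<^sup>2 * C\<^sup>2 * r\<^sup>2 + 2 * 0\<^sup>2 * T) / \<epsilon>"
      unfolding r_def
      by (rule supconv_superjet_scaled[OF u \<epsilon> sub A_sym A_psd C(2) _ T(2) jet[unfolded w_def] y]) (use C in simp)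
    then have 1: "H y p - c \<le> trace (A z ** X) + n * r\<^sup>2 / \<epsilon>" by (simp add: n_def)
    have "n * r\<^sup>2 / \<epsilon> \<le> n * (2 * K * \<epsilon>)\<^sup>2 / \<epsilon>" using r n \<epsilon> by (intro divide_right_mono mult_left_mono power_mono) auto
    also have "\<dots> = n * (4 * K\<^sup>2) * \<epsilon>" using \<epsilon> by (simp add: power2_eq_square)
    finally have 2: "n * r\<^sup>2 / \<epsilon> \<le> n * (4 * K\<^sup>2) * \<epsilon>" .
    have "\<gamma> * r \<le> \<gamma> * (2 * K * \<epsilon>)" using r \<gamma>_pos by (intro mult_left_mono) auto
    then have "\<gamma> * r \<le> 1 / 2" using \<epsilon>1(2) by (simp add: mult_ac)
    then have "\<bar>H z p - H y p\<bar> \<le> 2 * \<gamma> * r * (1 + \<bar>H y p\<bar>)" unfolding r_def by (rule H_oscillation)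
    also have "\<dots> \<le> 2 * \<gamma> * (2 * K * \<epsilon>) * (1 + M)" using r \<gamma>_pos M(2)[OF pK, of y] by (intro mult_mono) auto
    finally have 3: "H z p \<le> H y p + 4 * \<gamma> * K * (1 + M) * \<epsilon>" by (simp add: abs_le_iff mult_ac)
    have "0 \<le> 2 * K\<^sup>2 * \<epsilon>" using \<epsilon> by simp
    then have "n * (4 * K\<^sup>2) * \<epsilon> + 4 * \<gamma> * K * (1 + M) * \<epsilon> \<le> C2 * \<epsilon>" by (simp add: C2_def distrib_right)
    then show ?thesis using 1 2 3 \<epsilon>1(1) by linarith
  qed
  obtain \<delta> \<psi> where \<psi>: "C2_torus \<psi>" "\<And>x. \<bar>\<psi> x - w x\<bar> \<le> \<eta> / 2"
    and main: "\<And>x g. \<bar>g\<bar> \<le> \<bar>c\<bar> + \<eta> \<Longrightarrow>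
        (\<And>z p X. superjet w z p X \<Longrightarrow> norm (z - x) \<le> \<delta> \<Longrightarrow> H z p - trace (A z ** X) \<le> g) \<Longrightarrow>
        H x (grad \<psi> x) - trace (A x ** hess \<psi> x) \<le> g + \<eta> / 2"
    by (rule smoothing[OF wC0 K'(2,1) conv, of "\<eta> / 2" "\<bar>c\<bar> + \<eta>"]) (use \<epsilon> \<eta> in auto)
  have "\<bar>\<psi> x - u x\<bar> \<le> \<eta>" for x using \<psi>(2)[of x] wu[of x] unfolding abs_le_iff by linarith
  moreover have "H x (grad \<psi> x) - trace (A x ** hess \<psi> x) \<le> c + \<eta>" for x
  proof -
    have "\<bar>c + \<eta> / 2\<bar> \<le> \<bar>c\<bar> + \<eta>" using \<eta> abs_triangle_ineq[of c "\<eta> / 2"] by simp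
    from main[OF this jets, of x] show ?thesis by simp
  qed
  ultimately show ?thesis using that \<psi>(1) by blast
qed

end

section \<open>Weak compactness and separation\<close>

text \<open>
  \<open>\<alpha>\<close> is the ternary code of the memberships in countably many small balls. It transports measures on a
  compact set of any dimension to the real line, where Helly's and Skorohod's theorems apply.
\<close>

lemma compact_code:
  fixes K :: "'a::metric_space set"
  assumes K: "compact K" "K \<noteq> {}"
  shows "\<exists>\<alpha> :: 'a \<Rightarrow> real. (\<forall>z. 0 \<le> \<alpha> z \<and> \<alpha> z \<le> 2) \<and>
    (\<forall>e>0. \<exists>d>0. \<forall>z\<in>K. \<forall>z'\<in>K. \<bar>\<alpha> z - \<alpha> z'\<bar> < d \<longrightarrow> dist z z' < e)"
proof -
  have "\<forall>j. \<exists>F. finite F \<and> F \<subseteq> K \<and> K \<subseteq> (\<Union>x\<in>F. ball x (1 / real (Suc j)))"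
  proof
    fix j
    show "\<exists>F. finite F \<and> F \<subseteq> K \<and> K \<subseteq> (\<Union>x\<in>F. ball x (1 / real (Suc j)))"
      by (rule compactE_image[OF K(1), of K "\<lambda>x. ball x (1 / real (Suc j))"]) (auto intro: exI)
  qed
  then obtain F where F: "\<And>j. finite (F j)" "\<And>j. K \<subseteq> (\<Union>x\<in>F j. ball x (1 / real (Suc j)))" by metis
  define \<B> where "\<B> = (\<Union>j. (\<lambda>x. ball x (1 / real (Suc j))) ` F j)"
  have cB: "countable \<B>" unfolding \<B>_def using F(1) by (intro countable_UN) (auto intro: countable_finite)
  have neB: "\<B> \<noteq> {}" using F(2)[of 0] K(2) by (auto simp: \<B>_def)
  define B where "B = from_nat_into \<B>"
  define ind where "ind m z = (if z \<in> B m then 1 else 0 :: real)" for m z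
  \<comment> \<open>Base 3 with digits 0 and 1: the first differing digit, at place k, contributes
    3^-k, and the tail changes this by at most half. So close codes force equal initial
    digits.\<close>
  define \<alpha> where "\<alpha> z = (\<Sum>m. ind m z * (1/3) ^ m)" for z
  have geo: "summable (\<lambda>m. (1/3 :: real) ^ m)" by (intro summable_geometric) simp
  have sum: "summable (\<lambda>m. ind m z * (1/3) ^ m)" for z
    by (rule summable_comparison_test'[OF geo, of 0]) (auto simp: ind_def)
  have "0 \<le> \<alpha> z \<and> \<alpha> z \<le> 2" for z
  proof
    show "0 \<le> \<alpha> z" unfolding \<alpha>_def by (intro suminf_nonneg sum) (simp add: ind_def)
    have "\<alpha> z \<le> (\<Sum>m. (1/3 :: real) ^ m)" unfolding \<alpha>_def by (intro suminf_le sum geo) (simp add: ind_def)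
    also have "\<dots> = 3/2" by (subst suminf_geometric) auto
    finally show "\<alpha> z \<le> 2" by simp
  qed
  moreover have "\<exists>d>0. \<forall>z\<in>K. \<forall>z'\<in>K. \<bar>\<alpha> z - \<alpha> z'\<bar> < d \<longrightarrow> dist z z' < e" if e: "e > 0" for e
  proof -
    obtain j :: nat where j: "2 / real (Suc j) < e"
    proof -
      obtain j where "2 / e < real j" using reals_Archimedean2 by blast
      then have "2 / e < real (Suc j)" by simp
      then have "2 / real (Suc j) < e" using e by (simp add: field_simps)
      then show ?thesis using that by blast
    qed
    \<comment> \<open>The digits of the finitely many balls of radius 1/(j + 1) that cover K; M
      bounds their places. Points of K agreeing in these digits share one such ball.\<close>
    define I where "I = (\<lambda>x. to_nat_on \<B> (ball x (1 / real (Suc j)))) ` F j"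
    obtain M where M: "\<And>i. i \<in> I \<Longrightarrow> i < M"
      using finite_nat_set_iff_bounded[of I] F(1) by (auto simp: I_def)
    have "dist z z' < e" if z: "z \<in> K" "z' \<in> K" and close: "\<bar>\<alpha> z - \<alpha> z'\<bar> < (1/2) * (1/3) ^ M" for z z'
    proof -
      have same: "ind m z = ind m z'" if "m < M" for m
      proof (rule ccontr)
        assume "ind m z \<noteq> ind m z'"
        define k where "k = (LEAST m. ind m z \<noteq> ind m z')"
        have k: "ind k z \<noteq> ind k z'" unfolding k_def by (rule LeastI) fact
        have kle: "k \<le> m" unfolding k_def by (rule Least_le) fact
        have below: "ind i z = ind i z'" if "i < k" for i using not_less_Least that unfolding k_def by blast
        define f where "f i = ind i z * (1/3) ^ i - ind i z' * (1/3) ^ i" for i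
        have sf: "summable f" unfolding f_def by (intro summable_diff sum)
        have fb: "\<bar>f i\<bar> \<le> (1/3) ^ i" for i by (auto simp: f_def ind_def)
        have "\<alpha> z - \<alpha> z' = (\<Sum>i. f i)" unfolding \<alpha>_def f_def by (rule suminf_diff[OF sum sum])
        also have "\<dots> = (\<Sum>i. f (i + Suc k)) + (\<Sum>i<Suc k. f i)" by (rule suminf_split_initial_segment[OF sf])
        also have "(\<Sum>i<Suc k. f i) = f k" using below by (simp add: f_def)
        finally have eq: "\<alpha> z - \<alpha> z' = (\<Sum>i. f (i + Suc k)) + f k" .
        have gk: "summable (\<lambda>i. (1/3 :: real) ^ (i + Suc k))" using geo by (rule summable_ignore_initial_segment)
        have "\<bar>\<Sum>i. f (i + Suc k)\<bar> \<le> (\<Sum>i. (1/3) ^ (i + Suc k))"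
        proof -
          have s: "summable (\<lambda>i. \<bar>f (i + Suc k)\<bar>)"
          proof (rule summable_comparison_test'[OF gk, of 0])
            fix n show "norm \<bar>f (n + Suc k)\<bar> \<le> (1/3) ^ (n + Suc k)" using fb[of "n + Suc k"] by (simp del: power_Suc add_Suc_right)
          qed
          have "\<bar>\<Sum>i. f (i + Suc k)\<bar> \<le> (\<Sum>i. \<bar>f (i + Suc k)\<bar>)" by (rule summable_rabs[OF s])
          also have "\<dots> \<le> (\<Sum>i. (1/3) ^ (i + Suc k))" by (intro suminf_le s gk) (rule fb)
          finally show ?thesis .
        qed
        also have "(\<Sum>i. (1/3 :: real) ^ (i + Suc k)) = (\<Sum>i. (1/3) ^ Suc k * (1/3) ^ i)"
          by (simp add: power_add mult_ac)
        also have "\<dots> = (1/3) ^ Suc k * (3/2)"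
          by (subst suminf_mult[OF geo]) (subst suminf_geometric, auto)
        finally have "\<bar>\<Sum>i. f (i + Suc k)\<bar> \<le> (1/2) * (1/3) ^ k" by simp
        moreover have "\<bar>f k\<bar> = (1/3) ^ k" using k by (auto simp: f_def ind_def split: if_splits)
        ultimately have "(1/2) * (1/3) ^ k \<le> \<bar>\<alpha> z - \<alpha> z'\<bar>" unfolding eq by linarith
        moreover have "(1/3 :: real) ^ M \<le> (1/3) ^ k" using kle that by (intro power_decreasing) auto
        ultimately show False using close by linarith
      qed
      obtain x where x: "x \<in> F j" "z \<in> ball x (1 / real (Suc j))" using F(2)[of j] z by blast
      define b where "b = ball x (1 / real (Suc j))"
      have bB: "b \<in> \<B>" using x(1) by (auto simp: \<B>_def b_def)
      have "to_nat_on \<B> b \<in> I" using x(1) by (auto simp: I_def b_def)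
      then have "ind (to_nat_on \<B> b) z = ind (to_nat_on \<B> b) z'" by (intro same M)
      moreover have "B (to_nat_on \<B> b) = b" unfolding B_def by (rule from_nat_into_to_nat_on[OF cB bB])
      ultimately have "z' \<in> b" using x(2) by (auto simp: ind_def b_def split: if_splits)
      then have "dist z z' < 1 / real (Suc j) + 1 / real (Suc j)"
        using x(2) dist_triangle[of z z' x] unfolding b_def by (simp add: dist_commute)
      then show ?thesis using j by simp
    qed
    then show ?thesis by (intro exI[of _ "(1/2) * (1/3) ^ M"]) auto
  qed
  ultimately show ?thesis by blast
qed

text \<open>The codes of random points with laws p n are tight on the line, so a subsequence is
  represented by random variables Y n converging at every point. Decoding turns Y n into Z n in K;
  close codes mean close points, so Z n is Cauchy, and \<open>\<mu>\<close> is the law of its limit.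
  Working with probability mass functions keeps the decoding map measurable, since only countably
  many codes occur.\<close>

theorem pmf_weakly_compact:
  fixes K :: "'a::euclidean_space set" and p :: "nat \<Rightarrow> 'a pmf"
  assumes K: "compact K" and p: "\<And>n. set_pmf (p n) \<subseteq> K"
  shows "\<exists>r \<mu>. strict_mono (r :: nat \<Rightarrow> nat) \<and> prob_space \<mu> \<and> sets \<mu> = sets borel \<and> (AE z in \<mu>. z \<in> K) \<and>
    (\<forall>f :: 'a \<Rightarrow> real. continuous_on UNIV f \<longrightarrow>
      (\<lambda>n. measure_pmf.expectation (p (r n)) f) \<longlonglongrightarrow> (\<integral>z. f z \<partial>\<mu>))"
proof -
  have Kne: "K \<noteq> {}" using p[of 0] set_pmf_not_empty[of "p 0"] by blast
  obtain \<alpha> :: "'a \<Rightarrow> real" where \<alpha>: "\<And>z. 0 \<le> \<alpha> z" "\<And>z. \<alpha> z \<le> 2"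
    and sep: "\<And>e. e > 0 \<Longrightarrow> \<exists>d>0. \<forall>z\<in>K. \<forall>z'\<in>K. \<bar>\<alpha> z - \<alpha> z'\<bar> < d \<longrightarrow> dist z z' < e"
    using compact_code[OF K Kne] by blast
  have inj: "inj_on \<alpha> K"
  proof (rule inj_onI, rule ccontr)
    fix z z' assume z: "z \<in> K" "z' \<in> K" "\<alpha> z = \<alpha> z'" "z \<noteq> z'"
    then obtain d where "d > 0" "\<forall>x\<in>K. \<forall>y\<in>K. \<bar>\<alpha> x - \<alpha> y\<bar> < d \<longrightarrow> dist x y < dist z z'"
      using sep[of "dist z z'"] by auto
    then have "\<bar>\<alpha> z - \<alpha> z'\<bar> < d \<longrightarrow> dist z z' < dist z z'" using z by blast
    then show False using z \<open>d > 0\<close> by simp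
  qed
  define S where "S = (\<Union>n. set_pmf (p n))"
  have cS: "countable S" unfolding S_def by auto
  have SK: "S \<subseteq> K" using p by (auto simp: S_def)
  obtain z0 where z0: "z0 \<in> K" using Kne by blast
  define T where "T = \<alpha> ` S"
  have cT: "countable T" using cS by (simp add: T_def)
  have bT: "X \<in> sets borel" if "X \<subseteq> T" for X
    using countable_subset[OF that cT] by (rule sets.countable[rotated]) simp
  \<comment> \<open>Decodes the countably many codes that occur; all other values, which have
    probability zero, go to the default point z0 of K.\<close>
  define \<beta> where "\<beta> y = (if y \<in> T then inv_into S \<alpha> y else z0)" for y
  have \<beta>\<alpha>: "\<beta> (\<alpha> z) = z" if "z \<in> S" for z
    using that inj_on_subset[OF inj SK] by (simp add: \<beta>_def T_def)
  have \<alpha>\<beta>: "\<alpha> (\<beta> y) = y" "\<beta> y \<in> S" if "y \<in> T" for y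
    using that by (auto simp: \<beta>_def T_def f_inv_into_f inv_into_into)
  have m\<beta>: "\<beta> \<in> borel_measurable borel"
  proof (rule measurableI)
    fix X :: "'a set" assume "X \<in> sets borel"
    have "\<beta> -` X \<inter> space borel = {y \<in> T. \<beta> y \<in> X} \<union> (if z0 \<in> X then - T else {})"
      by (auto simp: \<beta>_def split: if_splits)
    also have "\<dots> \<in> sets borel"
      using bT[of "{y \<in> T. \<beta> y \<in> X}"] bT[of T] by (auto intro!: sets.Un)
    finally show "\<beta> -` X \<inter> space borel \<in> sets borel" .
  qed simp
  define \<nu> where "\<nu> n = distr (measure_pmf (p n)) borel \<alpha>" for n
  have rd: "real_distribution (\<nu> n)" for n
    unfolding \<nu>_def by (intro real_distribution.intro real_distribution_axioms.intro measure_pmf.prob_space_distr) auto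
  have "tight \<nu>"
    unfolding tight_def
  proof (intro conjI allI impI rd)
    fix \<epsilon> :: real assume "\<epsilon> > 0"
    have "measure (\<nu> n) {-1<..2} = 1" for n
    proof -
      have "measure (\<nu> n) {-1<..2} = measure (measure_pmf (p n)) (\<alpha> -` {-1<..2})"
        unfolding \<nu>_def by (subst measure_distr) auto
      also have "\<alpha> -` {-1<..2} = UNIV"
      proof -
        have "-1 < \<alpha> z" for z using \<alpha>(1)[of z] by linarith
        then show ?thesis using \<alpha>(2) by auto
      qed
      finally show ?thesis by simp
    qed
    then show "\<exists>a b. a < b \<and> (\<forall>n. 1 - \<epsilon> < measure (\<nu> n) {a<..b})"
      using \<open>\<epsilon> > 0\<close> by (intro exI[of _ "-1"] exI[of _ 2]) auto
  qed
  from tight_imp_convergent_subsubsequence[OF this strict_mono_id]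
  obtain r M where r: "strict_mono (r :: nat \<Rightarrow> nat)" "real_distribution M" "weak_conv_m (\<nu> \<circ> id \<circ> r) M" by blast
  have w: "weak_conv_m (\<lambda>n. \<nu> (r n)) M" using r(3) by (simp add: o_def)
  obtain \<Omega> :: "real measure" and Y :: "nat \<Rightarrow> real \<Rightarrow> real" and Yl :: "real \<Rightarrow> real" where
    \<Omega>: "prob_space \<Omega>" and mY: "\<And>n. Y n \<in> measurable \<Omega> borel" and dY: "\<And>n. distr \<Omega> borel (Y n) = \<nu> (r n)"
    and lY: "\<And>x. x \<in> space \<Omega> \<Longrightarrow> (\<lambda>n. Y n x) \<longlonglongrightarrow> Yl x"
    using Skorohod[OF rd r(2) w] by blast
  interpret \<Omega>: prob_space \<Omega> by (rule \<Omega>)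
  have AEn: "AE \<omega> in \<Omega>. Y n \<omega> \<in> T" for n
  proof -
    have "AE y in distr (measure_pmf (p (r n))) borel \<alpha>. y \<in> T"
      using bT[of T] by (subst AE_distr_iff) (auto simp: AE_measure_pmf_iff T_def S_def)
    then have "AE y in distr \<Omega> borel (Y n). y \<in> T" unfolding dY \<nu>_def .
    then show ?thesis using bT[of T] mY by (subst (asm) AE_distr_iff) auto
  qed
  have AEall: "AE \<omega> in \<Omega>. \<forall>n. Y n \<omega> \<in> T" using AEn by (simp add: AE_all_countable)
  \<comment> \<open>Off G, that is on a null set, all Z n will be z0, so that the sequence lies in K
    and converges at every point and its limit is measurable.\<close>
  define G where "G \<omega> \<longleftrightarrow> (\<forall>n. Y n \<omega> \<in> T)" for \<omega>
  have mG: "Measurable.pred \<Omega> G"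
    unfolding G_def using mY bT[of T] by (intro pred_intros_countable pred_sets2[OF _ mY]) auto
  define Z where "Z n \<omega> = (if G \<omega> then \<beta> (Y n \<omega>) else z0)" for n \<omega>
  have mZ: "Z n \<in> borel_measurable \<Omega>" for n
    unfolding Z_def using mG mY m\<beta> by (intro measurable_If measurable_compose[OF mY m\<beta>]) (auto simp: pred_def)
  have ZK: "Z n \<omega> \<in> K" for n \<omega> using \<alpha>\<beta>(2) SK z0 by (auto simp: Z_def G_def)
  have conv: "convergent (\<lambda>n. Z n \<omega>)" if \<omega>: "\<omega> \<in> space \<Omega>" for \<omega>
  proof (cases "G \<omega>")
    case False
    then show ?thesis by (simp add: Z_def convergent_const)
  next
    case True
    then have \<alpha>Z: "\<alpha> (Z n \<omega>) = Y n \<omega>" for n by (simp add: Z_def G_def \<alpha>\<beta>)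
    have "Cauchy (\<lambda>n. Z n \<omega>)"
      unfolding Cauchy_def
    proof (intro allI impI)
      fix e :: real assume "e > 0"
      from sep[OF this] obtain d where d: "d > 0" "\<And>z z'. z \<in> K \<Longrightarrow> z' \<in> K \<Longrightarrow> \<bar>\<alpha> z - \<alpha> z'\<bar> < d \<Longrightarrow> dist z z' < e"
        by blast
      obtain N where "\<And>m n. m \<ge> N \<Longrightarrow> n \<ge> N \<Longrightarrow> dist (Y m \<omega>) (Y n \<omega>) < d"
        using LIMSEQ_imp_Cauchy[OF lY[OF \<omega>]] d(1) unfolding Cauchy_def by blast
      then show "\<exists>N. \<forall>m\<ge>N. \<forall>n\<ge>N. dist (Z m \<omega>) (Z n \<omega>) < e"
        using d(2)[OF ZK[of _ \<omega>] ZK[of _ \<omega>]] unfolding \<alpha>Z dist_real_def by blast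
    qed
    then show ?thesis by (simp add: Cauchy_convergent_iff)
  qed
  \<comment> \<open>The limit is taken in K rather than by decoding \<open>Yl\<close>, whose value
    need not be a code.\<close>
  define Zl where "Zl \<omega> = lim (\<lambda>n. Z n \<omega>)" for \<omega>
  have lZ: "(\<lambda>n. Z n \<omega>) \<longlonglongrightarrow> Zl \<omega>" if "\<omega> \<in> space \<Omega>" for \<omega>
    using conv[OF that] by (simp add: Zl_def convergent_LIMSEQ_iff)
  have mZl: "Zl \<in> borel_measurable \<Omega>" by (rule borel_measurable_LIMSEQ_metric[OF mZ lZ])
  have ZlK: "Zl \<omega> \<in> K" if "\<omega> \<in> space \<Omega>" for \<omega>
    using closed_sequentially[OF compact_imp_closed[OF K] ZK lZ[OF that]] .
  define \<mu> where "\<mu> = distr \<Omega> borel Zl"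
  have "prob_space \<mu>" unfolding \<mu>_def by (rule \<Omega>.prob_space_distr[OF mZl])
  moreover have "AE z in \<mu>. z \<in> K"
    unfolding \<mu>_def using compact_imp_closed[OF K] mZl ZlK by (subst AE_distr_iff) (auto intro: borel_closed)
  moreover have "(\<lambda>n. measure_pmf.expectation (p (r n)) f) \<longlonglongrightarrow> (\<integral>z. f z \<partial>\<mu>)" if f: "continuous_on UNIV f" for f :: "'a \<Rightarrow> real"
  proof -
    have mf: "f \<in> borel_measurable borel" using f by (rule borel_measurable_continuous_onI)
    have E: "measure_pmf.expectation (p (r n)) f = (\<integral>\<omega>. f (Z n \<omega>) \<partial>\<Omega>)" for n
    proof -
      have "(\<integral>\<omega>. f (Z n \<omega>) \<partial>\<Omega>) = (\<integral>\<omega>. f (\<beta> (Y n \<omega>)) \<partial>\<Omega>)"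
      proof (rule integral_cong_AE)
        show "AE \<omega> in \<Omega>. f (Z n \<omega>) = f (\<beta> (Y n \<omega>))" using AEall by eventually_elim (simp add: Z_def G_def)
      qed (use measurable_compose[OF mZ mf] measurable_compose[OF measurable_compose[OF mY m\<beta>] mf] in auto)
      also have "\<dots> = (\<integral>y. f (\<beta> y) \<partial>distr \<Omega> borel (Y n))"
        using measurable_compose[OF m\<beta> mf] mY by (subst integral_distr) auto
      also have "\<dots> = (\<integral>z. f (\<beta> (\<alpha> z)) \<partial>measure_pmf (p (r n)))"
        unfolding dY \<nu>_def using measurable_compose[OF m\<beta> mf] by (subst integral_distr) auto
      also have "\<dots> = measure_pmf.expectation (p (r n)) f"
      proof (rule integral_cong_AE)
        have "\<beta> (\<alpha> z) = z" if "z \<in> set_pmf (p (r n))" for z using that by (intro \<beta>\<alpha>) (auto simp: S_def)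
        then show "AE z in measure_pmf (p (r n)). f (\<beta> (\<alpha> z)) = f z" by (simp add: AE_measure_pmf_iff)
      qed auto
      finally show ?thesis by simp
    qed
    have "bounded (f ` K)" using compact_imp_bounded[OF compact_continuous_image[OF continuous_on_subset[OF f] K]] by simp
    then obtain C where C: "\<And>z. z \<in> K \<Longrightarrow> norm (f z) \<le> C" unfolding bounded_iff by blast
    have "(\<lambda>n. \<integral>\<omega>. f (Z n \<omega>) \<partial>\<Omega>) \<longlonglongrightarrow> (\<integral>\<omega>. f (Zl \<omega>) \<partial>\<Omega>)"
    proof (rule integral_dominated_convergence[where w="\<lambda>_. C"])
      show "AE \<omega> in \<Omega>. (\<lambda>n. f (Z n \<omega>)) \<longlonglongrightarrow> f (Zl \<omega>)"
        using lZ f by (intro AE_I2) (auto intro: continuous_on_tendsto_compose[OF f])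
      show "AE \<omega> in \<Omega>. norm (f (Z n \<omega>)) \<le> C" for n using C ZK by (intro AE_I2) auto
    qed (use measurable_compose[OF mZ mf] measurable_compose[OF mZl mf] in auto)
    also have "(\<integral>\<omega>. f (Zl \<omega>) \<partial>\<Omega>) = (\<integral>z. f z \<partial>\<mu>)"
      unfolding \<mu>_def using mf mZl by (subst integral_distr) auto
    finally show ?thesis by (simp add: E)
  qed
  ultimately show ?thesis using r(1) by (intro exI[of _ r] exI[of _ \<mu>]) (auto simp: \<mu>_def)
qed

text \<open>The dense set has to consist of members of F. For each accuracy m, scale j and list l of
  rounded values on a finite net, one member of F with these data is chosen, if there is any; two
  members sharing the data differ by less than 3/(m + 1) on K.\<close>

lemma continuous_functions_separable:
  fixes F :: "('a::metric_space \<Rightarrow> real) set"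
  assumes K: "compact K" and F: "\<And>f. f \<in> F \<Longrightarrow> continuous_on K f"
  shows "\<exists>D. countable D \<and> D \<subseteq> F \<and> (\<forall>f\<in>F. \<forall>e>0. \<exists>g\<in>D. \<forall>z\<in>K. \<bar>f z - g z\<bar> < e)"
proof -
  have "\<forall>j. \<exists>L. set L \<subseteq> K \<and> K \<subseteq> (\<Union>x\<in>set L. ball x (1 / real (Suc j)))"
  proof
    fix j
    have "\<exists>F. finite F \<and> F \<subseteq> K \<and> K \<subseteq> (\<Union>x\<in>F. ball x (1 / real (Suc j)))"
      by (rule compactE_image[OF K, of K "\<lambda>x. ball x (1 / real (Suc j))"]) (auto intro: exI)
    then show "\<exists>L. set L \<subseteq> K \<and> K \<subseteq> (\<Union>x\<in>set L. ball x (1 / real (Suc j)))"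
      by (metis finite_list)
  qed
  then obtain L where L: "\<And>j. set (L j) \<subseteq> K" "\<And>j. K \<subseteq> (\<Union>x\<in>set (L j). ball x (1 / real (Suc j)))" by metis
  define Q where "Q f m j l \<longleftrightarrow> f \<in> F \<and>
    (\<forall>z\<in>K. \<forall>z'\<in>K. dist z z' < 1 / real (Suc j) \<longrightarrow> \<bar>f z - f z'\<bar> < 1 / real (Suc m)) \<and>
    map (\<lambda>z. \<lfloor>f z * real (Suc m)\<rfloor>) (L j) = l" for f m j l
  define D where "D = {SOME f. Q f m j l | m j l. \<exists>f. Q f m j l}"
  have "D \<subseteq> range (\<lambda>(m, j, l). SOME f. Q f m j l)"
  proof
    fix g assume "g \<in> D"
    then obtain m j l where "g = (SOME f. Q f m j l)" by (auto simp: D_def)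
    then show "g \<in> range (\<lambda>(m, j, l). SOME f. Q f m j l)" by (intro image_eqI[of _ _ "(m, j, l)"]) auto
  qed
  then have "countable D" by (rule countable_subset) simp
  moreover have "D \<subseteq> F"
  proof
    fix g assume "g \<in> D"
    then obtain m j l where "g = (SOME f. Q f m j l)" "\<exists>f. Q f m j l" by (auto simp: D_def)
    then have "Q g m j l" by (metis someI_ex)
    then show "g \<in> F" by (simp add: Q_def)
  qed
  moreover have "\<exists>g\<in>D. \<forall>z\<in>K. \<bar>f z - g z\<bar> < e" if f: "f \<in> F" and e: "e > 0" for f e
  proof -
    obtain m :: nat where m: "3 / real (Suc m) < e"
    proof -
      obtain m where "3 / e < real m" using reals_Archimedean2 by blast
      then have "3 / e < real (Suc m)" by simp
      then have "3 / real (Suc m) < e" using e by (simp add: field_simps)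
      then show ?thesis using that by blast
    qed
    have "uniformly_continuous_on K f" by (rule compact_uniformly_continuous[OF F[OF f] K])
    then obtain d where d: "d > 0" "\<And>z z'. z \<in> K \<Longrightarrow> z' \<in> K \<Longrightarrow> dist z z' < d \<Longrightarrow> dist (f z) (f z') < 1 / real (Suc m)"
      unfolding uniformly_continuous_on_def by (metis dist_commute of_nat_0_less_iff zero_less_Suc zero_less_divide_1_iff)
    obtain j where "1 / real (Suc j) < d" using nat_approx_posE[OF d(1)] by blast
    then have Qf: "Q f m j (map (\<lambda>z. \<lfloor>f z * real (Suc m)\<rfloor>) (L j))"
      using f d(2) unfolding Q_def dist_real_def by (meson less_trans)
    define g where "g = (SOME g. Q g m j (map (\<lambda>z. \<lfloor>f z * real (Suc m)\<rfloor>) (L j)))"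
    have Qg: "Q g m j (map (\<lambda>z. \<lfloor>f z * real (Suc m)\<rfloor>) (L j))"
      unfolding g_def by (rule someI[of "\<lambda>g. Q g m j (map (\<lambda>z. \<lfloor>f z * real (Suc m)\<rfloor>) (L j))" f]) (rule Qf)
    have "g \<in> D" unfolding D_def g_def using Qf by blast
    moreover have "\<bar>f z - g z\<bar> < e" if z: "z \<in> K" for z
    proof -
      obtain x where x: "x \<in> set (L j)" "dist z x < 1 / real (Suc j)" using L(2)[of j] z by (auto simp: dist_commute)
      have xK: "x \<in> K" using x(1) L(1) by blast
      have 1: "\<bar>f z - f x\<bar> < 1 / real (Suc m)" using Qf z xK x(2) by (simp add: Q_def)
      have 2: "\<bar>g z - g x\<bar> < 1 / real (Suc m)" using Qg z xK x(2) by (simp add: Q_def)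
      have "\<lfloor>g x * real (Suc m)\<rfloor> = \<lfloor>f x * real (Suc m)\<rfloor>"
        using Qg x(1) unfolding Q_def by (metis (mono_tags, lifting) map_eq_conv)
      then have "\<bar>g x * real (Suc m) - f x * real (Suc m)\<bar> < 1" by linarith
      then have "\<bar>g x - f x\<bar> * real (Suc m) < 1" by (simp add: left_diff_distrib[symmetric] abs_mult)
      then have 3: "\<bar>g x - f x\<bar> < 1 / real (Suc m)" by (simp add: pos_less_divide_eq)
      have "\<bar>f z - g z\<bar> < 3 * (1 / real (Suc m))" using 1 2 3 unfolding abs_less_iff by linarith
      then show ?thesis using m by simp
    qed
    ultimately show ?thesis by blast
  qed
  ultimately show ?thesis by blast
qed

text \<open>The square of the positive part is C^{1,1}; the right-hand side is its second-order
  upper bound with slope 2 max 0 x.\<close>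

lemma positive_part_square_le:
  fixes x d :: real
  shows "(max 0 (x + d))\<^sup>2 \<le> (max 0 x)\<^sup>2 + 2 * max 0 x * d + d\<^sup>2"
proof -
  have "(max 0 (x + d))\<^sup>2 \<le> (max 0 x + d)\<^sup>2"
  proof (cases "x \<ge> 0")
    case True
    then have "\<bar>max 0 (x + d)\<bar> \<le> \<bar>max 0 x + d\<bar>" by (simp add: max_def)
    then show ?thesis by (simp only: abs_le_square_iff)
  next
    case False
    then have "\<bar>max 0 (x + d)\<bar> \<le> \<bar>max 0 x + d\<bar>" by (simp add: max_def)
    then show ?thesis by (simp only: abs_le_square_iff)
  qed
  then show ?thesis by (simp add: power2_sum)
qed

text \<open>
  The multipliers come from a near minimizer \<open>p\<close> of a quadratic penalty over finitely supported
  measures: moving a little mass of \<open>p\<close> to a single point cannot lower the penalty much.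
\<close>

lemma finite_separation:
  fixes \<phi>0 \<phi>1 :: "'a \<Rightarrow> real" and b :: "nat \<Rightarrow> 'a \<Rightarrow> real"
  assumes S: "S \<noteq> {}" and bd: "\<And>z. z \<in> S \<Longrightarrow> \<bar>\<phi>0 z\<bar> \<le> C" "\<And>z. z \<in> S \<Longrightarrow> \<bar>\<phi>1 z\<bar> \<le> C" "\<And>j z. z \<in> S \<Longrightarrow> j < N \<Longrightarrow> \<bar>b j z\<bar> \<le> C"
    and \<eta>: "\<eta> > 0"
  shows "(\<exists>k0\<ge>0. \<exists>k1\<ge>0. \<exists>a. \<exists>m>0. \<forall>z\<in>S. m \<le> k0 * \<phi>0 z + k1 * \<phi>1 z + (\<Sum>j<N. a j * b j z)) \<or>
    (\<exists>p. finite (set_pmf p) \<and> set_pmf p \<subseteq> S \<and> measure_pmf.expectation p \<phi>0 \<le> \<eta> \<and> measure_pmf.expectation p \<phi>1 \<le> \<eta> \<and>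
      (\<forall>j<N. \<bar>measure_pmf.expectation p (b j)\<bar> \<le> \<eta>))"
proof -
  define \<P> where "\<P> = {p. finite (set_pmf p) \<and> set_pmf p \<subseteq> S}"
  define E where "E p f = measure_pmf.expectation p f" for p and f :: "'a \<Rightarrow> real"
  \<comment> \<open>Squared violation of the wanted constraints; only positive parts count for the
    two inequalities. Half its gradient at p gives the multipliers.\<close>
  define F where "F p = (max 0 (E p \<phi>0))\<^sup>2 + (max 0 (E p \<phi>1))\<^sup>2 + (\<Sum>j<N. (E p (b j))\<^sup>2)" for p
  show ?thesis
  proof (cases "\<exists>p\<in>\<P>. F p \<le> \<eta>\<^sup>2")
    case True
    then obtain p where p: "p \<in> \<P>" "F p \<le> \<eta>\<^sup>2" by blast
    have sn: "0 \<le> (\<Sum>j<N. (E p (b j))\<^sup>2)" by (intro sum_nonneg) simp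
    have "(max 0 (E p \<phi>0))\<^sup>2 \<le> \<eta>\<^sup>2" "(max 0 (E p \<phi>1))\<^sup>2 \<le> \<eta>\<^sup>2"
      using p(2) sn zero_le_power2[of "max 0 (E p \<phi>0)"] zero_le_power2[of "max 0 (E p \<phi>1)"] unfolding F_def by linarith+
    then have "max 0 (E p \<phi>0) \<le> \<eta>" "max 0 (E p \<phi>1) \<le> \<eta>" using \<eta> by (auto intro: power2_le_imp_le)
    moreover have "\<bar>E p (b j)\<bar> \<le> \<eta>" if j: "j < N" for j
    proof -
      have "(E p (b j))\<^sup>2 \<le> (\<Sum>j<N. (E p (b j))\<^sup>2)" using j by (intro member_le_sum) auto
      also have "\<dots> \<le> \<eta>\<^sup>2" using p(2) zero_le_power2[of "max 0 (E p \<phi>0)"] zero_le_power2[of "max 0 (E p \<phi>1)"] unfolding F_def by linarith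
      finally show ?thesis using \<eta> by (metis abs_le_square_iff abs_of_pos)
    qed
    ultimately show ?thesis using p(1) unfolding \<P>_def E_def by auto
  next
    case False
    then have big: "\<And>p. p \<in> \<P> \<Longrightarrow> F p \<ge> \<eta>\<^sup>2" by force
    obtain s where "s \<in> S" using S by blast
    then have ne: "\<P> \<noteq> {}" by (auto simp: \<P>_def intro!: exI[of _ "return_pmf s"])
    define m0 where "m0 = (INF p\<in>\<P>. F p)"
    have bdd: "bdd_below (F ` \<P>)" using big by (intro bdd_belowI2)
    have m0: "m0 \<ge> \<eta>\<^sup>2" unfolding m0_def using big by (intro cINF_greatest ne)
    then have m0p: "m0 > 0" using \<eta> zero_less_power[OF \<eta>, of 2] by linarith
    have m0F: "m0 \<le> F p" if "p \<in> \<P>" for p unfolding m0_def by (rule cINF_lower[OF bdd that])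
    have C0: "C \<ge> 0" using bd(1)[OF \<open>s \<in> S\<close>] by linarith
    \<comment> \<open>Bounds the second-order coefficient in t: N + 2 differences, each at most 2 C
      in absolute value.\<close>
    define D where "D = (real N + 2) * (2 * C)\<^sup>2 + 1"
    have D: "D > 0" using C0 by (simp add: D_def add_nonneg_pos)
    \<comment> \<open>Small enough that the second-order term t^2 D costs at most t m0 / 2; p misses
      the infimum by less than the same amount.\<close>
    define t where "t = min 1 (m0 / (2 * D))"
    have t: "0 < t" "t \<le> 1" "t * D \<le> m0 / 2"
    proof -
      show "0 < t" "t \<le> 1" using m0p D by (auto simp: t_def)
      have "t * D \<le> m0 / (2 * D) * D" using D by (intro mult_right_mono) (auto simp: t_def)
      then show "t * D \<le> m0 / 2" using D by simp
    qed
    have "\<exists>p\<in>\<P>. F p < m0 + t * m0 / 2"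
      using cINF_less_iff[OF ne bdd, of "m0 + t * m0 / 2"] t m0p unfolding m0_def by simp
    then obtain p where p: "p \<in> \<P>" "F p < m0 + t * m0 / 2" by blast
    define k0 where "k0 = max 0 (E p \<phi>0)"
    define k1 where "k1 = max 0 (E p \<phi>1)"
    have fin: "finite (set_pmf p)" and pS: "set_pmf p \<subseteq> S" using p(1) by (auto simp: \<P>_def)
    have Eb: "\<bar>E p f\<bar> \<le> C" if f: "\<And>z. z \<in> S \<Longrightarrow> \<bar>f z\<bar> \<le> C" for f
    proof -
      have "\<bar>E p f\<bar> \<le> measure_pmf.expectation p (\<lambda>z. \<bar>f z\<bar>)" unfolding E_def by (rule integral_abs_bound)
      also have "\<dots> \<le> measure_pmf.expectation p (\<lambda>z. C)"
        by (rule integral_mono_AE) (use f pS in \<open>auto simp: AE_measure_pmf_iff integrable_measure_pmf_finite[OF fin]\<close>)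
      finally show ?thesis by simp
    qed
    have "m0 / 2 \<le> k0 * \<phi>0 z + k1 * \<phi>1 z + (\<Sum>j<N. E p (b j) * b j z)" if z: "z \<in> S" for z
    proof -
      \<comment> \<open>The mixture of p with weight 1 - t and the unit mass at z with weight t,
        again finitely supported.\<close>
      define q where "q = bind_pmf (bernoulli_pmf t) (\<lambda>c. if c then return_pmf z else p)"
      have "q \<in> \<P>" using fin pS z unfolding \<P>_def q_def by (auto split: if_splits)
      have Eq: "E q f = E p f + t * (f z - E p f)" for f
      proof -
        have "E q f = (\<Sum>c\<in>UNIV. pmf (bernoulli_pmf t) c *\<^sub>R measure_pmf.expectation (if c then return_pmf z else p) f)"
          unfolding E_def q_def by (rule pmf_expectation_bind) (use fin in auto)
        also have "\<dots> = t * f z + (1 - t) * E p f" using t by (simp add: UNIV_bool E_def)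
        finally show ?thesis by (simp add: algebra_simps)
      qed
      define d0 where "d0 = \<phi>0 z - E p \<phi>0"
      define d1 where "d1 = \<phi>1 z - E p \<phi>1"
      define db where "db j = b j z - E p (b j)" for j
      have sq: "(f z - E p f)\<^sup>2 \<le> (2 * C)\<^sup>2" if f: "\<And>z. z \<in> S \<Longrightarrow> \<bar>f z\<bar> \<le> C" for f
      proof -
        have "\<bar>E p f\<bar> \<le> C" by (rule Eb) (rule f)
        then have "\<bar>f z - E p f\<bar> \<le> \<bar>2 * C\<bar>" using f[OF z] C0 by linarith
        then show ?thesis by (simp only: abs_le_square_iff)
      qed
      have "F q \<le> (k0\<^sup>2 + 2 * k0 * (t * d0) + (t * d0)\<^sup>2) + (k1\<^sup>2 + 2 * k1 * (t * d1) + (t * d1)\<^sup>2)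
          + (\<Sum>j<N. (E p (b j))\<^sup>2 + 2 * E p (b j) * (t * db j) + (t * db j)\<^sup>2)"
        unfolding F_def Eq k0_def k1_def d0_def d1_def db_def
        by (intro add_mono positive_part_square_le sum_mono) (simp add: power2_sum)
      also have "\<dots> = F p + 2 * t * (k0 * d0 + k1 * d1 + (\<Sum>j<N. E p (b j) * db j))
          + t\<^sup>2 * (d0\<^sup>2 + d1\<^sup>2 + (\<Sum>j<N. (db j)\<^sup>2))"
        by (simp add: F_def k0_def[symmetric] k1_def[symmetric] sum.distrib sum_distrib_left algebra_simps power_mult_distrib)
      also have "d0\<^sup>2 + d1\<^sup>2 + (\<Sum>j<N. (db j)\<^sup>2) \<le> D"
      proof -
        have "(\<Sum>j<N. (db j)\<^sup>2) \<le> (\<Sum>j<N. (2 * C)\<^sup>2)"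
          unfolding db_def by (intro sum_mono sq bd(3)) auto
        moreover have "d0\<^sup>2 \<le> (2 * C)\<^sup>2" "d1\<^sup>2 \<le> (2 * C)\<^sup>2" unfolding d0_def d1_def by (intro sq bd; assumption)+
        ultimately show ?thesis by (simp add: D_def algebra_simps)
      qed
      also have "k0 * d0 + k1 * d1 + (\<Sum>j<N. E p (b j) * db j)
          = (k0 * \<phi>0 z + k1 * \<phi>1 z + (\<Sum>j<N. E p (b j) * b j z)) - F p"
      proof -
        have mx: "max 0 x * x = (max 0 x)\<^sup>2" for x :: real by (simp add: max_def power2_eq_square)
        have "k0 * E p \<phi>0 = k0\<^sup>2" "k1 * E p \<phi>1 = k1\<^sup>2" unfolding k0_def k1_def by (rule mx)+
        then show ?thesis
          unfolding F_def k0_def[symmetric] k1_def[symmetric]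
          by (simp add: d0_def d1_def db_def right_diff_distrib sum_subtractf power2_eq_square[of "E p (b _)"])
      qed
      finally have "m0 \<le> F p + 2 * t * ((k0 * \<phi>0 z + k1 * \<phi>1 z + (\<Sum>j<N. E p (b j) * b j z)) - F p) + t\<^sup>2 * D"
        using m0F[OF \<open>q \<in> \<P>\<close>] t by (auto intro: order_trans mult_left_mono)
      then have 1: "2 * t * (F p - (k0 * \<phi>0 z + k1 * \<phi>1 z + (\<Sum>j<N. E p (b j) * b j z))) \<le> F p - m0 + t\<^sup>2 * D"
        by (simp add: algebra_simps)
      have "t\<^sup>2 * D \<le> t * (m0 / 2)" unfolding power2_eq_square mult.assoc using t by (intro mult_left_mono) auto
      then have "2 * t * (F p - (k0 * \<phi>0 z + k1 * \<phi>1 z + (\<Sum>j<N. E p (b j) * b j z))) \<le> t * m0"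
        using 1 p(2) by linarith
      then have "t * (2 * (F p - (k0 * \<phi>0 z + k1 * \<phi>1 z + (\<Sum>j<N. E p (b j) * b j z)))) \<le> t * m0"
        by (simp only: mult.assoc mult.left_commute)
      then have "2 * (F p - (k0 * \<phi>0 z + k1 * \<phi>1 z + (\<Sum>j<N. E p (b j) * b j z))) \<le> m0"
        using t(1) by (rule mult_le_cancel_left_pos[THEN iffD1, rotated])
      moreover have "2 * (x - y) \<le> m0 \<Longrightarrow> m0 \<le> x \<Longrightarrow> m0 / 2 \<le> y" for x y :: real by (simp add: field_simps)
      ultimately show ?thesis using m0F[OF p(1)] by blast
    qed
    then have "\<exists>k0\<ge>0. \<exists>k1\<ge>0. \<exists>a. \<exists>m>0. \<forall>z\<in>S. m \<le> k0 * \<phi>0 z + k1 * \<phi>1 z + (\<Sum>j<N. a j * b j z)"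
      using m0p by (intro exI[of _ k0] conjI exI[of _ k1] exI[of _ "\<lambda>j. E p (b j)"] exI[of _ "m0 / 2"]) (auto simp: k0_def k1_def)
    then show ?thesis by blast
  qed
qed

section \<open>The Lagrangian\<close>

context viscous_hamiltonian
begin

lemma lagrangian_bdd_above: "bdd_above (range (\<lambda>p. p \<bullet> v - H x p))"
proof -
  obtain K where K: "K > 0" "\<And>x p. norm p \<ge> K \<Longrightarrow> H x p \<ge> norm v * norm p"
    using H_coercive[of "norm v"] by blast
  obtain M where M: "M > 0" "\<And>x p. norm p \<le> K \<Longrightarrow> \<bar>H x p\<bar> \<le> M" using H_bounded[of K] by blast
  have "p \<bullet> v - H x p \<le> K * norm v + M" for p
  proof (cases "norm p \<le> K")
    case True
    have "p \<bullet> v \<le> norm p * norm v" by (rule norm_cauchy_schwarz)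
    also have "\<dots> \<le> K * norm v" using True by (intro mult_right_mono) auto
    finally show ?thesis using M(2)[OF True, of x] by linarith
  next
    case False
    have "p \<bullet> v \<le> norm v * norm p" using norm_cauchy_schwarz[of p v] by (simp add: mult.commute)
    also have "\<dots> \<le> H x p" using False by (intro K(2)) simp
    also have "\<dots> \<le> H x p + (K * norm v + M)" using K(1) M(1) by simp
    finally show ?thesis by linarith
  qed
  then show ?thesis by (intro bdd_aboveI2)
qed

lemma lagrangian_ge: "p \<bullet> v - H x p \<le> lagrangian H x v"
  unfolding lagrangian_def by (rule cSUP_upper[OF UNIV_I lagrangian_bdd_above])

lemma lagrangian_le: "(\<And>p. p \<bullet> v - H x p \<le> b) \<Longrightarrow> lagrangian H x v \<le> b"
  unfolding lagrangian_def by (rule cSUP_least) auto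

lemma lagrangian_subgradient: "subgradient x p v \<Longrightarrow> lagrangian H x v = p \<bullet> v - H x p"
proof (intro antisym lagrangian_le lagrangian_ge)
  fix q assume "subgradient x p v"
  then have "H x p + v \<bullet> (q - p) \<le> H x q" by (simp add: subgradient_def)
  then show "q \<bullet> v - H x q \<le> p \<bullet> v - H x p" by (simp add: inner_diff_right inner_commute)
qed

lemma lagrangian_periodic: "torus_fun (lagrangian H)"
  unfolding torus_fun_def lagrangian_def[abs_def] using H_shift by auto

lemma lagrangian_bounded_below:
  obtains C where "C > 0" "\<And>x v. - C \<le> lagrangian H x v"
proof -
  obtain M where M: "M > 0" "\<And>x p. norm p \<le> 0 \<Longrightarrow> \<bar>H x p\<bar> \<le> M" using H_bounded[of 0] by blast
  have "- M \<le> lagrangian H x v" for x v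
    using lagrangian_ge[of 0 v x] M(2)[of 0 x] by simp
  then show ?thesis using that M(1) by blast
qed

text \<open>For |v| <= R, momenta beyond some K cannot compete: superlinearity makes p . v - H x p
  at most \<open>- M0\<close>, which is a lower bound of L everywhere. For |p| <= K the expressions
  are Lipschitz in (x, v) with a common constant.\<close>

lemma lagrangian_locally_lipschitz:
  "\<exists>B>0. \<forall>x v x' v'. norm v \<le> R \<longrightarrow> norm v' \<le> R \<longrightarrow> \<gamma> * norm (x - x') \<le> 1 / 2 \<longrightarrow>
    lagrangian H x v \<le> lagrangian H x' v' + B * (norm (x - x') + norm (v - v'))"
proof -
  obtain M0 where M0: "M0 > 0" "\<And>x p. norm p \<le> 0 \<Longrightarrow> \<bar>H x p\<bar> \<le> M0" using H_bounded[of 0] by blast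
  obtain K0 where K0: "K0 > 0" "\<And>x p. norm p \<ge> K0 \<Longrightarrow> H x p \<ge> (\<bar>R\<bar> + M0) * norm p"
    using H_coercive[of "\<bar>R\<bar> + M0"] by blast
  define K where "K = max 1 K0"
  have K: "K \<ge> 1" "K \<ge> K0" by (auto simp: K_def)
  obtain M where M: "M > 0" "\<And>x p. norm p \<le> K \<Longrightarrow> \<bar>H x p\<bar> \<le> M" using H_bounded[of K] by blast
  define B where "B = K + 2 * \<gamma> * (1 + M)"
  have B: "B > 0" "K \<le> B" "2 * \<gamma> * (1 + M) \<le> B" using K M \<gamma>_pos by (auto simp: B_def intro: add_pos_pos)
  have "lagrangian H x v \<le> lagrangian H x' v' + B * (norm (x - x') + norm (v - v'))"
    if v: "norm v \<le> R" "norm v' \<le> R" and x: "\<gamma> * norm (x - x') \<le> 1 / 2" for x v x' v'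
  proof (rule lagrangian_le)
    fix p
    have B0: "0 \<le> B * (norm (x - x') + norm (v - v'))" using B by simp
    show "p \<bullet> v - H x p \<le> lagrangian H x' v' + B * (norm (x - x') + norm (v - v'))"
    proof (cases "norm p \<le> K")
      case True
      have "p \<bullet> (v - v') \<le> norm p * norm (v - v')" by (rule norm_cauchy_schwarz)
      also have "\<dots> \<le> B * norm (v - v')" using True B by (intro mult_right_mono) auto
      finally have 1: "p \<bullet> v - p \<bullet> v' \<le> B * norm (v - v')" by (simp add: inner_diff_right)
      have "\<bar>H x p - H x' p\<bar> \<le> 2 * \<gamma> * norm (x - x') * (1 + \<bar>H x' p\<bar>)" by (rule H_oscillation[OF x])
      also have "\<dots> \<le> 2 * \<gamma> * norm (x - x') * (1 + M)" using M(2)[OF True] \<gamma>_pos by (intro mult_left_mono) auto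
      also have "\<dots> = (2 * \<gamma> * (1 + M)) * norm (x - x')" by simp
      also have "\<dots> \<le> B * norm (x - x')" using B by (intro mult_right_mono) auto
      finally show ?thesis using 1 lagrangian_ge[of p v' x'] unfolding distrib_left by linarith
    next
      case False
      have p1: "norm p \<ge> 1" using False K by linarith
      have "p \<bullet> v \<le> norm p * norm v" by (rule norm_cauchy_schwarz)
      also have "\<dots> \<le> norm p * \<bar>R\<bar>" using v by (intro mult_left_mono) auto
      finally have "p \<bullet> v \<le> \<bar>R\<bar> * norm p" by (simp add: mult.commute)
      moreover have "H x p \<ge> \<bar>R\<bar> * norm p + M0 * norm p"
        using K0(2)[of p x] False K(2) by (simp add: distrib_right)
      moreover have "M0 * norm p \<ge> M0 * 1" using p1 M0 by (intro mult_left_mono) auto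
      ultimately have "p \<bullet> v - H x p \<le> - M0" by linarith
      also have "\<dots> \<le> lagrangian H x' v'" using lagrangian_ge[of 0 v' x'] M0(2)[of 0 x'] by simp
      finally show ?thesis using B0 by linarith
    qed
  qed
  then show ?thesis using B(1) by blast
qed

lemma lagrangian_continuous: "continuous_on UNIV (\<lambda>(x, v). lagrangian H x v)"
proof (rule continuous_at_imp_continuous_on, rule ballI)
  fix z :: "(real ^ 'n) \<times> (real ^ 'n)"
  obtain x v where z: "z = (x, v)" by (cases z)
  obtain B where B: "B > 0" "\<forall>x v' x' v. norm v' \<le> norm (snd z) + 1 \<longrightarrow> norm v \<le> norm (snd z) + 1 \<longrightarrow> \<gamma> * norm (x - x') \<le> 1 / 2 \<longrightarrow>
    lagrangian H x v' \<le> lagrangian H x' v + B * (norm (x - x') + norm (v' - v))"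
    using lagrangian_locally_lipschitz[of "norm (snd z) + 1"] by blast
  let ?L = "\<lambda>(x, v). lagrangian H x v"
  have "\<forall>\<^sub>F z' in at z. dist z' z < min 1 (1 / (2 * \<gamma>))"
    unfolding eventually_at using \<gamma>_pos by (intro exI[of _ "min 1 (1 / (2 * \<gamma>))"]) auto
  then have ev: "\<forall>\<^sub>F z' in at z. norm (?L z' - ?L z) \<le> B * (2 * dist z' z)"
  proof eventually_elim
    case (elim z')
    obtain x' v' where z': "z' = (x', v')" by (cases z')
    have d: "norm (x - x') \<le> dist z' z" "norm (v - v') \<le> dist z' z"
      using dist_fst_le[of z' z] dist_snd_le[of z' z] by (simp_all add: z z' dist_norm norm_minus_commute)
    have "\<gamma> * norm (x - x') \<le> \<gamma> * (1 / (2 * \<gamma>))" using d elim \<gamma>_pos by (intro mult_left_mono) auto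
    then have xx: "\<gamma> * norm (x - x') \<le> 1 / 2" "\<gamma> * norm (x' - x) \<le> 1 / 2" using \<gamma>_pos by (simp_all add: norm_minus_commute)
    have "norm v' \<le> norm v + norm (v - v')" using norm_triangle_ineq2[of v' v] by (simp add: norm_minus_commute)
    then have vv: "norm v' \<le> norm (snd z) + 1" using d elim by (simp add: z)
    have "?L z \<le> ?L z' + B * (norm (x - x') + norm (v - v'))" using B(2) vv xx by (simp add: z z')
    moreover have "?L z' \<le> ?L z + B * (norm (x' - x) + norm (v' - v))" using B(2) vv xx by (simp add: z z')
    moreover have "B * (norm (x - x') + norm (v - v')) \<le> B * (2 * dist z' z)"
      using d B(1) by (intro mult_left_mono) auto
    ultimately show "norm (?L z' - ?L z) \<le> B * (2 * dist z' z)"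
      unfolding real_norm_def by (simp only: norm_minus_commute[of x' x] norm_minus_commute[of v' v])
  qed
  have "((\<lambda>z'. B * (2 * dist z' z)) \<longlongrightarrow> B * (2 * dist z z)) (at z)" by (intro tendsto_intros)
  then have "((\<lambda>z'. ?L z' - ?L z) \<longlongrightarrow> 0) (at z)" using Lim_null_comparison[OF ev] by simp
  then show "isCont ?L z" unfolding isCont_def by (rule LIM_zero_cancel)
qed

end

section \<open>Mather measures and comparison\<close>

definition holonomic_form ::
  "(real ^ 'n \<Rightarrow> real ^ 'n ^ 'n) \<Rightarrow> (real ^ 'n \<Rightarrow> real) \<Rightarrow> (real ^ 'n) \<times> (real ^ 'n) \<Rightarrow> real" where
  "holonomic_form A \<phi> = (\<lambda>(x, v). v \<bullet> grad \<phi> x - trace (A x ** hess \<phi> x))"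

lemma holonomic_form_linear:
  fixes \<phi> \<psi> :: "real ^ 'n \<Rightarrow> real"
  assumes \<phi>: "C2_torus \<phi>" and \<psi>: "C2_torus \<psi>"
  shows "C2_torus (\<lambda>x. a * \<phi> x + b * \<psi> x)"
    and "holonomic_form A (\<lambda>x. a * \<phi> x + b * \<psi> x) z = a * holonomic_form A \<phi> z + b * holonomic_form A \<psi> z"
proof -
  note j = has_jet_add[OF has_jet_scaleR[OF C2_torus_has_jet[OF \<phi>], of a] has_jet_scaleR[OF C2_torus_has_jet[OF \<psi>], of b]]
  have "torus_fun (\<lambda>x. a * \<phi> x + b * \<psi> x)"
    using \<phi> \<psi> torus_fun_compose2[of \<phi> \<psi> "\<lambda>r s. a * r + b * s"] by (simp add: C2_torus_def)
  then show "C2_torus (\<lambda>x. a * \<phi> x + b * \<psi> x)" by (rule C2_torusI[OF j])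
  have "trace (P ** (a *\<^sub>R X + b *\<^sub>R Y)) = a * trace (P ** X) + b * trace (P ** Y)" for P X Y :: "real ^ 'n ^ 'n"
    by (simp only: trace_mul_sym[of P] trace_mult_comb_left)
  then show "holonomic_form A (\<lambda>x. a * \<phi> x + b * \<psi> x) z = a * holonomic_form A \<phi> z + b * holonomic_form A \<psi> z"
    unfolding holonomic_form_def case_prod_unfold has_jet_grad[OF j] has_jet_hess[OF j]
    by (simp add: inner_add_right right_diff_distrib)
qed

lemma holonomic_form_sum:
  fixes N :: nat
  assumes "\<And>j. j < N \<Longrightarrow> C2_torus (\<phi> j)"
  shows "\<exists>\<psi>. C2_torus \<psi> \<and> (\<forall>z. holonomic_form A \<psi> z = (\<Sum>j<N. a j * holonomic_form A (\<phi> j) z))"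
  using assms
proof (induction N)
  case 0
  have C: "C2_torus (\<lambda>x :: real ^ 'n. 0 :: real)" by (rule C2_torusI[OF has_jet_const torus_fun_const])
  have "holonomic_form A (\<lambda>x. 0) z = 0" for z
    using holonomic_form_linear(2)[OF C C, of A 0 0 z] by simp
  then show ?case by (intro exI[of _ "\<lambda>x. 0"] conjI C allI) simp
next
  case (Suc N)
  have "\<exists>\<psi>. C2_torus \<psi> \<and> (\<forall>z. holonomic_form A \<psi> z = (\<Sum>j<N. a j * holonomic_form A (\<phi> j) z))"
    by (rule Suc.IH) (simp add: Suc.prems)
  then obtain \<psi> where \<psi>: "C2_torus \<psi>" "\<forall>z. holonomic_form A \<psi> z = (\<Sum>j<N. a j * holonomic_form A (\<phi> j) z)"
    by (elim exE conjE)
  have "C2_torus (\<phi> N)" using Suc.prems by simp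
  note lin = holonomic_form_linear[OF \<psi>(1) this, where a = 1 and b = "a N"]
  have eq: "holonomic_form A (\<lambda>x. 1 * \<psi> x + a N * \<phi> N x) z = (\<Sum>j<Suc N. a j * holonomic_form A (\<phi> j) z)" for z
    unfolding lin(2) sum.lessThan_Suc \<psi>(2)[rule_format] by simp
  show ?case by (rule exI[of _ "\<lambda>x. 1 * \<psi> x + a N * \<phi> N x"], intro conjI allI lin(1) eq)
qed

lemma integrable_concentrated_on_compact:
  fixes f :: "'a::euclidean_space \<Rightarrow> real"
  assumes "finite_measure \<mu>" and sets: "sets \<mu> = sets borel" and S: "compact S" "AE z in \<mu>. z \<in> S"
    and f: "continuous_on UNIV f"
  shows "integrable \<mu> f"
proof -
  interpret finite_measure \<mu> by fact
  obtain B where B: "\<And>z. z \<in> S \<Longrightarrow> norm (f z) \<le> B"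
    using compact_imp_bounded[OF compact_continuous_image[OF continuous_on_subset[OF f subset_UNIV] S(1)]] unfolding bounded_iff by blast
  have "f \<in> borel_measurable \<mu>"
    unfolding measurable_cong_sets[OF sets refl] by (rule borel_measurable_continuous_onI[OF f])
  moreover have "AE z in \<mu>. norm (f z) \<le> B" using S(2) by eventually_elim (rule B)
  ultimately show ?thesis by (intro integrable_const_bound)
qed

lemma borel_measurable_frac_vec: "frac_vec \<in> borel_measurable borel"
proof (subst borel_measurable_euclidean_space, rule ballI)
  fix i :: "real ^ 'n" assume "i \<in> Basis"
  then obtain k where i: "i = axis k 1" by (auto simp: Basis_vec_def)
  have "(\<lambda>x :: real ^ 'n. x $ k) \<in> borel_measurable borel"
    by (intro borel_measurable_continuous_onI continuous_intros)
  then show "(\<lambda>x. frac_vec x \<bullet> i) \<in> borel_measurable borel"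
    unfolding i frac_vec_def frac_def inner_axis by simp
qed

context viscous_hamiltonian
begin

section \<open>Holonomic forms, minimal action and duality\<close>

lemma holonomic_form_continuous:
  assumes "C2_torus \<phi>"
  shows "continuous_on UNIV (holonomic_form A \<phi>)"
proof -
  note j = has_jet_continuous[OF C2_torus_has_jet[OF assms]]
  have "continuous_on UNIV (\<lambda>z. grad \<phi> (fst z))" "continuous_on UNIV (\<lambda>z. hess \<phi> (fst z))" "continuous_on UNIV (\<lambda>z. A (fst z))"
    by (auto intro!: continuous_on_compose2[OF j(2)] continuous_on_compose2[OF j(3)] continuous_on_compose2[OF A_continuous] continuous_intros)
  then show ?thesis
    unfolding holonomic_form_def case_prod_unfold trace_def matrix_matrix_mult_def
    by (auto intro!: continuous_intros)
qed

lemma holonomic_form_frac_vec: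
  assumes "C2_torus \<phi>"
  shows "holonomic_form A \<phi> (frac_vec x, v) = holonomic_form A \<phi> (x, v)"
proof -
  have "torus_fun \<phi>" using assms by (simp add: C2_torus_def)
  note p = has_jet_periodic[OF C2_torus_has_jet[OF assms] this]
  show ?thesis by (simp add: holonomic_form_def torus_fun_frac_vec[OF p(1)] torus_fun_frac_vec[OF p(2)] torus_fun_frac_vec[OF A_periodic])
qed

lemma lagrangian_ge_holonomic_form:
  assumes "H x (grad \<psi> x) - trace (A x ** hess \<psi> x) \<le> b"
  shows "holonomic_form A \<psi> (x, v) - b \<le> lagrangian H x v"
  using lagrangian_ge[of "grad \<psi> x" v x] assms by (simp add: holonomic_form_def inner_commute)

lemma action_integrable:
  assumes "integrable \<mu> (\<lambda>(x, v). lagrangian H x v)"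
  shows "action H \<mu> = ereal (\<integral>(x, v). lagrangian H x v \<partial>\<mu>)"
proof -
  obtain r q where rq: "0 \<le> r" "0 \<le> q" "(\<integral>\<^sup>+z. ennreal ((\<lambda>(x, v). lagrangian H x v) z) \<partial>\<mu>) = ennreal r"
    "(\<integral>\<^sup>+z. ennreal (- (\<lambda>(x, v). lagrangian H x v) z) \<partial>\<mu>) = ennreal q" "(\<integral>(x, v). lagrangian H x v \<partial>\<mu>) = r - q"
    using integrableE[OF assms] by metis
  then show ?thesis unfolding action_def case_prod_unfold by simp
qed

theorem holonomic_action_ge:
  assumes sol: "viscosity_solution H A c u" and \<nu>: "\<nu> \<in> holonomic_measures A"
  shows "ereal (- c) \<le> action H \<nu>"
proof -
  have sets: "sets \<nu> = sets borel" and prob: "prob_space \<nu>"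
    using \<nu> by (auto simp: holonomic_measures_def torus_prob_measures_def)
  interpret prob_space \<nu> by (rule prob)
  let ?L = "\<lambda>(x, v). lagrangian H x v"
  have mL: "?L \<in> borel_measurable \<nu>"
    unfolding measurable_cong_sets[OF sets refl] by (rule borel_measurable_continuous_onI[OF lagrangian_continuous])
  obtain C where C: "C > 0" "\<And>x v. - C \<le> lagrangian H x v" using lagrangian_bounded_below by blast
  have "(\<integral>\<^sup>+z. ennreal (- ?L z) \<partial>\<nu>) \<le> (\<integral>\<^sup>+z. ennreal C \<partial>\<nu>)"
  proof (intro nn_integral_mono ennreal_leI)
    fix z :: "(real ^ 'n) \<times> (real ^ 'n)"
    show "- ?L z \<le> C" using C(2)[of "fst z" "snd z"] by (simp add: case_prod_unfold)
  qed
  also have "\<dots> < \<infinity>" by (simp add: emeasure_space_1 ennreal_mult_less_top)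
  finally have neg: "(\<integral>\<^sup>+z. ennreal (- ?L z) \<partial>\<nu>) \<noteq> \<infinity>" by simp
  show ?thesis
  proof (cases "(\<integral>\<^sup>+z. ennreal (?L z) \<partial>\<nu>) = \<infinity>")
    case True
    have "enn2ereal (\<integral>\<^sup>+z. ennreal (- ?L z) \<partial>\<nu>) \<noteq> \<infinity>" using neg by simp
    then have "action H \<nu> = \<infinity>" using True unfolding action_def case_prod_unfold by simp
    then show ?thesis by simp
  next
    case False
    have int: "integrable \<nu> ?L" unfolding real_integrable_def using mL False neg by blast
    have "- c \<le> (\<integral>z. ?L z \<partial>\<nu>) + \<epsilon>" if \<epsilon>: "\<epsilon> > 0" for \<epsilon>
    proof -
      obtain \<psi> where \<psi>: "C2_torus \<psi>" "\<And>x. H x (grad \<psi> x) - trace (A x ** hess \<psi> x) \<le> c + \<epsilon>"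
        using smooth_subsolution_approximation[OF sol \<epsilon>] by metis
      have hb: "has_bochner_integral \<nu> (holonomic_form A \<psi>) 0"
        using \<nu> \<psi>(1) unfolding holonomic_measures_def holonomic_form_def by blast
      have "(\<integral>z. holonomic_form A \<psi> z - (c + \<epsilon>) \<partial>\<nu>) \<le> (\<integral>z. ?L z \<partial>\<nu>)"
      proof (rule integral_mono)
        show "integrable \<nu> (\<lambda>z. holonomic_form A \<psi> z - (c + \<epsilon>))" using hb by (auto simp: has_bochner_integral_iff)
        fix z :: "(real ^ 'n) \<times> (real ^ 'n)"
        show "holonomic_form A \<psi> z - (c + \<epsilon>) \<le> ?L z"
          using lagrangian_ge_holonomic_form[OF \<psi>(2), of "fst z" "snd z"] by (simp add: case_prod_unfold)
      qed (rule int)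
      moreover have "(\<integral>z. holonomic_form A \<psi> z - (c + \<epsilon>) \<partial>\<nu>) = - (c + \<epsilon>)"
        using hb by (simp add: has_bochner_integral_iff prob_space)
      ultimately show ?thesis by linarith
    qed
    then have "- c \<le> (\<integral>z. ?L z \<partial>\<nu>)" by (rule field_le_epsilon)
    then show ?thesis unfolding action_integrable[OF int] by simp
  qed
qed

text \<open>Weak limits live on the closed cube, but torus measures are encoded on the half-open
  cell, so the limit is pushed forward by \<open>frac_vec\<close>. Periodic continuous integrands
  keep their integrals. By \<open>holonomic_action_ge\<close> no holonomic measure has action below
  -c, so action at most -c means minimality.\<close>

theorem mather_measure_projection:
  fixes \<mu>0 :: "((real ^ 'n) \<times> (real ^ 'n)) measure" and g :: "real ^ 'n \<Rightarrow> real"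
  assumes sol: "viscosity_solution H A c u"
    and prob: "prob_space \<mu>0" and sets: "sets \<mu>0 = sets borel" and S: "compact S" "AE z in \<mu>0. z \<in> S"
    and hol: "\<And>\<phi>. C2_torus \<phi> \<Longrightarrow> (\<integral>z. holonomic_form A \<phi> z \<partial>\<mu>0) = 0"
    and act: "(\<integral>(x, v). lagrangian H x v \<partial>\<mu>0) \<le> - c"
  defines "\<mu> \<equiv> distr \<mu>0 borel (\<lambda>(x, v). (frac_vec x, v))"
  shows "\<mu> \<in> mather_measures H A" and "C0_torus g \<Longrightarrow> (\<integral>(x, v). g x \<partial>\<mu>) = (\<integral>(x, v). g x \<partial>\<mu>0)"
proof -
  interpret \<mu>0: prob_space \<mu>0 by (rule prob)
  let ?T = "\<lambda>(x :: real ^ 'n, v :: real ^ 'n). (frac_vec x, v)"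
  let ?L = "\<lambda>(x, v). lagrangian H x v"
  have "?T \<in> measurable borel borel"
    unfolding case_prod_unfold borel_prod[symmetric]
    by (intro measurable_Pair measurable_compose[OF measurable_fst borel_measurable_frac_vec] measurable_snd)
  then have mT: "?T \<in> measurable \<mu>0 borel" by (subst measurable_cong_sets[OF sets refl])
  have transfer: "integrable \<mu> f \<and> (\<integral>z. f z \<partial>\<mu>) = (\<integral>z. f z \<partial>\<mu>0)"
    if f: "continuous_on UNIV f" "\<And>x v. f (frac_vec x, v) = f (x, v)" for f :: "(real ^ 'n) \<times> (real ^ 'n) \<Rightarrow> real"
  proof -
    have mf: "f \<in> borel_measurable borel" by (rule borel_measurable_continuous_onI[OF f(1)])
    have fT: "f (?T z) = f z" for z using f(2) by (cases z) simp
    have "integrable \<mu>0 f" by (rule integrable_concentrated_on_compact[OF \<mu>0.finite_measure_axioms sets S f(1)])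
    then show ?thesis unfolding \<mu>_def by (simp only: integrable_distr_eq[OF mT mf] integral_distr[OF mT mf] fT)
  qed
  have "AE z in \<mu>. fst z \<in> unit_cell"
  proof -
    have "unit_cell = (\<Inter>i. {x :: real ^ 'n. 0 \<le> x $ i} \<inter> {x. x $ i < 1})" by (auto simp: unit_cell_def)
    also have "\<dots> \<in> sets borel"
      by (intro sets.countable_INT'' sets.Int borel_closed borel_open closed_Collect_le open_Collect_less continuous_intros) auto
    finally have "{z \<in> space borel. fst z \<in> (unit_cell :: (real ^ 'n) set)} \<in> sets (borel :: ((real ^ 'n) \<times> (real ^ 'n)) measure)"
      unfolding borel_prod[symmetric] by (intro measurable_sets_Collect[OF measurable_fst]) auto
    then show ?thesis unfolding \<mu>_def by (subst AE_distr_iff[OF mT]) (auto simp: frac_vec_in_unit_cell split: prod.splits)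
  qed
  moreover have "prob_space \<mu>" unfolding \<mu>_def by (rule \<mu>0.prob_space_distr[OF mT])
  moreover have "sets \<mu> = sets borel" by (simp add: \<mu>_def)
  ultimately have tp: "\<mu> \<in> torus_prob_measures" by (simp add: torus_prob_measures_def)
  have "has_bochner_integral \<mu> (holonomic_form A \<phi>) 0" if \<phi>: "C2_torus \<phi>" for \<phi>
    using transfer[OF holonomic_form_continuous[OF \<phi>] holonomic_form_frac_vec[OF \<phi>]] hol[OF \<phi>]
    by (simp add: has_bochner_integral_iff)
  then have holo: "\<mu> \<in> holonomic_measures A"
    using tp unfolding holonomic_measures_def holonomic_form_def by blast
  have L: "integrable \<mu> ?L" "(\<integral>z. ?L z \<partial>\<mu>) = (\<integral>z. ?L z \<partial>\<mu>0)"
    using transfer[OF lagrangian_continuous] torus_fun_frac_vec[OF lagrangian_periodic] by auto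
  have "action H \<mu> \<le> ereal (- c)" unfolding action_integrable[OF L(1)] L(2) using act by simp
  then show "\<mu> \<in> mather_measures H A"
    using holo holonomic_action_ge[OF sol] unfolding mather_measures_def by (auto intro: order_trans)
  show "(\<integral>(x, v). g x \<partial>\<mu>) = (\<integral>(x, v). g x \<partial>\<mu>0)" if g: "C0_torus g"
  proof -
    have "continuous_on UNIV (\<lambda>z :: (real ^ 'n) \<times> (real ^ 'n). g (fst z))"
      using g by (intro continuous_on_compose2[of UNIV g UNIV fst] continuous_on_fst continuous_on_id) (simp_all add: C0_torus_def)
    moreover have "g (fst (frac_vec x, v)) = g (fst (x, v))" for x v :: "real ^ 'n"
      using g by (simp add: C0_torus_def torus_fun_frac_vec)
    ultimately have "(\<integral>z. g (fst z) \<partial>\<mu>) = (\<integral>z. g (fst z) \<partial>\<mu>0)" using transfer[of "\<lambda>z. g (fst z)"] by simp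
    then show ?thesis unfolding case_prod_unfold .
  qed
qed

text \<open>If the first alternative of \<open>finite_separation\<close> held for some N, dividing
  by the multiplier of \<open>\<delta> - g\<close> would give the inequality. Otherwise there are
  measures on S that are holonomic, of action at most -c and of g-integral at least
  \<open>\<delta>\<close>, all up to an error tending to 0. Their weak limit projects to a Mather
  measure against which g has integral at least \<open>\<delta>\<close>, contrary to the
  hypothesis.\<close>

theorem mather_duality:
  assumes sol: "viscosity_solution H A c u" and g: "C0_torus g"
    and le: "\<And>\<mu>. \<mu> \<in> mather_measures H A \<Longrightarrow> (\<integral>(x, v). g x \<partial>\<mu>) \<le> 0"
    and R: "R \<ge> 0" and \<delta>: "\<delta> > 0"
  shows "\<exists>K>0. \<exists>\<phi>. C2_torus \<phi> \<and> (\<forall>x v. norm v \<le> R \<longrightarrow>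
    g x \<le> \<delta> + K * (lagrangian H x v + c) - holonomic_form A \<phi> (x, v))"
proof (rule ccontr)
  assume contra: "\<not> ?thesis"
  define S where "S = cbox (0 :: real ^ 'n) 1 \<times> cball (0 :: real ^ 'n) R"
  have S: "compact S" unfolding S_def by (intro compact_Times compact_cbox compact_cball)
  have fracS: "(frac_vec x, v) \<in> S" if "norm v \<le> R" for x v
    using that frac_vec_in_unit_cell[of x] unit_cell_subset_cbox by (auto simp: S_def)
  have Sne: "S \<noteq> {}" using fracS[of 0 0] R by auto
  define F where "F = holonomic_form A ` Collect C2_torus"
  have contF: "continuous_on UNIV f" if "f \<in> F" for f using that holonomic_form_continuous by (auto simp: F_def)
  have "\<exists>D. countable D \<and> D \<subseteq> F \<and> (\<forall>f\<in>F. \<forall>e>0. \<exists>g\<in>D. \<forall>z\<in>S. \<bar>f z - g z\<bar> < e)"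
    by (rule continuous_functions_separable[OF S]) (rule continuous_on_subset[OF contF subset_UNIV])
  then obtain D where D: "countable D" "D \<subseteq> F" and dense: "\<forall>f\<in>F. \<forall>e>0. \<exists>g\<in>D. \<forall>z\<in>S. \<bar>f z - g z\<bar> < e"
    by (elim exE conjE)
  have "C2_torus (\<lambda>x :: real ^ 'n. 0 :: real)" by (rule C2_torusI[OF has_jet_const torus_fun_const])
  then have "holonomic_form A (\<lambda>x. 0) \<in> F" by (auto simp: F_def)
  then have "\<exists>g\<in>D. \<forall>z\<in>S. \<bar>holonomic_form A (\<lambda>x. 0) z - g z\<bar> < 1" using dense zero_less_one by blast
  then have Dne: "D \<noteq> {}" by auto
  \<comment> \<open>An enumeration, possibly with repetitions, of a dense family of holonomic forms;
    the N-th measure below satisfies the first N constraints approximately.\<close>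
  define b where "b = from_nat_into D"
  have bD: "b j \<in> D" for j unfolding b_def by (rule from_nat_into[OF Dne])
  have "\<forall>j. \<exists>\<phi>. C2_torus \<phi> \<and> b j = holonomic_form A \<phi>" using bD D(2) by (auto simp: F_def)
  then obtain \<phi> where \<phi>: "\<And>j. C2_torus (\<phi> j)" "\<And>j. b j = holonomic_form A (\<phi> j)" by metis
  have contb: "continuous_on UNIV (b j)" for j using bD D(2) contF by blast
  define \<phi>0 where "\<phi>0 = (\<lambda>(x, v). lagrangian H x v + c)"
  define \<phi>1 where "\<phi>1 = (\<lambda>(x :: real ^ 'n, v :: real ^ 'n). \<delta> - g x)"
  have cont0: "continuous_on UNIV \<phi>0"
    using lagrangian_continuous unfolding \<phi>0_def case_prod_unfold by (intro continuous_intros)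
  have contg: "continuous_on UNIV (\<lambda>(x :: real ^ 'n, v :: real ^ 'n). g x)"
    unfolding case_prod_unfold using g
    by (intro continuous_on_compose2[of UNIV g UNIV fst] continuous_on_fst continuous_on_id) (simp_all add: C0_torus_def)
  then have cont1: "continuous_on UNIV \<phi>1" unfolding \<phi>1_def case_prod_unfold by (intro continuous_intros)
  have "\<exists>p. finite (set_pmf p) \<and> set_pmf p \<subseteq> S \<and> measure_pmf.expectation p \<phi>0 \<le> inverse (real (Suc N)) \<and>
      measure_pmf.expectation p \<phi>1 \<le> inverse (real (Suc N)) \<and>
      (\<forall>j<N. \<bar>measure_pmf.expectation p (b j)\<bar> \<le> inverse (real (Suc N)))" for N
  proof -
    have "bounded (f ` S)" if "continuous_on UNIV f" for f :: "(real ^ 'n) \<times> (real ^ 'n) \<Rightarrow> real"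
      by (rule compact_imp_bounded[OF compact_continuous_image[OF continuous_on_subset[OF that subset_UNIV] S]])
    then have "bounded (\<phi>0 ` S \<union> \<phi>1 ` S \<union> (\<Union>j<N. b j ` S))"
      using cont0 cont1 contb by (intro bounded_Un[THEN iffD2] conjI bounded_UN) auto
    then obtain C where C: "C > 0" "\<forall>y\<in>\<phi>0 ` S \<union> \<phi>1 ` S \<union> (\<Union>j<N. b j ` S). norm y \<le> C"
      unfolding bounded_pos by (elim exE conjE)
    have C0: "\<bar>\<phi>0 z\<bar> \<le> C" "\<bar>\<phi>1 z\<bar> \<le> C" if "z \<in> S" for z
      using bspec[OF C(2), of "\<phi>0 z"] bspec[OF C(2), of "\<phi>1 z"] that by simp_all
    have Cb: "\<bar>b j z\<bar> \<le> C" if "z \<in> S" "j < N" for z j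
      using bspec[OF C(2), of "b j z"] that by auto
    have "0 < inverse (real (Suc N))" by simp
    from finite_separation[OF Sne C0 Cb this] show ?thesis
    proof (rule disjE)
      assume "\<exists>k0\<ge>0. \<exists>k1\<ge>0. \<exists>a. \<exists>m>0. \<forall>z\<in>S. m \<le> k0 * \<phi>0 z + k1 * \<phi>1 z + (\<Sum>j<N. a j * b j z)"
      then obtain k0 k1 a m where 1: "k0 \<ge> 0" "k1 \<ge> 0" "m > 0"
        "\<forall>z\<in>S. m \<le> k0 * \<phi>0 z + k1 * \<phi>1 z + (\<Sum>j<N. a j * b j z)" by (elim exE conjE)
      \<comment> \<open>The multipliers k0 and k1 may vanish. The margin m pays for raising both by
        \<open>\<kappa>\<close>, after which one may divide by k, and K is positive.\<close>
      define \<kappa> where "\<kappa> = m / (2 * C)"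
      have \<kappa>: "\<kappa> > 0" using 1 C by (simp add: \<kappa>_def)
      define k where "k = k1 + \<kappa>"
      define K where "K = (k0 + \<kappa>) / k"
      have k: "k > 0" and K: "K > 0" using 1 \<kappa> by (simp_all add: k_def K_def)
      obtain \<psi> where \<psi>: "C2_torus \<psi>" "\<And>z. holonomic_form A \<psi> z = (\<Sum>j<N. (- a j / k) * holonomic_form A (\<phi> j) z)"
        using holonomic_form_sum[of N \<phi> A "\<lambda>j. - a j / k"] \<phi>(1) by blast
      have "g x \<le> \<delta> + K * (lagrangian H x v + c) - holonomic_form A \<psi> (x, v)" if v: "norm v \<le> R" for x v
      proof -
        define z where "z = (frac_vec x, v)"
        have z: "z \<in> S" unfolding z_def by (rule fracS[OF v])
        have "\<kappa> * (\<phi>0 z + \<phi>1 z) \<ge> \<kappa> * (- (2 * C))" using C0[OF z] \<kappa> by (intro mult_left_mono) linarith+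
        also have "\<kappa> * (- (2 * C)) = - m" using C by (simp add: \<kappa>_def)
        finally have "0 \<le> (k0 + \<kappa>) * \<phi>0 z + k * \<phi>1 z + (\<Sum>j<N. a j * b j z)"
          using bspec[OF 1(4) z] unfolding k_def distrib_right distrib_left by linarith
        moreover have "k * holonomic_form A \<psi> z = - (\<Sum>j<N. a j * b j z)"
          unfolding \<psi>(2) \<phi>(2) sum_distrib_left sum_negf[symmetric] using k by (intro sum.cong) auto
        moreover have "(k0 + \<kappa>) * \<phi>0 z = k * (K * \<phi>0 z)" using k by (simp add: K_def)
        ultimately have "0 \<le> k * (K * \<phi>0 z + \<phi>1 z - holonomic_form A \<psi> z)"
          by (simp add: right_diff_distrib distrib_left)
        then have "0 \<le> K * \<phi>0 z + \<phi>1 z - holonomic_form A \<psi> z" using k by (simp add: zero_le_mult_iff)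
        moreover have "\<phi>0 z = lagrangian H x v + c" "\<phi>1 z = \<delta> - g x" "holonomic_form A \<psi> z = holonomic_form A \<psi> (x, v)"
          using g by (simp_all add: \<phi>0_def \<phi>1_def z_def holonomic_form_frac_vec[OF \<psi>(1)] C0_torus_def
              torus_fun_frac_vec torus_fun_frac_vec[OF lagrangian_periodic])
        ultimately show ?thesis by simp
      qed
      then have False using contra K \<psi>(1) by blast
      then show ?thesis ..
    qed
  qed
  then have "\<exists>p. \<forall>N. finite (set_pmf (p N)) \<and> set_pmf (p N) \<subseteq> S \<and>
      measure_pmf.expectation (p N) \<phi>0 \<le> inverse (real (Suc N)) \<and>
      measure_pmf.expectation (p N) \<phi>1 \<le> inverse (real (Suc N)) \<and>
      (\<forall>j<N. \<bar>measure_pmf.expectation (p N) (b j)\<bar> \<le> inverse (real (Suc N)))"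
    by (intro choice allI)
  then obtain p where p: "set_pmf (p N) \<subseteq> S"
    "measure_pmf.expectation (p N) \<phi>0 \<le> inverse (real (Suc N))"
    "measure_pmf.expectation (p N) \<phi>1 \<le> inverse (real (Suc N))"
    "\<forall>j<N. \<bar>measure_pmf.expectation (p N) (b j)\<bar> \<le> inverse (real (Suc N))" for N
    by blast
  obtain r \<mu>0 where r: "strict_mono (r :: nat \<Rightarrow> nat)" and \<mu>0: "prob_space \<mu>0" "sets \<mu>0 = sets borel" "AE z in \<mu>0. z \<in> S"
    and lim0: "\<forall>f :: (real ^ 'n) \<times> (real ^ 'n) \<Rightarrow> real. continuous_on UNIV f \<longrightarrow>
      (\<lambda>n. measure_pmf.expectation (p (r n)) f) \<longlonglongrightarrow> (\<integral>z. f z \<partial>\<mu>0)"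
    using pmf_weakly_compact[of S p, OF S p(1)] by (elim exE conjE)
  note lim = lim0[rule_format]
  interpret \<mu>0: prob_space \<mu>0 by (rule \<mu>0(1))
  have int: "integrable \<mu>0 f" if "continuous_on UNIV f" for f :: "(real ^ 'n) \<times> (real ^ 'n) \<Rightarrow> real"
    by (rule integrable_concentrated_on_compact[OF \<mu>0.finite_measure_axioms \<mu>0(2) S \<mu>0(3) that])
  have inv: "(\<lambda>n. inverse (real (Suc (r n)))) \<longlonglongrightarrow> 0"
    using LIMSEQ_subseq_LIMSEQ[OF LIMSEQ_inverse_real_of_nat r] by (simp add: o_def)
  have I0: "(\<integral>z. \<phi>0 z \<partial>\<mu>0) \<le> 0" by (rule LIMSEQ_le[OF lim[OF cont0] inv]) (use p(2) in auto)
  have I1: "(\<integral>z. \<phi>1 z \<partial>\<mu>0) \<le> 0" by (rule LIMSEQ_le[OF lim[OF cont1] inv]) (use p(3) in auto)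
  have Ib: "(\<integral>z. b j z \<partial>\<mu>0) = 0" for j
  proof -
    have "\<bar>measure_pmf.expectation (p (r n)) (b j)\<bar> \<le> inverse (real (Suc (r n)))" if "n > j" for n
      using p(4)[of "r n", rule_format, of j] seq_suble[OF r, of n] that by simp
    then have "\<bar>\<integral>z. b j z \<partial>\<mu>0\<bar> \<le> 0"
      by (intro LIMSEQ_le[OF tendsto_rabs[OF lim[OF contb]] inv] exI[of _ "Suc j"]) auto
    then show ?thesis by simp
  qed
  have hol: "(\<integral>z. holonomic_form A \<psi> z \<partial>\<mu>0) = 0" if \<psi>: "C2_torus \<psi>" for \<psi>
  proof -
    let ?f = "holonomic_form A \<psi>"
    note cf = holonomic_form_continuous[OF \<psi>]
    have "\<bar>\<integral>z. ?f z \<partial>\<mu>0\<bar> \<le> 0 + e" if e: "e > 0" for e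
    proof -
      have "?f \<in> F" using \<psi> by (auto simp: F_def)
      then have "\<exists>h\<in>D. \<forall>z\<in>S. \<bar>?f z - h z\<bar> < e" using dense e by blast
      then obtain h where h: "h \<in> D" "\<forall>z\<in>S. \<bar>?f z - h z\<bar> < e" by blast
      obtain j where j: "h = b j" unfolding b_def using from_nat_into_surj[OF D(1) h(1)] by metis
      have "(\<integral>z. ?f z \<partial>\<mu>0) = (\<integral>z. ?f z - b j z \<partial>\<mu>0)" using int[OF cf] int[OF contb] Ib by simp
      moreover have "(\<integral>z. ?f z - b j z \<partial>\<mu>0) \<le> e"
      proof (rule \<mu>0.integral_le_const)
        show "AE z in \<mu>0. ?f z - b j z \<le> e" using \<mu>0(3)
        proof eventually_elim
          case (elim z) then show ?case using bspec[OF h(2), of z] j by (simp add: abs_less_iff)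
        qed
      qed (use int[OF cf] int[OF contb] in simp)
      moreover have "- e \<le> (\<integral>z. ?f z - b j z \<partial>\<mu>0)"
      proof (rule \<mu>0.integral_ge_const)
        show "AE z in \<mu>0. - e \<le> ?f z - b j z" using \<mu>0(3)
        proof eventually_elim
          case (elim z) then show ?case using bspec[OF h(2), of z] j by (simp add: abs_less_iff)
        qed
      qed (use int[OF cf] int[OF contb] in simp)
      ultimately show ?thesis by linarith
    qed
    then have "\<bar>\<integral>z. ?f z \<partial>\<mu>0\<bar> \<le> 0" by (rule field_le_epsilon)
    then show ?thesis by simp
  qed
  have act: "(\<integral>(x, v). lagrangian H x v \<partial>\<mu>0) \<le> - c"
    using I0 int[OF lagrangian_continuous] unfolding \<phi>0_def case_prod_unfold by (simp add: \<mu>0.prob_space)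
  let ?\<mu> = "distr \<mu>0 borel (\<lambda>(x, v). (frac_vec x, v))"
  have "?\<mu> \<in> mather_measures H A"
    by (rule mather_measure_projection(1)[OF sol \<mu>0(1,2) S \<mu>0(3) _ act]) (rule hol)
  then have "(\<integral>(x, v). g x \<partial>?\<mu>) \<le> 0" by (rule le)
  moreover have "(\<integral>(x, v). g x \<partial>?\<mu>) = (\<integral>(x, v). g x \<partial>\<mu>0)"
    by (rule mather_measure_projection(2)[OF sol \<mu>0(1,2) S \<mu>0(3) _ act g]) (rule hol)
  moreover have "\<delta> - (\<integral>(x, v). g x \<partial>\<mu>0) \<le> 0"
    using I1 int[OF contg] unfolding \<phi>1_def case_prod_unfold by (simp add: \<mu>0.prob_space)
  ultimately show False using \<delta> by linarith
qed

theorem mather_comparison: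
  assumes sol1: "viscosity_solution H A c u\<^sub>1" and sol2: "viscosity_solution H A c u\<^sub>2"
    and \<sigma>: "C0_torus \<sigma>" "\<And>x. \<sigma> x > 0"
    and le: "\<And>\<mu>. \<mu> \<in> mather_measures H A \<Longrightarrow> (\<integral>(x, v). u\<^sub>1 x * \<sigma> x \<partial>\<mu>) \<le> (\<integral>(x, v). u\<^sub>2 x * \<sigma> x \<partial>\<mu>)"
  shows "u\<^sub>1 x \<le> u\<^sub>2 x"
proof -
  have u1: "torus_fun u\<^sub>1" "continuous_on UNIV u\<^sub>1" and u2: "torus_fun u\<^sub>2" "continuous_on UNIV u\<^sub>2"
    using sol1 sol2 by (auto simp: viscosity_solution_def C0_torus_def)
  have s: "torus_fun \<sigma>" "continuous_on UNIV \<sigma>" using \<sigma> by (auto simp: C0_torus_def)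
  define g where "g x = u\<^sub>1 x * \<sigma> x - u\<^sub>2 x * \<sigma> x" for x
  have us: "torus_fun (\<lambda>x. u\<^sub>1 x * \<sigma> x)" "continuous_on UNIV (\<lambda>x. u\<^sub>1 x * \<sigma> x)"
    "torus_fun (\<lambda>x. u\<^sub>2 x * \<sigma> x)" "continuous_on UNIV (\<lambda>x. u\<^sub>2 x * \<sigma> x)"
    using torus_fun_compose2[OF u1(1) s(1), of "(*)"] torus_fun_compose2[OF u2(1) s(1), of "(*)"]
      continuous_on_mult[OF u1(2) s(2)] continuous_on_mult[OF u2(2) s(2)] by simp_all
  have g: "C0_torus g"
    using torus_fun_compose2[OF us(1,3), of "(-)"] continuous_on_diff[OF us(2,4)]
    unfolding g_def[abs_def] C0_torus_def by simp
  have gle: "(\<integral>(x, v). g x \<partial>\<mu>) \<le> 0" if \<mu>: "\<mu> \<in> mather_measures H A" for \<mu>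
  proof -
    have sets: "sets \<mu> = sets borel" and prob: "prob_space \<mu>"
      using \<mu> by (auto simp: mather_measures_def holonomic_measures_def torus_prob_measures_def)
    interpret prob_space \<mu> by (rule prob)
    have int: "integrable \<mu> (\<lambda>z. f (fst z))" if f: "torus_fun f" "continuous_on UNIV f" for f :: "real ^ 'n \<Rightarrow> real"
    proof -
      obtain M where "\<And>x. norm (f x) \<le> M" using torus_bounded[OF f] by blast
      moreover have "(\<lambda>z. f (fst z)) \<in> borel_measurable \<mu>"
        unfolding measurable_cong_sets[OF sets refl]
        by (intro borel_measurable_continuous_onI continuous_on_compose2[OF f(2)] continuous_on_fst continuous_on_id) simp
      ultimately show ?thesis by (intro integrable_const_bound[of _ M]) auto
    qed
    show ?thesis using le[OF \<mu>] int[OF us(1,2)] int[OF us(3,4)] by (simp add: g_def case_prod_unfold)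
  qed
  obtain y0 where "\<And>y. \<sigma> y0 \<le> \<sigma> y" using torus_attains_inf[OF s] by blast
  then obtain \<sigma>0 where \<sigma>0: "\<sigma>0 > 0" "\<And>y. \<sigma>0 \<le> \<sigma> y" using \<sigma>(2) by metis
  obtain K2 where K2: "K2 > 0" "\<And>x z. \<bar>u\<^sub>2 x - u\<^sub>2 z\<bar> \<le> K2 * norm (x - z)"
    using solution_lipschitz[OF sol2] by metis
  \<comment> \<open>R depends only on H and the Lipschitz bound of \<open>u\<^sub>2\<close>, so it
    can be handed to \<open>mather_duality\<close> before the touching point is known.\<close>
  obtain R where R: "R > 0" "\<And>x p v. norm p \<le> K2 \<Longrightarrow> subgradient x p v \<Longrightarrow> norm v \<le> R"
    using subgradient_bounded[of K2] by blast
  have "torus_fun (\<lambda>x. u\<^sub>1 x - u\<^sub>2 x)" "continuous_on UNIV (\<lambda>x. u\<^sub>1 x - u\<^sub>2 x)"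
    using torus_fun_compose2[OF u1(1) u2(1), of "(-)"] continuous_on_diff[OF u1(2) u2(2)] by simp_all
  then obtain xm where xm: "\<And>x. u\<^sub>1 x - u\<^sub>2 x \<le> u\<^sub>1 xm - u\<^sub>2 xm" using torus_attains_sup by blast
  define m where "m = u\<^sub>1 xm - u\<^sub>2 xm"
  have "m \<le> 0"
  proof (rule ccontr)
    assume "\<not> m \<le> 0"
    then have m: "m > 0" by simp
    \<comment> \<open>Then g x0 <= 3/2 \<open>\<delta>\<close> and
      \<open>\<sigma> \<ge> \<sigma>0\<close> leave \<open>u\<^sub>1 x0 - u\<^sub>2 x0\<close> at
      most 3/4 m.\<close>
    define \<delta> where "\<delta> = \<sigma>0 * m / 2"
    have \<delta>: "\<delta> > 0" using \<sigma>0 m by (simp add: \<delta>_def)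
    obtain K \<phi> where K: "K > 0" and \<phi>: "C2_torus \<phi>"
      "\<And>x v. norm v \<le> R \<Longrightarrow> g x \<le> \<delta> + K * (lagrangian H x v + c) - holonomic_form A \<phi> (x, v)"
      using mather_duality[OF sol1 g gle less_imp_le[OF R(1)] \<delta>] by blast
    have \<phi>t: "torus_fun \<phi>" "continuous_on UNIV \<phi>"
      using \<phi>(1) has_jet_continuous(1)[OF C2_torus_has_jet[OF \<phi>(1)]] by (auto simp: C2_torus_def)
    obtain B where B: "B > 0" "\<And>x. \<bar>\<phi> x\<bar> \<le> B" using torus_bounded[OF \<phi>t] unfolding real_norm_def by blast
    obtain B1 where B1: "B1 > 0" "\<And>x. \<bar>u\<^sub>1 x\<bar> \<le> B1" using torus_bounded[OF u1] unfolding real_norm_def by blast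
    \<comment> \<open>\<open>t * Q\<close> bounds the part of \<open>w - u\<^sub>1\<close> that
      comes from \<open>\<phi>\<close> and from the missing fraction t of
      \<open>u\<^sub>1\<close>.\<close>
    define Q where "Q = B / K + B1"
    have Q: "Q > 0" using B B1 K by (simp add: Q_def add_pos_pos)
    define t where "t = min (1/2) (m / (32 * Q))"
    have t: "0 < t" "t \<le> 1/2" "t * Q \<le> m / 32"
    proof -
      show "0 < t" "t \<le> 1/2" using m Q by (auto simp: t_def)
      have "t * Q \<le> m / (32 * Q) * Q" using Q by (intro mult_right_mono) (auto simp: t_def)
      then show "t * Q \<le> m / 32" using Q by simp
    qed
    \<comment> \<open>e is chosen after t: multiplied by K it must stay below half of the strictness
      \<open>t * \<delta>\<close> gained from \<open>\<phi>\<close>.\<close>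
    define e where "e = min (m / 32) (t * \<delta> / (2 * K))"
    have e: "e > 0" "e \<le> m / 32" "K * e \<le> t * \<delta> / 2"
    proof -
      show "0 < e" "e \<le> m / 32" using m t \<delta> K by (auto simp: e_def)
      have "K * e \<le> K * (t * \<delta> / (2 * K))" using K by (intro mult_left_mono) (auto simp: e_def)
      then show "K * e \<le> t * \<delta> / 2" using K by simp
    qed
    obtain \<psi> where \<psi>: "C2_torus \<psi>" "\<And>x. \<bar>\<psi> x - u\<^sub>1 x\<bar> \<le> e"
      "\<And>x. H x (grad \<psi> x) - trace (A x ** hess \<psi> x) \<le> c + e"
      using smooth_subsolution_approximation[OF sol1 e(1)] by metis
    define \<kappa> where "\<kappa> = t / K"
    have \<kappa>: "\<kappa> > 0" "\<kappa> * K = t" using t K by (simp_all add: \<kappa>_def)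
    define w where "w x = \<kappa> * \<phi> x + (1 - t) * \<psi> x" for x
    have w: "C2_torus w" and hw: "\<And>z. holonomic_form A w z = \<kappa> * holonomic_form A \<phi> z + (1 - t) * holonomic_form A \<psi> z"
      unfolding w_def[abs_def] by (rule holonomic_form_linear[OF \<phi>(1) \<psi>(1)])+
    have wt: "torus_fun w" "continuous_on UNIV w"
      using w has_jet_continuous(1)[OF C2_torus_has_jet[OF w]] by (auto simp: C2_torus_def)
    have wu: "\<bar>w x - u\<^sub>1 x\<bar> \<le> m / 16" for x
    proof -
      have "\<bar>\<kappa> * \<phi> x\<bar> \<le> \<kappa> * B" unfolding abs_mult using B \<kappa> by (intro mult_mono) auto
      moreover have "\<bar>(1 - t) * (\<psi> x - u\<^sub>1 x)\<bar> \<le> 1 * e" unfolding abs_mult using \<psi>(2)[of x] t by (intro mult_mono) auto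
      moreover have "\<bar>t * u\<^sub>1 x\<bar> \<le> t * B1" unfolding abs_mult using B1 t by (intro mult_mono) auto
      moreover have "w x - u\<^sub>1 x = \<kappa> * \<phi> x + (1 - t) * (\<psi> x - u\<^sub>1 x) - t * u\<^sub>1 x" by (simp add: w_def algebra_simps)
      moreover have "\<kappa> * B + t * B1 = t * Q" by (simp add: Q_def distrib_left \<kappa>_def)
      ultimately show ?thesis using t(3) e(2) by linarith
    qed
    have "torus_fun (\<lambda>x. u\<^sub>2 x - w x)" "continuous_on UNIV (\<lambda>x. u\<^sub>2 x - w x)"
      using torus_fun_compose2[OF u2(1) wt(1), of "(-)"] continuous_on_diff[OF u2(2) wt(2)] by simp_all
    then obtain x0 where x0: "\<And>x. u\<^sub>2 x0 - w x0 \<le> u\<^sub>2 x - w x" using torus_attains_inf by blast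
    define p0 where "p0 = grad w x0"
    have p0: "norm p0 \<le> K2"
    proof (rule gradient_le_one_sided_lipschitz)
      show "(w has_derivative (\<lambda>y. p0 \<bullet> y)) (at x0)" using C2_torus_has_jet[OF w] by (simp add: has_jet_def p0_def)
      show "w z - w x0 \<le> K2 * norm (z - x0)" for z using x0[of z] K2(2)[of z x0] by linarith
      show "K2 \<ge> 0" using K2(1) by simp
    qed
    obtain v where v: "subgradient x0 p0 v" by (rule subgradient_exists)
    define l where "l = lagrangian H x0 v + c"
    have "\<forall>\<^sub>F y in nhds x0. u\<^sub>2 y - w y \<ge> u\<^sub>2 x0 - w x0" using x0 by (intro always_eventually allI)
    then have "H x0 p0 \<ge> trace (A x0 ** hess w x0) + c"
      using sol2 w unfolding viscosity_solution_def viscosity_supersolution_def p0_def by blast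
    \<comment> \<open>At a subgradient v the Fenchel inequality is an equality, so the supersolution
      property becomes a lower bound for the holonomic form of w. In the convex combination below
      all multiples of l cancel.\<close>
    then have "l \<le> holonomic_form A w (x0, v)"
      using lagrangian_subgradient[OF v] by (simp add: l_def holonomic_form_def p0_def inner_commute)
    moreover have "\<kappa> * holonomic_form A \<phi> (x0, v) \<le> \<kappa> * (\<delta> + K * l - g x0)"
      using \<phi>(2)[OF R(2)[OF p0 v], of x0] \<kappa> unfolding l_def by (intro mult_left_mono) linarith+
    moreover have "\<kappa> * (\<delta> + K * l - g x0) = \<kappa> * (\<delta> - g x0) + t * l" by (simp add: \<kappa>(2)[symmetric] algebra_simps)
    moreover have "(1 - t) * holonomic_form A \<psi> (x0, v) \<le> (1 - t) * (l + e)"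
      using lagrangian_ge_holonomic_form[OF \<psi>(3), of x0 v] t unfolding l_def by (intro mult_left_mono) linarith+
    moreover have "(1 - t) * (l + e) \<le> l - t * l + e" using t e by (simp add: algebra_simps)
    ultimately have "0 \<le> \<kappa> * (\<delta> - g x0) + e" unfolding hw by linarith
    then have "0 \<le> K * (\<kappa> * (\<delta> - g x0) + e)" using K by simp
    also have "\<dots> = t * (\<delta> - g x0) + K * e" by (simp add: \<kappa>(2)[symmetric] algebra_simps)
    also have "\<dots> \<le> t * (\<delta> - g x0) + t * \<delta> / 2" using e by simp
    also have "\<dots> = t * (3 / 2 * \<delta> - g x0)" by (simp add: algebra_simps)
    finally have gx0: "g x0 \<le> 3 / 2 * \<delta>" using t(1) by (simp add: zero_le_mult_iff)
    have "u\<^sub>1 x0 - u\<^sub>2 x0 \<le> 3 / 4 * m"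
    proof (rule ccontr)
      assume n: "\<not> u\<^sub>1 x0 - u\<^sub>2 x0 \<le> 3 / 4 * m"
      then have "\<sigma>0 * (3 / 4 * m) < \<sigma>0 * (u\<^sub>1 x0 - u\<^sub>2 x0)" using \<sigma>0 by simp
      also have "\<dots> \<le> \<sigma> x0 * (u\<^sub>1 x0 - u\<^sub>2 x0)" using \<sigma>0(2) n m by (intro mult_right_mono) auto
      also have "\<dots> = g x0" by (simp add: g_def algebra_simps)
      finally show False using gx0 by (simp add: \<delta>_def)
    qed
    \<comment> \<open>Passing between w and \<open>u\<^sub>1\<close> at xm and at x0 costs m/16
      each, so m <= 3/4 m + m/8.\<close>
    then show False using x0[of xm] wu[of xm] wu[of x0] m m_def by linarith
  qed
  then show ?thesis using xm[of x] by (simp add: m_def)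
qed

end

theorem theorem2:
  fixes H :: "real ^ 'n \<Rightarrow> real ^ 'n \<Rightarrow> real"
    and A :: "real ^ 'n \<Rightarrow> real ^ 'n ^ 'n"
    and \<sigma> u\<^sub>1 u\<^sub>2 :: "real ^ 'n \<Rightarrow> real"
    and \<gamma>\<^sub>1 :: real
  assumes H_periodic: "torus_fun H"
    and H_C2: "C2 (\<lambda>(x, p). H x p)"
    and H_convex: "strictly_convex_in_p H"
    and H_superlinear: "superlinear_in_p H"
    and \<gamma>\<^sub>1_pos: "\<gamma>\<^sub>1 > 0"
    and H_growth: "\<And>x p. norm (grad (\<lambda>y. H y p) x) \<le> \<gamma>\<^sub>1 * (1 + \<bar>H x p\<bar>)"
    and A_C2: "C2_torus A"
    and A_sym: "\<And>x. transpose (A x) = A x"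
    and A_psd: "\<And>x \<xi>. 0 \<le> \<xi> \<bullet> (A x *v \<xi>)"
    and \<sigma>_cont: "C0_torus \<sigma>"
    and \<sigma>_pos: "\<And>x. \<sigma> x > 0"
    and u\<^sub>1_sol: "viscosity_solution H A (ergodic_constant H A) u\<^sub>1"
    and u\<^sub>2_sol: "viscosity_solution H A (ergodic_constant H A) u\<^sub>2"
    and integral_le: "\<And>\<mu>. \<mu> \<in> mather_measures H A \<Longrightarrow>
        (\<integral>(x, v). u\<^sub>1 x * \<sigma> x \<partial>\<mu>) \<le> (\<integral>(x, v). u\<^sub>2 x * \<sigma> x \<partial>\<mu>)"
  shows "\<forall>x. u\<^sub>1 x \<le> u\<^sub>2 x"
proof
  fix x
  interpret viscous_hamiltonian H A \<gamma>\<^sub>1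
    by unfold_locales (fact H_periodic H_C2 H_convex H_superlinear \<gamma>\<^sub>1_pos H_growth A_C2 A_sym A_psd)+
  show "u\<^sub>1 x \<le> u\<^sub>2 x"
    by (rule mather_comparison[OF u\<^sub>1_sol u\<^sub>2_sol \<sigma>_cont \<sigma>_pos integral_le])
qed

end
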